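(* Sewing two tori determines a holomorphic map $$F^\epsilon:\mathcal{D}^\epsilon\to\mathbb{H}_2,\qquad(\tau_1,\tau_2,\epsilon)\mapsto\Omega^{(2)}(\tau_1,\tau_2,\epsilon).$$ Moreover $\Omega^{(2)}=\Omega^{(2)}(\tau_1,\tau_2,\epsilon)$ is given by $$2\pi i\,\Omega^{(2)}_{11}=2\pi i\tau_1+\epsilon\,\big(A_2(I-A_1A_2)^{-1}\big)(1,1),$$ $$2\pi i\,\Omega^{(2)}_{22}=2\pi i\tau_2+\epsilon\,\big(A_1(I-A_2A_1)^{-1}\big)(1,1),$$ $$2\pi i\,\Omega^{(2)}_{12}=-\epsilon\,(I-A_1A_2)^{-1}(1,1),$$ where $A_a=A_a(\tau_a,\epsilon)$ is the infinite matrix with $(k,l)$-entry $$A_a(k,l,\tau_a,\epsilon)=\frac{\epsilon^{(k+l)/2}}{\sqrt{kl}}\,C(k,l,\tau_a),\qquad k,l\ge1,$$ and $(1,1)$ refers to the $(1,1)$-entry of a matrix.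
   Context: $\mathbb{H}_1$ is the complex upper half-plane and $\mathbb{H}_g$ the Siegel upper half-space of genus $g$ (symmetric complex $g\times g$ matrices with positive definite imaginary part). For $\tau\in\mathbb{H}_1$, $q=e^{2\pi i\tau}$: $E_k(\tau)=0$ for $k$ odd, and for even $k\ge2$, $E_k(\tau)=-\frac{B_k}{k!}+\frac{2}{(k-1)!}\sum_{n\ge1}\sigma_{k-1}(n)q^n$ ($B_k$ the Bernoulli numbers, $\sigma_{k-1}(n)=\sum_{d\mid n}d^{k-1}$). For $k,l\ge1$, $C(k,l,\tau)=(-1)^{k+1}\frac{(k+l-1)!}{(k-1)!(l-1)!}E_{k+l}(\tau)$. $\Lambda_\tau$ is the lattice with basis $(2\pi i\tau,2\pi i)$; for a lattice $\Lambda\subset\mathbb{C}$, $D(\Lambda)=\min_{0\ne\lambda\in\Lambda}|\lambda|$. $$\mathcal{D}^\epsilon=\{(\tau_1,\tau_2,\epsilon)\in\mathbb{H}_1\times\mathbb{H}_1\times\mathbb{C}\mid|\epsilon|<\tfrac14D(\Lambda_{\tau_1})D(\Lambda_{\tau_2})\}.$$ Sewing: let $\mathcal{S}_a=\mathbb{C}/\Lambda_{\tau_a}$, $a=1,2$, with coordinate $z_a$ centred at the origin. Write $\bar1=2,\bar2=1$. With $r_a<\frac12D(\Lambda_{\tau_a})$ and $|\epsilon|\le r_1r_2$, excise the discs $|z_a|\le|\epsilon|/r_{\bar a}$ and identify the annuli $|\epsilon|/r_{\bar a}\le|z_a|\le r_a$ via $z_1z_2=\epsilon$. This gives a compact Riemann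 surface of genus 2 (degenerate if $\epsilon=0$), with homology basis $a_1,b_1$ and $a_2,b_2$ inherited from $\mathcal{S}_1$ and $\mathcal{S}_2$, where $a_a$, $b_a$ are the cycles of $\mathcal{S}_a$ with periods $2\pi i$ and $2\pi i\tau_a$. Its period matrix is $\Omega^{(2)}_{ij}=\frac{1}{2\pi i}\oint_{b_i}\nu_j$, where $\nu_1,\nu_2$ are the holomorphic 1-forms with $\oint_{a_i}\nu_j=2\pi i\delta_{ij}$. $I$ is the infinite identity matrix and $(I-A_aA_{\bar a})^{-1}=\sum_{n\ge0}(A_aA_{\bar a})^n$ (convergent as a power series in $\epsilon$). *)

theory Defs
  imports "HOL-Complex_Analysis.Complex_Analysis" "HOL-Computational_Algebra.Computational_Algebra"
begin

section \<open>Half-spaces and holomorphic maps\<close>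

definition upper_half_plane :: "complex set" where
  "upper_half_plane = {\<tau>. 0 < Im \<tau>}"

definition siegel_upper_half_space :: "(complex ^ 'g ^ 'g) set" where
  "siegel_upper_half_space =
     {\<Omega>. transpose \<Omega> = \<Omega> \<and>
          (\<forall>x :: real ^ 'g. x \<noteq> 0 \<longrightarrow> 0 < (\<Sum>i\<in>UNIV. \<Sum>j\<in>UNIV. x $ i * Im (\<Omega> $ i $ j) * x $ j))}"

text \<open>Holomorphy in three complex variables: at every point each entry has a total derivative
  (over the reals) that is complex linear.\<close>

definition holomorphic_map_on ::
    "(complex \<times> complex \<times> complex \<Rightarrow> complex ^ 'n ^ 'm) \<Rightarrow> (complex \<times> complex \<times> complex) set \<Rightarrow> bool"
    where
  "holomorphic_map_on F D \<longleftrightarrow>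
     open D \<and>
     (\<forall>p\<in>D. \<forall>i j. \<exists>a b c. ((\<lambda>x. F x $ i $ j) has_derivative (\<lambda>(u, v, w). a * u + b * v + c * w)) (at p))"

section \<open>Eisenstein series\<close>

text \<open>Generating function \<open>x / (exp x - 1) = (\<Sum>n. B\<^sub>n x\<^sup>n / n!)\<close>, so \<open>B\<^sub>1 = - 1/2\<close>; only even
  indices are used below.\<close>

definition bernoulli_number :: "nat \<Rightarrow> real" where
  "bernoulli_number n = fact n * fps_nth (fps_X / (fps_exp 1 - 1)) n"

definition divisor_power_sum :: "nat \<Rightarrow> nat \<Rightarrow> nat" where
  "divisor_power_sum k n = (\<Sum>d | d dvd n. d ^ k)"

definition eisenstein :: "nat \<Rightarrow> complex \<Rightarrow> complex" where
  "eisenstein k \<tau> =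
     (if odd k then 0
      else - of_real (bernoulli_number k) / fact k
           + 2 / fact (k - 1) *
             (\<Sum>\<^sub>\<infinity>n\<in>{1..}. of_nat (divisor_power_sum (k - 1) n) * exp (2 * pi * \<i> * \<tau>) ^ n))"

definition torus_coeff :: "nat \<Rightarrow> nat \<Rightarrow> complex \<Rightarrow> complex" where
  "torus_coeff k l \<tau> =
     (- 1) ^ (k + 1) * (fact (k + l - 1) / (fact (k - 1) * fact (l - 1))) * eisenstein (k + l) \<tau>"

section \<open>Infinite matrices\<close>

text \<open>Rows and columns are numbered from 1; entries with an index 0 are irrelevant. An infinite sum
  that does not converge has the value 0, so convergence is recorded by separate predicates.\<close>

type_synonym imat = "nat \<Rightarrow> nat \<Rightarrow> complex"

definition imat_id :: imat where
  "imat_id k l = (if k = l then 1 else 0)"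

definition imat_mult :: "imat \<Rightarrow> imat \<Rightarrow> imat" where
  "imat_mult A B k l = (\<Sum>\<^sub>\<infinity>m\<in>{1..}. A k m * B m l)"

definition imat_mult_converges :: "imat \<Rightarrow> imat \<Rightarrow> bool" where
  "imat_mult_converges A B \<longleftrightarrow> (\<forall>k\<ge>1. \<forall>l\<ge>1. (\<lambda>m. A k m * B m l) summable_on {1..})"

primrec imat_power :: "imat \<Rightarrow> nat \<Rightarrow> imat" where
  "imat_power M 0 = imat_id"
| "imat_power M (Suc n) = imat_mult (imat_power M n) M"

text \<open>\<open>(I - M)\<^sup>-\<^sup>1\<close>, understood as the Neumann series of \<open>M\<close>.\<close>

definition neumann_inverse :: "imat \<Rightarrow> imat" where
  "neumann_inverse M k l = (\<Sum>\<^sub>\<infinity>n. imat_power M n k l)"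

definition neumann_converges :: "imat \<Rightarrow> bool" where
  "neumann_converges M \<longleftrightarrow>
     (\<forall>n. imat_mult_converges (imat_power M n) M) \<and>
     (\<forall>k\<ge>1. \<forall>l\<ge>1. (\<lambda>n. imat_power M n k l) summable_on UNIV)"

text \<open>The principal branch of \<open>\<epsilon>\<^bsup>1/2\<^esup>\<close> is used (and \<open>0 powr s = 0\<close>). The other branch changes the
  sign of the \<open>(k, l)\<close> entry by \<open>(-1)\<^bsup>k+l\<^esup>\<close>, which cancels in the \<open>(1, 1)\<close> entry of any product.\<close>

definition sewing_matrix :: "complex \<Rightarrow> complex \<Rightarrow> imat" where
  "sewing_matrix \<tau> \<epsilon> k l =
     \<epsilon> powr (of_nat (k + l) / 2) / of_real (sqrt (of_nat (k * l))) * torus_coeff k l \<tau>"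

section \<open>Sewing two tori\<close>

definition torus_lattice :: "complex \<Rightarrow> complex set" where
  "torus_lattice \<tau> = {of_int m * (2 * pi * \<i> * \<tau>) + of_int n * (2 * pi * \<i>) | m n. True}"

text \<open>For a lattice the infimum is attained.\<close>

definition min_norm :: "complex set \<Rightarrow> real" where
  "min_norm \<Lambda> = Inf (cmod ` (\<Lambda> - {0}))"

definition sewing_domain :: "(complex \<times> complex \<times> complex) set" where
  "sewing_domain =
     {(\<tau>1, \<tau>2, \<epsilon>). \<tau>1 \<in> upper_half_plane \<and> \<tau>2 \<in> upper_half_plane \<and>
        cmod \<epsilon> < min_norm (torus_lattice \<tau>1) * min_norm (torus_lattice \<tau>2) / 4}"

text \<open>The two tori are indexed by the two-element type \<^typ>\<open>2\<close>; the other index \<open>\<bar>a\<close> is \<open>a + 1\<close>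
  (note \<open>2 + 1 = 1\<close>). The inequality between \<open>\<bar>\<epsilon>\<bar>\<close> and \<open>r\<^sub>1 r\<^sub>2\<close> is strict: for equality the
  annuli degenerate to circles, which are lost when closed discs are excised.\<close>

definition sewing_radii :: "complex ^ 2 \<Rightarrow> complex \<Rightarrow> real ^ 2 \<Rightarrow> bool" where
  "sewing_radii \<tau> \<epsilon> r \<longleftrightarrow>
     (\<forall>a. 0 < r $ a \<and> r $ a < min_norm (torus_lattice (\<tau> $ a)) / 2) \<and> cmod \<epsilon> < r $ 1 * r $ 2"

text \<open>The inverse image in \<open>\<complex>\<close> of the torus \<open>\<complex> / \<Lambda>\<^sub>a\<close> with the closed disc
  \<open>\<bar>z\<^sub>a\<bar> \<le> \<bar>\<epsilon>\<bar> / r\<^bsub>a+1\<^esub>\<close> excised. In the degenerate case \<open>\<epsilon> = 0\<close> nothing is removed: the two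
  tori are joined at a node.\<close>

definition sewing_piece :: "complex ^ 2 \<Rightarrow> complex \<Rightarrow> real ^ 2 \<Rightarrow> 2 \<Rightarrow> complex set" where
  "sewing_piece \<tau> \<epsilon> r a =
     (if \<epsilon> = 0 then UNIV else {z. \<forall>\<kappa>\<in>torus_lattice (\<tau> $ a). \<not> cmod (z - \<kappa>) \<le> cmod \<epsilon> / r $ (a + 1)})"

text \<open>Points of a piece are identified modulo its lattice, and points of the two annuli around the
  excised discs through \<open>z\<^sub>1 z\<^sub>2 = \<epsilon>\<close>; the local coordinate at 0 of a point \<open>z\<close> near \<open>\<kappa> \<in> \<Lambda>\<^sub>a\<close> is
  \<open>z - \<kappa>\<close>. For \<open>\<epsilon> = 0\<close> only the two origins are identified.\<close>

definition sewing_rel :: "complex ^ 2 \<Rightarrow> complex \<Rightarrow> real ^ 2 \<Rightarrow> ((2 \<times> complex) \<times> (2 \<times> complex)) set" where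
  "sewing_rel \<tau> \<epsilon> r =
     {((a, z), (b, w)). z \<in> sewing_piece \<tau> \<epsilon> r a \<and> w \<in> sewing_piece \<tau> \<epsilon> r b \<and>
        (a = b \<and> z - w \<in> torus_lattice (\<tau> $ a) \<or>
         b = a + 1 \<and>
           (\<exists>\<kappa>\<in>torus_lattice (\<tau> $ a). \<exists>\<mu>\<in>torus_lattice (\<tau> $ b).
              if \<epsilon> = 0 then z = \<kappa> \<and> w = \<mu>
              else (z - \<kappa>) * (w - \<mu>) = \<epsilon> \<and> cmod (z - \<kappa>) < r $ a \<and> cmod (w - \<mu>) < r $ b))}"

definition sewn_surface :: "complex ^ 2 \<Rightarrow> complex \<Rightarrow> real ^ 2 \<Rightarrow> (2 \<times> complex) set set" where
  "sewn_surface \<tau> \<epsilon> r = (SIGMA a:UNIV. sewing_piece \<tau> \<epsilon> r a) // sewing_rel \<tau> \<epsilon> r"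

definition sewing_param :: "complex ^ 2 \<Rightarrow> complex \<Rightarrow> real ^ 2 \<Rightarrow> 2 \<Rightarrow> complex \<Rightarrow> (2 \<times> complex) set" where
  "sewing_param \<tau> \<epsilon> r a z = sewing_rel \<tau> \<epsilon> r `` {(a, z)}"

lemma sewn_surface_eq: "sewn_surface \<tau> \<epsilon> r = (\<Union>a. sewing_param \<tau> \<epsilon> r a ` sewing_piece \<tau> \<epsilon> r a)"
  by (auto simp: sewn_surface_def sewing_param_def quotient_def)

section \<open>Holomorphic 1-forms and the period matrix\<close>

text \<open>Let the complex structure of a surface \<open>X\<close> be given by maps \<open>\<phi>\<^sub>i : U\<^sub>i \<rightarrow> X\<close> on open sets
  \<open>U\<^sub>i \<subseteq> \<complex>\<close> that are locally biholomorphic (not necessarily injective) and jointly onto. A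
  holomorphic 1-form on \<open>X\<close> is represented by its pull-backs \<open>\<phi>\<^sub>i\<^sup>* \<nu> = f\<^sub>i(z) dz\<close>; these are the
  families of holomorphic functions that transform correctly under all coordinate changes \<open>t\<close>.\<close>

definition holomorphic_one_form ::
    "('i \<Rightarrow> complex set) \<Rightarrow> ('i \<Rightarrow> complex \<Rightarrow> 'p) \<Rightarrow> ('i \<Rightarrow> complex \<Rightarrow> complex) \<Rightarrow> bool" where
  "holomorphic_one_form U \<phi> f \<longleftrightarrow>
     (\<forall>i. f i holomorphic_on U i) \<and>
     (\<forall>i j V t. open V \<and> V \<subseteq> U i \<and> t holomorphic_on V \<and> t ` V \<subseteq> U j \<and> (\<forall>z\<in>V. \<phi> j (t z) = \<phi> i z) \<longrightarrow>
        (\<forall>z\<in>V. f i z = f j (t z) * deriv t z))"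

text \<open>For \<open>\<epsilon> = 0\<close> this yields pairs of holomorphic 1-forms on the two tori.\<close>

definition sewn_one_form ::
    "complex ^ 2 \<Rightarrow> complex \<Rightarrow> real ^ 2 \<Rightarrow> (2 \<Rightarrow> complex \<Rightarrow> complex) \<Rightarrow> bool" where
  "sewn_one_form \<tau> \<epsilon> r = holomorphic_one_form (sewing_piece \<tau> \<epsilon> r) (sewing_param \<tau> \<epsilon> r)"

text \<open>A path in \<open>\<complex>\<close> whose image in the sewn surface is a cycle on the part inherited from the
  torus \<open>a\<close>, with \<open>\<integral>dz = \<omega>\<close> for \<open>\<omega> \<in> \<Lambda>\<^sub>a\<close>. Two such cycles differ homologically by multiples of
  the boundary of the excised disc, which is null-homologous in the torus with the disc removed.\<close>

definition torus_cycle :: "complex ^ 2 \<Rightarrow> complex \<Rightarrow> real ^ 2 \<Rightarrow> 2 \<Rightarrow> complex \<Rightarrow> (real \<Rightarrow> complex) \<Rightarrow> bool"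
    where
  "torus_cycle \<tau> \<epsilon> r a \<omega> \<gamma> \<longleftrightarrow>
     valid_path \<gamma> \<and> path_image \<gamma> \<subseteq> sewing_piece \<tau> \<epsilon> r a \<and> pathfinish \<gamma> = pathstart \<gamma> + \<omega>"

definition a_cycle :: "complex ^ 2 \<Rightarrow> complex \<Rightarrow> real ^ 2 \<Rightarrow> 2 \<Rightarrow> (real \<Rightarrow> complex) \<Rightarrow> bool" where
  "a_cycle \<tau> \<epsilon> r a = torus_cycle \<tau> \<epsilon> r a (2 * pi * \<i>)"

definition b_cycle :: "complex ^ 2 \<Rightarrow> complex \<Rightarrow> real ^ 2 \<Rightarrow> 2 \<Rightarrow> (real \<Rightarrow> complex) \<Rightarrow> bool" where
  "b_cycle \<tau> \<epsilon> r a = torus_cycle \<tau> \<epsilon> r a (2 * pi * \<i> * \<tau> $ a)"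

definition has_period :: "((real \<Rightarrow> complex) \<Rightarrow> bool) \<Rightarrow> (complex \<Rightarrow> complex) \<Rightarrow> complex \<Rightarrow> bool" where
  "has_period is_cycle f c \<longleftrightarrow>
     (\<exists>\<gamma>. is_cycle \<gamma>) \<and> (\<forall>\<gamma>. is_cycle \<gamma> \<longrightarrow> (f has_contour_integral c) \<gamma>)"

definition is_period_matrix :: "complex ^ 2 \<Rightarrow> complex \<Rightarrow> real ^ 2 \<Rightarrow> complex ^ 2 ^ 2 \<Rightarrow> bool" where
  "is_period_matrix \<tau> \<epsilon> r \<Omega> \<longleftrightarrow>
     (\<exists>\<nu> :: 2 \<Rightarrow> 2 \<Rightarrow> complex \<Rightarrow> complex.
        (\<forall>j. sewn_one_form \<tau> \<epsilon> r (\<nu> j)) \<and>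
        (\<forall>i j. has_period (a_cycle \<tau> \<epsilon> r i) (\<nu> j i) (if i = j then 2 * pi * \<i> else 0)) \<and>
        (\<forall>i j. \<exists>c. has_period (b_cycle \<tau> \<epsilon> r i) (\<nu> j i) c \<and> \<Omega> $ i $ j = c / (2 * pi * \<i>)))"

definition period_map :: "complex \<times> complex \<times> complex \<Rightarrow> complex ^ 2 ^ 2" where
  "period_map = (\<lambda>(\<tau>1, \<tau>2, \<epsilon>).
     THE \<Omega>. \<exists>r. sewing_radii (vector [\<tau>1, \<tau>2]) \<epsilon> r \<and> is_period_matrix (vector [\<tau>1, \<tau>2]) \<epsilon> r \<Omega>)"

end

theory Submission
  imports Defs
begin

text \<open>On a torus with discs removed every one-form is \<open>c + \<Sum>\<^sub>k v\<^sub>k (- 1)\<^sup>k / k! \<cdot> zeta\<^bsup>(k)\<^esup>\<close>, where \<open>zeta\<close>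
  is quasi-periodic with simple poles on the lattice. In terms of rescaled Taylor coefficients \<open>x\<^sub>a\<close>
  the sewing relation \<open>z\<^sub>1 z\<^sub>2 = \<epsilon>\<close> becomes \<open>x\<^sub>a = c\<^sub>a \<rho>\<^sub>a e\<^sub>1 - G\<^sub>a U x\<^bsub>a+1\<^esub>\<close> with
  \<open>G\<^sub>a(k, l) = \<rho>\<^sub>a\<^bsup>k+l\<^esup> C(k, l) / sqrt (k l)\<close>, \<open>U = diag(u\<^sup>k)\<close> and \<open>u = \<epsilon> / (\<rho>\<^sub>1 \<rho>\<^sub>2)\<close>, \<open>\<bar>u\<bar> < 1\<close>. The
  decisive point is that \<open>G\<^sub>a\<close> is a contraction of \<open>\<ell>\<^sup>2\<close> whenever \<open>\<rho>\<^sub>a < D(\<Lambda>\<^sub>a) / 2\<close>: the form has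
  nonnegative area outside the disc of radius \<open>\<rho>\<^sub>a\<close> inside the Voronoi hexagon of the lattice, and
  this area is expressed by the periods and the Laurent coefficients. So the system is solved by a
  Neumann series, whose entries give the periods, and the same area inequality shows that the
  imaginary part of the period matrix is positive definite. Conversely the Laurent splitting on the
  collar and Liouville's theorem bring every one-form into the above shape. The entries of the
  solution are holomorphic in each variable and locally bounded, hence jointly holomorphic.\<close>

text \<open>Only the product of the radii is constrained by \<open>\<epsilon>\<close>, so neither
  sewing matrix is bounded by itself in a useful way: the powers of \<open>\<epsilon>\<close> are
  distributed between matrices \<open>G\<close> that depend on one torus each and a diagonal factor
  \<open>U\<close>. For \<open>G\<close> the bound 1 is all that is proved and all that is needed;
  strictness comes from \<open>U\<close> alone, once per passage through the collar. The sharp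
  constant 1/4 in the domain requires discs of every radius below D/2, and this forces a hexagon: a
  period parallelogram centred at 0 need not contain such a disc (for the hexagonal lattice its
  inscribed circle has radius sqrt 3 / 4 times D). The area inequality is first obtained for
  finitely many principal coefficients, which is why operator bounds are phrased through finite
  truncations. The Laurent splitting of an arbitrary form loses a little of the annulus, so
  uniqueness is proved with slightly smaller radii. The final formulas contain no radii, hence the
  period matrix does not change.\<close>

section \<open>Square-summable sequences indexed from 1\<close>

definition l2 :: "(nat \<Rightarrow> complex) \<Rightarrow> bool" where
  "l2 x \<longleftrightarrow> (\<lambda>k. (cmod (x k))\<^sup>2) summable_on {1..}"

definition l2norm :: "(nat \<Rightarrow> complex) \<Rightarrow> real" where
  "l2norm x = sqrt (\<Sum>\<^sub>\<infinity>k\<in>{1..}. (cmod (x k))\<^sup>2)"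

lemma l2norm_nonneg [simp]: "0 \<le> l2norm x"
  by (simp add: l2norm_def infsum_nonneg)

abbreviation trunc_norm :: "nat \<Rightarrow> (nat \<Rightarrow> complex) \<Rightarrow> real" where
  "trunc_norm N x \<equiv> L2_set (\<lambda>k. cmod (x k)) {1..N}"

lemma L2_set_le_l2norm:
  assumes "l2 x" "finite F" "F \<subseteq> {1..}"
  shows "L2_set (\<lambda>k. cmod (x k)) F \<le> l2norm x"
  unfolding L2_set_def l2norm_def
  using assms by (intro real_sqrt_le_mono finite_sum_le_infsum) (auto simp: l2_def)

lemma finite_subset_atLeast_Icc:
  assumes "finite F" "F \<subseteq> {1::nat..}"
  obtains N where "F \<subseteq> {1..N}"
proof -
  obtain N where "\<forall>x\<in>F. x \<le> N" using assms(1) by (meson finite_nat_set_iff_bounded_le)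
  then have "F \<subseteq> {1..N}" using assms(2) by auto
  then show ?thesis using that by blast
qed

text \<open>Estimates are made on truncations; a bound uniform in N suffices because every finite
  set of positive indices lies in some interval {1..N}.\<close>

lemma l2I_bounded:
  assumes "\<And>N. trunc_norm N x \<le> B"
  shows "l2 x" and "l2norm x \<le> B"
proof -
  have B: "0 \<le> B" using assms[of 0] by simp
  have *: "(\<Sum>k\<in>F. (cmod (x k))\<^sup>2) \<le> B\<^sup>2" if F: "finite F" "F \<subseteq> {1..}" for F
  proof -
    obtain N where N: "F \<subseteq> {1..N}" using finite_subset_atLeast_Icc F by blast
    have "(\<Sum>k\<in>F. (cmod (x k))\<^sup>2) \<le> (\<Sum>k=1..N. (cmod (x k))\<^sup>2)"
      using N by (intro sum_mono2) auto
    also have "\<dots> = (trunc_norm N x)\<^sup>2"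
      by (simp add: L2_set_def sum_nonneg)
    also have "\<dots> \<le> B\<^sup>2" using assms[of N] by (intro power_mono) auto
    finally show ?thesis .
  qed
  show l: "l2 x" unfolding l2_def
    by (rule nonneg_bdd_above_summable_on) (auto intro!: bdd_aboveI[of _ "B\<^sup>2"] *)
  have "(\<Sum>\<^sub>\<infinity>k\<in>{1..}. (cmod (x k))\<^sup>2) \<le> B\<^sup>2"
    by (rule infsum_le_finite_sums) (use l * in \<open>auto simp: l2_def\<close>)
  then show "l2norm x \<le> B" unfolding l2norm_def
    using B real_le_lsqrt by (simp add: real_sqrt_le_iff real_le_lsqrt)
qed

text \<open>Cauchy-Schwarz on finite index sets, with a bound that does not depend on the
  set.\<close>

lemma l2_mult:
  assumes "l2 x" "l2 y"
  shows "(\<lambda>k. cmod (x k * y k)) summable_on {1..}"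
    and "cmod (\<Sum>\<^sub>\<infinity>k\<in>{1..}. x k * y k) \<le> l2norm x * l2norm y"
proof -
  have *: "(\<Sum>k\<in>F. cmod (x k * y k)) \<le> l2norm x * l2norm y" if F: "finite F" "F \<subseteq> {1..}" for F
  proof -
    have "(\<Sum>k\<in>F. cmod (x k * y k)) = (\<Sum>k\<in>F. \<bar>cmod (x k)\<bar> * \<bar>cmod (y k)\<bar>)"
      by (simp add: norm_mult)
    also have "\<dots> \<le> L2_set (\<lambda>k. cmod (x k)) F * L2_set (\<lambda>k. cmod (y k)) F"
      by (rule L2_set_mult_ineq)
    also have "\<dots> \<le> l2norm x * l2norm y"
      using assms F by (intro mult_mono L2_set_le_l2norm) auto
    finally show ?thesis .
  qed
  show s: "(\<lambda>k. cmod (x k * y k)) summable_on {1..}"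
    by (rule nonneg_bdd_above_summable_on) (auto intro!: bdd_aboveI[of _ "l2norm x * l2norm y"] *)
  have "cmod (\<Sum>\<^sub>\<infinity>k\<in>{1..}. x k * y k) \<le> (\<Sum>\<^sub>\<infinity>k\<in>{1..}. cmod (x k * y k))"
    by (rule norm_infsum_bound) (rule s)
  also have "\<dots> \<le> l2norm x * l2norm y"
    by (rule infsum_le_finite_sums) (use s * in auto)
  finally show "cmod (\<Sum>\<^sub>\<infinity>k\<in>{1..}. x k * y k) \<le> l2norm x * l2norm y" .
qed

lemma cmod_le_l2norm:
  assumes "l2 x" "1 \<le> k" shows "cmod (x k) \<le> l2norm x"
  using L2_set_le_l2norm[OF assms(1), of "{k}"] assms(2) by simp

lemma l2_zero: "l2 (\<lambda>k. 0)" "l2norm (\<lambda>k. 0) = 0"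
  by (auto simp: l2_def l2norm_def)

lemma l2_scale:
  assumes "l2 x" shows "l2 (\<lambda>k. c * x k)" "l2norm (\<lambda>k. c * x k) = cmod c * l2norm x"
  using assms
  by (auto simp: l2_def l2norm_def norm_mult power_mult_distrib infsum_cmult_right' real_sqrt_mult
      intro!: summable_on_cmult_right)

lemma l2_add:
  assumes "l2 x" "l2 y"
  shows "l2 (\<lambda>k. x k + y k)" "l2norm (\<lambda>k. x k + y k) \<le> l2norm x + l2norm y"
proof -
  have *: "L2_set (\<lambda>k. cmod (x k + y k)) {1..N} \<le> l2norm x + l2norm y" for N
  proof -
    have "L2_set (\<lambda>k. cmod (x k + y k)) {1..N} \<le> L2_set (\<lambda>k. cmod (x k) + cmod (y k)) {1..N}"
      by (intro L2_set_mono norm_triangle_ineq) auto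
    also have "\<dots> \<le> trunc_norm N x + trunc_norm N y"
      by (rule L2_set_triangle_ineq)
    also have "\<dots> \<le> l2norm x + l2norm y"
      using assms by (intro add_mono L2_set_le_l2norm) auto
    finally show ?thesis .
  qed
  show "l2 (\<lambda>k. x k + y k)" "l2norm (\<lambda>k. x k + y k) \<le> l2norm x + l2norm y"
    using l2I_bounded[OF *] by auto
qed

lemma l2_diff:
  assumes "l2 x" "l2 y" shows "l2 (\<lambda>k. x k - y k)"
  using l2_add(1)[OF assms(1) l2_scale(1)[OF assms(2), of "-1"]] by simp

lemma l2_dominated:
  assumes "l2 x" "\<And>k. 1 \<le> k \<Longrightarrow> cmod (y k) \<le> c * cmod (x k)" "0 \<le> c"
  shows "l2 y" "l2norm y \<le> c * l2norm x"
proof -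
  have *: "trunc_norm N y \<le> c * l2norm x" for N
  proof -
    have "trunc_norm N y \<le> L2_set (\<lambda>k. c * cmod (x k)) {1..N}"
      using assms(2) by (intro L2_set_mono) auto
    also have "\<dots> = c * trunc_norm N x"
      using L2_set_right_distrib[OF assms(3)] by metis
    also have "\<dots> \<le> c * l2norm x"
      using assms by (intro mult_left_mono L2_set_le_l2norm) auto
    finally show ?thesis .
  qed
  show "l2 y" "l2norm y \<le> c * l2norm x"
    using l2I_bounded[OF *] by auto
qed

definition unit_seq :: "nat \<Rightarrow> nat \<Rightarrow> complex" where
  "unit_seq j k = (if k = j then 1 else 0)"

lemma L2_set_unit_seq: "1 \<le> j \<Longrightarrow> L2_set (\<lambda>k. cmod (unit_seq j k)) {1..N} \<le> 1"
proof -
  have "(\<Sum>k=1..N. (cmod (unit_seq j k))\<^sup>2) = (\<Sum>k=1..N. if k = j then 1 else 0)"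
    by (intro sum.cong) (auto simp: unit_seq_def)
  also have "\<dots> \<le> 1" by (simp add: sum.delta)
  finally show ?thesis unfolding L2_set_def by (simp add: real_le_lsqrt)
qed

lemma l2_unit_seq: "1 \<le> j \<Longrightarrow> l2 (unit_seq j)" "1 \<le> j \<Longrightarrow> l2norm (unit_seq j) \<le> 1"
  using l2I_bounded[OF L2_set_unit_seq] by blast+

section \<open>Infinite matrices as bounded operators\<close>

text \<open>Operator norm at most q, tested on finite truncations so that no convergence has to be
  known beforehand. The form is bilinear rather than sesquilinear, which makes transposition
  immediate; the bound is the same, since x may be replaced by its conjugate.\<close>

definition mbound :: "imat \<Rightarrow> real \<Rightarrow> bool" where
  "mbound K q \<longleftrightarrow> 0 \<le> q \<and> (\<forall>N x y. cmod (\<Sum>k=1..N. \<Sum>l=1..N. x k * K k l * y l)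
     \<le> q * trunc_norm N x * trunc_norm N y)"

lemma mboundD:
  assumes "mbound K q"
  shows "cmod (\<Sum>k=1..N. \<Sum>l=1..N. x k * K k l * y l)
     \<le> q * trunc_norm N x * trunc_norm N y"
  using assms unfolding mbound_def by blast

lemma mbound_nonneg: "mbound K q \<Longrightarrow> 0 \<le> q"
  by (simp add: mbound_def)

lemma mbound_transpose: "mbound K q \<Longrightarrow> mbound (\<lambda>k l. K l k) q"
proof -
  assume a: "mbound K q"
  have "cmod (\<Sum>k=1..N. \<Sum>l=1..N. x k * K l k * y l)
     \<le> q * trunc_norm N x * trunc_norm N y" for N x y
  proof -
    have "(\<Sum>k=1..N. \<Sum>l=1..N. x k * K l k * y l) = (\<Sum>l=1..N. \<Sum>k=1..N. x k * K l k * y l)"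
      by (rule sum.swap)
    also have "\<dots> = (\<Sum>l=1..N. \<Sum>k=1..N. y l * K l k * x k)" by (simp add: mult_ac)
    finally show ?thesis using mboundD[OF a, where x=y and N=N and y=x] by (simp add: mult_ac)
  qed
  then show ?thesis using a by (auto simp: mbound_def)
qed

text \<open>Duality: testing the bilinear form with the conjugate of \<open>w = K y\<close> turns it
  into the squared norm of w, and one factor of that norm cancels.\<close>

lemma mbound_finite_apply:
  assumes "mbound K q"
  shows "L2_set (\<lambda>k. cmod (\<Sum>l=1..N. K k l * y l)) {1..N} \<le> q * trunc_norm N y"
proof -
  define w where "w k = (\<Sum>l=1..N. K k l * y l)" for k
  define L where "L = trunc_norm N w"
  have cw: "(\<Sum>l=1..N. c * K k l * y l) = c * w k" for c k
    by (simp add: w_def sum_distrib_left mult_ac)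
  have "(\<Sum>k=1..N. \<Sum>l=1..N. cnj (w k) * K k l * y l) = (\<Sum>k=1..N. cnj (w k) * w k)"
    using cw by simp
  also have "\<dots> = of_real (\<Sum>k=1..N. (cmod (w k))\<^sup>2)"
    using complex_norm_square by (simp add: mult_ac del: of_real_power)
  also have "\<dots> = of_real (L\<^sup>2)" by (simp add: L_def L2_set_def sum_nonneg)
  finally have "L\<^sup>2 \<le> q * L * trunc_norm N y"
    using mboundD[OF assms, where x="\<lambda>k. cnj (w k)" and N=N and y=y] by (simp add: L_def norm_power)
  then have "L * L \<le> (q * trunc_norm N y) * L"
    by (simp add: power2_eq_square mult_ac)
  moreover have "0 \<le> L" "0 \<le> q * trunc_norm N y"
    using mbound_nonneg[OF assms] by (auto simp: L_def)
  ultimately have "L \<le> q * trunc_norm N y"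
    by (metis mult_le_cancel_right not_le order_le_less)
  then show ?thesis by (simp add: L_def w_def)
qed

text \<open>A column is the image of a unit sequence. The truncation is enlarged to
  \<open>max M l\<close> so that the unit sequence is visible in it.\<close>

lemma mbound_col:
  assumes "mbound K q" "1 \<le> l"
  shows "l2 (\<lambda>k. K k l)" "l2norm (\<lambda>k. K k l) \<le> q"
proof -
  have *: "L2_set (\<lambda>k. cmod (K k l)) {1..M} \<le> q" for M
  proof -
    define N where "N = max M l"
    have "L2_set (\<lambda>k. cmod (K k l)) {1..M} \<le> L2_set (\<lambda>k. cmod (K k l)) {1..N}"
      unfolding L2_set_def by (intro real_sqrt_le_mono sum_mono2) (auto simp: N_def)
    also have "L2_set (\<lambda>k. cmod (K k l)) {1..N} = L2_set (\<lambda>k. cmod (\<Sum>j=1..N. K k j * unit_seq l j)) {1..N}"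
      using assms(2) by (intro L2_set_cong) (auto simp: unit_seq_def N_def if_distrib sum.delta cong: if_cong)
    also have "\<dots> \<le> q * L2_set (\<lambda>k. cmod (unit_seq l k)) {1..N}"
      by (rule mbound_finite_apply[OF assms(1)])
    also have "\<dots> \<le> q * 1"
      using L2_set_unit_seq[OF assms(2)] mbound_nonneg[OF assms(1)] by (intro mult_left_mono) auto
    finally show ?thesis by simp
  qed
  show "l2 (\<lambda>k. K k l)" "l2norm (\<lambda>k. K k l) \<le> q" using l2I_bounded[OF *] by auto
qed

lemma mbound_row:
  assumes "mbound K q" "1 \<le> k"
  shows "l2 (\<lambda>l. K k l)" "l2norm (\<lambda>l. K k l) \<le> q"
  using mbound_col[OF mbound_transpose[OF assms(1)] assms(2)] by auto

lemma mbound_entry: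
  assumes "mbound K q" "1 \<le> k" "1 \<le> l" shows "cmod (K k l) \<le> q"
  using cmod_le_l2norm[OF mbound_col(1)[OF assms(1,3)] assms(2)] mbound_col(2)[OF assms(1,3)] by simp

definition imat_apply :: "imat \<Rightarrow> (nat \<Rightarrow> complex) \<Rightarrow> nat \<Rightarrow> complex" where
  "imat_apply K y k = (\<Sum>\<^sub>\<infinity>l\<in>{1..}. K k l * y l)"

lemma abs_summable_tendsto_Icc:
  fixes f :: "nat \<Rightarrow> complex"
  assumes "f summable_on {1..}"
  shows "(\<lambda>N. \<Sum>k=1..N. f k) \<longlonglongrightarrow> (\<Sum>\<^sub>\<infinity>k\<in>{1..}. f k)"
proof -
  have "(sum f \<longlongrightarrow> infsum f {1..}) (finite_subsets_at_top {1..})"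
    using assms by (rule infsum_tendsto)
  moreover have "filterlim (\<lambda>N. {1..N}) (finite_subsets_at_top {1::nat..}) sequentially"
    unfolding filterlim_finite_subsets_at_top
  proof (intro allI impI)
    fix X :: "nat set" assume X: "finite X \<and> X \<subseteq> {1..}"
    then obtain N where "X \<subseteq> {1..N}" using finite_subset_atLeast_Icc by blast
    then show "\<forall>\<^sub>F M in sequentially. finite {1..M} \<and> X \<subseteq> {1..M} \<and> {1..M} \<subseteq> {1..}"
      by (intro eventually_sequentiallyI[of N]) auto
  qed
  ultimately show ?thesis by (rule filterlim_compose)
qed

lemma imat_apply_summable:
  assumes "mbound K q" "l2 y" "1 \<le> k"
  shows "(\<lambda>l. cmod (K k l * y l)) summable_on {1..}"
  using l2_mult(1)[OF mbound_row(1)[OF assms(1,3)] assms(2)] .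

text \<open>The two truncations are decoupled: for a fixed output range M the inner sum runs to N,
  with N tending to infinity, and the bound for the square truncation N applies as soon as
  \<open>M \<le> N\<close>.\<close>

lemma imat_apply_l2:
  assumes "mbound K q" "l2 y"
  shows "l2 (imat_apply K y)" "l2norm (imat_apply K y) \<le> q * l2norm y"
proof -
  have *: "L2_set (\<lambda>k. cmod (imat_apply K y k)) {1..M} \<le> q * l2norm y" for M
  proof -
    have "(\<lambda>N. L2_set (\<lambda>k. cmod (\<Sum>l=1..N. K k l * y l)) {1..M}) \<longlonglongrightarrow> L2_set (\<lambda>k. cmod (imat_apply K y k)) {1..M}"
      unfolding L2_set_def imat_apply_def
      by (intro tendsto_intros abs_summable_tendsto_Icc abs_summable_summable[OF imat_apply_summable[OF assms]]) auto
    moreover have "\<forall>\<^sub>F N in sequentially. L2_set (\<lambda>k. cmod (\<Sum>l=1..N. K k l * y l)) {1..M} \<le> q * l2norm y"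
    proof (rule eventually_sequentiallyI[of M])
      fix N assume "M \<le> N"
      then have "L2_set (\<lambda>k. cmod (\<Sum>l=1..N. K k l * y l)) {1..M} \<le> L2_set (\<lambda>k. cmod (\<Sum>l=1..N. K k l * y l)) {1..N}"
        unfolding L2_set_def by (intro real_sqrt_le_mono sum_mono2) auto
      also have "\<dots> \<le> q * trunc_norm N y" by (rule mbound_finite_apply[OF assms(1)])
      also have "\<dots> \<le> q * l2norm y"
        using mbound_nonneg[OF assms(1)] assms(2) by (intro mult_left_mono L2_set_le_l2norm) auto
      finally show "L2_set (\<lambda>k. cmod (\<Sum>l=1..N. K k l * y l)) {1..M} \<le> q * l2norm y" .
    qed
    ultimately show ?thesis by (intro tendsto_upperbound) auto
  qed
  show "l2 (imat_apply K y)" "l2norm (imat_apply K y) \<le> q * l2norm y"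
    using l2I_bounded[OF *] by auto
qed

lemma l2_truncate:
  assumes "l2 x"
  shows "l2 (\<lambda>k. if k \<le> N then x k else 0)"
  by (rule l2_dominated(1)[OF assms, of _ 1]) auto

lemma l2_tail_tendsto_0:
  assumes "l2 x"
  shows "(\<lambda>N. l2norm (\<lambda>k. if k \<le> N then 0 else x k)) \<longlonglongrightarrow> 0"
proof -
  have s: "(\<lambda>k. complex_of_real ((cmod (x k))\<^sup>2)) summable_on {1..}"
    using assms unfolding l2_def by (rule summable_on_of_real)
  have "(\<lambda>N. \<Sum>k=1..N. complex_of_real ((cmod (x k))\<^sup>2)) \<longlonglongrightarrow> (\<Sum>\<^sub>\<infinity>k\<in>{1..}. complex_of_real ((cmod (x k))\<^sup>2))"
    using s by (rule abs_summable_tendsto_Icc)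
  then have "(\<lambda>N. Re (\<Sum>k=1..N. complex_of_real ((cmod (x k))\<^sup>2))) \<longlonglongrightarrow> Re (\<Sum>\<^sub>\<infinity>k\<in>{1..}. complex_of_real ((cmod (x k))\<^sup>2))"
    by (rule tendsto_Re)
  then have lim: "(\<lambda>N. \<Sum>k=1..N. (cmod (x k))\<^sup>2) \<longlonglongrightarrow> (\<Sum>\<^sub>\<infinity>k\<in>{1..}. (cmod (x k))\<^sup>2)"
    using infsum_Re[OF s] by simp
  have "(\<Sum>\<^sub>\<infinity>k\<in>{1..}. (cmod (if k \<le> N then 0 else x k))\<^sup>2)
      = (\<Sum>\<^sub>\<infinity>k\<in>{1..}. (cmod (x k))\<^sup>2) - (\<Sum>k=1..N. (cmod (x k))\<^sup>2)" for N
  proof -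
    have "(\<Sum>\<^sub>\<infinity>k\<in>{1..}. (cmod (x k))\<^sup>2) = (\<Sum>\<^sub>\<infinity>k\<in>{1..N} \<union> {N<..}. (cmod (x k))\<^sup>2) "
    proof -
      have "{1..} = {1..N} \<union> {N<..}" by auto
      then show ?thesis by simp
    qed
    also have "\<dots> = (\<Sum>\<^sub>\<infinity>k\<in>{1..N}. (cmod (x k))\<^sup>2) + (\<Sum>\<^sub>\<infinity>k\<in>{N<..}. (cmod (x k))\<^sup>2)"
      using assms summable_on_subset_banach[of "\<lambda>k. (cmod (x k))\<^sup>2" "{1..}"]
      by (intro infsum_Un_disjoint) (auto simp: l2_def subset_eq)
    also have "(\<Sum>\<^sub>\<infinity>k\<in>{N<..}. (cmod (x k))\<^sup>2) = (\<Sum>\<^sub>\<infinity>k\<in>{1..}. (cmod (if k \<le> N then 0 else x k))\<^sup>2)"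
      by (intro infsum_cong_neutral) auto
    finally show ?thesis by simp
  qed
  then have "(\<lambda>N. l2norm (\<lambda>k. if k \<le> N then 0 else x k))
     = (\<lambda>N. sqrt ((\<Sum>\<^sub>\<infinity>k\<in>{1..}. (cmod (x k))\<^sup>2) - (\<Sum>k=1..N. (cmod (x k))\<^sup>2)))"
    by (simp add: l2norm_def)
  moreover have "\<dots> \<longlonglongrightarrow> sqrt ((\<Sum>\<^sub>\<infinity>k\<in>{1..}. (cmod (x k))\<^sup>2) - (\<Sum>\<^sub>\<infinity>k\<in>{1..}. (cmod (x k))\<^sup>2))"
    by (intro tendsto_intros lim)
  ultimately show ?thesis by (simp only: diff_self real_sqrt_zero)
qed

lemma imat_bilinear_limit:
  assumes K: "mbound K q" and a: "l2 a" and b: "l2 b"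
  shows "(\<lambda>N. \<Sum>k=1..N. a k * imat_apply K b k) \<longlonglongrightarrow> (\<Sum>\<^sub>\<infinity>k\<in>{1..}. a k * imat_apply K b k)"
  by (rule abs_summable_tendsto_Icc[OF abs_summable_summable[OF l2_mult(1)[OF a imat_apply_l2(1)[OF K b]]]])

lemma infsum_sum:
  fixes f :: "'a \<Rightarrow> 'b \<Rightarrow> complex"
  assumes "finite A" "\<And>a. a \<in> A \<Longrightarrow> f a summable_on B"
  shows "(\<lambda>x. \<Sum>a\<in>A. f a x) summable_on B" "(\<Sum>\<^sub>\<infinity>x\<in>B. \<Sum>a\<in>A. f a x) = (\<Sum>a\<in>A. \<Sum>\<^sub>\<infinity>x\<in>B. f a x)"
  using assms by (induction rule: finite_induct) (auto simp: infsum_add summable_on_add)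

lemma infsum_truncate:
  "(\<Sum>\<^sub>\<infinity>k\<in>{1::nat..}. (if k \<le> N then x k else 0) * y k) = (\<Sum>k=1..N. x k * (y k :: complex))"
proof -
  have "(\<Sum>\<^sub>\<infinity>k\<in>{1..}. (if k \<le> N then x k else 0) * y k) = (\<Sum>\<^sub>\<infinity>k\<in>{1..N}. x k * y k)"
    by (rule infsum_cong_neutral) auto
  then show ?thesis by simp
qed

lemma infsum_diff:
  fixes f g :: "'a \<Rightarrow> complex"
  assumes "f summable_on A" "g summable_on A"
  shows "(\<Sum>\<^sub>\<infinity>x\<in>A. f x - g x) = infsum f A - infsum g A"
  using infsum_add[OF assms(1), of "\<lambda>x. - g x"] assms(2) by (simp add: summable_on_uminus infsum_uminus)

text \<open>The double series need not converge absolutely, because \<open>mbound\<close> does not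
  control the matrix of absolute values. The order of summation is therefore exchanged for a
  truncation of a, where the outer sum is finite, and the error is bounded by the norm of the tail
  of a.\<close>

lemma imat_bilinear_swap:
  assumes K: "mbound K q" and a: "l2 a" and b: "l2 b"
  shows "(\<Sum>\<^sub>\<infinity>k\<in>{1..}. a k * imat_apply K b k) = (\<Sum>\<^sub>\<infinity>l\<in>{1..}. imat_apply (\<lambda>k l. K l k) a l * b l)"
proof -
  define L where "L = (\<Sum>\<^sub>\<infinity>k\<in>{1..}. a k * imat_apply K b k)"
  define aN where "aN N k = (if k \<le> N then a k else 0)" for N k
  define ta where "ta N k = (if k \<le> N then 0 else a k)" for N k
  let ?K = "\<lambda>k l. K l k"
  have K': "mbound ?K q" by (rule mbound_transpose[OF K])
  have 1: "(\<Sum>k=1..N. a k * imat_apply K b k) = (\<Sum>\<^sub>\<infinity>l\<in>{1..}. imat_apply ?K (aN N) l * b l)" for N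
  proof -
    have "(\<Sum>k=1..N. a k * imat_apply K b k) = (\<Sum>k=1..N. \<Sum>\<^sub>\<infinity>l\<in>{1..}. a k * (K k l * b l))"
      unfolding imat_apply_def by (simp add: infsum_cmult_right')
    also have "\<dots> = (\<Sum>\<^sub>\<infinity>l\<in>{1..}. \<Sum>k=1..N. a k * (K k l * b l))"
      by (rule infsum_sum(2)[symmetric])
         (simp, intro summable_on_cmult_right, rule abs_summable_summable[OF imat_apply_summable[OF K b]], simp)
    also have "\<dots> = (\<Sum>\<^sub>\<infinity>l\<in>{1..}. imat_apply ?K (aN N) l * b l)"
    proof (rule infsum_cong)
      fix l :: nat assume "l \<in> {1..}"
      have "imat_apply ?K (aN N) l = (\<Sum>k=1..N. a k * K k l)"
        unfolding imat_apply_def aN_def using infsum_truncate[of N a "\<lambda>k. K k l"] by (simp add: mult.commute)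
      then show "(\<Sum>k=1..N. a k * (K k l * b l)) = imat_apply ?K (aN N) l * b l"
        by (simp add: sum_distrib_left sum_distrib_right mult_ac)
    qed
    finally show ?thesis .
  qed
  have 2: "cmod ((\<Sum>\<^sub>\<infinity>l\<in>{1..}. imat_apply ?K a l * b l) - (\<Sum>k=1..N. a k * imat_apply K b k)) \<le> q * l2norm (ta N) * l2norm b" for N
  proof -
    have laN: "l2 (aN N)" unfolding aN_def by (rule l2_truncate[OF a])
    have lt: "l2 (ta N)" by (rule l2_dominated(1)[OF a, of _ 1]) (auto simp: ta_def)
    have s1: "(\<lambda>l. imat_apply ?K a l * b l) summable_on {1..}"
      by (rule abs_summable_summable[OF l2_mult(1)[OF imat_apply_l2(1)[OF K' a] b]])
    have s2: "(\<lambda>l. imat_apply ?K (aN N) l * b l) summable_on {1..}"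
      by (rule abs_summable_summable[OF l2_mult(1)[OF imat_apply_l2(1)[OF K' laN] b]])
    have "imat_apply ?K a l - imat_apply ?K (aN N) l = imat_apply ?K (ta N) l" if "1 \<le> l" for l
    proof -
      have "imat_apply ?K a l = (\<Sum>\<^sub>\<infinity>k\<in>{1..}. K k l * aN N k + K k l * ta N k)"
        unfolding imat_apply_def by (rule infsum_cong) (auto simp: aN_def ta_def)
      also have "\<dots> = imat_apply ?K (aN N) l + imat_apply ?K (ta N) l"
        unfolding imat_apply_def
        using abs_summable_summable[OF imat_apply_summable[OF K' laN that]]
          abs_summable_summable[OF imat_apply_summable[OF K' lt that]]
        by (rule infsum_add)
      finally show ?thesis by simp
    qed
    then have "(\<Sum>\<^sub>\<infinity>l\<in>{1..}. imat_apply ?K a l * b l) - (\<Sum>\<^sub>\<infinity>l\<in>{1..}. imat_apply ?K (aN N) l * b l)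
        = (\<Sum>\<^sub>\<infinity>l\<in>{1..}. imat_apply ?K (ta N) l * b l)"
      by (subst infsum_diff[OF s1 s2, symmetric]) (auto intro!: infsum_cong simp flip: left_diff_distrib)
    also have "cmod \<dots> \<le> l2norm (imat_apply ?K (ta N)) * l2norm b"
      by (rule l2_mult(2)[OF imat_apply_l2(1)[OF K' lt] b])
    also have "\<dots> \<le> q * l2norm (ta N) * l2norm b"
      by (intro mult_right_mono imat_apply_l2(2)[OF K' lt]) auto
    finally show ?thesis using 1 by simp
  qed
  have "(\<lambda>N. q * l2norm (ta N) * l2norm b) \<longlonglongrightarrow> q * 0 * l2norm b"
    unfolding ta_def by (intro tendsto_intros l2_tail_tendsto_0 a)
  then have "(\<lambda>N. q * l2norm (ta N) * l2norm b) \<longlonglongrightarrow> 0" by simp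
  then have "(\<lambda>N. (\<Sum>\<^sub>\<infinity>l\<in>{1..}. imat_apply ?K a l * b l) - (\<Sum>k=1..N. a k * imat_apply K b k)) \<longlonglongrightarrow> 0"
    by (rule Lim_null_comparison[rotated]) (use 2 in auto)
  moreover have "(\<lambda>N. (\<Sum>\<^sub>\<infinity>l\<in>{1..}. imat_apply ?K a l * b l) - (\<Sum>k=1..N. a k * imat_apply K b k))
     \<longlonglongrightarrow> (\<Sum>\<^sub>\<infinity>l\<in>{1..}. imat_apply ?K a l * b l) - L"
    unfolding L_def by (intro tendsto_intros imat_bilinear_limit[OF K a b])
  ultimately show ?thesis unfolding L_def using LIMSEQ_unique by fastforce
qed

lemma imat_mult_summable:
  assumes A: "mbound A q" and B: "mbound B r" and "1 \<le> k" "1 \<le> l"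
  shows "(\<lambda>m. cmod (A k m * B m l)) summable_on {1..}"
  using l2_mult(1)[OF mbound_row(1)[OF A \<open>1 \<le> k\<close>] mbound_col(1)[OF B \<open>1 \<le> l\<close>]] .

text \<open>Row k of A takes the place of the sequence a in
  \<open>imat_bilinear_swap\<close>.\<close>

lemma imat_apply_mult:
  assumes A: "mbound A q" and B: "mbound B r" and y: "l2 y" and k: "1 \<le> k"
  shows "imat_apply (imat_mult A B) y k = imat_apply A (imat_apply B y) k"
proof -
  have "imat_apply A (imat_apply B y) k = (\<Sum>\<^sub>\<infinity>m\<in>{1..}. A k m * imat_apply B y m)"
    by (simp add: imat_apply_def)
  also have "\<dots> = (\<Sum>\<^sub>\<infinity>l\<in>{1..}. imat_apply (\<lambda>k l. B l k) (\<lambda>m. A k m) l * y l)"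
    by (rule imat_bilinear_swap[OF B mbound_row(1)[OF A k] y])
  also have "\<dots> = imat_apply (imat_mult A B) y k"
    by (simp add: imat_apply_def imat_mult_def mult.commute)
  finally show ?thesis ..
qed

text \<open>The form of the product is the pairing of the transpose of A applied to x with B applied
  to y. Both arguments are finite, so the outer sums can be moved inside the infinite one.\<close>

lemma mbound_mult:
  assumes A: "mbound A q" and B: "mbound B r"
  shows "mbound (imat_mult A B) (q * r)"
proof -
  have "cmod (\<Sum>k=1..N. \<Sum>l=1..N. x k * imat_mult A B k l * y l)
     \<le> q * r * trunc_norm N x * trunc_norm N y" for N x y
  proof -
    define w where "w m = (\<Sum>k=1..N. A k m * x k)" for m
    define z where "z m = (\<Sum>l=1..N. B m l * y l)" for m
    have w: "trunc_norm M w \<le> q * trunc_norm N x"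
     and z: "trunc_norm M z \<le> r * trunc_norm N y" for M
    proof -
      \<comment> \<open>Input range N and output range M differ here, whereas \<open>mbound\<close>
        speaks of square truncations; the input is padded with zeros up to
        \<open>P = max M N\<close>.\<close>
      have gen: "L2_set (\<lambda>m. cmod (\<Sum>k=1..N. K m k * u k)) {1..M} \<le> p * trunc_norm N u"
        if K: "mbound K p" for K p and u :: "nat \<Rightarrow> complex"
      proof -
        define P where "P = max M N"
        define v where "v k = (if k \<le> N then u k else 0)" for k
        have e: "(\<Sum>k=1..N. K m k * u k) = (\<Sum>k=1..P. K m k * v k)" for m
          by (rule sum.mono_neutral_cong_left) (auto simp: P_def v_def)
        have "L2_set (\<lambda>m. cmod (\<Sum>k=1..N. K m k * u k)) {1..M} \<le> L2_set (\<lambda>m. cmod (\<Sum>k=1..P. K m k * v k)) {1..P}"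
          unfolding L2_set_def e by (intro real_sqrt_le_mono sum_mono2) (auto simp: P_def)
        also have "\<dots> \<le> p * trunc_norm P v"
          by (rule mbound_finite_apply[OF K])
        also have "(\<Sum>k=1..P. (cmod (v k))\<^sup>2) = (\<Sum>k=1..N. (cmod (u k))\<^sup>2)"
          by (rule sum.mono_neutral_cong_right) (auto simp: P_def v_def)
        then have "trunc_norm P v = trunc_norm N u"
          by (simp add: L2_set_def)
        finally show ?thesis .
      qed
      show "trunc_norm M w \<le> q * trunc_norm N x"
        unfolding w_def by (rule gen[OF mbound_transpose[OF A]])
      show "trunc_norm M z \<le> r * trunc_norm N y"
        unfolding z_def by (rule gen[OF B])
    qed
    have lw: "l2 w" "l2norm w \<le> q * trunc_norm N x" using l2I_bounded[OF w] by auto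
    have lz: "l2 z" "l2norm z \<le> r * trunc_norm N y" using l2I_bounded[OF z] by auto
    have "(\<Sum>k=1..N. \<Sum>l=1..N. x k * imat_mult A B k l * y l)
        = (\<Sum>k=1..N. \<Sum>l=1..N. \<Sum>\<^sub>\<infinity>m\<in>{1..}. (x k * y l) * (A k m * B m l))"
      unfolding imat_mult_def by (simp only: infsum_cmult_right' mult_ac)
    also have "\<dots> = (\<Sum>k=1..N. \<Sum>\<^sub>\<infinity>m\<in>{1..}. \<Sum>l=1..N. (x k * y l) * (A k m * B m l))"
      using abs_summable_summable[OF imat_mult_summable[OF A B]]
      by (intro sum.cong infsum_sum(2)[symmetric] refl) (auto intro!: summable_on_cmult_right)
    also have "\<dots> = (\<Sum>\<^sub>\<infinity>m\<in>{1..}. \<Sum>k=1..N. \<Sum>l=1..N. (x k * y l) * (A k m * B m l))"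
      using abs_summable_summable[OF imat_mult_summable[OF A B]]
      by (intro infsum_sum(2)[symmetric]) (auto intro!: infsum_sum(1) summable_on_cmult_right)
    also have "\<dots> = (\<Sum>\<^sub>\<infinity>m\<in>{1..}. w m * z m)"
      unfolding w_def z_def by (simp add: sum_product mult_ac)
    finally have "cmod (\<Sum>k=1..N. \<Sum>l=1..N. x k * imat_mult A B k l * y l) \<le> l2norm w * l2norm z"
      using l2_mult(2)[OF lw(1) lz(1)] by simp
    also have "\<dots> \<le> (q * trunc_norm N x) * (r * trunc_norm N y)"
      using lw(2) lz(2) mbound_nonneg[OF A] by (intro mult_mono) auto
    finally show ?thesis by (simp add: mult_ac)
  qed
  then show ?thesis unfolding mbound_def using mbound_nonneg[OF A] mbound_nonneg[OF B] by simp
qed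

lemma mbound_id: "mbound imat_id 1"
proof -
  have "cmod (\<Sum>k=1..N. \<Sum>l=1..N. x k * imat_id k l * y l)
     \<le> 1 * trunc_norm N x * trunc_norm N y" for N x y
  proof -
    have "(\<Sum>k=1..N. \<Sum>l=1..N. x k * imat_id k l * y l) = (\<Sum>k=1..N. x k * y k)"
      by (intro sum.cong refl) (auto simp: imat_id_def if_distrib if_distribR sum.delta cong: if_cong)
    also have "cmod \<dots> \<le> (\<Sum>k=1..N. \<bar>cmod (x k)\<bar> * \<bar>cmod (y k)\<bar>)"
      by (rule order_trans[OF norm_sum]) (simp add: norm_mult)
    also have "\<dots> \<le> trunc_norm N x * trunc_norm N y"
      by (rule L2_set_mult_ineq)
    finally show ?thesis by simp
  qed
  then show ?thesis by (auto simp: mbound_def)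
qed

lemma mbound_power: "mbound K q \<Longrightarrow> mbound (imat_power K n) (q ^ n)"
  by (induction n) (auto simp: mbound_id mult.commute dest: mbound_mult)

lemma mbound_diag_right:
  assumes K: "mbound K q" and d: "\<And>l. 1 \<le> l \<Longrightarrow> cmod (d l) \<le> p" and p: "0 \<le> p"
  shows "mbound (\<lambda>k l. K k l * d l) (q * p)"
proof -
  have "cmod (\<Sum>k=1..N. \<Sum>l=1..N. x k * (K k l * d l) * y l)
     \<le> q * p * trunc_norm N x * trunc_norm N y" for N x y
  proof -
    have "L2_set (\<lambda>k. cmod (d k * y k)) {1..N} \<le> L2_set (\<lambda>k. p * cmod (y k)) {1..N}"
      by (intro L2_set_mono) (auto simp: norm_mult intro!: mult_right_mono d)
    also have "\<dots> = p * trunc_norm N y"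
      using L2_set_right_distrib[OF p] by metis
    finally have le: "L2_set (\<lambda>k. cmod (d k * y k)) {1..N} \<le> p * trunc_norm N y" .
    have "cmod (\<Sum>k=1..N. \<Sum>l=1..N. x k * (K k l * d l) * y l)
      \<le> (q * trunc_norm N x) * L2_set (\<lambda>k. cmod (d k * y k)) {1..N}"
      using mboundD[OF K, where x=x and N=N and y="\<lambda>k. d k * y k"] by (simp add: mult_ac)
    also have "\<dots> \<le> (q * trunc_norm N x) * (p * trunc_norm N y)"
      using mbound_nonneg[OF K] by (intro mult_left_mono le) auto
    finally show ?thesis by (simp add: mult_ac)
  qed
  then show ?thesis using p mbound_nonneg[OF K] by (auto simp: mbound_def)
qed

text \<open>Products of infinite matrices are not associative in general; for bounded ones this is
  \<open>imat_apply_mult\<close> applied to a column of C.\<close>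

lemma imat_mult_assoc:
  assumes A: "mbound A q" and B: "mbound B r" and C: "mbound C s" and "1 \<le> k" "1 \<le> l"
  shows "imat_mult (imat_mult A B) C k l = imat_mult A (imat_mult B C) k l"
  using imat_apply_mult[OF A B mbound_col(1)[OF C \<open>1 \<le> l\<close>] \<open>1 \<le> k\<close>]
  by (simp add: imat_apply_def imat_mult_def)

lemma imat_mult_cong:
  assumes "\<And>m. 1 \<le> m \<Longrightarrow> A k m = A' k m" "\<And>m. 1 \<le> m \<Longrightarrow> B m l = B' m l"
  shows "imat_mult A B k l = imat_mult A' B' k l"
  unfolding imat_mult_def using assms by (intro infsum_cong) auto

lemma imat_mult_id_left: "1 \<le> k \<Longrightarrow> imat_mult imat_id A k l = A k l"
  unfolding imat_mult_def
  by (subst infsum_cong_neutral[where T="{k}" and g="\<lambda>m. A m l"]) (auto simp: imat_id_def)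

lemma imat_mult_id_right: "1 \<le> l \<Longrightarrow> imat_mult A imat_id k l = A k l"
  unfolding imat_mult_def
  by (subst infsum_cong_neutral[where T="{l}" and g="\<lambda>m. A k m"]) (auto simp: imat_id_def)

text \<open>\<open>imat_power\<close> multiplies on the right, while the fixed point equation of the
  Neumann series needs the extra factor on the left.\<close>

lemma imat_power_commute:
  assumes K: "mbound K q" and "1 \<le> k" "1 \<le> l"
  shows "imat_mult K (imat_power K n) k l = imat_power K (Suc n) k l"
  using assms(2,3)
proof (induction n arbitrary: k l)
  case 0
  then show ?case by (simp add: imat_mult_id_left imat_mult_id_right)
next
  case (Suc n)
  have "imat_mult K (imat_power K (Suc n)) k l = imat_mult (imat_mult K (imat_power K n)) K k l"
    using imat_mult_assoc[OF K mbound_power[OF K] K Suc.prems, of n] by simp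
  also have "\<dots> = imat_mult (imat_power K (Suc n)) K k l"
    using Suc.IH Suc.prems by (intro imat_mult_cong) auto
  finally show ?case by simp
qed

lemma imat_mult_transpose:
  "imat_mult (\<lambda>k l. A l k) (\<lambda>k l. B l k) = (\<lambda>k l. imat_mult B A l k)"
  unfolding imat_mult_def by (simp add: mult.commute)

lemma imat_power_transpose:
  assumes K: "mbound K q" and "1 \<le> k" "1 \<le> l"
  shows "imat_power (\<lambda>k l. K l k) n k l = imat_power K n l k"
  using assms(2,3)
proof (induction n arbitrary: k l)
  case 0 then show ?case by (auto simp: imat_id_def)
next
  case (Suc n)
  have "imat_power (\<lambda>k l. K l k) (Suc n) k l = imat_mult (\<lambda>k l. imat_power K n l k) (\<lambda>k l. K l k) k l"
    unfolding imat_power.simps by (rule imat_mult_cong) (use Suc in auto)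
  also have "\<dots> = imat_mult K (imat_power K n) l k"
    by (rule fun_cong[OF fun_cong[OF imat_mult_transpose]])
  also have "\<dots> = imat_power K (Suc n) l k" using Suc.prems by (intro imat_power_commute[OF K]) auto
  finally show ?case .
qed

section \<open>Neumann series of a strict contraction\<close>

lemma neumann_entry_summable:
  assumes K: "mbound K q" and q: "q < 1" and "1 \<le> k" "1 \<le> l"
  shows "(\<lambda>n. cmod (imat_power K n k l)) summable_on UNIV"
proof (rule summable_on_comparison_test[where f="\<lambda>n. q ^ n"])
  show "(\<lambda>n. q ^ n) summable_on UNIV"
    using q mbound_nonneg[OF K] by (intro summable_nonneg_imp_summable_on summable_geometric) auto
  show "cmod (imat_power K n k l) \<le> q ^ n" for n
    by (rule mbound_entry[OF mbound_power[OF K] assms(3,4)])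
qed auto

lemma neumann_col:
  assumes K: "mbound K q" and q: "q < 1" and l: "1 \<le> l"
  shows "l2 (\<lambda>k. neumann_inverse K k l)" "l2norm (\<lambda>k. neumann_inverse K k l) \<le> 1 / (1 - q)"
proof -
  note q0 = mbound_nonneg[OF K]
  have *: "L2_set (\<lambda>k. cmod (neumann_inverse K k l)) {1..M} \<le> 1 / (1 - q)" for M
  proof -
    have lim: "(\<lambda>N. \<Sum>n<N. imat_power K n k l) \<longlonglongrightarrow> neumann_inverse K k l" if "1 \<le> k" for k
    proof -
      have "((\<lambda>n. imat_power K n k l) has_sum neumann_inverse K k l) UNIV"
        unfolding neumann_inverse_def
        by (rule has_sum_infsum[OF abs_summable_summable[OF neumann_entry_summable[OF K q that l]]])
      then show ?thesis using has_sum_imp_sums sums_def by blast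
    qed
    have "(\<lambda>N. L2_set (\<lambda>k. cmod (\<Sum>n<N. imat_power K n k l)) {1..M}) \<longlonglongrightarrow> L2_set (\<lambda>k. cmod (neumann_inverse K k l)) {1..M}"
      unfolding L2_set_def by (intro tendsto_intros lim) auto
    moreover have "L2_set (\<lambda>k. cmod (\<Sum>n<N. imat_power K n k l)) {1..M} \<le> 1 / (1 - q)" for N
    proof -
      have "L2_set (\<lambda>k. cmod (\<Sum>n<N. imat_power K n k l)) {1..M} \<le> (\<Sum>n<N. q ^ n)"
      proof (induction N)
        case (Suc N)
        have "L2_set (\<lambda>k. cmod (\<Sum>n<Suc N. imat_power K n k l)) {1..M}
           \<le> L2_set (\<lambda>k. cmod (\<Sum>n<N. imat_power K n k l) + cmod (imat_power K N k l)) {1..M}"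
          by (intro L2_set_mono) (auto intro: norm_triangle_ineq)
        also have "\<dots> \<le> L2_set (\<lambda>k. cmod (\<Sum>n<N. imat_power K n k l)) {1..M} + L2_set (\<lambda>k. cmod (imat_power K N k l)) {1..M}"
          by (rule L2_set_triangle_ineq)
        also have "\<dots> \<le> (\<Sum>n<N. q ^ n) + q ^ N"
          using Suc mbound_col[OF mbound_power[OF K, of N] l]
            L2_set_le_l2norm[OF mbound_col(1)[OF mbound_power[OF K, of N] l], of "{1..M}"]
          by (intro add_mono) auto
        finally show ?case by simp
      qed (simp add: L2_set_def)
      also have "\<dots> \<le> (\<Sum>n. q ^ n)"
        using q q0 by (intro sum_le_suminf summable_geometric) auto
      also have "\<dots> = 1 / (1 - q)" using q q0 by (intro suminf_geometric) auto
      finally show ?thesis .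
    qed
    ultimately show ?thesis by (intro tendsto_upperbound) auto
  qed
  show "l2 (\<lambda>k. neumann_inverse K k l)" "l2norm (\<lambda>k. neumann_inverse K k l) \<le> 1 / (1 - q)"
    using l2I_bounded[OF *] by auto
qed

text \<open>Splitting off the zeroth power leaves K applied to the series. The sums over powers and
  over the inner index may be exchanged because Cauchy-Schwarz, for row k of K and column l of the
  n-th power, bounds the inner absolute sum by \<open>q * q ^ n\<close>.\<close>

lemma neumann_eq:
  assumes K: "mbound K q" and q: "q < 1" and k: "1 \<le> k" and l: "1 \<le> l"
  shows "neumann_inverse K k l = imat_id k l + imat_apply K (\<lambda>m. neumann_inverse K m l) k"
proof -
  have s: "(\<lambda>n. imat_power K n k l) summable_on UNIV"
    by (rule abs_summable_summable[OF neumann_entry_summable[OF K q k l]])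
  have q0: "0 \<le> q" by (rule mbound_nonneg[OF K])
  have dom: "(\<lambda>(n,m). cmod (K k m * imat_power K n m l)) summable_on UNIV \<times> {1..}"
  proof (rule summable_on_SigmaI[where g="\<lambda>n. \<Sum>\<^sub>\<infinity>m\<in>{1..}. cmod (K k m * imat_power K n m l)"])
    have sm: "(\<lambda>m. cmod (K k m * imat_power K n m l)) summable_on {1..}" for n
      by (rule imat_mult_summable[OF K mbound_power[OF K] k l])
    show "((\<lambda>y. case (n, y) of (n, m) \<Rightarrow> cmod (K k m * imat_power K n m l)) has_sum
        (\<Sum>\<^sub>\<infinity>m\<in>{1..}. cmod (K k m * imat_power K n m l))) {1..}" for n
      using has_sum_infsum[OF sm] by simp
    show "(\<lambda>n. \<Sum>\<^sub>\<infinity>m\<in>{1..}. cmod (K k m * imat_power K n m l)) summable_on UNIV"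
    proof (rule summable_on_comparison_test[where f="\<lambda>n. q * q ^ n"])
      show "(\<lambda>n. q * q ^ n) summable_on UNIV"
        using q q0 by (intro summable_on_cmult_right summable_nonneg_imp_summable_on summable_geometric) auto
      show "(\<Sum>\<^sub>\<infinity>m\<in>{1..}. cmod (K k m * imat_power K n m l)) \<le> q * q ^ n" for n
      proof -
        have l2a: "l2 (\<lambda>m. of_real (cmod (K k m)))" "l2norm (\<lambda>m. of_real (cmod (K k m))) \<le> q"
          using mbound_row[OF K k] by (auto simp: l2_def l2norm_def)
        have l2b: "l2 (\<lambda>m. of_real (cmod (imat_power K n m l)))" "l2norm (\<lambda>m. of_real (cmod (imat_power K n m l))) \<le> q ^ n"
          using mbound_col[OF mbound_power[OF K] l, of n] by (auto simp: l2_def l2norm_def)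
        have "of_real (\<Sum>\<^sub>\<infinity>m\<in>{1..}. cmod (K k m * imat_power K n m l))
            = (\<Sum>\<^sub>\<infinity>m\<in>{1..}. complex_of_real (cmod (K k m)) * of_real (cmod (imat_power K n m l)))"
          using infsumI[OF has_sum_of_real[OF has_sum_infsum[OF sm[of n]], where 'a=complex]]
          by (simp add: norm_mult)
        also have "cmod \<dots> \<le> q * q ^ n"
          using l2_mult(2)[OF l2a(1) l2b(1)] l2a(2) l2b(2)
          by (meson l2norm_nonneg mult_mono order_trans q0)
        finally show ?thesis by simp
      qed
    qed (auto intro!: infsum_nonneg)
  qed auto
  have "imat_apply K (\<lambda>m. neumann_inverse K m l) k = (\<Sum>\<^sub>\<infinity>m\<in>{1..}. \<Sum>\<^sub>\<infinity>n. K k m * imat_power K n m l)"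
    unfolding imat_apply_def neumann_inverse_def by (simp add: infsum_cmult_right')
  also have "\<dots> = (\<Sum>\<^sub>\<infinity>n. \<Sum>\<^sub>\<infinity>m\<in>{1..}. K k m * imat_power K n m l)"
  proof (rule infsum_swap_banach[symmetric])
    have "(\<lambda>p. cmod ((\<lambda>(n, m). K k m * imat_power K n m l) p)) summable_on UNIV \<times> {1..}"
      using dom by (simp add: case_prod_unfold)
    then show "(\<lambda>(n, m). K k m * imat_power K n m l) summable_on UNIV \<times> {1..}"
      by (rule abs_summable_summable)
  qed
  also have "\<dots> = (\<Sum>\<^sub>\<infinity>n. imat_power K (Suc n) k l)"
    using imat_power_commute[OF K k l] by (simp add: imat_mult_def)
  also have "\<dots> = (\<Sum>\<^sub>\<infinity>n\<in>{1..}. imat_power K n k l)"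
    by (rule infsum_reindex_bij_witness[of _ "\<lambda>n. n - 1" Suc]) auto
  finally have e: "imat_apply K (\<lambda>m. neumann_inverse K m l) k = (\<Sum>\<^sub>\<infinity>n\<in>{1..}. imat_power K n k l)" .
  have "neumann_inverse K k l = (\<Sum>\<^sub>\<infinity>n\<in>{0} \<union> {1..}. imat_power K n k l)"
    unfolding neumann_inverse_def by (rule infsum_cong_neutral) auto
  also have "\<dots> = (\<Sum>\<^sub>\<infinity>n\<in>{0}. imat_power K n k l) + (\<Sum>\<^sub>\<infinity>n\<in>{1..}. imat_power K n k l)"
    using s by (intro infsum_Un_disjoint summable_on_subset_banach[OF s]) auto
  finally show ?thesis using e by simp
qed

section \<open>The loop through both tori\<close>

definition mscale :: "imat \<Rightarrow> complex \<Rightarrow> imat" where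
  "mscale G u k l = G k l * u ^ l"

text \<open>Strictness comes from numbering the columns from 1:
  \<open>cmod (u ^ l) \<le> cmod u\<close> for \<open>1 \<le> l\<close>, whereas G contributes only
  the factor 1.\<close>

lemma mbound_mscale:
  assumes G: "mbound G 1" and u: "cmod u < 1"
  shows "mbound (mscale G u) (cmod u)"
proof -
  have "cmod (u ^ l) \<le> cmod u" if "1 \<le> l" for l
    using power_decreasing[of 1 l "cmod u"] that u by (simp add: norm_power)
  then have "mbound (\<lambda>k l. G k l * u ^ l) (1 * cmod u)"
    by (intro mbound_diag_right[OF G]) auto
  then show ?thesis by (simp add: mscale_def[abs_def])
qed

lemma cmod_square_less_1: "cmod u < 1 \<Longrightarrow> cmod u * cmod u < 1"
  by (metis mult_less_cancel_right2 mult_strict_mono' norm_ge_zero mult_1)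

lemma mbound_loop:
  assumes "mbound G 1" "mbound G' 1" "cmod u < 1"
  shows "mbound (imat_mult (mscale G u) (mscale G' u)) (cmod u * cmod u)"
  by (intro mbound_mult mbound_mscale assms)

definition loop_resolvent :: "imat \<Rightarrow> imat \<Rightarrow> complex \<Rightarrow> imat" where
  "loop_resolvent G G' u = neumann_inverse (imat_mult (mscale G u) (mscale G' u))"

lemma loop_resolvent_l2:
  assumes "mbound G 1" "mbound G' 1" "cmod u < 1" "1 \<le> l"
  shows "l2 (\<lambda>k. loop_resolvent G G' u k l)"
  unfolding loop_resolvent_def
  by (rule neumann_col(1)[OF mbound_loop[OF assms(1-3)] cmod_square_less_1[OF assms(3)] assms(4)])

lemma loop_resolvent_eq:
  assumes "mbound G 1" "mbound G' 1" "cmod u < 1" "1 \<le> k"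
  shows "loop_resolvent G G' u k 1 = unit_seq 1 k
    + imat_apply (mscale G u) (imat_apply (mscale G' u) (\<lambda>m. loop_resolvent G G' u m 1)) k"
proof -
  have "loop_resolvent G G' u k 1 = imat_id k 1
      + imat_apply (imat_mult (mscale G u) (mscale G' u)) (\<lambda>m. loop_resolvent G G' u m 1) k"
    unfolding loop_resolvent_def
    by (rule neumann_eq[OF mbound_loop[OF assms(1-3)] cmod_square_less_1[OF assms(3)] assms(4)]) simp
  also have "imat_apply (imat_mult (mscale G u) (mscale G' u)) (\<lambda>m. loop_resolvent G G' u m 1) k
     = imat_apply (mscale G u) (imat_apply (mscale G' u) (\<lambda>m. loop_resolvent G G' u m 1)) k"
    by (rule imat_apply_mult[OF mbound_mscale mbound_mscale loop_resolvent_l2]) (use assms in auto)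
  finally show ?thesis by (simp add: imat_id_def unit_seq_def)
qed

text \<open>Going once around the loop multiplies the norm of x by at most
  \<open>cmod u * cmod u\<close>, which is less than 1.\<close>

lemma loop_homogeneous_zero:
  assumes G: "mbound G 1" "mbound G' 1" and u: "cmod u < 1"
    and x: "l2 x" "l2 y"
    and e: "\<And>k. 1 \<le> k \<Longrightarrow> x k = - imat_apply (mscale G u) y k"
      "\<And>k. 1 \<le> k \<Longrightarrow> y k = - imat_apply (mscale G' u) x k"
    and k: "1 \<le> k"
  shows "x k = 0"
proof -
  have "l2norm x = l2norm (imat_apply (mscale G u) y)" "l2norm y = l2norm (imat_apply (mscale G' u) x)"
    unfolding l2norm_def using e by (auto intro!: infsum_cong arg_cong[where f=sqrt])
  then have "l2norm x \<le> cmod u * l2norm y" "l2norm y \<le> cmod u * l2norm x"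
    using imat_apply_l2(2)[OF mbound_mscale[OF G(1) u] x(2)] imat_apply_l2(2)[OF mbound_mscale[OF G(2) u] x(1)]
    by auto
  then have "l2norm x \<le> (cmod u * cmod u) * l2norm x"
    by (metis (no_types, opaque_lifting) mult.assoc mult_left_mono norm_ge_zero order_trans)
  then have "(1 - cmod u * cmod u) * l2norm x \<le> 0" by (simp add: algebra_simps)
  then have "l2norm x \<le> 0"
    using cmod_square_less_1[OF u] by (simp add: mult_le_0_iff)
  then show ?thesis using cmod_le_l2norm[OF x(1) k] norm_le_zero_iff order_trans by blast
qed

text \<open>With symmetric G and G' the loops H and H' started at the two tori are intertwined: the
  transpose of H times U equals U times H'. The relation passes to powers, and written with U on
  both sides it involves no division by u. It is the source of the symmetry of the period
  matrix.\<close>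

lemma loop_power_transpose:
  assumes G: "mbound G 1" "mbound G' 1" and u: "cmod u < 1"
    and sym: "\<And>k l. 1 \<le> k \<Longrightarrow> 1 \<le> l \<Longrightarrow> G k l = G l k" "\<And>k l. 1 \<le> k \<Longrightarrow> 1 \<le> l \<Longrightarrow> G' k l = G' l k"
    and kl: "1 \<le> k" "1 \<le> l"
  defines "H \<equiv> imat_mult (mscale G u) (mscale G' u)" and "H' \<equiv> imat_mult (mscale G' u) (mscale G u)"
  shows "imat_power H n l k * u ^ l = u ^ k * imat_power H' n k l"
proof -
  have 1: "H l m * u ^ l = u ^ m * H' m l" if "1 \<le> l" "1 \<le> m" for l m
  proof -
    have "H l m * u ^ l = (\<Sum>\<^sub>\<infinity>p\<in>{1..}. (G l p * u ^ p) * (G' p m * u ^ m) * u ^ l)"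
      by (simp add: H_def imat_mult_def mscale_def infsum_cmult_left')
    also have "\<dots> = (\<Sum>\<^sub>\<infinity>p\<in>{1..}. u ^ m * ((G' m p * u ^ p) * (G p l * u ^ l)))"
      using that sym by (intro infsum_cong) (auto simp: mult_ac)
    also have "\<dots> = u ^ m * H' m l"
      by (simp add: H'_def imat_mult_def mscale_def infsum_cmult_right')
    finally show ?thesis .
  qed
  let ?T = "\<lambda>k l. H l k"
  have T: "imat_power ?T n k l * u ^ l = u ^ k * imat_power H' n k l" if "1 \<le> k" "1 \<le> l" for n k l
    using that
  proof (induction n arbitrary: k l)
    case 0 then show ?case by (simp add: imat_id_def)
  next
    case (Suc n)
    have "imat_power ?T (Suc n) k l * u ^ l = (\<Sum>\<^sub>\<infinity>m\<in>{1..}. imat_power ?T n k m * (H l m * u ^ l))"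
      by (simp add: imat_mult_def infsum_cmult_left' flip: mult.assoc)
    also have "\<dots> = (\<Sum>\<^sub>\<infinity>m\<in>{1..}. u ^ k * (imat_power H' n k m * H' m l))"
    proof (rule infsum_cong)
      fix m :: nat assume m: "m \<in> {1..}"
      have "imat_power ?T n k m * (H l m * u ^ l) = (imat_power ?T n k m * u ^ m) * H' m l"
        using 1[OF Suc.prems(2), of m] m by simp
      also have "\<dots> = u ^ k * (imat_power H' n k m * H' m l)"
        using Suc.IH[OF Suc.prems(1), of m] m by simp
      finally show "imat_power ?T n k m * (H l m * u ^ l) = u ^ k * (imat_power H' n k m * H' m l)" .
    qed
    also have "\<dots> = u ^ k * imat_power H' (Suc n) k l"
      by (simp add: imat_mult_def infsum_cmult_right')
    finally show ?case .
  qed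
  have "mbound H (cmod u * cmod u)" unfolding H_def by (rule mbound_loop[OF G u])
  from imat_power_transpose[OF this kl] T[OF kl] show ?thesis by simp
qed

text \<open>In the entry (1, 1) the intertwining relation carries the factor u on both sides, which
  cancels if \<open>u \<noteq> 0\<close>; for \<open>u = 0\<close> both entries are 1.\<close>

lemma loop_resolvent_sym:
  assumes G: "mbound G 1" "mbound G' 1" and u: "cmod u < 1"
    and sym: "\<And>k l. 1 \<le> k \<Longrightarrow> 1 \<le> l \<Longrightarrow> G k l = G l k" "\<And>k l. 1 \<le> k \<Longrightarrow> 1 \<le> l \<Longrightarrow> G' k l = G' l k"
  shows "loop_resolvent G G' u 1 1 = loop_resolvent G' G u 1 1"
proof (cases "u = 0")
  case True
  then have z: "mscale K u k l = 0" if "1 \<le> l" for K k l using that by (simp add: mscale_def)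
  have "imat_mult (mscale K u) (mscale K' u) k l = 0" if "1 \<le> l" for K K' k l
    unfolding imat_mult_def using z that by (intro infsum_0) auto
  then have "imat_apply (imat_mult (mscale K u) (mscale K' u)) y k = 0" for K K' y k
    unfolding imat_apply_def by (intro infsum_0) auto
  then show ?thesis
    unfolding loop_resolvent_def
    using neumann_eq[OF mbound_loop[OF G u] cmod_square_less_1[OF u], of 1 1]
      neumann_eq[OF mbound_loop[OF G(2,1) u] cmod_square_less_1[OF u], of 1 1] by simp
next
  case False
  then show ?thesis
    unfolding loop_resolvent_def neumann_inverse_def
    using loop_power_transpose[OF assms, where k=1 and l=1] by (simp add: mult.commute)
qed

text \<open>Conjugating by a diagonal matrix transfers the Neumann series of the loop
  \<open>G U G' U\<close>, a strict contraction, to that of \<open>A A'\<close>, which need not be bounded itself.\<close>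

lemma conjugated_neumann:
  fixes A A' G G' :: imat and W W' :: "nat \<Rightarrow> complex" and u :: complex
  assumes G: "mbound G 1" "mbound G' 1" and u: "cmod u < 1"
    and W: "\<And>k. 1 \<le> k \<Longrightarrow> W k \<noteq> 0" "\<And>k. 1 \<le> k \<Longrightarrow> W' k \<noteq> 0" "\<And>k. 1 \<le> k \<Longrightarrow> W k * W' k = u ^ k"
    and A: "\<And>k l. 1 \<le> k \<Longrightarrow> 1 \<le> l \<Longrightarrow> A k l = W k * G k l * W l"
    and A': "\<And>k l. 1 \<le> k \<Longrightarrow> 1 \<le> l \<Longrightarrow> A' k l = W' k * G' k l * W' l"
  defines "M \<equiv> imat_mult A A'"
  shows "imat_mult_converges A A'" "neumann_converges M" "imat_mult_converges A' (neumann_inverse M)"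
    and "neumann_inverse M 1 1 = loop_resolvent G G' u 1 1"
    and "imat_mult A' (neumann_inverse M) 1 1
       = W' 1 / W 1 * imat_apply (mscale G' u) (\<lambda>m. loop_resolvent G G' u m 1) 1"
proof -
  define H where "H = imat_mult (mscale G u) (mscale G' u)"
  define R where "R = loop_resolvent G G' u"
  have H: "mbound H (cmod u * cmod u)" unfolding H_def by (rule mbound_loop[OF G u])
  note u2 = cmod_square_less_1[OF u]
  \<comment> \<open>Inside the product \<open>A A'\<close> only \<open>W m * W' m = u ^ m\<close>
    occurs. The outer factors leave the conjugation \<open>W k / W l\<close>, which survives all
    powers and equals 1 in the entry (1, 1).\<close>
  have W'': "W' l = u ^ l / W l" if "1 \<le> l" for l
    using W(1)[OF that] W(3)[OF that] by (simp add: field_simps)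
  have t: "A k m * A' m l = W k / W l * (mscale G u k m * mscale G' u m l)" if "1 \<le> k" "1 \<le> l" "1 \<le> m" for k l m
    using that W(1)[of m] W(1)[of l] by (simp add: A A' W'' mscale_def field_simps)
  have s: "(\<lambda>m. mscale G u k m * mscale G' u m l) summable_on {1..}" if "1 \<le> k" "1 \<le> l" for k l
    by (rule abs_summable_summable[OF imat_mult_summable[OF mbound_mscale[OF G(1) u] mbound_mscale[OF G(2) u] that]])
  show "imat_mult_converges A A'" unfolding imat_mult_converges_def
  proof (intro allI impI)
    fix k l :: nat assume kl: "1 \<le> k" "1 \<le> l"
    show "(\<lambda>m. A k m * A' m l) summable_on {1..}"
      using summable_on_cmult_right[OF s[OF kl], of "W k / W l"]
      by (rule iffD2[OF summable_on_cong, rotated]) (use t kl in auto)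
  qed
  have M: "M k l = W k / W l * H k l" if "1 \<le> k" "1 \<le> l" for k l
  proof -
    have "M k l = (\<Sum>\<^sub>\<infinity>m\<in>{1..}. W k / W l * (mscale G u k m * mscale G' u m l))"
      unfolding M_def imat_mult_def using t that by (intro infsum_cong) auto
    then show ?thesis by (simp only: infsum_cmult_right' H_def imat_mult_def)
  qed
  have P: "imat_power M n k l = W k / W l * imat_power H n k l" if "1 \<le> k" "1 \<le> l" for n k l
    using that
  proof (induction n arbitrary: k l)
    case 0 then show ?case using W(1) by (auto simp: imat_id_def)
  next
    case (Suc n)
    have "imat_power M (Suc n) k l = (\<Sum>\<^sub>\<infinity>m\<in>{1..}. W k / W l * (imat_power H n k m * H m l))"
      unfolding imat_power.simps imat_mult_def
      using Suc W(1) by (intro infsum_cong) (auto simp: M)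
    then show ?case by (simp only: infsum_cmult_right' imat_power.simps imat_mult_def)
  qed
  show "neumann_converges M" unfolding neumann_converges_def imat_mult_converges_def
  proof (intro conjI allI impI)
    fix n and k l :: nat assume kl: "1 \<le> k" "1 \<le> l"
    have "(\<lambda>m. imat_power H n k m * H m l) summable_on {1..}"
      by (rule abs_summable_summable[OF imat_mult_summable[OF mbound_power[OF H] H kl]])
    from summable_on_cmult_right[OF this, of "W k / W l"]
    show "(\<lambda>m. imat_power M n k m * M m l) summable_on {1..}"
      by (rule iffD2[OF summable_on_cong, rotated]) (use kl W(1) in \<open>auto simp: P M\<close>)
  next
    fix k l :: nat assume kl: "1 \<le> k" "1 \<le> l"
    show "(\<lambda>n. imat_power M n k l) summable_on UNIV"
      unfolding P[OF kl]
      by (intro summable_on_cmult_right abs_summable_summable[OF neumann_entry_summable[OF H u2 kl]])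
  qed
  have N: "neumann_inverse M k l = W k / W l * R k l" if "1 \<le> k" "1 \<le> l" for k l
    unfolding neumann_inverse_def R_def loop_resolvent_def P[OF that] H_def by (simp only: infsum_cmult_right')
  show "neumann_inverse M 1 1 = loop_resolvent G G' u 1 1" using N[of 1 1] W(1)[of 1] by (simp add: R_def)
  have t': "A' k m * neumann_inverse M m l = W' k / W l * (mscale G' u k m * R m l)" if "1 \<le> k" "1 \<le> l" "1 \<le> m" for k l m
    using that W(1)[of m] W(1)[of l] by (simp add: N A' W'' mscale_def field_simps)
  show "imat_mult_converges A' (neumann_inverse M)" unfolding imat_mult_converges_def
  proof (intro allI impI)
    fix k l :: nat assume kl: "1 \<le> k" "1 \<le> l"
    have "(\<lambda>m. mscale G' u k m * R m l) summable_on {1..}"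
      unfolding R_def
      by (rule abs_summable_summable[OF imat_apply_summable[OF mbound_mscale[OF G(2) u] loop_resolvent_l2[OF G u kl(2)] kl(1)]])
    from summable_on_cmult_right[OF this, of "W' k / W l"]
    show "(\<lambda>m. A' k m * neumann_inverse M m l) summable_on {1..}"
      by (rule iffD2[OF summable_on_cong, rotated]) (use kl t' in auto)
  qed
  have "imat_mult A' (neumann_inverse M) 1 1 = (\<Sum>\<^sub>\<infinity>m\<in>{1..}. W' 1 / W 1 * (mscale G' u 1 m * R m 1))"
    unfolding imat_mult_def using t' by (intro infsum_cong) auto
  then show "imat_mult A' (neumann_inverse M) 1 1
       = W' 1 / W 1 * imat_apply (mscale G' u) (\<lambda>m. loop_resolvent G G' u m 1) 1"
    by (simp only: infsum_cmult_right' imat_apply_def R_def)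
qed

text \<open>The case \<open>\<epsilon> = 0\<close>, in which the conjugating diagonal of
  \<open>conjugated_neumann\<close> would vanish. The value 1 in the entry (1, 1) is the zeroth
  power.\<close>

lemma zero_neumann:
  fixes A A' :: imat
  assumes A: "\<And>k l. 1 \<le> k \<Longrightarrow> 1 \<le> l \<Longrightarrow> A k l = 0" and A': "\<And>k l. 1 \<le> k \<Longrightarrow> 1 \<le> l \<Longrightarrow> A' k l = 0"
  defines "M \<equiv> imat_mult A A'"
  shows "imat_mult_converges A A'" "neumann_converges M" "imat_mult_converges A' (neumann_inverse M)"
    and "neumann_inverse M 1 1 = 1"
    and "imat_mult A' (neumann_inverse M) 1 1 = 0"
proof -
  have s: "(\<lambda>m. f m * g m) summable_on {1..}" if "\<And>m. 1 \<le> m \<Longrightarrow> f m = 0 \<or> g m = 0" for f g :: "nat \<Rightarrow> complex"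
  proof -
    have "(\<lambda>m. f m * g m) summable_on {1..} \<longleftrightarrow> (\<lambda>m::nat. 0::complex) summable_on {1..}"
      using that by (intro summable_on_cong) auto
    then show ?thesis by simp
  qed
  have z: "imat_mult B C k l = 0" if "1 \<le> k" "1 \<le> l" "\<And>m. 1 \<le> m \<Longrightarrow> B k m = 0 \<or> C m l = 0" for B C k l
    unfolding imat_mult_def using that by (intro infsum_0) auto
  have M: "M k l = 0" if "1 \<le> k" "1 \<le> l" for k l
    unfolding M_def by (rule z) (use that A in auto)
  have P: "imat_power M (Suc n) k l = 0" if "1 \<le> k" "1 \<le> l" for n k l
    unfolding imat_power.simps by (rule z) (use that M in auto)
  show "imat_mult_converges A A'" "imat_mult_converges A' (neumann_inverse M)"
    unfolding imat_mult_converges_def by (intro conjI allI impI s; use A A' in auto)+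
  have sn: "(\<lambda>n. imat_power M n k l) summable_on UNIV" if "1 \<le> k" "1 \<le> l" for k l
  proof (rule finite_nonzero_values_imp_summable_on)
    have "{n \<in> UNIV. imat_power M n k l \<noteq> 0} \<subseteq> {0}"
    proof
      fix n assume "n \<in> {n \<in> UNIV. imat_power M n k l \<noteq> 0}"
      then show "n \<in> {0}" using P[OF that, of "n - 1"] by (cases n) simp_all
    qed
    then show "finite {n \<in> UNIV. imat_power M n k l \<noteq> 0}" using finite_subset by blast
  qed
  show "neumann_converges M"
    unfolding neumann_converges_def imat_mult_converges_def
    by (intro conjI allI impI s sn) (use M in auto)
  have "neumann_inverse M 1 1 = (\<Sum>\<^sub>\<infinity>n\<in>{0}. imat_power M n 1 1)"
    unfolding neumann_inverse_def
  proof (rule infsum_cong_neutral)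
    fix n :: nat assume "n \<in> UNIV - {0}"
    then show "imat_power M n 1 1 = 0" using P[of 1 1] by (cases n) auto
  qed auto
  then show "neumann_inverse M 1 1 = 1" by (simp add: imat_id_def)
  show "imat_mult A' (neumann_inverse M) 1 1 = 0" by (rule z) (use A' in auto)
qed

section \<open>Infinite sums of holomorphic functions\<close>

lemma higher_deriv_sum:
  fixes f :: "'a \<Rightarrow> complex \<Rightarrow> complex"
  assumes "finite F" "\<And>x. x \<in> F \<Longrightarrow> f x holomorphic_on A" "open A" "z \<in> A"
  shows "(deriv ^^ m) (\<lambda>w. \<Sum>x\<in>F. f x w) z = (\<Sum>x\<in>F. (deriv ^^ m) (f x) z)"
  using assms
proof (induction rule: finite_induct)
  case (insert x F)
  have "(deriv ^^ m) (\<lambda>w. \<Sum>x\<in>insert x F. f x w) z = (deriv ^^ m) (\<lambda>w. f x w + (\<Sum>x\<in>F. f x w)) z"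
    using insert.hyps by simp
  also have "\<dots> = (deriv ^^ m) (f x) z + (deriv ^^ m) (\<lambda>w. \<Sum>x\<in>F. f x w) z"
    using insert.prems by (intro higher_deriv_add[where S=A] holomorphic_on_sum) auto
  finally show ?case using insert by simp
qed simp

text \<open>By the Weierstrass test the net of finite partial sums converges uniformly; holomorphy
  and derivatives of every order pass to such limits.\<close>

lemma infsum_holomorphic:
  fixes f :: "'a \<Rightarrow> complex \<Rightarrow> complex"
  assumes A: "open A" and hol: "\<And>x. x \<in> X \<Longrightarrow> f x holomorphic_on A"
    and bound: "\<And>x z. x \<in> X \<Longrightarrow> z \<in> A \<Longrightarrow> cmod (f x z) \<le> M x" and M: "M summable_on X"
  shows "(\<lambda>z. \<Sum>\<^sub>\<infinity>x\<in>X. f x z) holomorphic_on A"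
    and "z \<in> A \<Longrightarrow> ((\<lambda>x. (deriv ^^ m) (f x) z) has_sum (deriv ^^ m) (\<lambda>z. \<Sum>\<^sub>\<infinity>x\<in>X. f x z) z) X"
proof -
  have ul: "uniform_limit A (\<lambda>F z. \<Sum>x\<in>F. f x z) (\<lambda>z. \<Sum>\<^sub>\<infinity>x\<in>X. f x z) (finite_subsets_at_top X)"
    by (rule Weierstrass_m_test_general[OF bound M])
  have ev: "\<forall>\<^sub>F F in finite_subsets_at_top X. finite F \<and> F \<subseteq> X"
    by (rule eventually_finite_subsets_at_top_weakI) auto
  then have evh: "\<forall>\<^sub>F F in finite_subsets_at_top X. (\<lambda>z. \<Sum>x\<in>F. f x z) holomorphic_on A"
    by eventually_elim (auto intro!: holomorphic_on_sum hol)
  have "(\<lambda>z. \<Sum>\<^sub>\<infinity>x\<in>X. f x z) analytic_on A"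
  proof -
      have "\<exists>e>0. (\<lambda>z. \<Sum>\<^sub>\<infinity>x\<in>X. f x z) holomorphic_on ball z e" if zA: "z \<in> A" for z
      proof -
        obtain e where e: "e > 0" "cball z e \<subseteq> A" using A zA open_contains_cball by blast
        have "(\<lambda>z. \<Sum>\<^sub>\<infinity>x\<in>X. f x z) holomorphic_on ball z e"
        proof (rule holomorphic_uniform_limit)
          show "\<forall>\<^sub>F F in finite_subsets_at_top X. continuous_on (cball z e) (\<lambda>z. \<Sum>x\<in>F. f x z)
              \<and> (\<lambda>z. \<Sum>x\<in>F. f x z) holomorphic_on ball z e"
          proof (rule eventually_mono[OF evh], intro conjI)
            fix F assume h: "(\<lambda>z. \<Sum>x\<in>F. f x z) holomorphic_on A"
            show "continuous_on (cball z e) (\<lambda>z. \<Sum>x\<in>F. f x z)"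
              by (rule continuous_on_subset[OF holomorphic_on_imp_continuous_on[OF h] e(2)])
            show "(\<lambda>z. \<Sum>x\<in>F. f x z) holomorphic_on ball z e"
              by (rule holomorphic_on_subset[OF h order_trans[OF ball_subset_cball e(2)]])
          qed
          show "uniform_limit (cball z e) (\<lambda>F z. \<Sum>x\<in>F. f x z) (\<lambda>z. \<Sum>\<^sub>\<infinity>x\<in>X. f x z) (finite_subsets_at_top X)"
            by (rule uniform_limit_on_subset[OF ul e(2)])
        qed auto
        then show ?thesis using e(1) by blast
      qed
      then show ?thesis by (auto simp: analytic_on_def)
  qed
  then show "(\<lambda>z. \<Sum>\<^sub>\<infinity>x\<in>X. f x z) holomorphic_on A" by (rule analytic_imp_holomorphic)
  assume z: "z \<in> A"
  have "((\<lambda>F. (deriv ^^ m) (\<lambda>z. \<Sum>x\<in>F. f x z) z) \<longlongrightarrow> (deriv ^^ m) (\<lambda>z. \<Sum>\<^sub>\<infinity>x\<in>X. f x z) z) (finite_subsets_at_top X)"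
    by (rule higher_deriv_complex_uniform_limit[OF ul evh _ A z]) simp
  moreover have "\<forall>\<^sub>F F in finite_subsets_at_top X. (deriv ^^ m) (\<lambda>z. \<Sum>x\<in>F. f x z) z = (\<Sum>x\<in>F. (deriv ^^ m) (f x) z)"
    using ev by eventually_elim (rule higher_deriv_sum[OF _ _ A z], use hol in auto)
  ultimately show "((\<lambda>x. (deriv ^^ m) (f x) z) has_sum (deriv ^^ m) (\<lambda>z. \<Sum>\<^sub>\<infinity>x\<in>X. f x z) z) X"
    unfolding has_sum_def by (rule Lim_transform_eventually)
qed

text \<open>Made for the Lambert series, whose first finitely many denominators have no convenient
  lower bound.\<close>

lemma infsum_holomorphic_cofinite:
  fixes f :: "'a \<Rightarrow> complex \<Rightarrow> complex"
  assumes A: "open A" and hol: "\<And>x. x \<in> X \<Longrightarrow> f x holomorphic_on A"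
    and F: "finite F" "F \<subseteq> X"
    and bound: "\<And>x z. x \<in> X - F \<Longrightarrow> z \<in> A \<Longrightarrow> cmod (f x z) \<le> M x" and M: "M summable_on X - F"
  shows "(\<lambda>z. \<Sum>\<^sub>\<infinity>x\<in>X. f x z) holomorphic_on A"
proof -
  have e: "(\<Sum>\<^sub>\<infinity>x\<in>X. f x z) = (\<Sum>x\<in>F. f x z) + (\<Sum>\<^sub>\<infinity>x\<in>X-F. f x z)" if "z \<in> A" for z
  proof -
    have "(\<lambda>x. f x z) summable_on X - F"
      using bound that by (intro abs_summable_summable[OF summable_on_comparison_test[OF M]]) auto
    then have "(\<Sum>\<^sub>\<infinity>x\<in>F \<union> (X-F). f x z) = (\<Sum>x\<in>F. f x z) + (\<Sum>\<^sub>\<infinity>x\<in>X-F. f x z)"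
      using F by (subst infsum_Un_disjoint) auto
    moreover have "F \<union> (X - F) = X" using F by auto
    ultimately show ?thesis by simp
  qed
  have "(\<lambda>z. (\<Sum>x\<in>F. f x z) + (\<Sum>\<^sub>\<infinity>x\<in>X-F. f x z)) holomorphic_on A"
    using F by (intro holomorphic_on_add holomorphic_on_sum infsum_holomorphic(1)[OF A _ bound M] hol) auto
  then show ?thesis using holomorphic_cong[OF refl e] by simp
qed

lemma summable_on_geometric_from_1:
  assumes "norm (x::'a::{real_normed_field,banach}) < 1"
  shows "(\<lambda>n. x ^ n) summable_on {1..}" "(\<lambda>n. norm (x ^ n)) summable_on {1..}"
    "(\<Sum>\<^sub>\<infinity>n\<in>{1..}. x ^ n) = x / (1 - x)"
proof -
  show "(\<lambda>n. x ^ n) summable_on {1..}" "(\<Sum>\<^sub>\<infinity>n\<in>{1..}. x ^ n) = x / (1 - x)"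
    using has_sum_geometric_from_1[OF assms] by (auto simp: has_sum_iff)
  have "(\<lambda>n. norm x ^ n) summable_on {1..}"
    using has_sum_geometric_from_1[of "norm x"] assms by (auto simp: has_sum_iff)
  then show "(\<lambda>n. norm (x ^ n)) summable_on {1..}" by (simp add: norm_power)
qed

section \<open>The lattice\<close>

lemma torus_lattice_iff:
  "\<kappa> \<in> torus_lattice \<tau> \<longleftrightarrow> (\<exists>m n. \<kappa> = of_int m * (2 * pi * \<i> * \<tau>) + of_int n * (2 * pi * \<i>))"
  by (simp add: torus_lattice_def)

lemma torus_lattice_zero: "0 \<in> torus_lattice \<tau>"
  unfolding torus_lattice_iff by (rule exI[of _ 0], rule exI[of _ 0]) simp

lemma torus_lattice_generators: "2 * pi * \<i> \<in> torus_lattice \<tau>" "2 * pi * \<i> * \<tau> \<in> torus_lattice \<tau>"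
  unfolding torus_lattice_iff
  by (rule exI[of _ 0], rule exI[of _ 1], simp) (rule exI[of _ 1], rule exI[of _ 0], simp)

lemma torus_lattice_add:
  assumes "\<kappa> \<in> torus_lattice \<tau>" "\<mu> \<in> torus_lattice \<tau>" shows "\<kappa> + \<mu> \<in> torus_lattice \<tau>"
proof -
  obtain m n m' n' where "\<kappa> = of_int m * (2 * pi * \<i> * \<tau>) + of_int n * (2 * pi * \<i>)"
      "\<mu> = of_int m' * (2 * pi * \<i> * \<tau>) + of_int n' * (2 * pi * \<i>)"
    using assms unfolding torus_lattice_iff by blast
  then have "\<kappa> + \<mu> = of_int (m + m') * (2 * pi * \<i> * \<tau>) + of_int (n + n') * (2 * pi * \<i>)"
    by (simp add: algebra_simps)
  then show ?thesis unfolding torus_lattice_iff by blast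
qed

lemma torus_lattice_uminus:
  assumes "\<kappa> \<in> torus_lattice \<tau>" shows "- \<kappa> \<in> torus_lattice \<tau>"
proof -
  obtain m n where "\<kappa> = of_int m * (2 * pi * \<i> * \<tau>) + of_int n * (2 * pi * \<i>)"
    using assms unfolding torus_lattice_iff by blast
  then have "- \<kappa> = of_int (- m) * (2 * pi * \<i> * \<tau>) + of_int (- n) * (2 * pi * \<i>)"
    by (simp add: algebra_simps)
  then show ?thesis unfolding torus_lattice_iff by blast
qed

lemma torus_lattice_diff:
  "\<kappa> \<in> torus_lattice \<tau> \<Longrightarrow> \<mu> \<in> torus_lattice \<tau> \<Longrightarrow> \<kappa> - \<mu> \<in> torus_lattice \<tau>"
  using torus_lattice_add[OF _ torus_lattice_uminus] by fastforce

lemma torus_lattice_norm: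
  "cmod (of_int m * (2 * pi * \<i> * \<tau>) + of_int n * (2 * pi * \<i>)) = 2 * pi * cmod (of_int m * \<tau> + of_int n)"
proof -
  have "of_int m * (2 * pi * \<i> * \<tau>) + of_int n * (2 * pi * \<i>) = (2 * pi * \<i>) * (of_int m * \<tau> + of_int n)"
    by (simp add: algebra_simps)
  then show ?thesis by (simp add: norm_mult)
qed

text \<open>In other words, \<open>1 / (exp w - 1) + 1 / 2\<close> is odd.\<close>

lemma exp_pole_reflect:
  fixes w :: complex
  assumes "exp w \<noteq> 1" shows "1 / (exp w - 1) + 1 / (exp (- w) - 1) = - 1"
proof -
  have *: "1 / (y - 1) + 1 / (inverse y - 1) = - 1" if "y \<noteq> 0" "y \<noteq> 1" for y :: complex
    using that by (simp add: divide_simps) (simp add: algebra_simps)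
  show ?thesis using *[of "exp w"] assms by (simp add: exp_minus)
qed

text \<open>\<open>1 / (exp z - 1)\<close> with its pole at 0 removed; the value at 0 is the
  limit.\<close>

definition exp_pole :: "complex \<Rightarrow> complex" where
  "exp_pole z = (if z = 0 then - (1 / 2) else 1 / (exp z - 1) - 1 / z)"

locale torus =
  fixes \<tau> :: complex
  assumes Im_pos: "0 < Im \<tau>"
begin

abbreviation "\<Lambda> \<equiv> torus_lattice \<tau>"
abbreviation "D \<equiv> min_norm (torus_lattice \<tau>)"

lemma coeff_bound:
  "\<bar>of_int m\<bar> * Im \<tau> \<le> cmod (of_int m * \<tau> + of_int n)"
  "\<bar>of_int n\<bar> \<le> cmod (of_int m * \<tau> + of_int n) + \<bar>of_int m\<bar> * cmod \<tau>"
proof -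
  have "\<bar>Im (of_int m * \<tau> + of_int n)\<bar> \<le> cmod (of_int m * \<tau> + of_int n)"
    by (rule abs_Im_le_cmod)
  then show "\<bar>of_int m\<bar> * Im \<tau> \<le> cmod (of_int m * \<tau> + of_int n)"
    using Im_pos by (simp add: abs_mult)
  have "cmod (of_int n) \<le> cmod (of_int m * \<tau> + of_int n) + cmod (of_int m * \<tau>)"
    by (metis add_diff_cancel_left' norm_triangle_ineq4)
  then show "\<bar>of_int n\<bar> \<le> cmod (of_int m * \<tau> + of_int n) + \<bar>of_int m\<bar> * cmod \<tau>"
    by (simp add: norm_mult)
qed

lemma finite_lattice_ball: "finite (\<Lambda> \<inter> cball 0 R)"
proof -
  define M where "M = \<lceil>R / (2 * pi) / Im \<tau>\<rceil>"
  define N where "N = \<lceil>R / (2 * pi) + of_int M * cmod \<tau>\<rceil>"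
  have "\<Lambda> \<inter> cball 0 R \<subseteq> (\<lambda>(m,n). of_int m * (2 * pi * \<i> * \<tau>) + of_int n * (2 * pi * \<i>)) ` ({-M..M} \<times> {-N..N})"
  proof
    fix x assume x: "x \<in> \<Lambda> \<inter> cball 0 R"
    then obtain m n where mn: "x = of_int m * (2 * pi * \<i> * \<tau>) + of_int n * (2 * pi * \<i>)"
      by (auto simp: torus_lattice_iff)
    have c: "cmod (of_int m * \<tau> + of_int n) \<le> R / (2 * pi)"
      using x mn torus_lattice_norm[of m \<tau> n] by (simp add: field_simps)
    have "\<bar>of_int m\<bar> \<le> R / (2 * pi) / Im \<tau>"
      using order_trans[OF coeff_bound(1) c] Im_pos by (simp only: pos_le_divide_eq)
    then have m: "\<bar>m\<bar> \<le> M" unfolding M_def by (metis ceiling_mono ceiling_of_int of_int_abs)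
    then have "\<bar>of_int m\<bar> * cmod \<tau> \<le> of_int M * cmod \<tau>"
      by (intro mult_right_mono) (auto simp flip: of_int_abs)
    then have "\<bar>of_int n\<bar> \<le> R / (2 * pi) + of_int M * cmod \<tau>"
      using coeff_bound(2)[of n m] c by linarith
    then have n: "\<bar>n\<bar> \<le> N" unfolding N_def by (metis ceiling_mono ceiling_of_int of_int_abs)
    show "x \<in> (\<lambda>(m,n). of_int m * (2 * pi * \<i> * \<tau>) + of_int n * (2 * pi * \<i>)) ` ({-M..M} \<times> {-N..N})"
      using m n mn by (intro image_eqI[of _ _ "(m,n)"]) auto
  qed
  then show ?thesis using finite_subset by blast
qed

lemma min_norm_attained:
  obtains \<kappa> where "\<kappa> \<in> \<Lambda>" "\<kappa> \<noteq> 0" "cmod \<kappa> = D"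
proof -
  \<comment> \<open>The generator \<open>2 * pi * \<i>\<close> has norm 2 pi, so the minimum is
    attained among the finitely many lattice points in this disc.\<close>
  define B where "B = (\<Lambda> - {0}) \<inter> cball 0 (2 * pi)"
  have fin: "finite (cmod ` B)" unfolding B_def using finite_lattice_ball[of "2 * pi"]
    by (auto intro: finite_subset[of _ "\<Lambda> \<inter> cball 0 (2*pi)"])
  have "2 * pi * \<i> \<in> B" unfolding B_def using torus_lattice_generators(1) by (simp add: norm_mult)
  then have ne: "cmod ` B \<noteq> {}" by blast
  define d where "d = Min (cmod ` B)"
  have "d \<in> cmod ` B" unfolding d_def using fin ne by (rule Min_in)
  then obtain \<kappa> where k: "\<kappa> \<in> B" "cmod \<kappa> = d" by blast
  have "d \<le> 2 * pi" using k by (auto simp: B_def)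
  have le: "d \<le> cmod x" if "x \<in> \<Lambda> - {0}" for x
  proof (cases "cmod x \<le> 2 * pi")
    case True then show ?thesis unfolding d_def using that fin by (intro Min_le) (auto simp: B_def)
  next
    case False then show ?thesis using \<open>d \<le> 2 * pi\<close> by simp
  qed
  have "D = d" unfolding min_norm_def
    by (rule cInf_eq_minimum) (use le k in \<open>auto simp: B_def\<close>)
  then show ?thesis using that k by (auto simp: B_def)
qed

lemma D_pos: "0 < D" using min_norm_attained by (metis zero_less_norm_iff)

lemma D_le: "\<kappa> \<in> \<Lambda> \<Longrightarrow> \<kappa> \<noteq> 0 \<Longrightarrow> D \<le> cmod \<kappa>"
  unfolding min_norm_def by (intro cInf_lower bdd_belowI[of _ 0]) auto

lemma lattice_sep: "\<kappa> \<in> \<Lambda> \<Longrightarrow> \<mu> \<in> \<Lambda> \<Longrightarrow> \<kappa> \<noteq> \<mu> \<Longrightarrow> D \<le> cmod (\<kappa> - \<mu>)"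
  using D_le torus_lattice_diff by simp

lemma nearest_unique:
  assumes "\<kappa> \<in> \<Lambda>" "\<mu> \<in> \<Lambda>" "cmod (z - \<kappa>) < D / 2" "cmod (z - \<mu>) \<le> D / 2" shows "\<kappa> = \<mu>"
proof (rule ccontr)
  assume "\<kappa> \<noteq> \<mu>"
  then have "D \<le> cmod (\<kappa> - \<mu>)" using lattice_sep assms by blast
  also have "\<kappa> - \<mu> = (z - \<mu>) - (z - \<kappa>)" by simp
  also have "cmod \<dots> \<le> cmod (z - \<mu>) + cmod (z - \<kappa>)" by (rule norm_triangle_ineq4)
  finally show False using assms by simp
qed

lemma closed_lattice_subset: "S \<subseteq> \<Lambda> \<Longrightarrow> closed S"
  by (rule discrete_imp_closed[OF D_pos]) (use lattice_sep in \<open>force simp: dist_norm\<close>)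

section \<open>The quasi-periodic function with simple poles on the lattice\<close>

definition "nome = exp (2 * pi * \<i> * \<tau>)"

text \<open>The n-th term equals 1 / (exp (z - n w) - 1) with w = 2 pi \<i> \<tau>, a translate of
  the simple pole series of the exponential. Thus the sum collects the poles in the rows n = 1, 2,
  ... of the lattice, and \<open>lambert (- z)\<close> those in the opposite rows.\<close>

definition "lambert z = (\<Sum>\<^sub>\<infinity>n\<in>{1..}. nome ^ n / (exp z - nome ^ n))"

text \<open>The Laurent coefficients of \<open>(- 1)\<^sup>k / k! \<cdot> zeta\<^bsup>(k)\<^esup>\<close> at 0 are \<open>C(k, l) / k\<close>. For \<open>2\<pi>\<i>\<tau>\<close>
  the quasi-period of \<open>zeta\<close> is \<open>-1\<close>, for \<open>2\<pi>\<i>\<close> it vanishes.\<close>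

definition "zeta_reg z = 1 / 2 + exp_pole z + lambert z - lambert (- z)"

text \<open>The Weierstrass zeta function of the lattice up to a linear summand; every lattice point
  is a simple pole of residue 1.\<close>

definition "zeta z = zeta_reg z + 1 / z"

lemma nome_nz: "nome \<noteq> 0" by (simp add: nome_def)

lemma nome_less_1: "cmod nome < 1"
  using Im_pos by (simp add: nome_def norm_exp_eq_Re)

lemma exp_eq_nome_power:
  assumes "exp z = nome ^ n" shows "z \<in> \<Lambda>"
proof -
  have "exp z = exp (of_nat n * (2 * pi * \<i> * \<tau>))" using assms by (simp add: nome_def exp_of_nat_mult)
  then obtain k :: int where "z = of_nat n * (2 * pi * \<i> * \<tau>) + (of_int (2 * k) * pi) * \<i>"
    unfolding exp_eq by blast
  then have "z = of_int (int n) * (2 * pi * \<i> * \<tau>) + of_int k * (2 * pi * \<i>)" by simp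
  then show ?thesis unfolding torus_lattice_iff by blast
qed

lemma exp_eq_nome_power_nz:
  assumes "exp z = nome ^ n" "1 \<le> n" shows "z \<in> \<Lambda> - {0}"
proof -
  have "cmod nome ^ n < 1" using nome_less_1 assms(2) by (simp add: power_less_one_iff)
  then have "z \<noteq> 0" using assms(1) by (metis exp_zero norm_one norm_power order_less_irrefl)
  then show ?thesis using exp_eq_nome_power[OF assms(1)] by simp
qed

lemma nome_power_small:
  assumes "0 < \<delta>" obtains N where "1 \<le> N" "\<And>n. N \<le> n \<Longrightarrow> cmod nome ^ n \<le> \<delta> / 2"
proof -
  have "(\<lambda>n. cmod nome ^ n) \<longlonglongrightarrow> 0" using nome_less_1 by (intro LIMSEQ_power_zero) auto
  then have "\<forall>\<^sub>F n in sequentially. cmod nome ^ n < \<delta> / 2"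
    using assms by (intro order_tendstoD(2)) auto
  then obtain N where "\<And>n. N \<le> n \<Longrightarrow> cmod nome ^ n < \<delta> / 2" by (auto simp: eventually_sequentially)
  then show ?thesis by (intro that[of "max 1 N"]) (auto intro: less_imp_le)
qed

lemma lambert_term_bound:
  assumes "0 < \<delta>" "\<delta> \<le> cmod x" "cmod nome ^ n \<le> \<delta> / 2"
  shows "cmod (nome ^ n / (x - nome ^ n)) \<le> 2 / \<delta> * cmod nome ^ n"
proof -
  have "cmod x - cmod (nome ^ n) \<le> cmod (x - nome ^ n)" by (rule norm_triangle_ineq2)
  then have "\<delta> / 2 \<le> cmod (x - nome ^ n)" using assms by (simp add: norm_power)
  then have "cmod nome ^ n / cmod (x - nome ^ n) \<le> cmod nome ^ n / (\<delta> / 2)"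
    using assms by (intro divide_left_mono mult_pos_pos) auto
  then show ?thesis by (simp add: norm_divide norm_power mult.commute)
qed

lemma nome_summable: "(\<lambda>n. c * cmod nome ^ n) summable_on A" if "A \<subseteq> {1..}"
proof -
  have "(\<lambda>n. cmod nome ^ n) summable_on {1..}"
    using summable_on_geometric_from_1(1)[of "cmod nome"] nome_less_1 by simp
  then show ?thesis using that by (intro summable_on_cmult_right) (rule summable_on_subset_banach)
qed

lemma lambert_summable: "(\<lambda>n. nome ^ n / (exp z - nome ^ n)) summable_on {1..}"
proof -
  obtain N where N: "1 \<le> N" "\<And>n. N \<le> n \<Longrightarrow> cmod nome ^ n \<le> cmod (exp z) / 2"
    using nome_power_small[of "cmod (exp z)"] by auto
  have "(\<lambda>n. cmod (nome ^ n / (exp z - nome ^ n))) summable_on {N..}"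
    using N nome_summable[of "{N..}" "2 / cmod (exp z)"]
    by (intro summable_on_comparison_test[OF nome_summable[of "{N..}" "2 / cmod (exp z)"]] lambert_term_bound) auto
  then have "(\<lambda>n. nome ^ n / (exp z - nome ^ n)) summable_on {N..}" by (rule abs_summable_summable)
  moreover have "(\<lambda>n. nome ^ n / (exp z - nome ^ n)) summable_on {1..<N}" by simp
  moreover have "{1..} = {N..} \<union> {1..<N}" using N(1) by auto
  ultimately show ?thesis by (metis summable_on_union)
qed

text \<open>Near a given point \<open>cmod (exp w)\<close> is bounded below by some \<delta>, and
  \<open>nome ^ n\<close> is eventually at most \<delta> / 2; from then on the terms are dominated
  by a geometric series.\<close>

lemma lambert_holomorphic: "lambert holomorphic_on - (\<Lambda> - {0})"
proof (subst holomorphic_on_open)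
  show o: "open (- (\<Lambda> - {0}))" by (intro open_Compl closed_lattice_subset) auto
  show "\<forall>z\<in>- (\<Lambda> - {0}). \<exists>f'. (lambert has_field_derivative f') (at z)"
  proof
    fix z assume z: "z \<in> - (\<Lambda> - {0})"
    then obtain e where e: "e > 0" "ball z e \<subseteq> - (\<Lambda> - {0})" using o open_contains_ball by blast
    define \<delta> where "\<delta> = exp (Re z - e)"
    obtain N where N: "1 \<le> N" "\<And>n. N \<le> n \<Longrightarrow> cmod nome ^ n \<le> \<delta> / 2"
      using nome_power_small[of \<delta>] by (auto simp: \<delta>_def)
    have d: "\<delta> \<le> cmod (exp w)" if "w \<in> ball z e" for w
      using that abs_Re_le_cmod[of "z - w"] by (simp add: \<delta>_def norm_exp_eq_Re dist_norm)
    have "lambert holomorphic_on ball z e"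
      unfolding lambert_def
    proof (rule infsum_holomorphic_cofinite[where F="{1..<N}" and M="\<lambda>n. 2 / \<delta> * cmod nome ^ n"])
      show "(\<lambda>w. nome ^ n / (exp w - nome ^ n)) holomorphic_on ball z e" if "n \<in> {1..}" for n
      proof (intro holomorphic_intros)
        fix w assume "w \<in> ball z e"
        then have "w \<notin> \<Lambda> - {0}" using e(2) by blast
        then show "exp w - nome ^ n \<noteq> 0" using exp_eq_nome_power_nz[of w n] that by auto
      qed
      show "cmod (nome ^ n / (exp w - nome ^ n)) \<le> 2 / \<delta> * cmod nome ^ n" if "n \<in> {1..} - {1..<N}" "w \<in> ball z e" for n w
        using that N(2)[of n] by (intro lambert_term_bound d) (auto simp: \<delta>_def)
      show "(\<lambda>n. 2 / \<delta> * cmod nome ^ n) summable_on {1..} - {1..<N}" by (rule nome_summable) auto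
    qed auto
    then show "\<exists>f'. (lambert has_field_derivative f') (at z)"
      using e(1) by (auto simp: holomorphic_on_open)
  qed
qed

lemma lambert_neg_holomorphic: "(\<lambda>z. lambert (- z)) holomorphic_on - (\<Lambda> - {0})"
proof -
  have "(lambert \<circ> uminus) holomorphic_on - (\<Lambda> - {0})"
  proof (rule holomorphic_on_compose)
    have "uminus ` (- (\<Lambda> - {0})) \<subseteq> - (\<Lambda> - {0})" using torus_lattice_uminus by force
    then show "lambert holomorphic_on uminus ` (- (\<Lambda> - {0}))"
      using lambert_holomorphic holomorphic_on_subset by blast
  qed (intro holomorphic_intros)
  then show ?thesis by (simp add: o_def)
qed

lemma zeta_formula:
  assumes "z \<noteq> 0" shows "zeta z = 1 / 2 + 1 / (exp z - 1) + lambert z - lambert (- z)"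
  using assms by (simp add: zeta_def zeta_reg_def exp_pole_def)

lemma lambert_exp_eq: "exp z = exp w \<Longrightarrow> lambert z = lambert w"
  by (simp add: lambert_def)

lemma zeta_period_1:
  assumes "z \<notin> \<Lambda>" shows "zeta (z + 2 * pi * \<i>) = zeta z"
proof -
  have nz: "z \<noteq> 0" "z + 2 * pi * \<i> \<noteq> 0"
    using assms torus_lattice_zero torus_lattice_uminus[OF torus_lattice_generators(1)]
    by (auto simp: eq_neg_iff_add_eq_0[symmetric])
  have "exp (z + 2 * pi * \<i>) = exp z" "exp (- (z + 2 * pi * \<i>)) = exp (- z)"
    using exp_two_pi_i by (simp_all add: exp_add exp_diff mult_ac)
  then show ?thesis using nz lambert_exp_eq by (metis (no_types, lifting) zeta_formula)
qed

lemma infsum_split_first: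
  fixes f :: "nat \<Rightarrow> complex"
  assumes "f summable_on {a..}"
  shows "infsum f {a..} = f a + (\<Sum>\<^sub>\<infinity>n\<in>{Suc a..}. f n)"
proof -
  have "{a..} = {a} \<union> {Suc a..}" by auto
  moreover have "f summable_on {Suc a..}" using assms by (rule summable_on_subset_banach) auto
  ultimately show ?thesis by (simp only:) (subst infsum_Un_disjoint, auto)
qed

text \<open>The translation cancels one factor \<open>nome\<close> and so lowers the summation index
  by one; the new term with index 0 is the one split off.\<close>

lemma lambert_shift:
  "lambert (z + 2 * pi * \<i> * \<tau>) = 1 / (exp z - 1) + lambert z"
proof -
  have e: "exp (z + 2 * pi * \<i> * \<tau>) = nome * exp z" by (simp add: exp_add nome_def)
  have "lambert (z + 2 * pi * \<i> * \<tau>) = (\<Sum>\<^sub>\<infinity>n\<in>{1..}. nome ^ (n-1) / (exp z - nome ^ (n-1)))"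
    unfolding lambert_def e
  proof (rule infsum_cong)
    fix n :: nat assume "n \<in> {1..}"
    then obtain m where m: "n = Suc m" by (cases n) auto
    have "nome ^ n / (nome * exp z - nome ^ n) = (nome * nome ^ m) / (nome * (exp z - nome ^ m))"
      by (simp add: m algebra_simps)
    then show "nome ^ n / (nome * exp z - nome ^ n) = nome ^ (n-1) / (exp z - nome ^ (n-1))"
      using nome_nz by (simp add: m)
  qed
  also have "\<dots> = (\<Sum>\<^sub>\<infinity>n\<in>{0..}. nome ^ n / (exp z - nome ^ n))"
    by (rule infsum_reindex_bij_witness[of _ Suc "\<lambda>n. n - 1"]) auto
  also have "\<dots> = 1 / (exp z - 1) + lambert z"
  proof -
    have "{0::nat..} = {0} \<union> {1..}" by auto
    then have "(\<lambda>n. nome ^ n / (exp z - nome ^ n)) summable_on {0..}"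
      using lambert_summable[of z] by (metis summable_on_union summable_on_finite finite.emptyI finite_insert)
    from infsum_split_first[OF this] show ?thesis by (simp add: lambert_def)
  qed
  finally show ?thesis .
qed

text \<open>The two Lambert series are shifted in opposite directions. After the terms at z cancel,
  the remaining ones are 1 / (exp w - 1) and 1 / (exp (- w) - 1) at the shifted point w, whose sum
  is -1.\<close>

lemma zeta_period_2:
  assumes "z \<notin> \<Lambda>" shows "zeta (z + 2 * pi * \<i> * \<tau>) = zeta z - 1"
proof -
  let ?w = "z + 2 * pi * \<i> * \<tau>"
  have w: "?w \<notin> \<Lambda>" using assms torus_lattice_diff[OF _ torus_lattice_generators(2)[of \<tau>], of ?w] by auto
  then have nz: "z \<noteq> 0" "?w \<noteq> 0" using assms torus_lattice_zero by metis+
  have "exp ?w \<noteq> 1" using w exp_eq_nome_power[of ?w 0] by auto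
  then have q: "1 / (exp ?w - 1) + 1 / (exp (- ?w) - 1) = - 1"
    by (rule exp_pole_reflect)
  have "lambert (- ?w + 2 * pi * \<i> * \<tau>) = 1 / (exp (- ?w) - 1) + lambert (- ?w)" by (rule lambert_shift)
  then have l: "lambert (- ?w) = lambert (- z) - 1 / (exp (- ?w) - 1)" by simp
  show ?thesis
    unfolding zeta_formula[OF nz(1)] zeta_formula[OF nz(2)] l lambert_shift using q by (simp add: algebra_simps)
qed

end

section \<open>Bernoulli numbers and the exponential pole\<close>

text \<open>The Bernoulli numbers are coefficients of a real power series. Its defining identity has
  real coefficients throughout and so carries over to complex series, where the quotient is
  determined by it.\<close>

lemma bernoulli_fps_complex:
  fixes F :: "complex fps" defines "F \<equiv> fps_X / (fps_exp 1 - 1)"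
  shows "fps_nth F n = of_real (bernoulli_number n) / fact n"
    and "F * (fps_exp 1 - 1) = fps_X"
proof -
  define E :: "real fps" where "E = fps_exp 1 - 1"
  define Ec :: "complex fps" where "Ec = fps_exp 1 - 1"
  define B where "B = fps_X / E"
  define Bc where "Bc = Abs_fps (\<lambda>n. complex_of_real (fps_nth B n))"
  have E1: "fps_nth E 1 = 1" "fps_nth E 0 = 0" by (auto simp: E_def)
  then have sE: "subdegree E = 1" by (intro subdegreeI) auto
  then have "E dvd fps_X" using E1 by (subst fps_dvd_iff) auto
  then have BE: "B * E = fps_X" by (simp add: B_def)
  have "Bc * Ec = fps_X"
  proof (rule fps_ext)
    fix n
    have "fps_nth (Bc * Ec) n = of_real (fps_nth (B * E) n)"
      by (auto simp: fps_mult_nth Bc_def E_def Ec_def intro!: sum.cong)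
    then show "fps_nth (Bc * Ec) n = fps_nth fps_X n" by (simp add: BE fps_X_def)
  qed
  moreover have "Ec \<noteq> 0"
  proof
    assume "Ec = 0"
    then have "fps_nth Ec 1 = 0" by simp
    then show False by (simp add: Ec_def)
  qed
  ultimately have "F = Bc" unfolding F_def Ec_def[symmetric]
    by (metis nonzero_mult_div_cancel_right)
  then show "fps_nth F n = of_real (bernoulli_number n) / fact n"
    by (simp add: Bc_def bernoulli_number_def B_def E_def)
  show "F * (fps_exp 1 - 1) = fps_X" using \<open>F = Bc\<close> \<open>Bc * Ec = fps_X\<close> by (simp add: Ec_def)
qed

lemma exp_pole_expansion:
  "exp_pole has_fps_expansion fps_shift 1 (fps_X / (fps_exp 1 - 1) - 1)"
proof -
  define E :: "complex fps" where "E = fps_exp 1 - 1"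
  define F where "F = fps_X / E"
  have FE: "F * E = fps_X" using bernoulli_fps_complex(2) by (simp add: F_def E_def)
  have En: "fps_nth E 0 = 0" "fps_nth E 1 = 1" "fps_nth E (Suc 0) = 1" "fps_nth E 2 = 1 / 2" by (auto simp: E_def fact_2)
  have F0: "fps_nth F 0 = 1"
    using arg_cong[OF FE, of "\<lambda>f. fps_nth f 1"] by (simp add: fps_mult_nth En)
  have F1: "fps_nth F 1 = - (1 / 2)"
    using arg_cong[OF FE, of "\<lambda>f. fps_nth f 2"] F0
    by (simp add: fps_mult_nth numeral_2_eq_2 En(4)[unfolded numeral_2_eq_2] En eq_neg_iff_add_eq_0 add.commute)
  have sE: "subdegree E = 1" using En by (intro subdegreeI) auto
  have g: "(\<lambda>x. if x = 0 then 1 else x / (exp x - 1)) has_fps_expansion F"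
    unfolding F_def
  proof (rule has_fps_expansion_divide)
    show "(\<lambda>x. exp x - 1) has_fps_expansion E" unfolding E_def by (intro fps_expansion_intros)
    show "(1::complex) = fps_nth fps_X (subdegree E) / fps_nth E (subdegree E)" using sE En by simp
  qed (use sE in \<open>auto intro: fps_expansion_intros\<close>)
  have "(\<lambda>x. (if x = 0 then 1 else x / (exp x - 1)) - 1) has_fps_expansion F - 1"
    by (intro fps_expansion_intros g)
  \<comment> \<open>The constant term of F is 1, so \<open>F - 1\<close> is divisible by X; its next
    coefficient -1/2 becomes the value of \<open>exp_pole\<close> at 0.\<close>
  moreover have "1 \<le> subdegree (F - 1)"
    by (rule subdegree_geI) (use F0 F1 in \<open>auto simp: fps_eq_iff intro!: exI[of _ 1]\<close>)
  ultimately have "(\<lambda>x. if x = 0 then - (1/2) else ((if x = 0 then 1 else x / (exp x - 1)) - 1) / x ^ 1) has_fps_expansion fps_shift 1 (F - 1)"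
    by (rule has_fps_expansion_shift) (use F1 in auto)
  also have "(\<lambda>x. if x = 0 then - (1/2) else ((if x = 0 then 1 else x / (exp x - 1)) - 1) / x ^ 1) = exp_pole"
    by (auto simp: exp_pole_def diff_divide_distrib)
  finally show ?thesis by (simp add: F_def E_def)
qed

lemma exp_pole_deriv_odd:
  assumes "odd j"
  shows "(deriv ^^ j) exp_pole 0 = fact j * (of_real (bernoulli_number (Suc j)) / fact (Suc j))"
  using fps_nth_fps_expansion[OF exp_pole_expansion, of j] bernoulli_fps_complex(1)[of "Suc j"] assms
  by (simp add: field_simps)

lemma exp_pole_holomorphic:
  assumes "open S" "\<And>z. z \<in> S \<Longrightarrow> exp z = 1 \<Longrightarrow> z = 0"
  shows "exp_pole holomorphic_on S"
proof -
  obtain s where s: "open s" "0 \<in> s" "exp_pole holomorphic_on s"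
    using has_fps_expansion_imp_holomorphic[OF exp_pole_expansion] by metis
  have "(\<lambda>z. 1 / (exp z - 1) - 1 / z) holomorphic_on S - {0}"
    using assms(2) by (intro holomorphic_intros) auto
  then have "exp_pole holomorphic_on S - {0}"
    by (rule holomorphic_transform) (auto simp: exp_pole_def)
  then have "exp_pole holomorphic_on (S - {0}) \<union> s"
    using s assms(1) by (intro holomorphic_on_Un) auto
  then show ?thesis by (rule holomorphic_on_subset) (use s in auto)
qed

text \<open>By \<open>exp_pole_reflect\<close> the function is odd near 0, hence its derivatives of
  even order vanish there.\<close>

lemma exp_pole_deriv_even:
  assumes "even j"
  shows "(deriv ^^ j) (\<lambda>z. 1 / 2 + exp_pole z) 0 = 0"
proof -
  obtain s where s: "open s" "0 \<in> s" "exp_pole holomorphic_on s"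
    using has_fps_expansion_imp_holomorphic[OF exp_pole_expansion] by metis
  then obtain e where e: "e > 0" "ball 0 e \<subseteq> s" by (meson open_contains_ball)
  \<comment> \<open>In a disc of radius at most 1 the only solution of \<open>exp z = 1\<close> is
    0, since any other has modulus at least pi.\<close>
  define d where "d = min e 1"
  have d: "d > 0" "d \<le> 1" "ball 0 d \<subseteq> s" using e by (auto simp: d_def)
  have hs: "exp_pole holomorphic_on ball 0 d" using s(3) d(3) by (rule holomorphic_on_subset)
  let ?f = "\<lambda>z. 1 / 2 + exp_pole z"
  have hf: "?f holomorphic_on ball 0 d" by (intro holomorphic_intros hs)
  have hn: "(\<lambda>z. ?f (- z)) holomorphic_on ball 0 d"
    using holomorphic_on_compose_gen[OF _ hf, of uminus "ball 0 d"]
    by (simp add: o_def holomorphic_on_minus holomorphic_on_ident image_subset_iff)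
  have odd: "?f z = - ?f (- z)" if "z \<in> ball 0 d" for z
  proof (cases "z = 0")
    case False
    have "exp z \<noteq> 1"
    proof
      assume "exp z = 1"
      then obtain n :: int where n: "z = of_int (2 * n) * pi * \<i>" unfolding exp_eq_1 by (metis complex_eq_iff complex_i_mult_minus Re_complex_of_real Im_complex_of_real complex_eq mult.commute add_0 of_real_0 of_real_mult of_real_of_int_eq)
      then have cz: "cmod z = \<bar>of_int (2 * n)\<bar> * pi" by (simp add: norm_mult)
      have "n \<noteq> 0" using n False by auto
      then have "1 \<le> \<bar>of_int (2 * n) :: real\<bar>" by (simp flip: of_int_abs)
      then have "pi \<le> \<bar>of_int (2 * n)\<bar> * pi" using mult_right_mono[of 1 "\<bar>of_int (2 * n)\<bar>" pi] by simp
      moreover have "cmod z < 1" using that d(2) by simp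
      ultimately have "pi < 1" using cz by linarith
      then show False using pi_gt3 by simp
    qed
    then have "1 / (exp z - 1) + 1 / (exp (- z) - 1) = - 1" by (rule exp_pole_reflect)
    then show ?thesis using False by (simp add: exp_pole_def algebra_simps)
  qed (simp add: exp_pole_def)
  have "(deriv ^^ j) ?f 0 = (deriv ^^ j) (\<lambda>z. - ?f (- z)) 0"
    by (rule higher_deriv_transform_within_open[where S="ball 0 d", OF hf holomorphic_on_minus[OF hn]])
       (use d odd in auto)
  also have "\<dots> = - (deriv ^^ j) (\<lambda>z. ?f (-1 * z)) 0"
    using higher_deriv_uminus[OF hn open_ball, of 0 j] d by simp
  also have "(deriv ^^ j) (\<lambda>z. ?f (-1 * z)) 0 = (-1) ^ j * (deriv ^^ j) ?f (-1 * 0)"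
    by (rule higher_deriv_compose_linear[OF hf open_ball[of 0 d] open_ball, of 0]) (use d in auto)
  finally show ?thesis using assms by simp
qed

text \<open>Each further factor n comes from differentiating the power series once and multiplying
  by x.\<close>

lemma summable_nat_power_geometric:
  assumes "\<bar>x\<bar> < (1::real)" shows "summable (\<lambda>n. of_nat n ^ j * x ^ n)"
  using assms
proof (induction j arbitrary: x)
  case 0 then show ?case by (simp add: summable_geometric)
next
  case (Suc j)
  have "summable (\<lambda>n. diffs (\<lambda>n. of_nat n ^ j) n * x ^ n)"
    using Suc by (intro termdiff_converges[of x 1]) auto
  then have "summable (\<lambda>n. x * (diffs (\<lambda>n. of_nat n ^ j) n * x ^ n))" by (rule summable_mult)
  then have "summable (\<lambda>n. of_nat (Suc n) ^ Suc j * x ^ Suc n)" by (simp add: diffs_def mult_ac)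
  then show ?case by (subst summable_Suc_iff[symmetric])
qed

lemma summable_on_Times_mult:
  fixes f :: "'a \<Rightarrow> real" and g :: "'b \<Rightarrow> real"
  assumes f: "f summable_on A" and g: "g summable_on B"
    and nn: "\<And>x. x \<in> A \<Longrightarrow> 0 \<le> f x" "\<And>y. y \<in> B \<Longrightarrow> 0 \<le> g y"
  shows "(\<lambda>(x,y). f x * g y) summable_on A \<times> B"
proof (rule summable_on_SigmaI[where g="\<lambda>x. f x * infsum g B"])
  show "((\<lambda>y. case (x, y) of (x, y) \<Rightarrow> f x * g y) has_sum f x * infsum g B) B" for x
    using has_sum_cmult_right[OF has_sum_infsum[OF g]] by simp
  show "(\<lambda>x. f x * infsum g B) summable_on A" by (intro summable_on_cmult_left f)
qed (use nn in auto)

section \<open>Lambert series and the Taylor coefficients of the zeta function\<close>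

context torus begin

lemma zeta_reg_holomorphic: "zeta_reg holomorphic_on - (\<Lambda> - {0})"
  unfolding zeta_reg_def
proof (intro holomorphic_intros lambert_holomorphic lambert_neg_holomorphic exp_pole_holomorphic)
  show "open (- (\<Lambda> - {0}))" by (intro open_Compl closed_lattice_subset) auto
  show "z = 0" if "z \<in> - (\<Lambda> - {0})" "exp z = 1" for z using exp_eq_nome_power[of z 0] that by auto
qed

lemma zeta_holomorphic: "zeta holomorphic_on - \<Lambda>"
  unfolding zeta_def using torus_lattice_zero[of \<tau>]
  by (intro holomorphic_intros holomorphic_on_subset[OF zeta_reg_holomorphic]) auto

text \<open>For positive m and n the product n m is at least m + n - 1, so the double series is
  dominated by a product of two single series; the factor \<open>1 / cmod nome\<close> pays for the
  -1.\<close>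

lemma double_summable:
  assumes "cmod y * cmod nome < 1"
  shows "(\<lambda>(m,n). cmod (of_nat m ^ j * y ^ m * nome ^ (n * m))) summable_on {1..} \<times> {1..}"
proof (rule summable_on_comparison_test)
  define r where "r = cmod y * cmod nome"
  have r: "0 \<le> r" "r < 1" using assms by (auto simp: r_def)
  have "summable (\<lambda>m. of_nat m ^ j * r ^ m)" using r by (intro summable_nat_power_geometric) auto
  then have 1: "(\<lambda>m. of_nat m ^ j * r ^ m) summable_on {1..}"
    using r by (intro summable_on_subset_banach[OF summable_nonneg_imp_summable_on, where B="{1..}"]) auto
  have 2: "(\<lambda>n. 1 / cmod nome * cmod nome ^ n) summable_on {1..}" by (rule nome_summable) auto
  show "(\<lambda>(m,n). (of_nat m ^ j * r ^ m) * (1 / cmod nome * cmod nome ^ n)) summable_on {1..} \<times> {1..}"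
    by (rule summable_on_Times_mult[OF 1 2]) (use r in auto)
  show "(case p of (m,n) \<Rightarrow> cmod (of_nat m ^ j * y ^ m * nome ^ (n * m))) \<le> (case p of (m,n) \<Rightarrow> (of_nat m ^ j * r ^ m) * (1 / cmod nome * cmod nome ^ n))"
    if pin: "p \<in> {1..} \<times> {1..}" for p
  proof -
    obtain m' n' where p: "p = (m', n')" "1 \<le> m'" "1 \<le> n'" using pin by (cases p) auto
    define m n where "m = m' - 1" and "n = n' - 1"
    have mn: "p = (Suc m, Suc n)" using p by (simp add: m_def n_def)
    have "cmod nome ^ (Suc n * Suc m) \<le> cmod nome ^ (Suc m + n)"
      using nome_less_1 by (intro power_decreasing) auto
    also have "\<dots> = cmod nome ^ Suc m * (1 / cmod nome * cmod nome ^ Suc n)" using nome_nz by (simp add: power_add)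
    finally have "of_nat (Suc m) ^ j * cmod y ^ Suc m * cmod nome ^ (Suc n * Suc m)
        \<le> of_nat (Suc m) ^ j * cmod y ^ Suc m * (cmod nome ^ Suc m * (1 / cmod nome * cmod nome ^ Suc n))"
      by (rule mult_left_mono) simp
    also have "\<dots> = (of_nat (Suc m) ^ j * r ^ Suc m) * (1 / cmod nome * cmod nome ^ Suc n)"
      unfolding r_def power_mult_distrib mult.assoc ..
    finally show ?thesis unfolding mn prod.case norm_mult norm_power norm_of_nat .
  qed
qed (auto split: prod.splits)

text \<open>Expanding each term geometrically and summing over n first yields a series in powers of
  \<open>exp (- z)\<close>, whose derivatives at 0 can be read off termwise. The hypothesis
  describes a half plane that contains 0.\<close>

lemma lambert_double:
  assumes "cmod (exp (- z)) * cmod nome < 1"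
  shows "lambert z = (\<Sum>\<^sub>\<infinity>m\<in>{1..}. nome ^ m / (1 - nome ^ m) * exp (- (of_nat m * z)))"
proof -
  define y where "y = exp (- z)"
  have yq: "cmod y * cmod nome < 1" using assms by (simp add: y_def)
  have small: "cmod (y * nome ^ n) < 1" if "1 \<le> n" for n
  proof -
    have "cmod nome ^ n \<le> cmod nome" using power_decreasing[of 1 n "cmod nome"] that nome_less_1 by simp
    then have "cmod y * cmod nome ^ n \<le> cmod y * cmod nome" by (rule mult_left_mono) simp
    then show ?thesis using yq by (simp add: norm_mult norm_power)
  qed
  have "lambert z = (\<Sum>\<^sub>\<infinity>n\<in>{1..}. \<Sum>\<^sub>\<infinity>m\<in>{1..}. y ^ m * nome ^ (n * m))"
    unfolding lambert_def
  proof (rule infsum_cong)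
    fix n :: nat assume n: "n \<in> {1..}"
    have "nome ^ n / (exp z - nome ^ n) = (y * nome ^ n) / (1 - y * nome ^ n)"
    proof -
      have "exp z = 1 / y" "y \<noteq> 0" by (simp_all add: y_def exp_minus inverse_eq_divide)
      then have "exp z - nome ^ n = (1 - y * nome ^ n) / y" by (simp add: field_simps)
      then show ?thesis by simp
    qed
    also have "\<dots> = (\<Sum>\<^sub>\<infinity>m\<in>{1..}. (y * nome ^ n) ^ m)"
      using summable_on_geometric_from_1(3)[OF small[of n]] n by simp
    finally show "nome ^ n / (exp z - nome ^ n) = (\<Sum>\<^sub>\<infinity>m\<in>{1..}. y ^ m * nome ^ (n * m))"
      by (simp add: power_mult_distrib power_mult)
  qed
  also have "\<dots> = (\<Sum>\<^sub>\<infinity>m\<in>{1..}. \<Sum>\<^sub>\<infinity>n\<in>{1..}. y ^ m * nome ^ (n * m))"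
  proof (rule infsum_swap_banach[symmetric])
    have "(\<lambda>p. cmod (case p of (m,n) \<Rightarrow> y ^ m * nome ^ (n * m))) summable_on {1..} \<times> {1..}"
      using double_summable[OF yq, of 0] by (simp add: case_prod_unfold)
    then show "(\<lambda>(m,n). y ^ m * nome ^ (n * m)) summable_on {1..} \<times> {1..}"
      by (rule abs_summable_summable)
  qed
  also have "\<dots> = (\<Sum>\<^sub>\<infinity>m\<in>{1..}. nome ^ m / (1 - nome ^ m) * exp (- (of_nat m * z)))"
  proof (rule infsum_cong)
    fix m :: nat assume m: "m \<in> {1..}"
    have "cmod (nome ^ m) < 1" using nome_less_1 m by (simp add: norm_power power_less_one_iff)
    then have "(\<Sum>\<^sub>\<infinity>n\<in>{1..}. (nome ^ m) ^ n) = nome ^ m / (1 - nome ^ m)"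
      by (rule summable_on_geometric_from_1(3))
    then have "y ^ m * (nome ^ m / (1 - nome ^ m)) = (\<Sum>\<^sub>\<infinity>n\<in>{1..}. y ^ m * (nome ^ m) ^ n)"
      by (simp only: infsum_cmult_right')
    then have "(\<Sum>\<^sub>\<infinity>n\<in>{1..}. y ^ m * nome ^ (n * m)) = y ^ m * (nome ^ m / (1 - nome ^ m))"
      by (simp add: power_mult[symmetric] mult.commute)
    moreover have "y ^ m = exp (- (of_nat m * z))" by (simp add: y_def flip: exp_of_nat_mult)
    ultimately show "(\<Sum>\<^sub>\<infinity>n\<in>{1..}. y ^ m * nome ^ (n * m)) = nome ^ m / (1 - nome ^ m) * exp (- (of_nat m * z))"
      by simp
  qed
  finally show ?thesis .
qed

text \<open>Both sides are groupings of the double series with terms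
  \<open>of_nat m ^ j * nome ^ (n * m)\<close>: on the left by m, on the right by the product N = n
  m, where m runs through the divisors of N.\<close>

lemma divisor_sum_series:
  "(\<Sum>\<^sub>\<infinity>m\<in>{1..}. of_nat m ^ j * (nome ^ m / (1 - nome ^ m)))
    = (\<Sum>\<^sub>\<infinity>n\<in>{1..}. of_nat (divisor_power_sum j n) * nome ^ n)"
proof -
  define g :: "nat \<times> nat \<Rightarrow> complex" where "g = (\<lambda>(m,n). of_nat m ^ j * nome ^ (n * m))"
  have ab: "(\<lambda>p. cmod (g p)) summable_on {1..} \<times> {1..}"
    using double_summable[of 1 j] nome_less_1 by (simp add: case_prod_unfold g_def)
  then have sg: "g summable_on {1..} \<times> {1..}" by (rule abs_summable_summable)
  have "(\<Sum>\<^sub>\<infinity>m\<in>{1..}. of_nat m ^ j * (nome ^ m / (1 - nome ^ m))) = (\<Sum>\<^sub>\<infinity>m\<in>{1..}. \<Sum>\<^sub>\<infinity>n\<in>{1..}. g (m,n))"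
  proof (rule infsum_cong)
    fix m :: nat assume m: "m \<in> {1..}"
    have "cmod (nome ^ m) < 1" using nome_less_1 m by (simp add: norm_power power_less_one_iff)
    then have "(\<Sum>\<^sub>\<infinity>n\<in>{1..}. (nome ^ m) ^ n) = nome ^ m / (1 - nome ^ m)"
      by (rule summable_on_geometric_from_1(3))
    then have "of_nat m ^ j * (nome ^ m / (1 - nome ^ m)) = (\<Sum>\<^sub>\<infinity>n\<in>{1..}. of_nat m ^ j * (nome ^ m) ^ n)"
      by (simp only: infsum_cmult_right')
    then show "of_nat m ^ j * (nome ^ m / (1 - nome ^ m)) = (\<Sum>\<^sub>\<infinity>n\<in>{1..}. g (m,n))"
      by (simp add: g_def power_mult[symmetric] mult.commute)
  qed
  also have "\<dots> = infsum g ({1..} \<times> {1..})"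
    by (rule infsum_Sigma_banach[OF sg])
  also have "\<dots> = infsum (\<lambda>(N,m). of_nat m ^ j * nome ^ N) (SIGMA N:{1..}. {m. m dvd N})"
    by (rule infsum_reindex_bij_witness[of _ "\<lambda>(N,m). (m, N div m)" "\<lambda>(m,n). (n * m, m)"])
       (auto simp: g_def dvd_pos_nat Suc_le_eq intro!: Nat.gr0I)
  also have "\<dots> = (\<Sum>\<^sub>\<infinity>N\<in>{1..}. \<Sum>\<^sub>\<infinity>m\<in>{m. m dvd N}. of_nat m ^ j * nome ^ N)"
  proof -
    have "g summable_on {1..} \<times> {1..} \<longleftrightarrow>
        (\<lambda>(N,m). of_nat m ^ j * nome ^ N) summable_on (SIGMA N:{1..}. {m. m dvd N})"
      by (rule summable_on_reindex_bij_witness[of _ "\<lambda>(N,m). (m, N div m)" "\<lambda>(m,n). (n * m, m)"])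
         (auto simp: g_def dvd_pos_nat Suc_le_eq intro!: Nat.gr0I)
    then have "(\<lambda>(N,m). of_nat m ^ j * nome ^ N) summable_on (SIGMA N:{1..}. {m. m dvd N})"
      using sg by blast
    from infsum_Sigma_banach[OF this] show ?thesis by simp
  qed
  also have "\<dots> = (\<Sum>\<^sub>\<infinity>N\<in>{1..}. of_nat (divisor_power_sum j N) * nome ^ N)"
    by (rule infsum_cong) (simp add: divisor_power_sum_def sum_distrib_right)
  finally show ?thesis .
qed

lemma lambert_deriv_0:
  "(deriv ^^ j) lambert 0 = (-1) ^ j * (\<Sum>\<^sub>\<infinity>n\<in>{1..}. of_nat (divisor_power_sum j n) * nome ^ n)"
proof -
  define s where "s m = nome ^ m / (1 - nome ^ m)" for m
  have q1: "0 < cmod nome" "cmod nome < 1" using nome_nz nome_less_1 by auto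
  \<comment> \<open>Chosen so that \<open>exp e * cmod nome\<close> is the square root of
    \<open>cmod nome\<close>; on the disc of radius e the expansion in powers of
    \<open>exp (- z)\<close> is then dominated geometrically.\<close>
  define e where "e = - ln (cmod nome) / 2"
  have e: "e > 0" using q1 by (simp add: e_def)
  define f where "f m z = s m * exp (- (of_nat m * z))" for m z
  have ee: "exp e * exp e = 1 / cmod nome"
    using q1 by (simp add: e_def flip: exp_add) (simp add: exp_minus inverse_eq_divide)
  have nb: "exp e * cmod nome < 1"
  proof -
    have "exp e * cmod nome = 1 / exp e" using ee q1 by (simp add: field_simps)
    then show ?thesis using e by simp
  qed
  have ex: "cmod (exp (- z)) \<le> exp e" if "z \<in> ball 0 e" for z
    using that abs_Re_le_cmod[of z] by (simp add: norm_exp_eq_Re)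
  have hol: "f m holomorphic_on ball 0 e" for m unfolding f_def by (intro holomorphic_intros)
  have bound: "cmod (f m z) \<le> 1 / (1 - cmod nome) * (exp e * cmod nome) ^ m" if "m \<in> {1..}" "z \<in> ball 0 e" for m z
  proof -
    have "1 - cmod nome \<le> 1 - cmod nome ^ m" using power_decreasing[of 1 m "cmod nome"] that q1 by simp
    also have "\<dots> \<le> cmod (1 - nome ^ m)" using norm_triangle_ineq2[of 1 "nome ^ m"] by (simp add: norm_power)
    finally have "cmod (s m) \<le> cmod nome ^ m / (1 - cmod nome)"
      unfolding s_def norm_divide norm_power using q1 by (intro divide_left_mono mult_pos_pos) auto
    moreover have "cmod (exp (- (of_nat m * z))) \<le> exp e ^ m"
    proof -
      have "exp (- (of_nat m * z)) = exp (- z) ^ m" by (simp flip: exp_of_nat_mult)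
      then show ?thesis using power_mono[OF ex[OF that(2)], of m] by (simp add: norm_power)
    qed
    ultimately have "cmod (f m z) \<le> (cmod nome ^ m / (1 - cmod nome)) * exp e ^ m"
      unfolding f_def norm_mult using q1 by (intro mult_mono) auto
    then show ?thesis by (simp add: power_mult_distrib mult_ac)
  qed
  have summ: "(\<lambda>m. 1 / (1 - cmod nome) * (exp e * cmod nome) ^ m) summable_on {1..}"
    using summable_on_geometric_from_1(1)[of "exp e * cmod nome"] nb
    by (intro summable_on_cmult_right) (simp add: abs_mult)
  have eq: "lambert z = (\<Sum>\<^sub>\<infinity>m\<in>{1..}. f m z)" if "z \<in> ball 0 e" for z
  proof -
    have "cmod (exp (- z)) * cmod nome \<le> exp e * cmod nome" using ex[OF that] by (intro mult_right_mono) auto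
    then show ?thesis using nb lambert_double[of z] by (simp add: f_def s_def)
  qed
  have "(deriv ^^ j) lambert 0 = (deriv ^^ j) (\<lambda>z. \<Sum>\<^sub>\<infinity>m\<in>{1..}. f m z) 0"
  proof (rule higher_deriv_transform_within_open[OF _ _ open_ball, of _ 0 e])
    show h: "(\<lambda>z. \<Sum>\<^sub>\<infinity>m\<in>{1..}. f m z) holomorphic_on ball 0 e"
      by (rule infsum_holomorphic(1)[OF open_ball hol bound summ])
    show "lambert holomorphic_on ball 0 e" by (rule holomorphic_transform[OF h eq[symmetric]])
  qed (use eq e in auto)
  also have "\<dots> = (\<Sum>\<^sub>\<infinity>m\<in>{1..}. (deriv ^^ j) (f m) 0)"
    using infsum_holomorphic(2)[OF open_ball hol bound summ, of 0 j] e by (simp add: infsumI)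
  also have "\<dots> = (\<Sum>\<^sub>\<infinity>m\<in>{1..}. (-1) ^ j * (of_nat m ^ j * s m))"
  proof (rule infsum_cong)
    fix m :: nat
    have "(deriv ^^ j) (\<lambda>z. s m * exp (- of_nat m * z)) 0 = s m * (deriv ^^ j) (\<lambda>z. exp (- of_nat m * z)) 0"
      by (rule higher_deriv_cmult[where A=UNIV]) (auto intro!: holomorphic_intros)
    also have "(deriv ^^ j) (\<lambda>z::complex. exp (- of_nat m * z)) 0 = (- of_nat m) ^ j * (deriv ^^ j) exp (- of_nat m * 0)"
      by (rule higher_deriv_compose_linear[where S=UNIV and T=UNIV]) (auto intro!: holomorphic_intros)
    also have "(deriv ^^ j) exp = (exp :: complex \<Rightarrow> complex)"
      by (induction j) (auto intro!: ext DERIV_imp_deriv derivative_eq_intros)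
    finally show "(deriv ^^ j) (f m) 0 = (-1) ^ j * (of_nat m ^ j * s m)"
      by (simp add: f_def[abs_def] power_minus[of "of_nat m"] mult_ac)
  qed
  also have "\<dots> = (-1) ^ j * (\<Sum>\<^sub>\<infinity>n\<in>{1..}. of_nat (divisor_power_sum j n) * nome ^ n)"
    unfolding s_def divisor_sum_series[symmetric] infsum_cmult_right' ..
  finally show ?thesis .
qed

text \<open>\<open>zeta_reg\<close> is odd. For even j all contributions cancel, in accordance with
  the vanishing Eisenstein series of odd weight; for odd j the two Lambert series add up to the
  q-expansion and \<open>exp_pole\<close> supplies the Bernoulli constant.\<close>

theorem zeta_reg_deriv_0:
  "(deriv ^^ j) zeta_reg 0 = - fact j * eisenstein (Suc j) \<tau>"
proof -
  let ?S = "- (\<Lambda> - {0})"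
  have S: "open ?S" by (intro open_Compl closed_lattice_subset) auto
  have S0: "0 \<in> ?S" by simp
  note S = S S0
  have h1: "(\<lambda>z. 1 / 2 + exp_pole z) holomorphic_on ?S"
    by (intro holomorphic_intros exp_pole_holomorphic S) (use exp_eq_nome_power[of _ 0] in auto)
  have d: "(deriv ^^ j) zeta_reg 0 = (deriv ^^ j) (\<lambda>z. 1 / 2 + exp_pole z) 0 + (deriv ^^ j) lambert 0 - (deriv ^^ j) (\<lambda>z. lambert (- z)) 0"
    unfolding zeta_reg_def[abs_def]
    using higher_deriv_diff[OF _ lambert_neg_holomorphic S, of "\<lambda>z. 1 / 2 + exp_pole z + lambert z" j]
      higher_deriv_add[OF h1 lambert_holomorphic S, of j] h1 lambert_holomorphic
    by (simp add: holomorphic_on_add)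
  have "(deriv ^^ j) (\<lambda>z. lambert (-1 * z)) 0 = (-1) ^ j * (deriv ^^ j) lambert (-1 * 0)"
    by (rule higher_deriv_compose_linear[OF lambert_holomorphic S(1) S(1) S(2)])
       (use torus_lattice_uminus[of _ \<tau>] in force)
  then have n: "(deriv ^^ j) (\<lambda>z. lambert (- z)) 0 = (-1) ^ j * (deriv ^^ j) lambert 0" by simp
  show ?thesis
  proof (cases "even j")
    case True
    then show ?thesis using exp_pole_deriv_even[OF True] by (simp add: d n eisenstein_def)
  next
    case False
    have "(deriv ^^ j) (\<lambda>z. 1 / 2 + exp_pole z) 0 = (deriv ^^ j) (\<lambda>z. 1 / 2) 0 + (deriv ^^ j) exp_pole 0"
      by (rule higher_deriv_add[where S="?S"])
         (use S exp_eq_nome_power[of _ 0] in \<open>auto intro!: holomorphic_intros exp_pole_holomorphic\<close>)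
    also have "\<dots> = fact j * (of_real (bernoulli_number (Suc j)) / fact (Suc j))"
      using False exp_pole_deriv_odd[OF False] by (simp add: odd_pos)
    finally show ?thesis using False
      unfolding d n lambert_deriv_0 eisenstein_def nome_def[symmetric]
      by (simp add: algebra_simps)
  qed
qed

end

section \<open>Series of derivatives\<close>

text \<open>The normalisation makes the k-th term of the pole 1 / z equal to z^(-k-1). With
  \<open>zeta\<close> in place of \<phi> the sum therefore has the principal part \<Sum> v k
  z^(-k-1) at the lattice points.\<close>

definition dseries :: "(nat \<Rightarrow> complex) \<Rightarrow> (complex \<Rightarrow> complex) \<Rightarrow> complex \<Rightarrow> complex" where
  "dseries v \<phi> z = (\<Sum>\<^sub>\<infinity>k. v k * ((- 1) ^ k / fact k) * (deriv ^^ k) \<phi> z)"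

text \<open>Equivalently, \<Sum> v k z^(-k-1) converges absolutely for
  \<open>\<delta> < cmod z\<close>. By Cauchy's inequality the series of derivatives then converges
  wherever the closed disc of radius \<delta> avoids the singularities of \<phi>.\<close>

definition decays :: "real \<Rightarrow> (nat \<Rightarrow> complex) \<Rightarrow> bool" where
  "decays \<delta> v \<longleftrightarrow> (\<forall>d>\<delta>. (\<lambda>k. cmod (v k) / d ^ k) summable_on UNIV)"

lemma cball_subset_open_enlarge:
  assumes "open S" "cball z \<delta> \<subseteq> S" "0 \<le> \<delta>"
  obtains \<eta> where "0 < \<eta>" "cball z (\<delta> + \<eta>) \<subseteq> (S :: complex set)"
proof -
  obtain e where e: "e > 0" "{x. infdist x (cball z \<delta>) \<le> e} \<subseteq> S"
  proof (rule compact_in_open_separated[of "cball z \<delta>" S])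
    show "cball z \<delta> \<noteq> {}" using assms(3) by simp
  qed (use assms in auto)
  have "cball z (\<delta> + e / 2) \<subseteq> S"
  proof
    fix x assume x: "x \<in> cball z (\<delta> + e / 2)"
    show "x \<in> S"
    proof (cases "x \<in> cball z \<delta>")
      case False
      then have n: "cmod (x - z) > \<delta>" by (auto simp: dist_norm norm_minus_commute)
      then have n0: "cmod (x - z) > 0" using assms(3) by linarith
      define y where "y = z + of_real (\<delta> / cmod (x - z)) * (x - z)"
      have "cmod (of_real (\<delta> / cmod (x - z)) * (x - z)) = \<delta>"
        unfolding norm_mult norm_of_real using assms(3) n0 by simp
      then have "y \<in> cball z \<delta>" by (simp add: y_def dist_norm)
      moreover have "x - y = of_real (1 - \<delta> / cmod (x - z)) * (x - z)" by (simp add: y_def algebra_simps)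
      then have "cmod (x - y) = (1 - \<delta> / cmod (x - z)) * cmod (x - z)"
        using n n0 by (simp only: norm_mult norm_of_real) (simp add: divide_simps)
      then have "dist x y \<le> e / 2" using x n0 by (simp add: dist_norm norm_minus_commute algebra_simps)
      ultimately have "infdist x (cball z \<delta>) \<le> e / 2" by (rule infdist_le2)
      then show ?thesis using e by auto
    qed (use assms in auto)
  qed
  then show ?thesis using that[of "e / 2"] e(1) by simp
qed

text \<open>Cauchy's inequality on discs of a radius d slightly larger than \<delta> bounds the k-th
  term by a multiple of \<open>cmod (v k) / d ^ k\<close>, uniformly for nearby centres.\<close>

lemma dseries_local_bound:
  assumes S: "open S" and \<phi>: "\<phi> holomorphic_on S" and v: "decays \<delta> v" and \<delta>: "0 \<le> \<delta>" and z: "cball z \<delta> \<subseteq> S"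
  obtains e d B where "0 < e" "\<And>w. w \<in> ball z e \<Longrightarrow> cball w \<delta> \<subseteq> S" "\<delta> < d"
    "\<And>k w. w \<in> ball z e \<Longrightarrow> cmod (v k * ((- 1) ^ k / fact k) * (deriv ^^ k) \<phi> w) \<le> B * (cmod (v k) / d ^ k)"
    "(\<lambda>k. B * (cmod (v k) / d ^ k)) summable_on UNIV"
proof -
  obtain \<eta> where \<eta>: "0 < \<eta>" "cball z (\<delta> + \<eta>) \<subseteq> S" using cball_subset_open_enlarge[OF S z \<delta>] by blast
  \<comment> \<open>Half of the room \<eta> is spent on moving the centre, the other half on
    enlarging the radius.\<close>
  define e where "e = \<eta> / 2"
  define d where "d = \<delta> + \<eta> / 2"
  have d: "\<delta> < d" "0 < d" using \<eta> \<delta> by (auto simp: d_def)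
  have sub: "cball w d \<subseteq> cball z (\<delta> + \<eta>)" if "w \<in> ball z e" for w
  proof
    fix x assume "x \<in> cball w d"
    then show "x \<in> cball z (\<delta> + \<eta>)" using that dist_triangle[of z x w] by (simp add: e_def d_def)
  qed
  have "compact (\<phi> ` cball z (\<delta> + \<eta>))"
    using \<eta>(2) \<phi> by (intro compact_continuous_image continuous_on_subset[OF holomorphic_on_imp_continuous_on]) auto
  then obtain B where B: "\<And>x. x \<in> cball z (\<delta> + \<eta>) \<Longrightarrow> cmod (\<phi> x) \<le> B"
    using compact_imp_bounded bounded_iff by (metis imageI)
  have ineq: "cmod ((deriv ^^ k) \<phi> w) \<le> fact k * B / d ^ k" if w: "w \<in> ball z e" for k w
  proof (rule Cauchy_inequality)
    have "cball w d \<subseteq> S" using sub[OF w] \<eta>(2) by blast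
    then show "\<phi> holomorphic_on ball w d" "continuous_on (cball w d) \<phi>"
      using \<phi> holomorphic_on_subset ball_subset_cball
      by (blast, meson holomorphic_on_imp_continuous_on holomorphic_on_subset)
    show "cmod (\<phi> x) \<le> B" if "cmod (w - x) = d" for x
    proof (rule B)
      have "x \<in> cball w d" using that by (simp add: dist_norm)
      then show "x \<in> cball z (\<delta> + \<eta>)" using sub[OF w] by blast
    qed
  qed (rule d(2))
  show ?thesis
  proof (rule that[of e d B])
    show "0 < e" using \<eta> by (simp add: e_def)
    show "cball w \<delta> \<subseteq> S" if "w \<in> ball z e" for w
    proof -
      have "cball w \<delta> \<subseteq> cball w d" using d by auto
      then show ?thesis using sub[OF that] \<eta>(2) by blast
    qed
    show "cmod (v k * ((- 1) ^ k / fact k) * (deriv ^^ k) \<phi> w) \<le> B * (cmod (v k) / d ^ k)" if "w \<in> ball z e" for k w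
    proof -
      have "cmod (v k * ((- 1) ^ k / fact k) * (deriv ^^ k) \<phi> w) = cmod (v k) / fact k * cmod ((deriv ^^ k) \<phi> w)"
        by (simp add: norm_mult norm_divide norm_power)
      also have "\<dots> \<le> cmod (v k) / fact k * (fact k * B / d ^ k)"
        using ineq[OF that] by (intro mult_left_mono) auto
      finally show ?thesis by (simp add: mult.commute)
    qed
    show "(\<lambda>k. B * (cmod (v k) / d ^ k)) summable_on UNIV"
      using v d(1) unfolding decays_def by (intro summable_on_cmult_right) auto
  qed (rule d(1))
qed

lemma dseries_term_holomorphic:
  assumes "open S" "\<phi> holomorphic_on S" shows "(\<lambda>z. v k * ((- 1) ^ k / fact k) * (deriv ^^ k) \<phi> z) holomorphic_on S"
  using assms by (intro holomorphic_intros) auto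

lemma dseries_props:
  assumes S: "open S" and \<phi>: "\<phi> holomorphic_on S" and v: "decays \<delta> v" and \<delta>: "0 \<le> \<delta>" and z: "cball z \<delta> \<subseteq> S"
  shows dseries_summable: "(\<lambda>k. cmod (v k * ((- 1) ^ k / fact k) * (deriv ^^ k) \<phi> z)) summable_on UNIV"
    and dseries_local: "\<exists>e>0. (\<forall>w\<in>ball z e. cball w \<delta> \<subseteq> S) \<and> dseries v \<phi> holomorphic_on ball z e"
    and dseries_higher_deriv: "(deriv ^^ m) (dseries v \<phi>) z = dseries v ((deriv ^^ m) \<phi>) z"
proof -
  obtain e d B where e: "0 < e" "\<And>w. w \<in> ball z e \<Longrightarrow> cball w \<delta> \<subseteq> S" "\<delta> < d"
    "\<And>k w. w \<in> ball z e \<Longrightarrow> cmod (v k * ((- 1) ^ k / fact k) * (deriv ^^ k) \<phi> w) \<le> B * (cmod (v k) / d ^ k)"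
    "(\<lambda>k. B * (cmod (v k) / d ^ k)) summable_on UNIV"
    by (rule dseries_local_bound[OF assms]) (rule that)
  have bS: "ball z e \<subseteq> S"
  proof
    fix w assume "w \<in> ball z e"
    then show "w \<in> S" using e(2)[of w] \<delta> by auto
  qed
  have zb: "z \<in> ball z e" using e(1) by simp
  show "(\<lambda>k. cmod (v k * ((- 1) ^ k / fact k) * (deriv ^^ k) \<phi> z)) summable_on UNIV"
    by (rule summable_on_comparison_test[OF e(5)]) (use e(4)[OF zb] in auto)
  have hol: "(\<lambda>z. v k * ((- 1) ^ k / fact k) * (deriv ^^ k) \<phi> z) holomorphic_on ball z e" for k
    by (rule holomorphic_on_subset[OF dseries_term_holomorphic[OF S \<phi>] bS])
  have d: "dseries v \<phi> = (\<lambda>w. \<Sum>\<^sub>\<infinity>k. v k * ((- 1) ^ k / fact k) * (deriv ^^ k) \<phi> w)"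
    by (simp add: dseries_def[abs_def])
  have "dseries v \<phi> holomorphic_on ball z e"
    unfolding d by (rule infsum_holomorphic(1)[OF open_ball hol e(4,5)])
  then show "\<exists>e>0. (\<forall>w\<in>ball z e. cball w \<delta> \<subseteq> S) \<and> dseries v \<phi> holomorphic_on ball z e"
    using e by blast
  have "((\<lambda>k. (deriv ^^ m) (\<lambda>z. v k * ((- 1) ^ k / fact k) * (deriv ^^ k) \<phi> z) z) has_sum (deriv ^^ m) (dseries v \<phi>) z) UNIV"
    unfolding d by (rule infsum_holomorphic(2)[OF open_ball hol e(4,5) zb])
  moreover have "(deriv ^^ m) (\<lambda>z. v k * ((- 1) ^ k / fact k) * (deriv ^^ k) \<phi> z) z
     = v k * ((- 1) ^ k / fact k) * (deriv ^^ k) ((deriv ^^ m) \<phi>) z" for k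
  proof -
    have "(deriv ^^ m) (\<lambda>z. v k * ((- 1) ^ k / fact k) * (deriv ^^ k) \<phi> z) z
      = v k * ((- 1) ^ k / fact k) * (deriv ^^ m) ((deriv ^^ k) \<phi>) z"
      by (rule higher_deriv_cmult[where A=S]) (use S \<phi> bS zb in \<open>auto intro: holomorphic_higher_deriv\<close>)
    also have "(deriv ^^ m) ((deriv ^^ k) \<phi>) = (deriv ^^ k) ((deriv ^^ m) \<phi>)"
      by (metis add.commute comp_apply funpow_add)
    finally show ?thesis .
  qed
  ultimately show "(deriv ^^ m) (dseries v \<phi>) z = dseries v ((deriv ^^ m) \<phi>) z"
    by (simp add: dseries_def infsumI)
qed

lemma open_cball_interior:
  assumes "open S" "0 \<le> \<delta>" shows "open {z :: complex. cball z \<delta> \<subseteq> S}"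
  unfolding open_contains_ball
proof
  fix z assume "z \<in> {z. cball z \<delta> \<subseteq> S}"
  then obtain \<eta> where \<eta>: "0 < \<eta>" "cball z (\<delta> + \<eta>) \<subseteq> S" using cball_subset_open_enlarge[OF assms(1) _ assms(2)] by blast
  have "cball w \<delta> \<subseteq> S" if "w \<in> ball z \<eta>" for w
  proof
    fix x assume "x \<in> cball w \<delta>"
    then have "x \<in> cball z (\<delta> + \<eta>)" using that dist_triangle[of z x w] by simp
    then show "x \<in> S" using \<eta> by blast
  qed
  then show "\<exists>e>0. ball z e \<subseteq> {z. cball z \<delta> \<subseteq> S}" using \<eta>(1) by blast
qed

lemma dseries_holomorphic:
  assumes "open S" "\<phi> holomorphic_on S" "decays \<delta> v" "0 \<le> \<delta>" "T \<subseteq> {z. cball z \<delta> \<subseteq> S}"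
  shows "dseries v \<phi> holomorphic_on T"
proof -
  have "dseries v \<phi> analytic_on {z. cball z \<delta> \<subseteq> S}"
    unfolding analytic_on_def using dseries_local[OF assms(1-4)] by blast
  then show ?thesis using analytic_imp_holomorphic holomorphic_on_subset assms(5) by blast
qed

lemma dseries_has_field_derivative:
  assumes "open S" "\<phi> holomorphic_on S" "decays \<delta> v" "0 \<le> \<delta>" "cball z \<delta> \<subseteq> S"
  shows "(dseries v \<phi> has_field_derivative dseries v (deriv \<phi>) z) (at z)"
proof -
  have "dseries v \<phi> holomorphic_on {z. cball z \<delta> \<subseteq> S}" by (rule dseries_holomorphic[OF assms(1-4)]) simp
  then have "(dseries v \<phi> has_field_derivative deriv (dseries v \<phi>) z) (at z)"
    using assms(5) open_cball_interior[OF assms(1,4)] by (intro holomorphic_derivI) auto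
  then show ?thesis using dseries_higher_deriv[OF assms, of 1] by simp
qed

text \<open>Integration lowers the order of differentiation by one. The coefficient of index 1 lands
  at index 0, where it meets the quasi-period of \<open>zeta\<close>; a coefficient of index 0 would
  be a residue and has no place.\<close>

definition antideriv_coeffs :: "(nat \<Rightarrow> complex) \<Rightarrow> nat \<Rightarrow> complex" where
  "antideriv_coeffs v k = - v (Suc k) / of_nat (Suc k)"

lemma decays_antideriv_coeffs:
  assumes "decays \<delta> v" "0 \<le> \<delta>" shows "decays \<delta> (antideriv_coeffs v)"
  unfolding decays_def
proof (intro allI impI)
  fix d assume d: "\<delta> < d"
  have "(\<lambda>k. cmod (v k) / d ^ k) summable_on {1..}"
    using assms d summable_on_subset_banach unfolding decays_def by blast
  then have "(\<lambda>k. cmod (v (Suc k)) / d ^ Suc k) summable_on UNIV"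
    by (subst summable_on_reindex_bij_witness[of UNIV "\<lambda>n. n - 1" Suc "{1..}" "\<lambda>k. cmod (v k) / d ^ k"]) auto
  then have "(\<lambda>k. d * (cmod (v (Suc k)) / d ^ Suc k)) summable_on UNIV" by (rule summable_on_cmult_right)
  then show "(\<lambda>k. cmod (antideriv_coeffs v k) / d ^ k) summable_on UNIV"
  proof (rule summable_on_comparison_test)
    fix k
    have "cmod (antideriv_coeffs v k) = cmod (v (Suc k)) / of_nat (Suc k)"
      by (simp add: antideriv_coeffs_def norm_divide del: of_nat_Suc)
    also have "\<dots> \<le> cmod (v (Suc k)) / 1" by (intro divide_left_mono) auto
    finally have "cmod (antideriv_coeffs v k) / d ^ k \<le> cmod (v (Suc k)) / d ^ k"
      using d assms by (intro divide_right_mono) auto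
    then show "cmod (antideriv_coeffs v k) / d ^ k \<le> d * (cmod (v (Suc k)) / d ^ Suc k)"
      using d assms by simp
    show "0 \<le> cmod (antideriv_coeffs v k) / d ^ k" using d assms by simp
  qed
qed

lemma dseries_antideriv:
  assumes v0: "v 0 = 0"
  shows "dseries (antideriv_coeffs v) (deriv \<phi>) z = dseries v \<phi> z"
proof -
  have "dseries v \<phi> z = (\<Sum>\<^sub>\<infinity>k\<in>{1..}. v k * ((- 1) ^ k / fact k) * (deriv ^^ k) \<phi> z)"
    unfolding dseries_def using v0 by (intro infsum_cong_neutral) (auto simp: not_le)
  also have "\<dots> = (\<Sum>\<^sub>\<infinity>k. v (Suc k) * ((- 1) ^ Suc k / fact (Suc k)) * (deriv ^^ Suc k) \<phi> z)"
    by (rule infsum_reindex_bij_witness[of _ Suc "\<lambda>n. n - 1"]) auto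
  also have "\<dots> = dseries (antideriv_coeffs v) (deriv \<phi>) z"
    unfolding dseries_def
  proof (rule infsum_cong)
    fix k
    have "(deriv ^^ k) (deriv \<phi>) z = (deriv ^^ Suc k) \<phi> z" by (simp add: funpow_swap1)
    then show "v (Suc k) * ((- 1) ^ Suc k / fact (Suc k)) * (deriv ^^ Suc k) \<phi> z
      = antideriv_coeffs v k * ((- 1) ^ k / fact k) * (deriv ^^ k) (deriv \<phi>) z"
      by (simp add: antideriv_coeffs_def field_simps)
  qed
  finally show ?thesis ..
qed

lemma dseries_add:
  assumes S: "open S" and "\<phi> holomorphic_on S" "\<psi> holomorphic_on S" and v: "decays \<delta> v" "0 \<le> \<delta>" and z: "cball z \<delta> \<subseteq> S"
  shows "dseries v (\<lambda>z. \<phi> z + \<psi> z) z = dseries v \<phi> z + dseries v \<psi> z"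
proof -
  have zS: "z \<in> S" using z v(2) by (meson centre_in_cball subset_iff)
  have "dseries v (\<lambda>z. \<phi> z + \<psi> z) z = (\<Sum>\<^sub>\<infinity>k. v k * ((- 1) ^ k / fact k) * (deriv ^^ k) \<phi> z + v k * ((- 1) ^ k / fact k) * (deriv ^^ k) \<psi> z)"
    unfolding dseries_def using higher_deriv_add[OF assms(2,3,1) zS]
    by (intro infsum_cong) (simp add: algebra_simps add_divide_distrib)
  also have "\<dots> = dseries v \<phi> z + dseries v \<psi> z"
    unfolding dseries_def
    using abs_summable_summable[OF dseries_summable[OF S assms(2) v z]]
      abs_summable_summable[OF dseries_summable[OF S assms(3) v z]] by (rule infsum_add)
  finally show ?thesis .
qed

lemma higher_deriv_inverse:
  assumes "z \<noteq> 0" shows "(deriv ^^ k) (\<lambda>z::complex. 1 / z) z = (-1) ^ k * fact k / z ^ Suc k"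
  using assms
proof (induction k arbitrary: z)
  case (Suc k)
  have "(deriv ^^ Suc k) (\<lambda>z::complex. 1 / z) z = deriv (\<lambda>z. (-1) ^ k * fact k / z ^ Suc k) z"
    unfolding funpow.simps o_apply
  proof (rule complex_derivative_transform_within_open[where s="-{0}"])
    show "(deriv ^^ k) (\<lambda>z. 1 / z) holomorphic_on -{0}" by (intro holomorphic_higher_deriv holomorphic_intros) auto
    show "(\<lambda>z. (-1) ^ k * fact k / z ^ Suc k) holomorphic_on -{0::complex}" by (intro holomorphic_intros) auto
  qed (use Suc in auto)
  also have "((\<lambda>z. (-1) ^ k * fact k / z ^ Suc k) has_field_derivative (-1) ^ Suc k * fact (Suc k) / z ^ Suc (Suc k)) (at z)"
  proof -
    have p: "((\<lambda>z::complex. z ^ Suc k) has_field_derivative of_nat (Suc k) * z ^ k) (at z)"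
      using DERIV_power[OF DERIV_ident, of "Suc k" z UNIV] by simp
    have "((\<lambda>z. ((-1) ^ k * fact k) * inverse (z ^ Suc k)) has_field_derivative
        ((-1) ^ k * fact k) * - (inverse (z ^ Suc k) * (of_nat (Suc k) * z ^ k) * inverse (z ^ Suc k))) (at z)"
      using Suc.prems by (intro DERIV_cmult DERIV_inverse' p) auto
    moreover have "((-1) ^ k * fact k) * - (inverse (z ^ Suc k) * (of_nat (Suc k) * z ^ k) * inverse (z ^ Suc k))
        = (-1) ^ Suc k * fact (Suc k) / z ^ Suc (Suc k)"
      using Suc.prems by (simp add: field_simps)
    ultimately show ?thesis by (simp only: divide_inverse)
  qed
  then have "deriv (\<lambda>z. (-1) ^ k * fact k / z ^ Suc k) z = (-1) ^ Suc k * fact (Suc k) / z ^ Suc (Suc k)"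
    by (rule DERIV_imp_deriv)
  finally show ?case .
qed simp

lemma dseries_inverse:
  assumes "z \<noteq> 0" shows "dseries v (\<lambda>z. 1 / z) z = (\<Sum>\<^sub>\<infinity>k. v k / z ^ Suc k)"
  unfolding dseries_def
proof (rule infsum_cong)
  fix k show "v k * ((- 1) ^ k / fact k) * (deriv ^^ k) (\<lambda>z. 1 / z) z = v k / z ^ Suc k"
  proof -
    have "((- 1) ^ k / fact k) * ((-1) ^ k * fact k / z ^ Suc k) = 1 / z ^ Suc k"
      by (simp add: field_simps flip: power_mult_distrib)
    then show ?thesis unfolding higher_deriv_inverse[OF assms] by (simp add: field_simps)
  qed
qed

section \<open>Functions with quasi-periods on a torus\<close>

context torus begin

definition "punctured \<delta> = {z. \<forall>\<kappa>\<in>\<Lambda>. \<delta> < cmod (z - \<kappa>)}"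

lemma punctured_cball: "z \<in> punctured \<delta> \<longleftrightarrow> cball z \<delta> \<subseteq> - \<Lambda>"
  by (force simp: punctured_def dist_norm)

lemma punctured_open: "0 \<le> \<delta> \<Longrightarrow> open (punctured \<delta>)"
proof -
  assume "0 \<le> \<delta>"
  moreover have "punctured \<delta> = {z. cball z \<delta> \<subseteq> - \<Lambda>}" using punctured_cball by blast
  ultimately show ?thesis using open_cball_interior[of "- \<Lambda>" \<delta>] closed_lattice_subset[of \<Lambda>] by (simp only: open_Compl order_refl)
qed

lemma punctured_not_lattice: "z \<in> punctured \<delta> \<Longrightarrow> 0 \<le> \<delta> \<Longrightarrow> z \<notin> \<Lambda>"
  by (force simp: punctured_def)

lemma punctured_shift: "z \<in> punctured \<delta> \<Longrightarrow> \<omega> \<in> \<Lambda> \<Longrightarrow> z + \<omega> \<in> punctured \<delta>"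
proof -
  assume a: "z \<in> punctured \<delta>" "\<omega> \<in> \<Lambda>"
  have "\<delta> < cmod (z + \<omega> - \<kappa>)" if "\<kappa> \<in> \<Lambda>" for \<kappa>
  proof -
    have "\<delta> < cmod (z - (\<kappa> - \<omega>))" using a torus_lattice_diff[OF that a(2)] by (simp add: punctured_def)
    then show ?thesis by (simp add: algebra_simps)
  qed
  then show ?thesis by (simp add: punctured_def)
qed

definition "quasi m n = of_int m * (2 * pi * \<i> * \<tau>) + of_int n * (2 * pi * \<i>)"

lemma quasi_lattice: "quasi m n \<in> \<Lambda>" unfolding quasi_def torus_lattice_iff by blast

lemma lattice_quasi: assumes "\<kappa> \<in> \<Lambda>" obtains m n where "\<kappa> = quasi m n"
  using assms unfolding quasi_def torus_lattice_iff by blast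

lemma zeta_quasi_1: assumes "z \<notin> \<Lambda>" shows "zeta (z + of_int n * (2 * pi * \<i>)) = zeta z"
proof -
  have nl: "z + of_int n * (2 * pi * \<i>) \<notin> \<Lambda>" for n
    using assms torus_lattice_diff[OF _ quasi_lattice[of 0 n], of "z + of_int n * (2 * pi * \<i>)"] by (auto simp: quasi_def)
  have step: "zeta (z + of_int (n + 1) * (2 * pi * \<i>)) = zeta (z + of_int n * (2 * pi * \<i>))" for n
    using zeta_period_1[OF nl[of n]] by (simp add: algebra_simps)
  show ?thesis
  proof (induction n rule: int_induct[of _ 0])
    case (step2 i) then show ?case using step[of "i - 1"] by simp
  qed (use step in simp_all)
qed

lemma zeta_quasi: assumes "z \<notin> \<Lambda>" shows "zeta (z + quasi m n) = zeta z - of_int m"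
proof -
  have nl: "z + of_int m * (2 * pi * \<i> * \<tau>) \<notin> \<Lambda>" for m
    using assms torus_lattice_diff[OF _ quasi_lattice[of m 0], of "z + of_int m * (2 * pi * \<i> * \<tau>)"] by (auto simp: quasi_def)
  have step: "zeta (z + of_int (m + 1) * (2 * pi * \<i> * \<tau>)) = zeta (z + of_int m * (2 * pi * \<i> * \<tau>)) - 1" for m
    using zeta_period_2[OF nl[of m]] by (simp add: algebra_simps)
  define g where "g m = zeta (z + of_int m * (2 * pi * \<i> * \<tau>))" for m :: int
  have step': "g (m + 1) = g m - 1" for m using step[of m] by (simp only: g_def)
  have g0: "g 0 = zeta z" by (simp add: g_def)
  have "g m = zeta z - of_int m"
  proof (induction m rule: int_induct[of _ 0])
    case (step2 i)
    have "g (i - 1) = g i + 1" using step'[of "i - 1"] by simp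
    then show ?case unfolding step2(2) by simp
  qed (use step' g0 in simp_all)
  then have "zeta (z + of_int m * (2 * pi * \<i> * \<tau>)) = zeta z - of_int m" by (simp only: g_def)
  then show ?thesis using zeta_quasi_1[OF nl[of m], of n] by (simp add: quasi_def add.assoc)
qed

lemma open_minus_lattice: "open (- \<Lambda>)" by (intro open_Compl closed_lattice_subset) auto

lemma open_minus_lattice_0: "open (- (\<Lambda> - {0}))" by (intro open_Compl closed_lattice_subset) auto

lemma zeta_deriv_quasi:
  assumes "z \<notin> \<Lambda>"
  shows "(deriv ^^ k) zeta (z + quasi m n) = (deriv ^^ k) zeta z - (if k = 0 then of_int m else 0)"
proof -
  have hs: "(\<lambda>w. zeta (1 * w + quasi m n)) holomorphic_on - \<Lambda>"
    and inv: "\<And>w. w \<in> - \<Lambda> \<Longrightarrow> 1 * w + quasi m n \<in> - \<Lambda>"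
  proof -
    show inv: "1 * w + quasi m n \<in> - \<Lambda>" if "w \<in> - \<Lambda>" for w
      using that torus_lattice_diff[OF _ quasi_lattice[of m n], of "w + quasi m n"] by auto
    show "(\<lambda>w. zeta (1 * w + quasi m n)) holomorphic_on - \<Lambda>"
      by (rule holomorphic_on_compose_gen[OF _ zeta_holomorphic, unfolded o_def]) (use inv in \<open>auto intro!: holomorphic_intros\<close>)
  qed
  have "(deriv ^^ k) (\<lambda>w. zeta (1 * w + quasi m n)) z = 1 ^ k * (deriv ^^ k) zeta (1 * z + quasi m n)"
    by (rule higher_deriv_compose_linear'[OF zeta_holomorphic open_minus_lattice open_minus_lattice])
       (use assms inv in auto)
  moreover have "(deriv ^^ k) (\<lambda>w. zeta (1 * w + quasi m n)) z = (deriv ^^ k) (\<lambda>w. zeta w - of_int m) z"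
    by (rule higher_deriv_transform_within_open[OF hs _ open_minus_lattice])
       (use assms zeta_quasi in \<open>auto intro!: holomorphic_intros zeta_holomorphic\<close>)
  moreover have "(deriv ^^ k) (\<lambda>w. zeta w - of_int m) z = (deriv ^^ k) zeta z - (deriv ^^ k) (\<lambda>w. of_int m) z"
    by (rule higher_deriv_diff[OF zeta_holomorphic _ open_minus_lattice]) (use assms in auto)
  ultimately show ?thesis by simp
qed

text \<open>Derivatives of \<open>zeta\<close> are periodic, so only the term with index 0 notices
  the translation.\<close>

lemma dseries_zeta_quasi:
  assumes "decays \<delta> v" "0 \<le> \<delta>" "z \<in> punctured \<delta>"
  shows "dseries v zeta (z + quasi m n) = dseries v zeta z - of_int m * v 0"
proof -
  have s: "(\<lambda>k. v k * ((- 1) ^ k / fact k) * (deriv ^^ k) zeta z) summable_on UNIV"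
    using abs_summable_summable[OF dseries_summable[OF open_minus_lattice zeta_holomorphic assms(1,2)]] assms(3) punctured_cball
    by blast
  have fin: "(\<lambda>k::nat. if k = 0 then of_int m * v 0 else 0) summable_on UNIV"
    "(\<Sum>\<^sub>\<infinity>k::nat. if k = 0 then of_int m * v 0 else 0) = of_int m * v 0"
    using has_sum_finite_neutralI[of "{0::nat}" UNIV "\<lambda>k. if k = 0 then of_int m * v 0 else 0" "of_int m * v 0"]
    by (auto simp: has_sum_iff)
  have "dseries v zeta (z + quasi m n)
     = (\<Sum>\<^sub>\<infinity>k. v k * ((- 1) ^ k / fact k) * (deriv ^^ k) zeta z + - (if k = 0 then of_int m * v 0 else 0))"
    unfolding dseries_def zeta_deriv_quasi[OF punctured_not_lattice[OF assms(3,2)]]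
    by (intro infsum_cong) (simp add: algebra_simps)
  also have "\<dots> = dseries v zeta z + (\<Sum>\<^sub>\<infinity>k::nat. - (if k = 0 then of_int m * v 0 else 0))"
    unfolding dseries_def using s fin(1) by (intro infsum_add) (auto simp: summable_on_uminus)
  also have "(\<Sum>\<^sub>\<infinity>k::nat. - (if k = 0 then of_int m * v 0 else 0)) = - (of_int m * v 0)"
    using fin(2) by (simp only: infsum_uminus)
  finally show ?thesis by simp
qed

definition "tform c v z = c + dseries v zeta z"

definition "tprim c v z = c * z + dseries (antideriv_coeffs v) zeta z"

lemma tprim_derivative:
  assumes "decays \<delta> v" "0 \<le> \<delta>" "v 0 = 0" "z \<in> punctured \<delta>"
  shows "(tprim c v has_field_derivative tform c v z) (at z)"
proof -
  have "(dseries (antideriv_coeffs v) zeta has_field_derivative dseries (antideriv_coeffs v) (deriv zeta) z) (at z)"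
    by (rule dseries_has_field_derivative[OF open_minus_lattice zeta_holomorphic decays_antideriv_coeffs assms(2)])
       (use assms punctured_cball in auto)
  then show ?thesis unfolding tprim_def[abs_def] tform_def dseries_antideriv[of v zeta z, OF assms(3)]
    by (auto intro!: derivative_eq_intros)
qed

text \<open>The quasi-periods of the primitive are the periods of the form. The summand
  \<open>of_int m * v 1\<close> arises because the coefficient of \<open>zeta\<close> in the
  primitive is \<open>- v 1\<close> and its quasi-period is -1.\<close>

lemma tprim_quasi:
  assumes "decays \<delta> v" "0 \<le> \<delta>" "z \<in> punctured \<delta>"
  shows "tprim c v (z + quasi m n) = tprim c v z + (c * quasi m n + of_int m * v 1)"
  using dseries_zeta_quasi[OF decays_antideriv_coeffs[OF assms(1,2)] assms(2,3)]
  by (simp add: tprim_def antideriv_coeffs_def algebra_simps)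

lemma tform_quasi:
  assumes "decays \<delta> v" "0 \<le> \<delta>" "v 0 = 0" "z \<in> punctured \<delta>" "\<omega> \<in> \<Lambda>"
  shows "tform c v (z + \<omega>) = tform c v z"
  using assms dseries_zeta_quasi[OF assms(1,2,4)] by (metis tform_def lattice_quasi diff_zero mult_zero_right)

lemma tform_holomorphic:
  assumes "decays \<delta> v" "0 \<le> \<delta>"
  shows "tform c v holomorphic_on punctured \<delta>"
  unfolding tform_def[abs_def]
  by (intro holomorphic_intros dseries_holomorphic[OF open_minus_lattice zeta_holomorphic assms]) (use punctured_cball in blast)

lemma tform_contour_integral:
  assumes "decays \<delta> v" "0 \<le> \<delta>" "v 0 = 0"
    and "valid_path \<gamma>" "path_image \<gamma> \<subseteq> punctured \<delta>" "pathfinish \<gamma> = pathstart \<gamma> + quasi m n"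
  shows "(tform c v has_contour_integral (c * quasi m n + of_int m * v 1)) \<gamma>"
proof -
  have "(tform c v has_contour_integral (tprim c v (pathfinish \<gamma>) - tprim c v (pathstart \<gamma>))) \<gamma>"
    using tprim_derivative[OF assms(1-3)] assms(4,5)
    by (intro contour_integral_primitive[where S="punctured \<delta>"]) (auto intro: has_field_derivative_at_within)
  moreover have "pathstart \<gamma> \<in> punctured \<delta>" using assms(5) pathstart_in_path_image by blast
  ultimately show ?thesis using tprim_quasi[OF assms(1,2)] assms(6) by simp
qed

section \<open>The Laurent expansion at the origin\<close>

lemma cball_near_0:
  assumes "cmod z + \<delta> < D" shows "cball z \<delta> \<subseteq> - (\<Lambda> - {0})"
proof
  fix x assume x: "x \<in> cball z \<delta>"
  have "cmod x < D" using x assms norm_triangle_ineq2[of x z] by (simp add: dist_norm norm_minus_commute)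
  then show "x \<in> - (\<Lambda> - {0})" using D_le[of x] by auto
qed

lemma dseries_zeta_split:
  assumes v: "decays \<delta> v" and \<delta>: "0 \<le> \<delta>" and z: "\<delta> < cmod z" "cmod z + \<delta> < D"
  shows "dseries v zeta z = dseries v zeta_reg z + (\<Sum>\<^sub>\<infinity>k. v k / z ^ Suc k)"
proof -
  have z0: "z \<noteq> 0" using z(1) \<delta> by auto
  have c: "cball z \<delta> \<subseteq> - \<Lambda>"
    using cball_near_0[OF z(2)] z(1) by (auto simp: dist_norm)
  have "dseries v zeta z = dseries v (\<lambda>z. zeta_reg z + 1 / z) z" by (simp add: zeta_def[abs_def])
  also have "\<dots> = dseries v zeta_reg z + dseries v (\<lambda>z. 1 / z) z"
    using torus_lattice_zero
    by (intro dseries_add[OF open_minus_lattice _ _ v \<delta> c] holomorphic_on_subset[OF zeta_reg_holomorphic] holomorphic_intros) auto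
  finally show ?thesis unfolding dseries_inverse[OF z0] .
qed

lemma dseries_zeta_reg_holomorphic:
  assumes "decays \<delta> v" "0 \<le> \<delta>" "r + \<delta> \<le> D"
  shows "dseries v zeta_reg holomorphic_on ball 0 r"
  by (rule dseries_holomorphic[OF open_minus_lattice_0 zeta_reg_holomorphic assms(1,2)])
     (use assms(3) cball_near_0 in force)

text \<open>Here the numbers C(k, l) enter: they are the Taylor coefficients at 0 of the regular
  part of the k-th term, computed from \<open>zeta_reg_deriv_0\<close> with derivative order k + l -
  1.\<close>

lemma dseries_zeta_reg_coeff:
  assumes "decays \<delta> v" "0 \<le> \<delta>" "\<delta> < D" "1 \<le> l" "v 0 = 0"
  shows "(deriv ^^ (l - 1)) (dseries v zeta_reg) 0 / fact (l - 1)
    = (\<Sum>\<^sub>\<infinity>k\<in>{1..}. v k * (torus_coeff k l \<tau> / of_nat k))"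
    and "(\<lambda>k. cmod (v k * (torus_coeff k l \<tau> / of_nat k))) summable_on {1..}"
proof -
  have c: "cball 0 \<delta> \<subseteq> - (\<Lambda> - {0})" by (rule cball_near_0) (use assms in simp)
  obtain j where l: "l = Suc j" using assms(4) by (cases l) auto
  have t: "v k * ((- 1) ^ k / fact k) * (deriv ^^ k) ((deriv ^^ j) zeta_reg) 0 = fact j * (v k * (torus_coeff k l \<tau> / of_nat k))" if k: "1 \<le> k" for k
  proof -
    obtain i where i: "k = Suc i" using k by (cases k) auto
    have "(deriv ^^ k) ((deriv ^^ j) zeta_reg) 0 = (deriv ^^ (k + j)) zeta_reg 0" by (simp add: funpow_add)
    also have "\<dots> = - fact (k + j) * eisenstein (Suc (k + j)) \<tau>" by (rule zeta_reg_deriv_0)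
    finally have "v k * ((- 1) ^ k / fact k) * (deriv ^^ k) ((deriv ^^ j) zeta_reg) 0
        = v k * ((- 1) ^ (k + 1) * fact (k + j) / fact k * eisenstein (k + l) \<tau>)"
      by (simp add: l)
    also have "(- 1) ^ (k + 1) * fact (k + j) / fact k * eisenstein (k + l) \<tau>
        = fact j * (torus_coeff k l \<tau> / of_nat k)"
      unfolding torus_coeff_def i l by (simp add: field_simps del: of_nat_Suc)
    finally show ?thesis by (simp add: mult_ac)
  qed
  have dd: "dseries v ((deriv ^^ j) zeta_reg) 0 = (\<Sum>\<^sub>\<infinity>k\<in>{1..}. fact j * (v k * (torus_coeff k l \<tau> / of_nat k)))"
    unfolding dseries_def using t assms(5) by (intro infsum_cong_neutral) (auto simp: not_le)
  show "(deriv ^^ (l - 1)) (dseries v zeta_reg) 0 / fact (l - 1)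
    = (\<Sum>\<^sub>\<infinity>k\<in>{1..}. v k * (torus_coeff k l \<tau> / of_nat k))"
    using dseries_higher_deriv[OF open_minus_lattice_0 zeta_reg_holomorphic assms(1,2) c, of j] dd[unfolded infsum_cmult_right']
    by (simp add: l)
  have "(\<lambda>k. cmod (v k * ((- 1) ^ k / fact k) * (deriv ^^ k) ((deriv ^^ j) zeta_reg) 0)) summable_on UNIV"
    by (rule dseries_summable[OF open_minus_lattice_0 _ assms(1,2) c])
       (intro holomorphic_higher_deriv zeta_reg_holomorphic open_minus_lattice_0)
  then have "(\<lambda>k. cmod (v k * ((- 1) ^ k / fact k) * (deriv ^^ k) ((deriv ^^ j) zeta_reg) 0)) summable_on {1..}"
    by (rule summable_on_subset_banach) auto
  then have "(\<lambda>k. fact j * cmod (v k * (torus_coeff k l \<tau> / of_nat k))) summable_on {1..}"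
    by (rule iffD1[OF summable_on_cong, rotated]) (use t in \<open>auto simp: norm_mult norm_divide\<close>)
  then have "(\<lambda>k. 1 / fact j * (fact j * cmod (v k * (torus_coeff k l \<tau> / of_nat k)))) summable_on {1..}"
    by (rule summable_on_cmult_right)
  then show "(\<lambda>k. cmod (v k * (torus_coeff k l \<tau> / of_nat k))) summable_on {1..}" by simp
qed

end

section \<open>Area swept out by a homotopy\<close>

lemma continuous_on_slices:
  assumes "continuous_on ({0..1} \<times> {0..1::real}) (\<lambda>(t,s). h t s :: complex)"
  shows "t \<in> {0..1} \<Longrightarrow> continuous_on {0..1} (\<lambda>s. h t s)" "s \<in> {0..1} \<Longrightarrow> continuous_on {0..1} (\<lambda>t. h t s)"
proof -
  show "continuous_on {0..1} (\<lambda>s. h t s)" if "t \<in> {0..1}"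
  proof -
    have "continuous_on {0..1} (\<lambda>s. (\<lambda>(t,s). h t s) (t, s))"
      by (rule continuous_on_compose2[OF assms continuous_on_Pair]) (use that in \<open>auto intro!: continuous_intros\<close>)
    then show ?thesis by simp
  qed
  show "continuous_on {0..1} (\<lambda>t. h t s)" if "s \<in> {0..1}"
  proof -
    have "continuous_on {0..1} (\<lambda>t. (\<lambda>(t,s). h t s) (t, s))"
      by (rule continuous_on_compose2[OF assms continuous_on_Pair]) (use that in \<open>auto intro!: continuous_intros\<close>)
    then show ?thesis by simp
  qed
qed

text \<open>If \<open>F' = f\<close>, then \<open>\<partial>\<^sub>t(cnj F f g\<^sub>s) - \<partial>\<^sub>s(cnj F f g\<^sub>t) = 2\<i> \<bar>f\<bar>\<^sup>2 Im (cnj g\<^sub>t g\<^sub>s)\<close> along a homotopy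
  \<open>g\<close>; this replaces Green's theorem.\<close>

lemma homotopy_area:
  fixes F f :: "complex \<Rightarrow> complex" and g gt gs gts :: "real \<Rightarrow> real \<Rightarrow> complex"
  assumes U: "open U" and F: "\<And>z. z \<in> U \<Longrightarrow> (F has_field_derivative f z) (at z)" and f: "f holomorphic_on U"
    and gU: "\<And>t s. t \<in> {0..1} \<Longrightarrow> s \<in> {0..1} \<Longrightarrow> g t s \<in> U"
    and dt: "\<And>t s. t \<in> {0..1} \<Longrightarrow> s \<in> {0..1} \<Longrightarrow> ((\<lambda>t. g t s) has_vector_derivative gt t s) (at t within {0..1})"
    and ds: "\<And>t s. t \<in> {0..1} \<Longrightarrow> s \<in> {0..1} \<Longrightarrow> ((\<lambda>s. g t s) has_vector_derivative gs t s) (at s within {0..1})"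
    and dst: "\<And>t s. t \<in> {0..1} \<Longrightarrow> s \<in> {0..1} \<Longrightarrow> ((\<lambda>t. gs t s) has_vector_derivative gts t s) (at t within {0..1})"
    and dts: "\<And>t s. t \<in> {0..1} \<Longrightarrow> s \<in> {0..1} \<Longrightarrow> ((\<lambda>s. gt t s) has_vector_derivative gts t s) (at s within {0..1})"
    and cg: "continuous_on ({0..1} \<times> {0..1}) (\<lambda>(t,s). g t s)"
    and cgt: "continuous_on ({0..1} \<times> {0..1}) (\<lambda>(t,s). gt t s)"
    and cgs: "continuous_on ({0..1} \<times> {0..1}) (\<lambda>(t,s). gs t s)"
    and cgts: "continuous_on ({0..1} \<times> {0..1}) (\<lambda>(t,s). gts t s)"
    and pos: "\<And>t s. t \<in> {0..1} \<Longrightarrow> s \<in> {0..1} \<Longrightarrow> 0 \<le> Im (cnj (gt t s) * gs t s)"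
  shows "Im (integral {0..1} (\<lambda>t. cnj (F (g t 1)) * f (g t 1) * gt t 1)) - Im (integral {0..1} (\<lambda>t. cnj (F (g t 0)) * f (g t 0) * gt t 0))
     \<le> Im (integral {0..1} (\<lambda>s. cnj (F (g 1 s)) * f (g 1 s) * gs 1 s)) - Im (integral {0..1} (\<lambda>s. cnj (F (g 0 s)) * f (g 0 s) * gs 0 s))"
proof -
  define X where "X t s = cnj (F (g t s)) * f (g t s) * gs t s" for t s
  define Y where "Y t s = cnj (F (g t s)) * f (g t s) * gt t s" for t s
  define Xt where "Xt t s = cnj (f (g t s) * gt t s) * f (g t s) * gs t s
     + cnj (F (g t s)) * (deriv f (g t s) * gt t s * gs t s + f (g t s) * gts t s)" for t s
  define Ys where "Ys t s = cnj (f (g t s) * gs t s) * f (g t s) * gt t s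
     + cnj (F (g t s)) * (deriv f (g t s) * gs t s * gt t s + f (g t s) * gts t s)" for t s
  have cF: "continuous_on U F" using F by (meson DERIV_continuous_on has_field_derivative_at_within)
  have cf: "continuous_on U f" by (rule holomorphic_on_imp_continuous_on[OF f])
  have cdf: "continuous_on U (deriv f)" by (intro holomorphic_on_imp_continuous_on holomorphic_deriv f U)
  have gU': "\<And>p. p \<in> {0..1} \<times> {0..1} \<Longrightarrow> (case p of (t,s) \<Rightarrow> g t s) \<in> U" using gU by auto
  have comp: "continuous_on ({0..1} \<times> {0..1}) (\<lambda>(t,s). h (g t s))" if "continuous_on U h" for h :: "complex \<Rightarrow> complex"
    using continuous_on_compose2[OF that cg] gU' by (auto simp: case_prod_unfold image_subset_iff)
  note conts = cg[unfolded case_prod_unfold] cgt[unfolded case_prod_unfold] cgs[unfolded case_prod_unfold] cgts[unfolded case_prod_unfold]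
     comp[OF cF, unfolded case_prod_unfold] comp[OF cf, unfolded case_prod_unfold] comp[OF cdf, unfolded case_prod_unfold]
  have cX: "continuous_on ({0..1} \<times> {0..1}) (\<lambda>(t,s). X t s)"
    and cY: "continuous_on ({0..1} \<times> {0..1}) (\<lambda>(t,s). Y t s)"
    and cXt: "continuous_on ({0..1} \<times> {0..1}) (\<lambda>(t,s). Xt t s)"
    and cYs: "continuous_on ({0..1} \<times> {0..1}) (\<lambda>(t,s). Ys t s)"
    unfolding X_def Y_def Xt_def Ys_def case_prod_unfold by (intro continuous_intros conts)+
  have chain: "((\<lambda>x. h (k x)) has_vector_derivative h' * k') (at x within A)"
    if "(h has_field_derivative h') (at (k x))" "(k has_vector_derivative k') (at x within A)"
    for h h' k k' x and A :: "real set"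
    using field_vector_diff_chain_within[OF that(2) has_field_derivative_at_within[OF that(1), of "k ` A"]]
    by (simp add: o_def mult.commute)
  have fd: "(f has_field_derivative deriv f z) (at z)" if "z \<in> U" for z
    using holomorphic_derivI[OF f U that] .
  have dX: "((\<lambda>t. X t s) has_vector_derivative Xt t s) (at t within {0..1})" if "t \<in> {0..1}" "s \<in> {0..1}" for t s
  proof -
    have "((\<lambda>t. cnj (F (g t s)) * f (g t s) * gs t s) has_vector_derivative
       (cnj (F (g t s)) * f (g t s)) * gts t s + (cnj (F (g t s)) * (deriv f (g t s) * gt t s) + cnj (f (g t s) * gt t s) * f (g t s)) * gs t s) (at t within {0..1})"
      using that by (intro has_vector_derivative_mult dst has_vector_derivative_cnj chain F fd dt gU)
    then show ?thesis unfolding X_def Xt_def by (rule has_vector_derivative_eq_rhs) (simp add: algebra_simps)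
  qed
  have dY: "((\<lambda>s. Y t s) has_vector_derivative Ys t s) (at s within {0..1})" if "t \<in> {0..1}" "s \<in> {0..1}" for t s
  proof -
    have "((\<lambda>s. cnj (F (g t s)) * f (g t s) * gt t s) has_vector_derivative
       (cnj (F (g t s)) * f (g t s)) * gts t s + (cnj (F (g t s)) * (deriv f (g t s) * gs t s) + cnj (f (g t s) * gs t s) * f (g t s)) * gt t s) (at s within {0..1})"
      using that by (intro has_vector_derivative_mult dts has_vector_derivative_cnj chain F fd ds gU)
    then show ?thesis unfolding Y_def Ys_def by (rule has_vector_derivative_eq_rhs) (simp add: algebra_simps)
  qed
  have diff: "0 \<le> Im (Xt t s - Ys t s)" if "t \<in> {0..1}" "s \<in> {0..1}" for t s
  proof -
    have "Xt t s - Ys t s = (f (g t s) * cnj (f (g t s))) * (cnj (gt t s) * gs t s - cnj (cnj (gt t s) * gs t s))"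
      by (simp add: Xt_def Ys_def algebra_simps)
    also have "\<dots> = of_real ((cmod (f (g t s)))\<^sup>2) * (2 * \<i> * of_real (Im (cnj (gt t s) * gs t s)))"
      by (simp only: complex_norm_square complex_diff_cnj) (simp add: mult_ac)
    finally have "Im (Xt t s - Ys t s) = (cmod (f (g t s)))\<^sup>2 * (2 * Im (cnj (gt t s) * gs t s))" by simp
    then show ?thesis using pos[OF that] by simp
  qed
  \<comment> \<open>The difference is integrated over the unit square: the derivative in t is moved
    out of the integral over s, and the derivative in s is integrated by the fundamental theorem for
    each t.\<close>
  define I where "I t = integral {0..1} (X t)" for t
  have dI: "(I has_vector_derivative integral {0..1} (Xt t)) (at t within {0..1})" if "t \<in> {0..1}" for t
    unfolding I_def
    using leibniz_rule_vector_derivative[of "{0..1}" 0 1 X Xt t] dX cXt continuous_on_slices(1)[OF cX] that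
    by (auto intro!: integrable_continuous_interval)
  have FTC: "((\<lambda>t. integral {0..1} (Xt t)) has_integral (I 1 - I 0)) {0..1}"
    by (rule fundamental_theorem_of_calculus) (use dI in auto)
  have intY: "((Ys t) has_integral (Y t 1 - Y t 0)) {0..1}" if "t \<in> {0..1}" for t
    by (rule fundamental_theorem_of_calculus) (use dY that in auto)
  have le: "Im (Y t 1 - Y t 0) \<le> Im (integral {0..1} (Xt t))" if t: "t \<in> {0..1}" for t
  proof -
    have iX: "(Xt t has_integral integral {0..1} (Xt t)) {0..1}"
      by (intro integrable_integral integrable_continuous_interval continuous_on_slices(1)[OF cXt t])
    have "((\<lambda>s. Im (Xt t s - Ys t s)) has_integral Im (integral {0..1} (Xt t) - (Y t 1 - Y t 0))) {0..1}"
      using has_integral_Im[OF has_integral_diff[OF iX intY[OF t]]] .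
    then have "0 \<le> Im (integral {0..1} (Xt t) - (Y t 1 - Y t 0))"
      by (rule has_integral_nonneg) (use diff t in auto)
    then show ?thesis by simp
  qed
  have iY: "((\<lambda>t. Y t 1 - Y t 0) has_integral integral {0..1} (\<lambda>t. Y t 1) - integral {0..1} (\<lambda>t. Y t 0)) {0..1}"
    by (intro has_integral_diff integrable_integral integrable_continuous_interval continuous_on_slices(2)[OF cY]) auto
  have "Im (integral {0..1} (\<lambda>t. Y t 1) - integral {0..1} (\<lambda>t. Y t 0)) \<le> Im (I 1 - I 0)"
    by (rule has_integral_le[OF has_integral_Im[OF iY] has_integral_Im[OF FTC]]) (use le in auto)
  then show ?thesis by (simp add: I_def X_def[abs_def] Y_def[abs_def])
qed

section \<open>Radial homotopy from a circle to a segment\<close>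

definition seg :: "complex \<Rightarrow> complex \<Rightarrow> real \<Rightarrow> complex" where
  "seg p q s = p + of_real s * (q - p)"

definition arc_scale :: "real \<Rightarrow> complex \<Rightarrow> complex \<Rightarrow> real \<Rightarrow> real" where
  "arc_scale \<rho> p q s = \<rho> / cmod (seg p q s)"

definition arc_scale' :: "real \<Rightarrow> complex \<Rightarrow> complex \<Rightarrow> real \<Rightarrow> real" where
  "arc_scale' \<rho> p q s = - \<rho> * Re (cnj (seg p q s) * (q - p)) / cmod (seg p q s) ^ 3"

text \<open>Radial projection of the segment to the circle. It does not have constant speed, but
  every point of the segment is joined to its projection by a ray, and this makes the Jacobian of
  the homotopy explicit.\<close>

definition radial_arc :: "real \<Rightarrow> complex \<Rightarrow> complex \<Rightarrow> real \<Rightarrow> complex" where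
  "radial_arc \<rho> p q s = of_real (arc_scale \<rho> p q s) * seg p q s"

definition radial_arc' :: "real \<Rightarrow> complex \<Rightarrow> complex \<Rightarrow> real \<Rightarrow> complex" where
  "radial_arc' \<rho> p q s = of_real (arc_scale' \<rho> p q s) * seg p q s + of_real (arc_scale \<rho> p q s) * (q - p)"

lemma seg_derivative: "(seg p q has_vector_derivative (q - p)) (at s within A)"
  unfolding seg_def[abs_def] by (auto intro!: derivative_eq_intros simp: has_vector_derivative_def scaleR_conv_of_real)

lemma arc_scale_derivative:
  assumes "seg p q s \<noteq> 0"
  shows "(arc_scale \<rho> p q has_real_derivative arc_scale' \<rho> p q s) (at s within A)"
proof -
  define A where "A s = (Re p + s * (Re q - Re p))\<^sup>2 + (Im p + s * (Im q - Im p))\<^sup>2" for s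
  have n: "cmod (seg p q s) = sqrt (A s)" for s
    by (simp add: seg_def cmod_def A_def)
  have pos: "A s > 0" using assms n[of s] by (metis real_sqrt_gt_0_iff zero_less_norm_iff)
  have "((\<lambda>s. sqrt (A s)) has_real_derivative Re (cnj (seg p q s) * (q - p)) / sqrt (A s)) (at s)"
  proof -
    have "(A has_real_derivative 2 * Re (cnj (seg p q s) * (q - p))) (at s)"
      unfolding A_def by (auto intro!: derivative_eq_intros simp: seg_def algebra_simps power2_eq_square)
    from DERIV_chain2[where g=A, OF DERIV_real_sqrt[OF pos] this]
    show ?thesis
    proof (rule DERIV_cong)
      show "inverse (sqrt (A s)) / 2 * (2 * Re (cnj (seg p q s) * (q - p))) = Re (cnj (seg p q s) * (q - p)) / sqrt (A s)"
        by (simp only: divide_inverse) (simp only: mult_ac, simp)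
    qed
  qed
  moreover have "((\<lambda>s. \<rho> / S s) has_real_derivative - \<rho> * d / (S s)\<^sup>2) (at s)"
    if "(S has_real_derivative d) (at s)" "S s \<noteq> 0" for S d
    using that by (auto intro!: derivative_eq_intros simp: power2_eq_square)
  ultimately have d: "((\<lambda>s. \<rho> / sqrt (A s)) has_real_derivative - \<rho> * (Re (cnj (seg p q s) * (q - p)) / sqrt (A s)) / (sqrt (A s))\<^sup>2) (at s)"
    using pos by fastforce
  have e: "- \<rho> * (R / S) / S\<^sup>2 = - \<rho> * R / S ^ 3" for R S :: real
    by (simp add: power2_eq_square power3_eq_cube)
  show ?thesis
    unfolding arc_scale_def[abs_def] arc_scale'_def n
    by (rule has_field_derivative_at_within[OF d[unfolded e]])
qed

lemma radial_arc_derivative: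
  assumes "seg p q s \<noteq> 0"
  shows "(radial_arc \<rho> p q has_vector_derivative radial_arc' \<rho> p q s) (at s within A)"
proof -
  have "((\<lambda>s. of_real (arc_scale \<rho> p q s)) has_vector_derivative complex_of_real (arc_scale' \<rho> p q s)) (at s within A)"
    using arc_scale_derivative[OF assms, of \<rho> A]
    by (simp add: has_real_derivative_iff_has_vector_derivative has_vector_derivative_of_real)
  from has_vector_derivative_mult[OF this seg_derivative[of p q s A]]
  show ?thesis unfolding radial_arc_def[abs_def] radial_arc'_def by (simp add: add.commute)
qed

lemma seg_continuous: "continuous_on A (seg p q)"
  unfolding seg_def[abs_def] by (intro continuous_intros)

lemma arc_continuous:
  assumes "\<And>s. s \<in> A \<Longrightarrow> seg p q s \<noteq> 0"
  shows "continuous_on A (arc_scale \<rho> p q)" "continuous_on A (arc_scale' \<rho> p q)"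
    "continuous_on A (radial_arc \<rho> p q)" "continuous_on A (radial_arc' \<rho> p q)"
proof -
  show 1: "continuous_on A (arc_scale \<rho> p q)" "continuous_on A (arc_scale' \<rho> p q)"
    unfolding arc_scale_def[abs_def] arc_scale'_def[abs_def] using assms
    by (auto intro!: continuous_intros seg_continuous)
  show "continuous_on A (radial_arc \<rho> p q)" "continuous_on A (radial_arc' \<rho> p q)"
    unfolding radial_arc_def[abs_def] radial_arc'_def[abs_def] by (intro continuous_intros seg_continuous 1)+
qed

lemma radial_arc_norm: "seg p q s \<noteq> 0 \<Longrightarrow> 0 < \<rho> \<Longrightarrow> cmod (radial_arc \<rho> p q s) = \<rho>"
  unfolding radial_arc_def arc_scale_def norm_mult norm_of_real by simp

definition line_energy :: "(complex \<Rightarrow> complex) \<Rightarrow> (complex \<Rightarrow> complex) \<Rightarrow> complex \<Rightarrow> complex \<Rightarrow> complex" where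
  "line_energy F f p q = integral {0..1} (\<lambda>s. cnj (F (seg p q s)) * f (seg p q s) * (q - p))"

definition arc_energy :: "(complex \<Rightarrow> complex) \<Rightarrow> (complex \<Rightarrow> complex) \<Rightarrow> real \<Rightarrow> complex \<Rightarrow> complex \<Rightarrow> complex" where
  "arc_energy F f \<rho> p q = integral {0..1} (\<lambda>s. cnj (F (radial_arc \<rho> p q s)) * f (radial_arc \<rho> p q s) * radial_arc' \<rho> p q s)"

text \<open>The straight side of a sector, from the circle out to the vertex p. Adjacent sectors
  share it, so that these terms telescope around the hexagon.\<close>

definition ray_energy :: "(complex \<Rightarrow> complex) \<Rightarrow> (complex \<Rightarrow> complex) \<Rightarrow> real \<Rightarrow> complex \<Rightarrow> real" where
  "ray_energy F f \<rho> p = Im (integral {0..1} (\<lambda>t. cnj (F (of_real ((1 - t) * (\<rho> / cmod p) + t) * p))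
     * f (of_real ((1 - t) * (\<rho> / cmod p) + t) * p) * (of_real (1 - \<rho> / cmod p) * p)))"

text \<open>The homotopy rescales the segment by a real factor going from \<open>arc_scale\<close>
  to 1. It covers the sector between circle and segment, and \<open>0 \<le> Im (cnj p * q)\<close>
  makes its orientation positive.\<close>

lemma sector_inequality:
  assumes U: "open U" and F: "\<And>z. z \<in> U \<Longrightarrow> (F has_field_derivative f z) (at z)" and f: "f holomorphic_on U"
    and \<rho>: "0 < \<rho>" and far: "\<And>s. s \<in> {0..1} \<Longrightarrow> \<rho> \<le> cmod (seg p q s)" and orient: "0 \<le> Im (cnj p * q)"
    and inU: "\<And>s k. s \<in> {0..1} \<Longrightarrow> 0 \<le> k \<Longrightarrow> k \<le> 1 \<Longrightarrow> \<rho> \<le> k * cmod (seg p q s) \<Longrightarrow> of_real k * seg p q s \<in> U"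
  shows "ray_energy F f \<rho> q - ray_energy F f \<rho> p \<le> Im (line_energy F f p q) - Im (arc_energy F f \<rho> p q)"
proof -
  have nz: "seg p q s \<noteq> 0" if "s \<in> {0..1}" for s using far[OF that] \<rho> by auto
  let ?n = "arc_scale \<rho> p q" and ?n' = "arc_scale' \<rho> p q" and ?p = "seg p q"
  define k where "k t s = (1 - t) * ?n s + t" for t s
  define g where "g t s = of_real (k t s) * ?p s" for t s
  define gt where "gt t s = of_real (1 - ?n s) * ?p s" for t s :: real
  define gs where "gs t s = of_real ((1 - t) * ?n' s) * ?p s + of_real (k t s) * (q - p)" for t s
  define gts where "gts t s = - of_real (?n' s) * ?p s + of_real (1 - ?n s) * (q - p)" for t s :: real
  have n01: "0 < ?n s" "?n s \<le> 1" if "s \<in> {0..1}" for s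
    using far[OF that] nz[OF that] \<rho> by (auto simp: arc_scale_def)
  have k01: "?n s \<le> k t s" "k t s \<le> 1" if "t \<in> {0..1}" "s \<in> {0..1}" for t s
  proof -
    have e: "k t s = ?n s + t * (1 - ?n s)" "1 = k t s + (1 - t) * (1 - ?n s)" by (simp_all add: k_def algebra_simps)
    have "0 \<le> t * (1 - ?n s)" "0 \<le> (1 - t) * (1 - ?n s)" using that n01(2)[OF that(2)] by auto
    then show "?n s \<le> k t s" "k t s \<le> 1" using e by linarith+
  qed
  have "Im (integral {0..1} (\<lambda>t. cnj (F (g t 1)) * f (g t 1) * gt t 1)) - Im (integral {0..1} (\<lambda>t. cnj (F (g t 0)) * f (g t 0) * gt t 0))
     \<le> Im (integral {0..1} (\<lambda>s. cnj (F (g 1 s)) * f (g 1 s) * gs 1 s)) - Im (integral {0..1} (\<lambda>s. cnj (F (g 0 s)) * f (g 0 s) * gs 0 s))"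
  proof (rule homotopy_area[OF U F f, where gts=gts])
    fix t s :: real assume t: "t \<in> {0..1}" and s: "s \<in> {0..1}"
    show "g t s \<in> U" unfolding g_def
    proof (rule inU[OF s])
      show "0 \<le> k t s" "k t s \<le> 1" using k01[OF t s] n01[OF s] by auto
      have "\<rho> = ?n s * cmod (?p s)" using nz[OF s] by (simp add: arc_scale_def)
      also have "\<dots> \<le> k t s * cmod (?p s)" using k01[OF t s] by (intro mult_right_mono) auto
      finally show "\<rho> \<le> k t s * cmod (?p s)" .
    qed
    show "((\<lambda>t. g t s) has_vector_derivative gt t s) (at t within {0..1})"
      unfolding g_def k_def gt_def has_vector_derivative_def
      by (auto intro!: derivative_eq_intros simp: scaleR_conv_of_real algebra_simps)
    have dn: "((\<lambda>s. complex_of_real (?n s)) has_vector_derivative of_real (?n' s)) (at s within {0..1})"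
      using arc_scale_derivative[OF nz[OF s], of \<rho> "{0..1}"]
      by (simp add: has_real_derivative_iff_has_vector_derivative has_vector_derivative_of_real)
    have "((\<lambda>s. (of_real (1 - t) * of_real (?n s) + of_real t) * ?p s) has_vector_derivative
        (of_real (1 - t) * of_real (?n s) + of_real t) * (q - p) + (of_real (1 - t) * of_real (?n' s) + 0) * ?p s) (at s within {0..1})"
      by (intro has_vector_derivative_mult seg_derivative has_vector_derivative_add has_vector_derivative_mult_right dn has_vector_derivative_const)
    then show "((\<lambda>s. g t s) has_vector_derivative gs t s) (at s within {0..1})"
      unfolding g_def k_def gs_def by (simp add: add.commute)
    show "((\<lambda>t. gs t s) has_vector_derivative gts t s) (at t within {0..1})"
      unfolding gs_def k_def gts_def has_vector_derivative_def
      by (auto intro!: derivative_eq_intros simp: scaleR_conv_of_real algebra_simps)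
    have "((\<lambda>s. (1 - of_real (?n s)) * ?p s) has_vector_derivative
        (1 - of_real (?n s)) * (q - p) + (0 - of_real (?n' s)) * ?p s) (at s within {0..1})"
      by (intro has_vector_derivative_mult seg_derivative has_vector_derivative_diff dn has_vector_derivative_const)
    then show "((\<lambda>s. gt t s) has_vector_derivative gts t s) (at s within {0..1})"
      unfolding gt_def gts_def by (simp add: add.commute)
    show "0 \<le> Im (cnj (gt t s) * gs t s)"
    proof -
      \<comment> \<open>The component of \<open>gs\<close> along \<open>seg p q s\<close> is a real
        multiple of the direction of \<open>gt\<close> and drops out of the imaginary part.\<close>
      have "Im (cnj (gt t s) * gs t s) = (1 - ?n s) * k t s * Im (cnj (?p s) * (q - p))"
        by (simp add: gt_def gs_def algebra_simps)
      also have "Im (cnj (?p s) * (q - p)) = Im (cnj p * q)"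
        by (simp add: seg_def algebra_simps)
      finally show ?thesis using n01[OF s] k01[OF t s] orient by (auto intro!: mult_nonneg_nonneg)
    qed
  next
    have sn: "seg p q (snd x) \<noteq> 0" if "x \<in> {0..1} \<times> {0..1}" for x :: "real \<times> real" using nz that by auto
    have c: "continuous_on ({0..1} \<times> {0..1}) (\<lambda>x::real \<times> real. h (snd x))" if "continuous_on {0..1} h" for h :: "real \<Rightarrow> 'a::topological_space"
      by (rule continuous_on_compose2[OF that]) (auto intro!: continuous_intros)
    note cc = c[OF arc_continuous(1)] c[OF arc_continuous(2)] c[OF seg_continuous]
    show "continuous_on ({0..1} \<times> {0..1}) (\<lambda>(t,s). g t s)" "continuous_on ({0..1} \<times> {0..1}) (\<lambda>(t,s). gt t s)"
      "continuous_on ({0..1} \<times> {0..1}) (\<lambda>(t,s). gs t s)" "continuous_on ({0..1} \<times> {0..1}) (\<lambda>(t,s). gts t s)"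
      unfolding g_def gt_def gs_def gts_def k_def case_prod_unfold
      by (intro continuous_intros cc nz; assumption)+
  qed
  moreover have "g 0 s = radial_arc \<rho> p q s" "gs 0 s = radial_arc' \<rho> p q s" "g 1 s = seg p q s" "gs 1 s = q - p" for s
    by (simp_all add: radial_arc'_def radial_arc_def gs_def g_def k_def)
  moreover have "g t 0 = of_real ((1 - t) * (\<rho> / cmod p) + t) * p" "gt t 0 = of_real (1 - \<rho> / cmod p) * p"
    "g t 1 = of_real ((1 - t) * (\<rho> / cmod q) + t) * q" "gt t 1 = of_real (1 - \<rho> / cmod q) * q" for t
    by (simp_all add: g_def gt_def k_def arc_scale_def seg_def)
  ultimately show ?thesis
    unfolding ray_energy_def line_energy_def arc_energy_def by (simp only:)
qed

lemma seg_linepath: "seg p q = linepath p q"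
  by (auto simp: seg_def linepath_def fun_eq_iff scaleR_conv_of_real algebra_simps)

lemma line_energy_contour:
  "line_energy F f p q = contour_integral (linepath p q) (\<lambda>z. cnj (F z) * f z)"
  by (simp add: line_energy_def seg_linepath contour_integral_integral)

text \<open>Opposite sides of the hexagon are translates of each other with reversed direction. The
  conjugated primitive changes by a constant, so besides the sign only that constant times the
  integral of f remains.\<close>

lemma line_energy_reverse_translate:
  assumes F: "\<And>z. z \<in> closed_segment p q \<Longrightarrow> (F has_field_derivative f z) (at z)"
    and f: "continuous_on (closed_segment p q) f"
    and per: "\<And>z. z \<in> closed_segment p q \<Longrightarrow> F (z - \<omega>) = F z - \<eta>" "\<And>z. z \<in> closed_segment p q \<Longrightarrow> f (z - \<omega>) = f z"
  shows "line_energy F f (q - \<omega>) (p - \<omega>) = - line_energy F f p q + cnj \<eta> * (F q - F p)"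
proof -
  have cF: "continuous_on (closed_segment p q) F"
    using F by (meson DERIV_continuous_on has_field_derivative_at_within)
  have seg: "seg q p s \<in> closed_segment p q" if "s \<in> {0..1}" for s
    using that by (simp add: seg_linepath) (metis closed_segment_commute linepath_in_path path_image_linepath atLeastAtMost_iff)
  have tr: "seg (q - \<omega>) (p - \<omega>) s = seg q p s - \<omega>" for s by (simp add: seg_def)
  have "line_energy F f (q - \<omega>) (p - \<omega>) = integral {0..1} (\<lambda>s. cnj (F (seg q p s) - \<eta>) * f (seg q p s) * (p - q))"
    unfolding line_energy_def tr using per[OF seg] by (intro integral_cong) simp
  also have "\<dots> = contour_integral (linepath q p) (\<lambda>z. cnj (F z) * f z - cnj \<eta> * f z)"
    by (simp add: contour_integral_integral seg_linepath algebra_simps)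
  also have "\<dots> = - contour_integral (linepath p q) (\<lambda>z. cnj (F z) * f z - cnj \<eta> * f z)"
    using cF f closed_segment_commute[of p q]
    by (intro contour_integral_reverse_linepath) (auto intro!: continuous_intros)
  also have "contour_integral (linepath p q) (\<lambda>z. cnj (F z) * f z - cnj \<eta> * f z)
     = contour_integral (linepath p q) (\<lambda>z. cnj (F z) * f z) - contour_integral (linepath p q) (\<lambda>z. cnj \<eta> * f z)"
    using cF f by (intro contour_integral_diff contour_integrable_continuous_linepath) (auto intro!: continuous_intros)
  also have "contour_integral (linepath p q) (\<lambda>z. cnj \<eta> * f z) = cnj \<eta> * contour_integral (linepath p q) f"
    using f by (intro contour_integral_lmul contour_integrable_continuous_linepath) auto
  also have "(f has_contour_integral (F (pathfinish (linepath p q)) - F (pathstart (linepath p q)))) (linepath p q)"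
    using F by (intro contour_integral_primitive[where S="closed_segment p q"]) (auto intro: has_field_derivative_at_within)
  then have "contour_integral (linepath p q) f = F q - F p" by (simp add: contour_integral_unique)
  finally show ?thesis by (simp add: line_energy_contour algebra_simps)
qed

lemma arc_endpoints:
  "radial_arc \<rho> p q 0 = of_real (\<rho> / cmod p) * p" "radial_arc \<rho> p q 1 = of_real (\<rho> / cmod q) * q"
  by (simp_all add: radial_arc_def arc_scale_def seg_def)

lemma arc_integral_primitive:
  assumes nz: "\<And>s. s \<in> {0..1} \<Longrightarrow> seg p q s \<noteq> 0"
    and \<Phi>: "\<And>s. s \<in> {0..1} \<Longrightarrow> (\<Phi> has_field_derivative \<phi> (radial_arc \<rho> p q s)) (at (radial_arc \<rho> p q s))"
  shows "((\<lambda>s. \<phi> (radial_arc \<rho> p q s) * radial_arc' \<rho> p q s) has_integral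
     (\<Phi> (of_real (\<rho> / cmod q) * q) - \<Phi> (of_real (\<rho> / cmod p) * p))) {0..1}"
proof -
  have "((\<lambda>s. \<phi> (radial_arc \<rho> p q s) * radial_arc' \<rho> p q s) has_integral (\<Phi> (radial_arc \<rho> p q 1) - \<Phi> (radial_arc \<rho> p q 0))) {0..1}"
  proof (rule fundamental_theorem_of_calculus)
    fix s :: real assume s: "s \<in> {0..1}"
    have "((\<Phi> \<circ> radial_arc \<rho> p q) has_vector_derivative radial_arc' \<rho> p q s * \<phi> (radial_arc \<rho> p q s)) (at s within {0..1})"
      by (rule field_vector_diff_chain_within[OF radial_arc_derivative[OF nz[OF s]] has_field_derivative_at_within[OF \<Phi>[OF s]]])
    then show "((\<lambda>s. \<Phi> (radial_arc \<rho> p q s)) has_vector_derivative \<phi> (radial_arc \<rho> p q s) * radial_arc' \<rho> p q s) (at s within {0..1})"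
      by (simp add: o_def mult.commute)
  qed simp
  then show ?thesis by (simp only: arc_endpoints)
qed

text \<open>If a point of the segment lay on the ray opposite to p, orientation would force q / p to
  be real, and the segment would run through 0.\<close>

lemma seg_ratio_not_nonpos:
  assumes nz: "\<And>s. s \<in> {0..1} \<Longrightarrow> seg p q s \<noteq> 0" and orient: "0 \<le> Im (cnj p * q)" and s: "s \<in> {0..1}"
  shows "seg p q s / p \<notin> \<real>\<^sub>\<le>\<^sub>0"
proof
  assume a: "seg p q s / p \<in> \<real>\<^sub>\<le>\<^sub>0"
  have p: "p \<noteq> 0" using nz[of 0] by (simp add: seg_def)
  define w where "w = q / p"
  have e: "seg p q t / p = 1 + of_real t * (w - 1)" for t using p by (simp add: seg_def w_def field_simps)
  have im: "s * Im w = 0" and re: "1 + s * (Re w - 1) \<le> 0" using a by (auto simp: e complex_nonpos_Reals_iff)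
  have s0: "s \<noteq> 0" using re by auto
  then have iw: "Im w = 0" using im by simp
  have lt: "Re w - 1 < 0" using re s s0 by (smt (verit) atLeastAtMost_iff mult_nonneg_nonneg)
  \<comment> \<open>The parameter at which the segment, divided by p, vanishes.\<close>
  define t where "t = 1 / (1 - Re w)"
  have "t \<in> {0..1}"
  proof -
    have "1 \<le> s * (1 - Re w)" using re by (simp add: algebra_simps)
    also have "\<dots> \<le> 1 * (1 - Re w)" using s lt by (intro mult_right_mono) auto
    finally show ?thesis using lt by (simp add: t_def)
  qed
  moreover have "seg p q t / p = 0"
    unfolding e using lt iw by (simp add: t_def complex_eq_iff field_simps)
  ultimately show False using nz p by auto
qed

text \<open>The principal logarithm of \<open>seg p q s / p\<close> stays off its cut. Its real part
  is compensated by the logarithm of the scale, since the arc lies on a circle, and only the angle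
  survives.\<close>

lemma arc_integral_inverse:
  assumes nz: "\<And>s. s \<in> {0..1} \<Longrightarrow> seg p q s \<noteq> 0" and orient: "0 \<le> Im (cnj p * q)" and \<rho>: "0 < \<rho>"
  shows "((\<lambda>s. 1 / radial_arc \<rho> p q s * radial_arc' \<rho> p q s) has_integral \<i> * of_real (Im (Ln (q / p)))) {0..1}"
proof -
  have p: "p \<noteq> 0" "q \<noteq> 0" using nz[of 0] nz[of 1] by (auto simp: seg_def)
  define \<Phi> where "\<Phi> s = of_real (ln (arc_scale \<rho> p q s)) + Ln (seg p q s / p)" for s
  have "((\<lambda>s. 1 / radial_arc \<rho> p q s * radial_arc' \<rho> p q s) has_integral (\<Phi> 1 - \<Phi> 0)) {0..1}"
  proof (rule fundamental_theorem_of_calculus)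
    fix s :: real assume s: "s \<in> {0..1}"
    have n: "arc_scale \<rho> p q s > 0" using nz[OF s] \<rho> by (simp add: arc_scale_def)
    have "((\<lambda>s. ln (arc_scale \<rho> p q s)) has_real_derivative 1 / arc_scale \<rho> p q s * arc_scale' \<rho> p q s) (at s within {0..1})"
      by (rule DERIV_chain2[OF DERIV_ln_divide[OF n] arc_scale_derivative[OF nz[OF s]]])
    then have 1: "((\<lambda>s. complex_of_real (ln (arc_scale \<rho> p q s))) has_vector_derivative of_real (1 / arc_scale \<rho> p q s * arc_scale' \<rho> p q s)) (at s within {0..1})"
      by (simp only: has_real_derivative_iff_has_vector_derivative has_vector_derivative_of_real)
    have d: "((\<lambda>z. Ln (z / p)) has_field_derivative 1 / seg p q s) (at (seg p q s))"
      using seg_ratio_not_nonpos[OF nz orient s] p nz[OF s]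
      by (auto intro!: derivative_eq_intros simp: field_simps)
    have 2: "((\<lambda>s. Ln (seg p q s / p)) has_vector_derivative (q - p) * (1 / seg p q s)) (at s within {0..1})"
      using field_vector_diff_chain_within[OF seg_derivative has_field_derivative_at_within[OF d]] by (simp add: o_def)
    show "(\<Phi> has_vector_derivative 1 / radial_arc \<rho> p q s * radial_arc' \<rho> p q s) (at s within {0..1})"
      unfolding \<Phi>_def
    proof (rule has_vector_derivative_eq_rhs[OF has_vector_derivative_add[OF 1 2]])
      have "(a * m + n * r) / (n * m) = a / n + r / m" if "n \<noteq> 0" "m \<noteq> 0" for a n m r :: complex
        using that by (simp add: field_simps)
      from this[of "of_real (arc_scale \<rho> p q s)" "seg p q s"]
      show "of_real (1 / arc_scale \<rho> p q s * arc_scale' \<rho> p q s) + (q - p) * (1 / seg p q s) = 1 / radial_arc \<rho> p q s * radial_arc' \<rho> p q s"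
        using n nz[OF s] by (simp add: radial_arc_def radial_arc'_def)
    qed
  qed simp
  also have "\<Phi> 1 - \<Phi> 0 = of_real (ln (\<rho> / cmod q) - ln (\<rho> / cmod p)) + Ln (q / p)"
    using p by (simp add: \<Phi>_def arc_scale_def seg_def)
  also have "\<dots> = \<i> * of_real (Im (Ln (q / p)))"
    using p \<rho> Re_Ln[of "q / p"] by (simp add: complex_eq_iff[of _ "\<i> * of_real _"] ln_div norm_divide)
  finally show ?thesis .
qed

lemma Ln_quotient_bounds:
  assumes nz: "\<And>s. s \<in> {0..1} \<Longrightarrow> seg p q s \<noteq> 0" and orient: "0 \<le> Im (cnj p * q)"
  shows "0 \<le> Im (Ln (q / p))" "Im (Ln (q / p)) < pi"
proof -
  have p: "p \<noteq> 0" "q \<noteq> 0" using nz[of 0] nz[of 1] by (auto simp: seg_def)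
  have "q / p = cnj p * q / of_real ((cmod p)\<^sup>2)" using p by (simp add: complex_norm_square del: of_real_power)
  then have "Im (q / p) = Im (cnj p * q) / (cmod p)\<^sup>2" by (metis Im_divide_of_real)
  then have "0 \<le> Im (q / p)" using orient by simp
  moreover have "q / p \<notin> \<real>\<^sub>\<le>\<^sub>0" using seg_ratio_not_nonpos[OF nz orient, of 1] by (simp add: seg_def)
  ultimately show "0 \<le> Im (Ln (q / p))" "Im (Ln (q / p)) < pi"
    using p Im_Ln_pos_le[of "q / p"] Im_Ln_less_pi[of "q / p"] by auto
qed

text \<open>By central symmetry three consecutive quotients multiply to -1, so their angles add up
  to an odd multiple of pi. As each angle lies in [0, pi), this multiple is pi itself, and the other
  half contributes the same.\<close>

lemma hexagon_angle:
  fixes v :: "nat \<Rightarrow> complex"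
  assumes opp: "\<And>j. v (j + 3) = - v j"
    and nz: "\<And>j s. s \<in> {0..1} \<Longrightarrow> seg (v j) (v (Suc j)) s \<noteq> 0" and orient: "\<And>j. 0 \<le> Im (cnj (v j) * v (Suc j))"
  shows "(\<Sum>j<6. Im (Ln (v (Suc j) / v j))) = 2 * pi"
proof -
  have v: "v j \<noteq> 0" for j using nz[of 0 j] by (simp add: seg_def)
  define \<theta> where "\<theta> j = Im (Ln (v (Suc j) / v j))" for j
  have b: "0 \<le> \<theta> j" "\<theta> j < pi" for j unfolding \<theta>_def using Ln_quotient_bounds[OF nz orient, of j] by auto
  have per: "\<theta> (j + 3) = \<theta> j" for j
    using opp[of j] opp[of "Suc j"] by (simp add: \<theta>_def)
  have "exp (Ln (v 1 / v 0) + Ln (v 2 / v 1) + Ln (v 3 / v 2)) = (v 1 / v 0) * (v 2 / v 1) * (v 3 / v 2)"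
    using v by (simp add: exp_add)
  also have "\<dots> = - 1" using v opp[of 0] by (simp add: field_simps)
  also have "\<dots> = exp (\<i> * pi)" by simp
  finally obtain n :: int where "Ln (v 1 / v 0) + Ln (v 2 / v 1) + Ln (v 3 / v 2) = \<i> * pi + (of_int (2 * n) * pi) * \<i>"
    unfolding exp_eq by blast
  then have "Im (Ln (v 1 / v 0) + Ln (v 2 / v 1) + Ln (v 3 / v 2)) = Im (\<i> * pi + (of_int (2 * n) * pi) * \<i>)" by simp
  then have s: "\<theta> 0 + \<theta> 1 + \<theta> 2 = pi * (1 + 2 * of_int n)"
    by (simp add: \<theta>_def numeral_2_eq_2 numeral_3_eq_3 algebra_simps)
  have "0 \<le> pi * (1 + 2 * of_int n)" "pi * (1 + 2 * of_int n) < pi * 3" using b[of 0] b[of 1] b[of 2] s by linarith+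
  then have "0 \<le> 1 + 2 * real_of_int n" "1 + 2 * real_of_int n < 3" by (auto simp: zero_le_mult_iff mult_less_cancel_left)
  then have "n = 0" by linarith
  then have "\<theta> 0 + \<theta> 1 + \<theta> 2 = pi" using s by simp
  moreover have "(\<Sum>j<6. \<theta> j) = 2 * (\<theta> 0 + \<theta> 1 + \<theta> 2)"
    using per[of 0] per[of 1] per[of 2] by (simp add: eval_nat_numeral)
  ultimately show ?thesis by (simp add: \<theta>_def)
qed

section \<open>Energy of Laurent polynomials on a circle\<close>

text \<open>On the circle \<open>cnj z\<close> is \<rho>^2 / z, so the integrand is a combination of
  integral powers of z. Powers with a primitive telescope around the closed hexagon; the exponent -1
  yields the total angle 2 pi. Working with primitives avoids reparametrising the arcs.\<close>

lemma hexagon_laurent_energy: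
  fixes v :: "nat \<Rightarrow> complex" and c :: "int \<Rightarrow> complex"
  assumes opp: "\<And>j. v (j + 3) = - v j"
    and nz: "\<And>j s. s \<in> {0..1} \<Longrightarrow> seg (v j) (v (Suc j)) s \<noteq> 0" and orient: "\<And>j. 0 \<le> Im (cnj (v j) * v (Suc j))"
    and \<rho>: "0 < \<rho>" and S: "finite S"
  defines "L \<equiv> \<lambda>z. \<Sum>n\<in>S. c n * z powi n" and "L' \<equiv> \<lambda>z. \<Sum>n\<in>S. of_int n * c n * z powi (n - 1)"
  shows "(\<Sum>j<6. arc_energy L L' \<rho> (v j) (v (Suc j))) = 2 * pi * \<i> * (\<Sum>n\<in>S. of_int n * of_real ((cmod (c n))\<^sup>2 * \<rho> powi (2 * n)))"
proof -
  have vp: "v 6 = v 0" using opp[of 0] opp[of 3] by simp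
  define K where "K j m n s = cnj (c m) * of_real (\<rho> powi (2 * m)) * (of_int n * c n) * (radial_arc \<rho> (v j) (v (Suc j)) s powi (n - 1 - m) * radial_arc' \<rho> (v j) (v (Suc j)) s)" for j m n s
  define I where "I j m n = cnj (c m) * of_real (\<rho> powi (2 * m)) * (of_int n * c n) *
     (if n = m then \<i> * of_real (Im (Ln (v (Suc j) / v j)))
      else ((of_real (\<rho> / cmod (v (Suc j))) * v (Suc j)) powi (n - m) / of_int (n - m) - (of_real (\<rho> / cmod (v j)) * v j) powi (n - m) / of_int (n - m)))" for j m n
  have hI: "(K j m n has_integral I j m n) {0..1}" for j m n
    unfolding K_def I_def
  proof (rule has_integral_mult_right, cases "n = m")
    case True
    then show "((\<lambda>s. radial_arc \<rho> (v j) (v (Suc j)) s powi (n - 1 - m) * radial_arc' \<rho> (v j) (v (Suc j)) s) has_integral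
      (if n = m then \<i> * of_real (Im (Ln (v (Suc j) / v j)))
      else ((of_real (\<rho> / cmod (v (Suc j))) * v (Suc j)) powi (n - m) / of_int (n - m) - (of_real (\<rho> / cmod (v j)) * v j) powi (n - m) / of_int (n - m)))) {0..1}"
      using arc_integral_inverse[OF nz[of _ j] orient[of j] \<rho>] by (simp add: divide_inverse power_int_minus)
  next
    case False
    have "((\<lambda>s. radial_arc \<rho> (v j) (v (Suc j)) s powi (n - m - 1) * radial_arc' \<rho> (v j) (v (Suc j)) s) has_integral
      ((of_real (\<rho> / cmod (v (Suc j))) * v (Suc j)) powi (n - m) / of_int (n - m) - (of_real (\<rho> / cmod (v j)) * v j) powi (n - m) / of_int (n - m))) {0..1}"
    proof (rule arc_integral_primitive[OF nz[of _ j], where \<Phi>="\<lambda>z. z powi (n - m) / of_int (n - m)" and \<phi>="\<lambda>z. z powi (n - m - 1)"])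
      fix s :: real assume s: "s \<in> {0..1}"
      have "radial_arc \<rho> (v j) (v (Suc j)) s \<noteq> 0" using radial_arc_norm[OF nz[OF s] \<rho>, of j] \<rho> by auto
      then show "((\<lambda>z. z powi (n - m) / of_int (n - m)) has_field_derivative radial_arc \<rho> (v j) (v (Suc j)) s powi (n - m - 1)) (at (radial_arc \<rho> (v j) (v (Suc j)) s))"
        using False by (auto intro!: derivative_eq_intros simp flip: of_int_diff)
    qed
    then show "((\<lambda>s. radial_arc \<rho> (v j) (v (Suc j)) s powi (n - 1 - m) * radial_arc' \<rho> (v j) (v (Suc j)) s) has_integral
      (if n = m then \<i> * of_real (Im (Ln (v (Suc j) / v j)))
      else ((of_real (\<rho> / cmod (v (Suc j))) * v (Suc j)) powi (n - m) / of_int (n - m) - (of_real (\<rho> / cmod (v j)) * v j) powi (n - m) / of_int (n - m)))) {0..1}"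
      using False by (simp add: algebra_simps)
  qed
  have E: "arc_energy L L' \<rho> (v j) (v (Suc j)) = (\<Sum>m\<in>S. \<Sum>n\<in>S. I j m n)" for j
  proof -
    have "((\<lambda>s. \<Sum>m\<in>S. \<Sum>n\<in>S. K j m n s) has_integral (\<Sum>m\<in>S. \<Sum>n\<in>S. I j m n)) {0..1}"
      by (intro has_integral_sum S hI)
    moreover have "cnj (L (radial_arc \<rho> (v j) (v (Suc j)) s)) * L' (radial_arc \<rho> (v j) (v (Suc j)) s) * radial_arc' \<rho> (v j) (v (Suc j)) s = (\<Sum>m\<in>S. \<Sum>n\<in>S. K j m n s)"
      if s: "s \<in> {0..1}" for s
    proof -
      define z where "z = radial_arc \<rho> (v j) (v (Suc j)) s"
      have zn: "cmod z = \<rho>" unfolding z_def by (rule radial_arc_norm[OF nz[OF s] \<rho>])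
      then have z0: "z \<noteq> 0" using \<rho> by auto
      have "cnj z = of_real (\<rho>\<^sup>2) / z" using z0 zn complex_norm_square[of z] by (simp add: field_simps)
      then have cz: "cnj (z powi m) = of_real (\<rho> powi (2 * m)) * z powi (- m)" for m
        by (simp add: power_int_minus divide_inverse power_int_mult power_int_mult_distrib power_int_inverse)
      have pw: "z powi (- m) * z powi (n - 1) = z powi (n - 1 - m)" for m n
        using z0 by (simp add: power_int_add[symmetric] algebra_simps)
      have "cnj (L z) * L' z * radial_arc' \<rho> (v j) (v (Suc j)) s
         = (\<Sum>m\<in>S. \<Sum>n\<in>S. cnj (c m * z powi m) * (of_int n * c n * z powi (n - 1))) * radial_arc' \<rho> (v j) (v (Suc j)) s"
        by (simp add: L_def L'_def sum_product)
      also have "\<dots> = (\<Sum>m\<in>S. \<Sum>n\<in>S. K j m n s)"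
        unfolding sum_distrib_right K_def z_def[symmetric] pw[symmetric] complex_cnj_mult cz
        by (intro sum.cong refl) (simp only: mult_ac)
      finally show ?thesis by (simp add: z_def)
    qed
    ultimately show ?thesis unfolding arc_energy_def by (metis (no_types, lifting) has_integral_eq_rhs integral_cong integral_unique)
  qed
  have T: "(\<Sum>j<6. I j m n) = (if n = m then 2 * pi * \<i> * (of_int n * of_real ((cmod (c n))\<^sup>2 * \<rho> powi (2 * n))) else 0)" for m n
  proof (cases "n = m")
    case True
    have "(\<Sum>j<6. I j m n) = cnj (c n) * of_real (\<rho> powi (2 * n)) * (of_int n * c n) * (\<i> * of_real (\<Sum>j<6. Im (Ln (v (Suc j) / v j))))"
      unfolding I_def using True by (simp add: sum_distrib_left)
    also have "\<dots> = 2 * pi * \<i> * (of_int n * ((c n * cnj (c n)) * of_real (\<rho> powi (2 * n))))"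
    proof -
      have "(\<Sum>j<6. Im (Ln (v (Suc j) / v j))) = 2 * pi" by (rule hexagon_angle[OF opp nz orient])
      then show ?thesis by (simp only:) (simp add: mult_ac)
    qed
    finally show ?thesis using True by (simp add: complex_norm_square del: of_real_power)
  next
    case False
    then have "(\<Sum>j<6. I j m n) = cnj (c m) * of_real (\<rho> powi (2 * m)) * (of_int n * c n) *
      (\<Sum>j<6. (of_real (\<rho> / cmod (v (Suc j))) * v (Suc j)) powi (n - m) / of_int (n - m) - (of_real (\<rho> / cmod (v j)) * v j) powi (n - m) / of_int (n - m))"
      unfolding I_def by (simp add: sum_distrib_left)
    also have "\<dots> = 0" by (subst sum_lessThan_telescope) (simp add: vp)
    finally show ?thesis using False by simp
  qed
  have "(\<Sum>j<6. arc_energy L L' \<rho> (v j) (v (Suc j))) = (\<Sum>m\<in>S. \<Sum>n\<in>S. \<Sum>j<6. I j m n)"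
    unfolding E by (subst sum.swap, intro sum.cong refl, subst sum.swap) simp
  also have "\<dots> = (\<Sum>m\<in>S. 2 * pi * \<i> * (of_int m * of_real ((cmod (c m))\<^sup>2 * \<rho> powi (2 * m))))"
    unfolding T using S by (intro sum.cong refl) (simp add: sum.delta)
  finally show ?thesis by (simp add: sum_distrib_left)
qed

section \<open>The area of a period hexagon\<close>

text \<open>A form of Riemann's bilinear relation: the ray terms cancel, and pairing opposite sides
  expresses the outer boundary integral through the quasi-periods \<eta>1 and \<eta>2 alone.\<close>

lemma hexagon_area:
  fixes v :: "nat \<Rightarrow> complex"
  assumes opp: "\<And>j. v (j + 3) = - v j" and v0: "v 0 = c" "v 1 = \<omega>2 - c" "v 2 = c - \<omega>1"
    and U: "open U" and F: "\<And>z. z \<in> U \<Longrightarrow> (F has_field_derivative f z) (at z)" and f: "f holomorphic_on U"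
    and \<rho>: "0 < \<rho>" and far: "\<And>j s. s \<in> {0..1} \<Longrightarrow> \<rho> \<le> cmod (seg (v j) (v (Suc j)) s)" and orient: "\<And>j. 0 \<le> Im (cnj (v j) * v (Suc j))"
    and inU: "\<And>j s k. s \<in> {0..1} \<Longrightarrow> 0 \<le> k \<Longrightarrow> k \<le> 1 \<Longrightarrow> \<rho> \<le> k * cmod (seg (v j) (v (Suc j)) s) \<Longrightarrow> of_real k * seg (v j) (v (Suc j)) s \<in> U"
    and per1: "\<And>z. z \<in> U \<Longrightarrow> F (z - \<omega>1) = F z - \<eta>1" "\<And>z. z \<in> U \<Longrightarrow> F (z + \<omega>1) = F z + \<eta>1"
    and per2: "\<And>z. z \<in> U \<Longrightarrow> F (z - \<omega>2) = F z - \<eta>2" "\<And>z. z \<in> U \<Longrightarrow> F (z - (\<omega>2 - \<omega>1)) = F z - (\<eta>2 - \<eta>1)"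
    and perf: "\<And>z. z \<in> U \<Longrightarrow> f (z + \<omega>1) = f z" "\<And>z. z \<in> U \<Longrightarrow> f (z - \<omega>2) = f z" "\<And>z. z \<in> U \<Longrightarrow> f (z - (\<omega>2 - \<omega>1)) = f z"
  shows "Im (\<Sum>j<6. arc_energy F f \<rho> (v j) (v (Suc j))) \<le> 2 * Im (cnj \<eta>1 * \<eta>2)"
proof -
  have v3: "v 3 = - c" "v 4 = c - \<omega>2" "v 5 = \<omega>1 - c" "v 6 = c"
    using opp[of 0] opp[of 1] opp[of 2] opp[of 3] v0 by auto
  have segU: "closed_segment (v j) (v (Suc j)) \<subseteq> U" for j
  proof
    fix z assume "z \<in> closed_segment (v j) (v (Suc j))"
    then obtain s where s: "s \<in> {0..1}" "z = seg (v j) (v (Suc j)) s"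
      by (metis seg_linepath path_image_linepath path_image_def imageE)
    then show "z \<in> U" using inU[of s 1 j] far[of s j] by simp
  qed
  have vU: "v j \<in> U" for j using segU[of j] by auto
  have cf: "continuous_on (closed_segment (v j) (v (Suc j))) f" for j
    by (rule continuous_on_subset[OF holomorphic_on_imp_continuous_on[OF f] segU])
  have rev: "line_energy F f (v (Suc j) - \<omega>) (v j - \<omega>) = - line_energy F f (v j) (v (Suc j)) + cnj \<eta> * (F (v (Suc j)) - F (v j))"
    if "\<And>z. z \<in> U \<Longrightarrow> F (z - \<omega>) = F z - \<eta>" "\<And>z. z \<in> U \<Longrightarrow> f (z - \<omega>) = f z" for j \<omega> \<eta>
    by (rule line_energy_reverse_translate) (use that F cf segU in blast)+
  \<comment> \<open>Sides 0, 1, 2 are carried to sides 3, 4, 5 by subtracting \<omega>2, \<omega>2 -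
    \<omega>1 and - \<omega>1 respectively.\<close>
  define E where "E j = line_energy F f (v j) (v (Suc j))" for j
  have E3: "E 3 = - E 0 + cnj \<eta>2 * (F (v 1) - F (v 0))"
    using rev[OF per2(1) perf(2), of 0] by (simp add: E_def v0 v3 v0(2)[unfolded One_nat_def])
  have E4: "E 4 = - E 1 + cnj (\<eta>2 - \<eta>1) * (F (v 2) - F (v 1))"
    using rev[OF per2(2) perf(3), of 1] by (simp add: E_def v0 v3 v0(2)[unfolded One_nat_def] v0(3)[unfolded numeral_2_eq_2] numeral_2_eq_2[symmetric])
  have E5: "E 5 = - E 2 + cnj (- \<eta>1) * (F (v 3) - F (v 2))"
    using rev[of "- \<omega>1" "- \<eta>1" 2] per1(2) perf(1) by (simp add: E_def v0 v3)
  have "c - \<omega>1 \<in> U" "c \<in> U" "- c \<in> U" "\<omega>2 - c \<in> U" using vU[of 0] vU[of 1] vU[of 2] vU[of 3] v0 v3 by auto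
  then have F1: "F (v 1) = F (- c) + \<eta>2" "F (v 2) = F c - \<eta>1"
    using per1(1)[of c] per2(1)[of "\<omega>2 - c"] v0 by auto
  have "(\<Sum>j<6. E j) = E 0 + E 1 + E 2 + E 3 + E 4 + E 5" by (simp add: eval_nat_numeral)
  also have "\<dots> = cnj \<eta>1 * \<eta>2 - cnj (cnj \<eta>1 * \<eta>2)"
    unfolding E3 E4 E5 F1 v0(1) v3(1) by (simp add: algebra_simps)
  finally have sE: "Im (\<Sum>j<6. E j) = 2 * Im (cnj \<eta>1 * \<eta>2)" by simp
  have "ray_energy F f \<rho> (v (Suc j)) - ray_energy F f \<rho> (v j) \<le> Im (E j) - Im (arc_energy F f \<rho> (v j) (v (Suc j)))" for j
    unfolding E_def by (rule sector_inequality[OF U F f \<rho> far orient inU])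
  then have "(\<Sum>j<6. ray_energy F f \<rho> (v (Suc j)) - ray_energy F f \<rho> (v j)) \<le> (\<Sum>j<6. Im (E j) - Im (arc_energy F f \<rho> (v j) (v (Suc j))))"
    by (intro sum_mono)
  also have "(\<Sum>j<6. ray_energy F f \<rho> (v (Suc j)) - ray_energy F f \<rho> (v j)) = 0"
    by (subst sum_lessThan_telescope) (simp add: v0 v3)
  finally show ?thesis using sE by (simp add: sum_subtractf)
qed

lemma Im_cnj_combination:
  "Im (cnj (of_real a * \<omega>1 + of_real b * \<omega>2) * (of_real c * \<omega>1 + of_real d * \<omega>2)) = (a * d - b * c) * Im (cnj \<omega>1 * \<omega>2)"
  by (simp add: algebra_simps)

lemma real_combination_zero:
  assumes "Im (cnj \<omega>1 * \<omega>2) \<noteq> 0" "of_real a * \<omega>1 + of_real b * \<omega>2 = 0"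
  shows "a = 0" "b = 0"
proof -
  have "Im (cnj (of_real a * \<omega>1 + of_real b * \<omega>2) * (of_real 0 * \<omega>1 + of_real 1 * \<omega>2)) = 0"
    "Im (cnj (of_real a * \<omega>1 + of_real b * \<omega>2) * (of_real 1 * \<omega>1 + of_real 0 * \<omega>2)) = 0"
    using assms(2) by simp_all
  then show "a = 0" "b = 0" unfolding Im_cnj_combination using assms(1) by auto
qed

section \<open>Reduced bases and the Voronoi hexagon\<close>

context torus begin

lemma quasi_orient: "Im (cnj (quasi m1 n1) * quasi m2 n2) = of_int (n1 * m2 - m1 * n2) * (4 * pi\<^sup>2 * Im \<tau>)"
  by (simp add: quasi_def algebra_simps power2_eq_square)

lemma quasi_minus: "quasi (- m) (- n) = - quasi m n" by (simp add: quasi_def)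

lemma shortest_coprime:
  assumes "quasi m n \<noteq> 0" "cmod (quasi m n) = D" shows "coprime m n"
proof (rule ccontr)
  define g where "g = gcd m n"
  assume "\<not> coprime m n"
  then have g1: "g \<noteq> 1" by (simp add: g_def coprime_iff_gcd_eq_1)
  have "g \<noteq> 0" using assms(1) by (auto simp: g_def quasi_def)
  then have g: "g \<ge> 2" using g1 gcd_ge_0_int[of m n] unfolding g_def[symmetric] by linarith
  obtain m' n' where mn: "m = g * m'" "n = g * n'" by (metis dvdE g_def gcd_dvd1 gcd_dvd2)
  then have e: "quasi m n = of_int g * quasi m' n'" by (simp add: quasi_def algebra_simps)
  then have "quasi m' n' \<noteq> 0" using assms(1) by auto
  then have "D \<le> cmod (quasi m' n')" using D_le quasi_lattice by blast
  then have "2 * D \<le> of_int g * cmod (quasi m' n')" using g D_pos by (intro mult_mono) auto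
  then show False using e assms(2) g D_pos by (simp add: norm_mult)
qed

text \<open>Gauss reduction: a shortest vector is primitive, Bezout completes it to a basis, and
  rounding the projection of the second vector makes that projection at most half as long as the
  first. In the triangle spanned by the resulting pair no angle is obtuse.\<close>

lemma reduced_basis:
  obtains m1 n1 m2 n2 where "n1 * m2 - m1 * n2 = 1"
    "0 \<le> Re (cnj (quasi m1 n1) * quasi m2 n2)"
    "2 * Re (cnj (quasi m1 n1) * quasi m2 n2) \<le> (cmod (quasi m1 n1))\<^sup>2"
    "2 * Re (cnj (quasi m1 n1) * quasi m2 n2) \<le> (cmod (quasi m2 n2))\<^sup>2"
proof -
  obtain \<kappa> where k: "\<kappa> \<in> \<Lambda>" "\<kappa> \<noteq> 0" "cmod \<kappa> = D" by (rule min_norm_attained)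
  obtain m n where mn: "\<kappa> = quasi m n" by (rule lattice_quasi[OF k(1)])
  have "coprime m n" using shortest_coprime k mn by blast
  then obtain a b where ab: "a * m + b * n = 1" by (metis bezout_int coprime_iff_gcd_eq_1)
  define K where "K = (cmod \<kappa>)\<^sup>2"
  have K: "K > 0" using k D_pos by (simp add: K_def)
  define r where "r = Re (cnj \<kappa> * quasi b (- a)) / K"
  define j where "j = round r"
  define m' n' where "m' = b - j * m" and "n' = - a - j * n"
  have det: "n * m' - m * n' = 1" using ab by (simp add: m'_def n'_def algebra_simps)
  have q: "quasi m' n' = quasi b (- a) - of_int j * \<kappa>" by (simp add: m'_def n'_def mn quasi_def algebra_simps)
  define d where "d = Re (cnj \<kappa> * quasi m' n')"
  have "Re (cnj \<kappa> * \<kappa>) = K" unfolding K_def cmod_power2 by (simp add: power2_eq_square)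
  moreover have "Re (cnj \<kappa> * (quasi b (- a) - of_int j * \<kappa>)) = Re (cnj \<kappa> * quasi b (- a)) - of_int j * Re (cnj \<kappa> * \<kappa>)"
    by (simp add: algebra_simps)
  moreover have "Re (cnj \<kappa> * quasi b (- a)) = K * r" using K by (simp add: r_def)
  ultimately have "Re (cnj \<kappa> * (quasi b (- a) - of_int j * \<kappa>)) = K * (r - of_int j)"
    by (simp add: algebra_simps)
  then have d: "d = K * (r - of_int j)" by (simp add: d_def q)
  have "\<bar>r - of_int j\<bar> \<le> 1 / 2" using of_int_round_abs_le[of r] by (simp add: j_def abs_minus_commute)
  then have "K * \<bar>r - of_int j\<bar> \<le> K * (1 / 2)" using K by (intro mult_left_mono) auto
  then have dK: "2 * \<bar>d\<bar> \<le> K" using K by (simp add: d abs_mult)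
  have "quasi m' n' \<noteq> 0"
  proof
    assume "quasi m' n' = 0"
    then show False using quasi_orient[of m n m' n'] det Im_pos by simp
  qed
  then have "D \<le> cmod (quasi m' n')" using D_le quasi_lattice by blast
  then have "D\<^sup>2 \<le> (cmod (quasi m' n'))\<^sup>2" using D_pos by (intro power_mono) auto
  then have K': "K \<le> (cmod (quasi m' n'))\<^sup>2" using k by (simp add: K_def)
  show ?thesis
  proof (cases "0 \<le> d")
    case True
    have "2 * d \<le> K" "2 * d \<le> (cmod (quasi m' n'))\<^sup>2" using True dK K' by linarith+
    then show ?thesis by (intro that[of n m' m n']) (use det True in \<open>simp_all only: d_def K_def mn\<close>)
  next
    case False
    \<comment> \<open>For an obtuse pair the quarter turn of the basis, second vector first and then
      the negative of the shortest one, keeps the orientation and reverses the sign of the scalar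
      product.\<close>
    have e: "Re (cnj (quasi m' n') * quasi (- m) (- n)) = - d" by (simp add: quasi_minus d_def mn algebra_simps)
    have "2 * - d \<le> (cmod (quasi (- m) (- n)))\<^sup>2" "2 * - d \<le> (cmod (quasi m' n'))\<^sup>2"
      using dK K' unfolding K_def mn quasi_minus norm_minus_cancel by linarith+
    then show ?thesis
      by (intro that[of n' "- m" m' "- n"], unfold e) (use det False in \<open>simp_all add: algebra_simps\<close>)
  qed
qed

text \<open>The points \<open>v j\<close> are the vertices of the Voronoi cell of 0; \<open>c\<close> is the circumcentre of the
  triangle \<open>0, \<omega>1, \<omega>2\<close>. The cell contains the disc of radius \<open>D / 2\<close>.\<close>

lemma reduced_hexagon:
  assumes det: "n1 * m2 - m1 * n2 = 1" and w: "\<omega>1 = quasi m1 n1" "\<omega>2 = quasi m2 n2"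
    and red: "0 \<le> Re (cnj \<omega>1 * \<omega>2)" "2 * Re (cnj \<omega>1 * \<omega>2) \<le> (cmod \<omega>1)\<^sup>2" "2 * Re (cnj \<omega>1 * \<omega>2) \<le> (cmod \<omega>2)\<^sup>2"
  obtains v :: "nat \<Rightarrow> complex" and c where "\<And>j. v (j + 3) = - v j" "v 0 = c" "v 1 = \<omega>2 - c" "v 2 = c - \<omega>1"
    "\<And>j s. s \<in> {0..1} \<Longrightarrow> D / 2 \<le> cmod (seg (v j) (v (Suc j)) s)" "\<And>j. 0 \<le> Im (cnj (v j) * v (Suc j))"
    "\<And>j s k. s \<in> {0..1} \<Longrightarrow> 0 \<le> k \<Longrightarrow> k \<le> 1 \<Longrightarrow> 0 < k * cmod (seg (v j) (v (Suc j)) s) \<Longrightarrow> of_real k * seg (v j) (v (Suc j)) s \<notin> \<Lambda>"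
proof -
  define A B d J where "A = (cmod \<omega>1)\<^sup>2" and "B = (cmod \<omega>2)\<^sup>2" and "d = Re (cnj \<omega>1 * \<omega>2)" and "J = Im (cnj \<omega>1 * \<omega>2)"
  have J: "J > 0" using quasi_orient[of m1 n1 m2 n2] det Im_pos by (simp add: J_def w)
  have lag: "A * B - d * d = J * J"
    unfolding A_def B_def d_def J_def cmod_power2 by (simp add: algebra_simps power2_eq_square)
  have A: "A > 0" "B > 0" using J by (auto simp: A_def B_def J_def)
  have d: "0 \<le> d" "2 * d \<le> A" "2 * d \<le> B" using red by (auto simp: A_def B_def d_def)
  \<comment> \<open>Coordinates of the circumcentre: the solution of
    \<open>Re (cnj \<omega>1 * c) = A / 2\<close> and \<open>Re (cnj \<omega>2 * c) = B / 2\<close>,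
    whose Gram determinant is \<open>J * J\<close>. Reducedness makes both positive with sum at most
    1.\<close>
  define x y where "x = B * (A - d) / (2 * (J * J))" and "y = A * (B - d) / (2 * (J * J))"
  have JJ: "J * J > 0" using J by simp
  have x0: "0 < x" "0 < y" using A d JJ by (auto simp: x_def y_def intro!: divide_pos_pos mult_pos_pos)
  have xy: "x + y \<le> 1"
  proof -
    have "d * (2 * d) \<le> d * (A + B)" using d A by (intro mult_left_mono) auto
    then have "B * (A - d) + A * (B - d) \<le> 2 * (J * J)" unfolding lag[symmetric] by (simp add: algebra_simps)
    then show ?thesis using JJ by (simp add: x_def y_def add_divide_distrib[symmetric])
  qed
  define c where "c = of_real x * \<omega>1 + of_real y * \<omega>2"
  have q1: "Re (cnj \<omega>1 * c) = x * A + y * d" "Re (cnj \<omega>2 * c) = x * d + y * B"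
    unfolding A_def B_def d_def cmod_power2 c_def by (simp_all add: algebra_simps power2_eq_square)
  have "x * A + y * d = A * (A * B - d * d) / (2 * (J * J))" "x * d + y * B = B * (A * B - d * d) / (2 * (J * J))"
    by (simp_all add: x_def y_def add_divide_distrib[symmetric] algebra_simps)
  then have b1: "Re (cnj \<omega>1 * c) = A / 2" "Re (cnj \<omega>2 * c) = B / 2"
    using JJ q1 unfolding lag by auto
  \<comment> \<open>Both endpoints lie on the perpendicular bisector of 0 and the lattice point
    \<omega>. Coordinates of modulus below 1 in the reduced basis are recorded in order to exclude
    further lattice points.\<close>
  define good where "good p q \<omega> \<longleftrightarrow> \<omega> \<in> \<Lambda> \<and> \<omega> \<noteq> 0 \<and> Re (cnj \<omega> * p) = (cmod \<omega>)\<^sup>2 / 2 \<and> Re (cnj \<omega> * q) = (cmod \<omega>)\<^sup>2 / 2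
     \<and> 0 \<le> Im (cnj p * q)
     \<and> (\<exists>X Y X' Y'. p = of_real X * \<omega>1 + of_real Y * \<omega>2 \<and> q = of_real X' * \<omega>1 + of_real Y' * \<omega>2 \<and> \<bar>X\<bar> < 1 \<and> \<bar>Y\<bar> < 1 \<and> \<bar>X'\<bar> < 1 \<and> \<bar>Y'\<bar> < 1)"
    for p q \<omega>
  have good_neg: "good (- p) (- q) (- \<omega>)" if gd: "good p q \<omega>" for p q \<omega>
  proof -
    obtain X Y X' Y' where "p = of_real X * \<omega>1 + of_real Y * \<omega>2" "q = of_real X' * \<omega>1 + of_real Y' * \<omega>2" "\<bar>X\<bar> < 1" "\<bar>Y\<bar> < 1" "\<bar>X'\<bar> < 1" "\<bar>Y'\<bar> < 1"
      using gd unfolding good_def by blast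
    then have "\<exists>X Y X' Y'. - p = of_real X * \<omega>1 + of_real Y * \<omega>2 \<and> - q = of_real X' * \<omega>1 + of_real Y' * \<omega>2 \<and> \<bar>X\<bar> < 1 \<and> \<bar>Y\<bar> < 1 \<and> \<bar>X'\<bar> < 1 \<and> \<bar>Y'\<bar> < 1"
      by (intro exI[of _ "- X"] exI[of _ "- Y"] exI[of _ "- X'"] exI[of _ "- Y'"]) simp
    then show ?thesis using gd torus_lattice_uminus[of \<omega> \<tau>] unfolding good_def by simp
  qed
  have p0: "c = of_real x * \<omega>1 + of_real y * \<omega>2" "\<omega>2 - c = of_real (- x) * \<omega>1 + of_real (1 - y) * \<omega>2"
    "c - \<omega>1 = of_real (x - 1) * \<omega>1 + of_real y * \<omega>2" "- c = of_real (- x) * \<omega>1 + of_real (- y) * \<omega>2"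
    by (simp_all add: c_def algebra_simps)
  have abs: "\<bar>x\<bar> < 1" "\<bar>y\<bar> < 1" "\<bar>- x\<bar> < 1" "\<bar>- y\<bar> < 1" "\<bar>1 - y\<bar> < 1" "\<bar>x - 1\<bar> < 1" using x0 xy by auto
  have L: "\<omega>1 \<in> \<Lambda>" "\<omega>2 \<in> \<Lambda>" "\<omega>2 - \<omega>1 \<in> \<Lambda>" using w quasi_lattice torus_lattice_diff by auto
  have nz: "\<omega>1 \<noteq> 0" "\<omega>2 \<noteq> 0" "\<omega>2 - \<omega>1 \<noteq> 0" using J by (auto simp: J_def)
  have Jxy: "J * x + J * y \<le> J" using mult_left_mono[OF xy, of J] J by (simp add: algebra_simps)
  have o: "0 \<le> Im (cnj c * (\<omega>2 - c))" "0 \<le> Im (cnj (\<omega>2 - c) * (c - \<omega>1))" "0 \<le> Im (cnj (c - \<omega>1) * (- c))"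
    unfolding p0(2-4) by (simp_all only: p0(1) Im_cnj_combination J_def[symmetric])
      (use J x0 Jxy in \<open>auto intro!: mult_nonneg_nonneg simp: algebra_simps\<close>)
  have sq: "Re (cnj \<omega> * \<omega>) = (cmod \<omega>)\<^sup>2" for \<omega> unfolding cmod_power2 by (simp add: power2_eq_square)
  have d': "Re (cnj \<omega>2 * \<omega>1) = d" by (simp add: d_def algebra_simps)
  have C: "(cmod (\<omega>2 - \<omega>1))\<^sup>2 = A + B - 2 * d"
    unfolding A_def B_def d_def cmod_power2 by (simp add: algebra_simps power2_eq_square)
  have goodI: "good p q \<omega>" if "\<omega> \<in> \<Lambda>" "\<omega> \<noteq> 0" "Re (cnj \<omega> * p) = (cmod \<omega>)\<^sup>2 / 2" "Re (cnj \<omega> * q) = (cmod \<omega>)\<^sup>2 / 2"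
    "0 \<le> Im (cnj p * q)" "p = of_real X * \<omega>1 + of_real Y * \<omega>2" "q = of_real X' * \<omega>1 + of_real Y' * \<omega>2"
    "\<bar>X\<bar> < 1" "\<bar>Y\<bar> < 1" "\<bar>X'\<bar> < 1" "\<bar>Y'\<bar> < 1" for p q \<omega> X Y X' Y'
    unfolding good_def using that by blast
  have dist: "Re (cnj \<omega> * (p - q)) = Re (cnj \<omega> * p) - Re (cnj \<omega> * q)" "Re (cnj (\<omega> - p) * q) = Re (cnj \<omega> * q) - Re (cnj p * q)" for \<omega> p q
    by (simp_all add: algebra_simps)
  have g1: "good c (\<omega>2 - c) \<omega>2"
    by (rule goodI[OF L(2) nz(2) _ _ o(1) p0(1,2) abs(1,2,3,5)], unfold dist sq b1) (simp_all add: B_def)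
  have g2: "good (\<omega>2 - c) (c - \<omega>1) (\<omega>2 - \<omega>1)"
    by (rule goodI[OF L(3) nz(3) _ _ o(2) p0(2,3) abs(3,5,6,2)], unfold C dist sq b1 d' d_def[symmetric]) (simp_all add: A_def B_def)
  have neg: "Re (cnj (- \<omega>) * p) = - Re (cnj \<omega> * p)" "Re (cnj \<omega> * - p) = - Re (cnj \<omega> * p)" for \<omega> p by simp_all
  have "Re (cnj (- \<omega>1) * (c - \<omega>1)) = (cmod (- \<omega>1))\<^sup>2 / 2" "Re (cnj (- \<omega>1) * - c) = (cmod (- \<omega>1))\<^sup>2 / 2"
    unfolding neg dist sq b1 norm_minus_cancel by (simp_all add: A_def)
  then have g3: "good (c - \<omega>1) (- c) (- \<omega>1)"
    using nz(1) by (intro goodI[OF torus_lattice_uminus[OF L(1)] _ _ _ o(3) p0(3,4) abs(6,2,3,4)]) simp_all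
  define a where "a = (\<lambda>r::nat. if r = 0 then c else if r = 1 then \<omega>2 - c else c - \<omega>1)"
  define v where "v j = (-1) ^ (j div 3) * a (j mod 3)" for j
  have opp: "v (j + 3) = - v j" for j by (simp add: v_def)
  have v0: "v 0 = c" "v 1 = \<omega>2 - c" "v 2 = c - \<omega>1" by (simp_all add: v_def a_def)
  have gv: "\<exists>\<omega>. good (v j) (v (Suc j)) \<omega>" for j
  proof (induction j rule: less_induct)
    case (less j)
    have v3: "v 3 = - c" using opp[of 0] v0 by simp
    consider "j = 0" | "j = 1" | "j = 2" | i where "j = i + 3" by (metis One_nat_def Suc_1 add.commute add_2_eq_Suc' le_Suc_ex less_2_cases linorder_not_less numeral_3_eq_3 not_less_eq less_antisym)
    then show ?case
    proof cases
      case 1 then show ?thesis using g1 v0 by auto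
    next
      case 2 then show ?thesis using g2 v0 by (auto simp: numeral_2_eq_2[symmetric])
    next
      case 3 then show ?thesis using g3 v0 v3 by (auto simp: numeral_3_eq_3[symmetric])
    next
      case 4
      have "i < j" using 4 by simp
      from less.IH[OF this] obtain \<omega> where "good (v i) (v (Suc i)) \<omega>" by blast
      then show ?thesis using good_neg opp[of i] opp[of "Suc i"] 4 by auto
    qed
  qed
  show ?thesis
  proof (rule that[of v c])
    fix j and s :: real assume s: "s \<in> {0..1}"
    obtain \<omega> where g: "good (v j) (v (Suc j)) \<omega>" using gv by blast
    \<comment> \<open>The whole edge lies on the bisector, whose distance from 0 is half of
      \<open>cmod \<omega>\<close> and hence at least D / 2.\<close>
    have "Re (cnj \<omega> * seg (v j) (v (Suc j)) s) = (1 - s) * Re (cnj \<omega> * v j) + s * Re (cnj \<omega> * v (Suc j))"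
      by (simp add: seg_def algebra_simps)
    also have "\<dots> = (cmod \<omega>)\<^sup>2 / 2"
    proof -
      have "Re (cnj \<omega> * v j) = (cmod \<omega>)\<^sup>2 / 2" "Re (cnj \<omega> * v (Suc j)) = (cmod \<omega>)\<^sup>2 / 2"
        using g unfolding good_def by blast+
      moreover have "(1 - s) * X + s * X = X" for X :: real by (simp add: algebra_simps)
      ultimately show ?thesis by (simp only:)
    qed
    finally have "(cmod \<omega>)\<^sup>2 / 2 \<le> cmod (cnj \<omega> * seg (v j) (v (Suc j)) s)" by (metis complex_Re_le_cmod)
    then have "cmod \<omega> * (cmod \<omega> / 2) \<le> cmod \<omega> * cmod (seg (v j) (v (Suc j)) s)" by (simp add: norm_mult power2_eq_square)
    then have "cmod \<omega> / 2 \<le> cmod (seg (v j) (v (Suc j)) s)" using g by (simp add: good_def)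
    moreover have "D \<le> cmod \<omega>" using g D_le by (simp add: good_def)
    ultimately show "D / 2 \<le> cmod (seg (v j) (v (Suc j)) s)" by linarith
    fix k :: real assume k: "0 \<le> k" "k \<le> 1" "0 < k * cmod (seg (v j) (v (Suc j)) s)"
    show "of_real k * seg (v j) (v (Suc j)) s \<notin> \<Lambda>"
    proof
      assume z: "of_real k * seg (v j) (v (Suc j)) s \<in> \<Lambda>"
      obtain X Y X' Y' where XY: "v j = of_real X * \<omega>1 + of_real Y * \<omega>2" "v (Suc j) = of_real X' * \<omega>1 + of_real Y' * \<omega>2"
          "\<bar>X\<bar> < 1" "\<bar>Y\<bar> < 1" "\<bar>X'\<bar> < 1" "\<bar>Y'\<bar> < 1" using g unfolding good_def by blast
      obtain m n where mn: "of_real k * seg (v j) (v (Suc j)) s = quasi m n" by (rule lattice_quasi[OF z])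
      \<comment> \<open>The integral coordinates of the point in the reduced basis, by Cramer's rule
        with determinant 1. Being of modulus less than 1 they vanish.\<close>
      define \<alpha> \<beta> where "\<alpha> = n * m2 - m * n2" and "\<beta> = m * n1 - n * m1"
      have "\<alpha> * m1 + \<beta> * m2 = m * (n1 * m2 - m1 * n2)" "\<alpha> * n1 + \<beta> * n2 = n * (n1 * m2 - m1 * n2)"
        by (simp_all add: \<alpha>_def \<beta>_def algebra_simps)
      then have ab: "\<alpha> * m1 + \<beta> * m2 = m" "\<alpha> * n1 + \<beta> * n2 = n" using det by auto
      have "quasi m n = of_int \<alpha> * \<omega>1 + of_int \<beta> * \<omega>2"
        unfolding w quasi_def ab[symmetric] by (simp add: algebra_simps)
      then have lin: "of_real (k * ((1 - s) * X + s * X') - of_int \<alpha>) * \<omega>1 + of_real (k * ((1 - s) * Y + s * Y') - of_int \<beta>) * \<omega>2 = 0"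
        using mn unfolding seg_def XY by (simp add: algebra_simps)
      then have e: "k * ((1 - s) * X + s * X') = of_int \<alpha>" "k * ((1 - s) * Y + s * Y') = of_int \<beta>"
        using real_combination_zero[OF _ lin] J J_def by linarith+
      have conv: "\<bar>k * ((1 - s) * P + s * Q)\<bar> < 1" if "\<bar>P\<bar> < 1" "\<bar>Q\<bar> < 1" for P Q :: real
      proof -
        have "\<bar>(1 - s) * P + s * Q\<bar> \<le> (1 - s) * \<bar>P\<bar> + s * \<bar>Q\<bar>"
          using s by (intro order_trans[OF abs_triangle_ineq]) (simp add: abs_mult)
        also have "\<dots> \<le> (1 - s) * max \<bar>P\<bar> \<bar>Q\<bar> + s * max \<bar>P\<bar> \<bar>Q\<bar>" using s by (intro add_mono mult_left_mono) auto
        also have "\<dots> = max \<bar>P\<bar> \<bar>Q\<bar>" by (simp add: algebra_simps)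
        finally have "\<bar>(1 - s) * P + s * Q\<bar> < 1" using that by linarith
        moreover have "\<bar>k * ((1 - s) * P + s * Q)\<bar> \<le> 1 * \<bar>(1 - s) * P + s * Q\<bar>"
          unfolding abs_mult[of k] using k by (intro mult_right_mono) auto
        ultimately show ?thesis by (simp only: mult_1)
      qed
      have "\<bar>of_int \<alpha> :: real\<bar> < 1" "\<bar>of_int \<beta> :: real\<bar> < 1" using conv XY e by metis+
      then have "\<alpha> = 0" "\<beta> = 0" by linarith+
      then have "quasi m n = 0" using ab by (simp add: quasi_def)
      then show False using mn k by (metis norm_mult norm_of_real norm_zero abs_of_nonneg order_less_irrefl)
    qed
  next
    show "0 \<le> Im (cnj (v j) * v (Suc j))" for j using gv[of j] by (auto simp: good_def)
  qed (use opp v0 in auto)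
qed

end

section \<open>The area inequality on one torus\<close>

lemma powser_partial_sums_uniform:
  assumes f: "f holomorphic_on ball 0 R" and \<rho>: "0 \<le> \<rho>" "\<rho> < R"
  shows "uniform_limit (cball 0 \<rho>) (\<lambda>M z. \<Sum>n<M. (deriv ^^ n) f 0 / fact n * z ^ n) f sequentially"
proof -
  obtain R' where R': "\<rho> < R'" "R' < R" using \<rho>(2) dense by blast
  have sums: "(\<lambda>n. (deriv ^^ n) f 0 / fact n * z ^ n) sums f z" if "cmod z < R" for z
    using holomorphic_power_series[OF f, of z] that by simp
  have "ereal (norm (of_real R' :: complex)) \<le> conv_radius (\<lambda>n. (deriv ^^ n) f 0 / fact n)"
    by (rule conv_radius_geI) (use sums[of "of_real R'"] R' \<rho> sums_summable in auto)
  then have "ereal \<rho> < conv_radius (\<lambda>n. (deriv ^^ n) f 0 / fact n)"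
    using R' \<rho> by (simp add: order.strict_trans2[of "ereal \<rho>" "ereal R'"])
  from powser_uniform_limit[OF this, of 0]
  show ?thesis
    by (rule uniform_limit_cong'[THEN iffD1, rotated 2]) (use sums \<rho> in \<open>auto simp: sums_iff\<close>)
qed

lemma arc_energy_limit:
  assumes nz: "\<And>s. s \<in> {0..1} \<Longrightarrow> seg p q s \<noteq> 0" and \<rho>: "0 < \<rho>"
    and L: "uniform_limit (sphere 0 \<rho>) L F sequentially" and L': "uniform_limit (sphere 0 \<rho>) L' f sequentially"
    and cL: "\<And>M. continuous_on (sphere 0 \<rho>) (L M)" "\<And>M. continuous_on (sphere 0 \<rho>) (L' M)"
  shows "(\<lambda>M. arc_energy (L M) (L' M) \<rho> p q) \<longlonglongrightarrow> arc_energy F f \<rho> p q"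
proof -
  have cF: "continuous_on (sphere 0 \<rho>) F" "continuous_on (sphere 0 \<rho>) f"
    using uniform_limit_theorem[OF always_eventually L] uniform_limit_theorem[OF always_eventually L'] cL by auto
  have arcs: "radial_arc \<rho> p q s \<in> sphere 0 \<rho>" if "s \<in> {0..1}" for s using radial_arc_norm[OF nz[OF that] \<rho>] by simp
  note ca = arc_continuous[OF nz, of "{0..1}" \<rho>]
  have co: "continuous_on {0..1} (\<lambda>s. h (radial_arc \<rho> p q s))" if "continuous_on (sphere 0 \<rho>) h" for h :: "complex \<Rightarrow> complex"
    by (rule continuous_on_compose2[OF that ca(3)]) (use arcs in auto)
  have bd: "bounded (h ` {0..1})" if "continuous_on {0..1} h" for h :: "real \<Rightarrow> complex"
    using compact_imp_bounded[OF compact_continuous_image[OF that]] by simp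
  have ul: "uniform_limit {0..1} (\<lambda>M s. K M (radial_arc \<rho> p q s)) (\<lambda>s. k (radial_arc \<rho> p q s)) sequentially"
    if "uniform_limit (sphere 0 \<rho>) K k sequentially" for K k
    using that arcs unfolding uniform_limit_iff by (fast elim: eventually_mono)
  have ulc: "uniform_limit {0..1} (\<lambda>M s. cnj (L M (radial_arc \<rho> p q s))) (\<lambda>s. cnj (F (radial_arc \<rho> p q s))) sequentially"
    using ul[OF L] unfolding uniform_limit_iff by (simp add: dist_norm flip: complex_cnj_diff)
  have "uniform_limit {0..1} (\<lambda>M s. cnj (L M (radial_arc \<rho> p q s)) * L' M (radial_arc \<rho> p q s) * radial_arc' \<rho> p q s)
      (\<lambda>s. cnj (F (radial_arc \<rho> p q s)) * f (radial_arc \<rho> p q s) * radial_arc' \<rho> p q s) sequentially"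
    by (intro uniform_lim_mult ulc ul[OF L'] uniform_limit_const bd continuous_intros co cF ca nz)
  then obtain I J where I: "\<And>M. ((\<lambda>s. cnj (L M (radial_arc \<rho> p q s)) * L' M (radial_arc \<rho> p q s) * radial_arc' \<rho> p q s) has_integral I M) {0..1}"
      "((\<lambda>s. cnj (F (radial_arc \<rho> p q s)) * f (radial_arc \<rho> p q s) * radial_arc' \<rho> p q s) has_integral J) {0..1}" "I \<longlonglongrightarrow> J"
    by (rule uniform_limit_integral) (auto intro!: continuous_intros co cL ca nz)
  then show ?thesis unfolding arc_energy_def by (simp add: integral_unique[OF I(1)] integral_unique[OF I(2)])
qed

context torus begin

text \<open>The coefficient of z^(l-1) at 0 in the regular part of \<open>tform a v\<close>; the
  shift matches the index l with the power z^l of the primitive.\<close>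

definition "regular_coeff a v l = (if l = 1 then a else 0) + (\<Sum>\<^sub>\<infinity>k\<in>{1..}. v k * (torus_coeff k l \<tau> / of_nat k))"

lemma decays_finite:
  assumes "\<And>k. N < k \<Longrightarrow> v k = 0" shows "decays \<delta> v"
  unfolding decays_def
proof (intro allI impI)
  fix d
  have "finite {k. cmod (v k) / d ^ k \<noteq> 0}"
    by (rule finite_subset[of _ "{..N}"]) (use assms not_le in auto)
  then show "(\<lambda>k. cmod (v k) / d ^ k) summable_on UNIV" by (intro finite_nonzero_values_imp_summable_on) simp
qed

lemma tform_regular_part:
  assumes v: "decays \<delta> v" "0 \<le> \<delta>" "\<delta> < D" "v 0 = 0" and l: "1 \<le> l"
  shows "(deriv ^^ (l - 1)) (\<lambda>z. a + dseries v zeta_reg z) 0 / fact (l - 1) = regular_coeff a v l"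
proof -
  have h: "dseries v zeta_reg holomorphic_on ball 0 (D - \<delta>)" by (rule dseries_zeta_reg_holomorphic[OF v(1,2)]) simp
  have "(deriv ^^ (l - 1)) (\<lambda>z. a + dseries v zeta_reg z) 0 = (deriv ^^ (l - 1)) (\<lambda>z. a) 0 + (deriv ^^ (l - 1)) (dseries v zeta_reg) 0"
    by (rule higher_deriv_add[OF _ h]) (use v in auto)
  then show ?thesis using dseries_zeta_reg_coeff(1)[OF v(1-3) l v(4)] l
    by (auto simp: regular_coeff_def add_divide_distrib)
qed

text \<open>The integral of \<open>cnj F * f\<close> over the boundary of the hexagon minus the disc
  is 2 \<i> times a nonnegative area. The outer boundary gives the periods. On the circle each
  Laurent term of the primitive contributes n |b n|^2 \<rho>^(2n) up to the common factor 2 pi \<i>,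
  positive for the regular and negative for the principal part.\<close>

lemma area_inequality_finite:
  assumes v0: "v 0 = 0" and vN: "\<And>k. N < k \<Longrightarrow> v k = 0" and \<rho>: "0 < \<rho>" "\<rho> < D / 2"
  shows "pi * ((\<Sum>l=1..M. (cmod (regular_coeff a v l))\<^sup>2 * \<rho> ^ (2 * l) / l) - (\<Sum>k=1..N. (cmod (v k))\<^sup>2 / (k * \<rho> ^ (2 * k))))
    \<le> Im (cnj (2 * pi * \<i> * a) * (2 * pi * \<i> * \<tau> * a + v 1))"
proof -
  define F where "F = tprim a v"
  define f where "f = tform a v"
  have dec: "decays 0 v" by (rule decays_finite[OF vN])
  define w where "w = antideriv_coeffs v"
  have dw: "decays 0 w" unfolding w_def by (rule decays_antideriv_coeffs[OF dec]) simp
  have pL: "punctured 0 = - \<Lambda>" by (auto simp: punctured_def)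
  have Fd: "(F has_field_derivative f z) (at z)" if "z \<in> - \<Lambda>" for z
    unfolding F_def f_def by (rule tprim_derivative[OF dec _ v0]) (use that pL in auto)
  have fh: "f holomorphic_on - \<Lambda>" unfolding f_def using tform_holomorphic[OF dec, of a] pL by simp
  \<comment> \<open>The periods of the form along the two generators; all other quasi-periods of F
    are integral combinations of them.\<close>
  define P Q where "P = 2 * pi * \<i> * \<tau> * a + v 1" and "Q = 2 * pi * \<i> * a"
  have per: "F (z + quasi m n) = F z + (of_int m * P + of_int n * Q)" if "z \<in> - \<Lambda>" for z m n
    unfolding F_def using tprim_quasi[OF dec, of z a m n] that pL by (simp add: P_def Q_def quasi_def algebra_simps)
  have perf: "f (z + \<omega>) = f z" if "z \<in> - \<Lambda>" "\<omega> \<in> \<Lambda>" for z \<omega>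
    unfolding f_def using tform_quasi[OF dec _ v0, of z \<omega> a] that pL by simp
  obtain m1 n1 m2 n2 where det: "n1 * m2 - m1 * n2 = 1"
    and red: "0 \<le> Re (cnj (quasi m1 n1) * quasi m2 n2)"
    "2 * Re (cnj (quasi m1 n1) * quasi m2 n2) \<le> (cmod (quasi m1 n1))\<^sup>2"
    "2 * Re (cnj (quasi m1 n1) * quasi m2 n2) \<le> (cmod (quasi m2 n2))\<^sup>2"
    by (rule reduced_basis)
  obtain u :: "nat \<Rightarrow> complex" and c where opp: "\<And>j. u (j + 3) = - u j" and u0: "u 0 = c" "u 1 = quasi m2 n2 - c" "u 2 = c - quasi m1 n1"
    and far: "\<And>j s. s \<in> {0..1} \<Longrightarrow> D / 2 \<le> cmod (seg (u j) (u (Suc j)) s)" and orient: "\<And>j. 0 \<le> Im (cnj (u j) * u (Suc j))"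
    and inU: "\<And>j s k. s \<in> {0..1} \<Longrightarrow> 0 \<le> k \<Longrightarrow> k \<le> 1 \<Longrightarrow> 0 < k * cmod (seg (u j) (u (Suc j)) s) \<Longrightarrow> of_real k * seg (u j) (u (Suc j)) s \<notin> \<Lambda>"
    by (rule reduced_hexagon[OF det refl refl red]) (rule that)
  have nz: "seg (u j) (u (Suc j)) s \<noteq> 0" if "s \<in> {0..1}" for j s using far[OF that, of j] D_pos by auto
  define \<eta>1 \<eta>2 where "\<eta>1 = of_int m1 * P + of_int n1 * Q" and "\<eta>2 = of_int m2 * P + of_int n2 * Q"

  have q21: "quasi m2 n2 - quasi m1 n1 = quasi (m2 - m1) (n2 - n1)" by (simp add: quasi_def algebra_simps)
  have "Im (\<Sum>j<6. arc_energy F f \<rho> (u j) (u (Suc j))) \<le> 2 * Im (cnj \<eta>1 * \<eta>2)"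
  proof (rule hexagon_area[OF opp u0 open_minus_lattice Fd fh \<rho>(1) _ orient])
    show "\<rho> \<le> cmod (seg (u j) (u (Suc j)) s)" if "s \<in> {0..1}" for j s using far[OF that, of j] \<rho> by simp
    show "of_real k * seg (u j) (u (Suc j)) s \<in> - \<Lambda>" if "s \<in> {0..1}" "0 \<le> k" "k \<le> 1" "\<rho> \<le> k * cmod (seg (u j) (u (Suc j)) s)" for j s k
      using inU[OF that(1-3), of j] that(4) \<rho> by auto
    fix z assume z: "z \<in> - \<Lambda>"
    show "F (z - quasi m1 n1) = F z - \<eta>1" "F (z + quasi m1 n1) = F z + \<eta>1" "F (z - quasi m2 n2) = F z - \<eta>2"
      "F (z - (quasi m2 n2 - quasi m1 n1)) = F z - (\<eta>2 - \<eta>1)"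
    proof -
      have m: "F (z - quasi m n) = F z - (of_int m * P + of_int n * Q)" for m n
        using per[OF z, of "- m" "- n"] by (simp add: quasi_minus algebra_simps)
      show "F (z - quasi m1 n1) = F z - \<eta>1" "F (z + quasi m1 n1) = F z + \<eta>1" "F (z - quasi m2 n2) = F z - \<eta>2"
        "F (z - (quasi m2 n2 - quasi m1 n1)) = F z - (\<eta>2 - \<eta>1)"
        unfolding q21 m per[OF z] by (simp_all add: \<eta>1_def \<eta>2_def algebra_simps)
    qed
    show "f (z + quasi m1 n1) = f z" "f (z - quasi m2 n2) = f z" "f (z - (quasi m2 n2 - quasi m1 n1)) = f z"
    proof -
      have m: "f (z - quasi m n) = f z" for m n
        using perf[OF z quasi_lattice, of "- m" "- n"] by (simp add: quasi_minus)
      show "f (z + quasi m1 n1) = f z" "f (z - quasi m2 n2) = f z" "f (z - (quasi m2 n2 - quasi m1 n1)) = f z"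
        unfolding q21 m by (simp_all add: perf[OF z quasi_lattice])
    qed
  qed
  also have "Im (cnj \<eta>1 * \<eta>2) = of_int (n1 * m2 - m1 * n2) * Im (cnj Q * P)"
    by (simp add: \<eta>1_def \<eta>2_def algebra_simps)
  finally have le: "Im (\<Sum>j<6. arc_energy F f \<rho> (u j) (u (Suc j))) \<le> 2 * Im (cnj Q * P)" by (simp add: det)
  define \<alpha> where "\<alpha> = regular_coeff a v"
  define R where "R z = a * z + dseries w zeta_reg z" for z
  define R' where "R' z = a + dseries v zeta_reg z" for z
  have Rh: "R holomorphic_on ball 0 D" "R' holomorphic_on ball 0 D"
    unfolding R_def R'_def by (intro holomorphic_intros dseries_zeta_reg_holomorphic[where \<delta>=0] dw dec; simp)+
  have RR': "(R has_field_derivative R' z) (at z)" if "z \<in> ball 0 D" for z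
  proof -
    have "(dseries w zeta_reg has_field_derivative dseries w (deriv zeta_reg) z) (at z)"
      by (rule dseries_has_field_derivative[OF open_minus_lattice_0 zeta_reg_holomorphic dw]) (use cball_near_0[of z 0] that in auto)
    then show ?thesis unfolding R_def[abs_def] R'_def w_def dseries_antideriv[of v zeta_reg z, OF v0]
      by (auto intro!: derivative_eq_intros)
  qed
  have R'c: "(deriv ^^ n) R' 0 / fact n = \<alpha> (Suc n)" for n
    using tform_regular_part[OF dec _ D_pos v0, of "Suc n" a] by (simp add: \<alpha>_def R'_def[abs_def])
  have Rc: "(deriv ^^ Suc n) R 0 / fact (Suc n) = \<alpha> (Suc n) / of_nat (Suc n)" for n
  proof -
    have "(deriv ^^ n) (deriv R) 0 = (deriv ^^ n) R' 0"
      by (rule higher_deriv_transform_within_open[OF holomorphic_deriv[OF Rh(1)] Rh(2)])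
         (use RR' D_pos in \<open>auto intro: DERIV_imp_deriv\<close>)
    then have "(deriv ^^ Suc n) R 0 = (deriv ^^ n) R' 0" by (simp add: funpow_swap1)
    then show ?thesis using R'c[of n] by (simp add: field_simps del: of_nat_Suc)
  qed
  \<comment> \<open>Laurent coefficients of the primitive F. The constant term is irrelevant to the
    energy, where it is weighted by n = 0.\<close>
  define b where "b n = (if n > 0 then \<alpha> (nat n) / of_int n else if n = 0 then R 0 else v (nat (- n)) / of_int n)" for n :: int
  define S where "S M = {- int N..int M}" for M
  define L where "L M z = (\<Sum>n\<in>S M. b n * z powi n)" for M z
  define L' where "L' M z = (\<Sum>n\<in>S M. of_int n * b n * z powi (n - 1))" for M z
  have fin: "finite (S M)" for M by (simp add: S_def)
  have split: "(\<Sum>n\<in>S M. g n) = (\<Sum>n<Suc M. g (int n)) + (\<Sum>k=1..N. g (- int k))" for g :: "int \<Rightarrow> 'x::comm_monoid_add" and M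
  proof -
    have "S M = int ` {..<Suc M} \<union> (\<lambda>k. - int k) ` {1..N}"
    proof
      show "S M \<subseteq> int ` {..<Suc M} \<union> (\<lambda>k. - int k) ` {1..N}"
      proof
        fix n assume n: "n \<in> S M"
        show "n \<in> int ` {..<Suc M} \<union> (\<lambda>k. - int k) ` {1..N}"
        proof (cases "n \<ge> 0")
          case True then show ?thesis using n by (intro UnI1 image_eqI[of _ _ "nat n"]) (auto simp: S_def)
        next
          case False then show ?thesis using n by (intro UnI2 image_eqI[of _ _ "nat (- n)"]) (auto simp: S_def)
        qed
      qed
    qed (auto simp: S_def)
    also have "sum g \<dots> = sum g (int ` {..<Suc M}) + sum g ((\<lambda>k. - int k) ` {1..N})"
      by (rule sum.union_disjoint) auto
    also have "sum g (int ` {..<Suc M}) = (\<Sum>n<Suc M. g (int n))" by (subst sum.reindex) (auto simp: inj_on_def)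
    also have "sum g ((\<lambda>k. - int k) ` {1..N}) = (\<Sum>k=1..N. g (- int k))" by (subst sum.reindex) (auto simp: inj_on_def)
    finally show ?thesis .
  qed
  have near: "0 < cmod z" "cmod z + 0 < D" "z \<in> - \<Lambda>" "z \<noteq> 0" if "z \<in> sphere 0 \<rho>" for z
    using that \<rho> D_le[of z] by auto
  define PP where "PP z = (\<Sum>k=1..N. - v k / of_nat k * z powi (- int k))" for z
  define PP' where "PP' z = (\<Sum>k=1..N. v k * z powi (- int k - 1))" for z
  have principal: "(\<Sum>\<^sub>\<infinity>k. x k / z ^ Suc k) = (\<Sum>k<K. x k / z ^ Suc k)" if "\<And>k. K \<le> k \<Longrightarrow> x k = 0" for x :: "nat \<Rightarrow> complex" and K z
    by (subst infsum_cong_neutral[where T="{..<K}" and g="\<lambda>k. x k / z ^ Suc k"]) (use that in auto)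
  have pw: "z powi (- int k) = 1 / z ^ k" for z :: complex and k by (simp add: power_int_minus divide_inverse)
  have pw': "z powi (- int k - 1) = 1 / z ^ Suc k" for z :: complex and k
  proof -
    have "- int k - 1 = - int (Suc k)" by simp
    then show ?thesis using pw[of z "Suc k"] by (simp only:)
  qed
  have Feq: "F z = R z + PP z" if "z \<in> sphere 0 \<rho>" for z
  proof -
    have "dseries w zeta z = dseries w zeta_reg z + (\<Sum>\<^sub>\<infinity>k. w k / z ^ Suc k)"
      by (rule dseries_zeta_split[OF dw]) (use near[OF that] in auto)
    also have "(\<Sum>\<^sub>\<infinity>k. w k / z ^ Suc k) = (\<Sum>k<N. w k / z ^ Suc k)"
      by (rule principal) (use vN in \<open>auto simp: w_def antideriv_coeffs_def\<close>)
    also have "\<dots> = (\<Sum>k=1..N. w (k - 1) / z ^ k)"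
      by (rule sum.reindex_bij_witness[of _ "\<lambda>k. k - 1" Suc]) auto
    also have "\<dots> = PP z" unfolding PP_def pw
      by (rule sum.cong) (auto simp: w_def antideriv_coeffs_def)
    finally show ?thesis by (simp add: F_def tprim_def R_def w_def)
  qed
  have feq: "f z = R' z + PP' z" if "z \<in> sphere 0 \<rho>" for z
  proof -
    have "dseries v zeta z = dseries v zeta_reg z + (\<Sum>\<^sub>\<infinity>k. v k / z ^ Suc k)"
      by (rule dseries_zeta_split[OF dec]) (use near[OF that] in auto)
    also have "(\<Sum>\<^sub>\<infinity>k. v k / z ^ Suc k) = (\<Sum>k<Suc N. v k / z ^ Suc k)"
      by (rule principal) (use vN in auto)
    also have "\<dots> = (\<Sum>k=1..N. v k / z ^ Suc k)"
      by (rule sum.mono_neutral_right) (auto simp: v0 not_less_eq_eq)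
    also have "\<dots> = PP' z" unfolding PP'_def pw' by simp
    finally show ?thesis by (simp add: f_def tform_def R'_def)
  qed
  have LM: "L M z = (\<Sum>n<Suc M. (deriv ^^ n) R 0 / fact n * z ^ n) + PP z" for M z
  proof -
    have "b (int n) = (deriv ^^ n) R 0 / fact n" for n
    proof (cases n)
      case (Suc i)
      have "b (int n) = \<alpha> (nat (int n)) / of_int (int n)" using Suc by (simp add: b_def)
      then show ?thesis using Rc[of i] Suc by (simp only: nat_int of_int_of_nat_eq)
    qed (simp add: b_def)
    moreover have "b (- int k) = - v k / of_nat k" if "1 \<le> k" for k using that by (simp add: b_def)
    ultimately show ?thesis unfolding L_def split PP_def by (intro arg_cong2[where f="(+)"] sum.cong) auto
  qed
  have LM': "L' M z = (\<Sum>n<M. (deriv ^^ n) R' 0 / fact n * z ^ n) + PP' z" for M z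
  proof -
    have "(\<Sum>n<Suc M. of_int (int n) * b (int n) * z powi (int n - 1)) = (\<Sum>n<M. of_int (int (Suc n)) * b (int (Suc n)) * z powi (int (Suc n) - 1))"
      by (subst sum.lessThan_Suc_shift) simp
    also have "\<dots> = (\<Sum>n<M. (deriv ^^ n) R' 0 / fact n * z ^ n)"
      unfolding R'c
    proof (rule sum.cong)
      fix n
      have "b (int (Suc n)) = \<alpha> (nat (int (Suc n))) / of_int (int (Suc n))" by (simp add: b_def)
      then have "of_int (int (Suc n)) * b (int (Suc n)) = \<alpha> (Suc n)"
        using of_nat_neq_0[of n, where 'a=complex] by (simp only: nat_int of_int_of_nat_eq) simp
      moreover have "int (Suc n) - 1 = int n" by simp
      ultimately show "of_int (int (Suc n)) * b (int (Suc n)) * z powi (int (Suc n) - 1) = \<alpha> (Suc n) * z ^ n"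
        by (simp only: power_int_of_nat)
    qed simp
    moreover have "(\<Sum>k=1..N. of_int (- int k) * b (- int k) * z powi (- int k - 1)) = PP' z"
      unfolding PP'_def by (rule sum.cong) (auto simp: b_def)
    ultimately show ?thesis unfolding L'_def split by simp
  qed
  have sub: "sphere 0 \<rho> \<subseteq> cball 0 \<rho>" by auto
  have ps: "uniform_limit (sphere 0 \<rho>) (\<lambda>M z. \<Sum>n<M. (deriv ^^ n) g 0 / fact n * z ^ n) g sequentially" if "g holomorphic_on ball 0 D" for g
    by (rule uniform_limit_on_subset[OF powser_partial_sums_uniform[OF that] sub]) (use \<rho> in auto)
  have UL: "uniform_limit (sphere 0 \<rho>) L F sequentially"
  proof -
    have "uniform_limit (sphere 0 \<rho>) (\<lambda>M z. \<Sum>n<Suc M. (deriv ^^ n) R 0 / fact n * z ^ n) R sequentially"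
      using filterlim_compose[OF ps[OF Rh(1)] filterlim_Suc] .
    then have "uniform_limit (sphere 0 \<rho>) (\<lambda>M z. (\<Sum>n<Suc M. (deriv ^^ n) R 0 / fact n * z ^ n) + PP z) (\<lambda>z. R z + PP z) sequentially"
      by (intro uniform_limit_add uniform_limit_const)
    then show ?thesis by (rule uniform_limit_cong'[THEN iffD1, rotated 2]) (use Feq in \<open>auto simp: LM\<close>)
  qed
  have UL': "uniform_limit (sphere 0 \<rho>) L' f sequentially"
  proof -
    have "uniform_limit (sphere 0 \<rho>) (\<lambda>M z. (\<Sum>n<M. (deriv ^^ n) R' 0 / fact n * z ^ n) + PP' z) (\<lambda>z. R' z + PP' z) sequentially"
      by (intro uniform_limit_add uniform_limit_const ps Rh)
    then show ?thesis by (rule uniform_limit_cong'[THEN iffD1, rotated 2]) (use feq in \<open>auto simp: LM'\<close>)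
  qed
  have cont: "continuous_on (sphere 0 \<rho>) (L M)" "continuous_on (sphere 0 \<rho>) (L' M)" for M
    unfolding L_def[abs_def] L'_def[abs_def] using \<rho> by (auto intro!: continuous_intros)
  have lim: "(\<lambda>M. Im (\<Sum>j<6. arc_energy (L M) (L' M) \<rho> (u j) (u (Suc j)))) \<longlonglongrightarrow> Im (\<Sum>j<6. arc_energy F f \<rho> (u j) (u (Suc j)))"
    by (intro tendsto_intros arc_energy_limit nz \<rho>(1) UL UL' cont)
  \<comment> \<open>Regular terms beyond M are nonnegative, so omitting them keeps the inequality
    while M' tends to infinity.\<close>
  have ev: "2 * pi * ((\<Sum>l=1..M. (cmod (\<alpha> l))\<^sup>2 * \<rho> ^ (2 * l) / l) - (\<Sum>k=1..N. (cmod (v k))\<^sup>2 / (k * \<rho> ^ (2 * k))))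
      \<le> Im (\<Sum>j<6. arc_energy (L M') (L' M') \<rho> (u j) (u (Suc j)))" if "M \<le> M'" for M'
  proof -
    have "(\<Sum>j<6. arc_energy (L M') (L' M') \<rho> (u j) (u (Suc j))) = 2 * pi * \<i> * (\<Sum>n\<in>S M'. of_int n * of_real ((cmod (b n))\<^sup>2 * \<rho> powi (2 * n)))"
      unfolding L_def[abs_def] L'_def[abs_def] by (rule hexagon_laurent_energy[OF opp nz orient \<rho>(1) fin])
    also have "\<dots> = 2 * pi * \<i> * of_real (\<Sum>n\<in>S M'. of_int n * ((cmod (b n))\<^sup>2 * \<rho> powi (2 * n)))" by simp
    finally have E: "Im (\<Sum>j<6. arc_energy (L M') (L' M') \<rho> (u j) (u (Suc j))) = 2 * pi * (\<Sum>n\<in>S M'. of_int n * ((cmod (b n))\<^sup>2 * \<rho> powi (2 * n)))"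
      by (simp del: of_real_sum)
    have "(\<Sum>n\<in>S M'. of_int n * ((cmod (b n))\<^sup>2 * \<rho> powi (2 * n)))
       = (\<Sum>n<Suc M'. of_int (int n) * ((cmod (b (int n)))\<^sup>2 * \<rho> powi (2 * int n))) + (\<Sum>k=1..N. of_int (- int k) * ((cmod (b (- int k)))\<^sup>2 * \<rho> powi (2 * - int k)))"
      by (rule split)
    also have "(\<Sum>n<Suc M'. of_int (int n) * ((cmod (b (int n)))\<^sup>2 * \<rho> powi (2 * int n))) = (\<Sum>l=1..M'. (cmod (\<alpha> l))\<^sup>2 * \<rho> ^ (2 * l) / l)"
    proof -
      have "(\<Sum>n<Suc M'. of_int (int n) * ((cmod (b (int n)))\<^sup>2 * \<rho> powi (2 * int n))) = (\<Sum>l=1..M'. of_int (int l) * ((cmod (b (int l)))\<^sup>2 * \<rho> powi (2 * int l)))"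
        by (rule sum.mono_neutral_right) (auto simp: not_less_eq_eq)
      also have "\<dots> = (\<Sum>l=1..M'. (cmod (\<alpha> l))\<^sup>2 * \<rho> ^ (2 * l) / l)"
      proof (rule sum.cong)
        fix l assume "l \<in> {1..M'}"
        moreover have "\<rho> powi (2 * int l) = \<rho> ^ (2 * l)" by (metis of_nat_mult of_nat_numeral power_int_of_nat)
        ultimately show "of_int (int l) * ((cmod (b (int l)))\<^sup>2 * \<rho> powi (2 * int l)) = (cmod (\<alpha> l))\<^sup>2 * \<rho> ^ (2 * l) / l"
          by (simp add: b_def norm_divide power_divide power2_eq_square)
      qed simp
      finally show ?thesis .
    qed
    also have "(\<Sum>k=1..N. of_int (- int k) * ((cmod (b (- int k)))\<^sup>2 * \<rho> powi (2 * - int k))) = - (\<Sum>k=1..N. (cmod (v k))\<^sup>2 / (k * \<rho> ^ (2 * k)))"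
      unfolding sum_negf[symmetric]
    proof (rule sum.cong)
      fix k assume k: "k \<in> {1..N}"
      have "2 * - int k = - int (2 * k)" by simp
      then have "\<rho> powi (2 * - int k) = inverse (\<rho> ^ (2 * k))" by (simp only: power_int_minus power_int_of_nat)
      then show "of_int (- int k) * ((cmod (b (- int k)))\<^sup>2 * \<rho> powi (2 * - int k)) = - ((cmod (v k))\<^sup>2 / (k * \<rho> ^ (2 * k)))"
        using k by (simp add: b_def norm_mult norm_inverse power2_eq_square divide_inverse)
    qed simp
    finally have E2: "(\<Sum>n\<in>S M'. of_int n * ((cmod (b n))\<^sup>2 * \<rho> powi (2 * n))) = (\<Sum>l=1..M'. (cmod (\<alpha> l))\<^sup>2 * \<rho> ^ (2 * l) / l) - (\<Sum>k=1..N. (cmod (v k))\<^sup>2 / (k * \<rho> ^ (2 * k)))"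
      by simp
    have "(\<Sum>l=1..M. (cmod (\<alpha> l))\<^sup>2 * \<rho> ^ (2 * l) / l) \<le> (\<Sum>l=1..M'. (cmod (\<alpha> l))\<^sup>2 * \<rho> ^ (2 * l) / l)"
      using that \<rho> by (intro sum_mono2) auto
    then show ?thesis unfolding E E2 by (intro mult_left_mono) auto
  qed
  have "2 * pi * ((\<Sum>l=1..M. (cmod (\<alpha> l))\<^sup>2 * \<rho> ^ (2 * l) / l) - (\<Sum>k=1..N. (cmod (v k))\<^sup>2 / (k * \<rho> ^ (2 * k))))
      \<le> Im (\<Sum>j<6. arc_energy F f \<rho> (u j) (u (Suc j)))"
    by (rule tendsto_lowerbound[OF lim eventually_sequentiallyI[OF ev]]) simp_all
  then show ?thesis using le by (simp add: \<alpha>_def P_def Q_def mult.assoc)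
qed

end

section \<open>The Grunsky-type contraction\<close>

text \<open>For odd k + l the Eisenstein series vanishes; otherwise k and l have the same parity and
  the signs agree.\<close>

lemma torus_coeff_sym:
  assumes "1 \<le> k" "1 \<le> l" shows "torus_coeff k l \<tau> = torus_coeff l k \<tau>"
proof (cases "even (k + l)")
  case True
  then have "(- 1 :: complex) ^ (k + 1) = (- 1) ^ (l + 1)" by (auto simp: minus_one_power_iff)
  then show ?thesis by (simp add: torus_coeff_def add.commute mult.commute)
next
  case False
  then show ?thesis by (simp add: torus_coeff_def eisenstein_def add.commute)
qed

text \<open>For positive \<rho> this is \<open>sewing_matrix\<close> at \<epsilon> = \<rho>^2, so
  the square root causes no choice of branch.\<close>

definition grunsky :: "complex \<Rightarrow> real \<Rightarrow> imat" where
  "grunsky \<tau> \<rho> k l = of_real (\<rho> ^ (k + l) / sqrt (real (k * l))) * torus_coeff k l \<tau>"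

lemma grunsky_sym: "1 \<le> k \<Longrightarrow> 1 \<le> l \<Longrightarrow> grunsky \<tau> \<rho> k l = grunsky \<tau> \<rho> l k"
  using torus_coeff_sym by (simp add: grunsky_def add.commute mult.commute)

text \<open>The scaling for which the energy of the principal part at radius \<rho> is the plain sum
  of the squares of y.\<close>

definition principal_coeffs :: "real \<Rightarrow> (nat \<Rightarrow> complex) \<Rightarrow> nat \<Rightarrow> complex" where
  "principal_coeffs \<rho> y k = of_real (sqrt (real k) * \<rho> ^ k) * y k"

lemma principal_coeffs_0: "principal_coeffs \<rho> y 0 = 0" by (simp add: principal_coeffs_def)

lemma decays_principal_coeffs:
  assumes y: "l2 y" and \<rho>: "0 \<le> \<rho>"
  shows "decays \<rho> (principal_coeffs \<rho> y)"
  unfolding decays_def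
proof (intro allI impI)
  fix d assume d: "\<rho> < d"
  define q where "q = \<rho> / d"
  have q: "0 \<le> q" "q < 1" using d \<rho> by (auto simp: q_def)
  have "summable (\<lambda>k. of_nat k ^ 1 * q ^ k)" using q by (intro summable_nat_power_geometric) auto
  then have "summable (\<lambda>k. l2norm y * (of_nat k ^ 1 * q ^ k))" by (rule summable_mult)
  then have "(\<lambda>k. l2norm y * (of_nat k ^ 1 * q ^ k)) summable_on UNIV"
    using q by (intro summable_nonneg_imp_summable_on) (auto intro!: mult_nonneg_nonneg)
  then show "(\<lambda>k. cmod (principal_coeffs \<rho> y k) / d ^ k) summable_on UNIV"
  proof (rule summable_on_comparison_test)
    fix k
    show "cmod (principal_coeffs \<rho> y k) / d ^ k \<le> l2norm y * (of_nat k ^ 1 * q ^ k)"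
    proof (cases "k = 0")
      case False
      have "sqrt (real k) \<le> real k" using False by (intro real_le_lsqrt) (auto simp: power2_eq_square)
      moreover have "cmod (y k) \<le> l2norm y" using cmod_le_l2norm[OF y, of k] False by simp
      ultimately have "sqrt (real k) * cmod (y k) \<le> real k * l2norm y" by (intro mult_mono) auto
      then have "(sqrt (real k) * cmod (y k)) * q ^ k \<le> (real k * l2norm y) * q ^ k" using q by (intro mult_right_mono) auto
      moreover have "cmod (principal_coeffs \<rho> y k) / d ^ k = (sqrt (real k) * cmod (y k)) * q ^ k"
        using \<rho> by (simp add: principal_coeffs_def norm_mult norm_power q_def power_divide)
      ultimately show ?thesis by (simp add: mult_ac)
    qed (simp add: principal_coeffs_0)
    show "0 \<le> cmod (principal_coeffs \<rho> y k) / d ^ k" using d \<rho> by simp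
  qed
qed

context torus begin

text \<open>The weight on the left is the square root of the one carried by the regular coefficients
  in the area inequality. In these coordinates passing from the principal to the regular part is a
  symmetric matrix.\<close>

lemma regular_coeff_grunsky:
  assumes l: "1 \<le> l" and \<rho>: "0 < \<rho>"
  shows "regular_coeff a (principal_coeffs \<rho> y) l * of_real (\<rho> ^ l / sqrt (real l))
    = of_real \<rho> * a * unit_seq 1 l + imat_apply (grunsky \<tau> \<rho>) y l"
proof -
  have "(\<Sum>\<^sub>\<infinity>k\<in>{1..}. principal_coeffs \<rho> y k * (torus_coeff k l \<tau> / of_nat k)) * of_real (\<rho> ^ l / sqrt (real l))
     = (\<Sum>\<^sub>\<infinity>k\<in>{1..}. principal_coeffs \<rho> y k * (torus_coeff k l \<tau> / of_nat k) * of_real (\<rho> ^ l / sqrt (real l)))"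
    by (rule infsum_cmult_left'[symmetric])
  also have "\<dots> = imat_apply (grunsky \<tau> \<rho>) y l"
    unfolding imat_apply_def
  proof (rule infsum_cong)
    fix k :: nat assume k: "k \<in> {1..}"
    have "sqrt (real k) * sqrt (real k) = real k" by simp
    then have "sqrt (real k) * \<rho> ^ k / real k * (\<rho> ^ l / sqrt (real l)) = \<rho> ^ (k + l) / sqrt (real (k * l))"
      using k by (simp add: real_sqrt_mult power_add divide_simps)
    then have "of_real (sqrt (real k) * \<rho> ^ k) / of_nat k * of_real (\<rho> ^ l / sqrt (real l)) = complex_of_real (\<rho> ^ (k + l) / sqrt (real (k * l)))"
      by (metis of_real_divide of_real_mult of_real_of_nat_eq)
    moreover have "principal_coeffs \<rho> y k * (torus_coeff k l \<tau> / of_nat k) * of_real (\<rho> ^ l / sqrt (real l))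
        = ((of_real (sqrt (real k) * \<rho> ^ k) / of_nat k * of_real (\<rho> ^ l / sqrt (real l))) * torus_coeff k l \<tau>) * y k"
      unfolding principal_coeffs_def by (simp only: divide_inverse mult_ac)
    ultimately have "principal_coeffs \<rho> y k * (torus_coeff k l \<tau> / of_nat k) * of_real (\<rho> ^ l / sqrt (real l))
        = (of_real (\<rho> ^ (k + l) / sqrt (real (k * l))) * torus_coeff k l \<tau>) * y k"
      by (simp only:)
    also have "\<dots> = grunsky \<tau> \<rho> k l * y k" by (simp add: grunsky_def)
    finally show "principal_coeffs \<rho> y k * (torus_coeff k l \<tau> / of_nat k) * of_real (\<rho> ^ l / sqrt (real l)) = grunsky \<tau> \<rho> l k * y k"
      using grunsky_sym[of k l \<tau> \<rho>] k l by simp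
  qed
  finally have e: "(\<Sum>\<^sub>\<infinity>k\<in>{1..}. principal_coeffs \<rho> y k * (torus_coeff k l \<tau> / of_nat k)) * of_real (\<rho> ^ l / sqrt (real l))
     = imat_apply (grunsky \<tau> \<rho>) y l" .
  have "(if l = 1 then a else 0) * of_real (\<rho> ^ l / sqrt (real l)) = of_real \<rho> * a * unit_seq 1 l"
    by (simp add: unit_seq_def)
  then show ?thesis unfolding regular_coeff_def distrib_right e by simp
qed

text \<open>The boundary term of the hexagon: conjugated a-period times b-period, where b is the
  part of the b-period not coming from the constant a.\<close>

definition "period_form a b = Im (cnj (2 * pi * \<i> * a) * (2 * pi * \<i> * \<tau> * a + b))"

lemma energy_inequality_finite:
  assumes yN: "\<And>k. N < k \<Longrightarrow> y k = 0" and \<rho>: "0 < \<rho>" "\<rho> < D / 2"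
  shows "pi * (L2_set (\<lambda>l. cmod (of_real \<rho> * a * unit_seq 1 l + imat_apply (grunsky \<tau> \<rho>) y l)) {1..M})\<^sup>2
    \<le> period_form a (of_real \<rho> * y 1) + pi * (trunc_norm N y)\<^sup>2"
proof -
  let ?v = "principal_coeffs \<rho> y"
  have "pi * ((\<Sum>l=1..M. (cmod (regular_coeff a ?v l))\<^sup>2 * \<rho> ^ (2 * l) / l) - (\<Sum>k=1..N. (cmod (?v k))\<^sup>2 / (k * \<rho> ^ (2 * k))))
    \<le> Im (cnj (2 * pi * \<i> * a) * (2 * pi * \<i> * \<tau> * a + ?v 1))"
    by (rule area_inequality_finite[OF _ _ \<rho>]) (use yN in \<open>auto simp: principal_coeffs_def\<close>)
  also have "(\<Sum>l=1..M. (cmod (regular_coeff a ?v l))\<^sup>2 * \<rho> ^ (2 * l) / l)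
      = (\<Sum>l=1..M. (cmod (of_real \<rho> * a * unit_seq 1 l + imat_apply (grunsky \<tau> \<rho>) y l))\<^sup>2)"
  proof (rule sum.cong)
    fix l assume l: "l \<in> {1..M}"
    then have l1: "1 \<le> l" by simp
    have "\<bar>\<rho> ^ l / sqrt (real l)\<bar>\<^sup>2 = \<rho> ^ (2 * l) / real l" by (simp add: power_divide power_mult[symmetric] mult.commute)
    then show "(cmod (regular_coeff a ?v l))\<^sup>2 * \<rho> ^ (2 * l) / l = (cmod (of_real \<rho> * a * unit_seq 1 l + imat_apply (grunsky \<tau> \<rho>) y l))\<^sup>2"
      unfolding regular_coeff_grunsky[OF l1 \<rho>(1), symmetric] norm_mult norm_of_real power_mult_distrib
      by (simp only: times_divide_eq_right)
  qed simp
  also have "(\<Sum>k=1..N. (cmod (?v k))\<^sup>2 / (k * \<rho> ^ (2 * k))) = (\<Sum>k=1..N. (cmod (y k))\<^sup>2)"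
  proof (rule sum.cong)
    fix k assume k: "k \<in> {1..N}"
    have "(cmod (?v k))\<^sup>2 = real k * \<rho> ^ (2 * k) * (cmod (y k))\<^sup>2"
      using \<rho> by (simp add: principal_coeffs_def norm_mult norm_power power_mult_distrib power_mult[symmetric] mult.commute)
    then show "(cmod (?v k))\<^sup>2 / (k * \<rho> ^ (2 * k)) = (cmod (y k))\<^sup>2" using k \<rho> by simp
  qed simp
  finally show ?thesis
    by (simp add: period_form_def L2_set_def sum_nonneg principal_coeffs_def right_diff_distrib)
qed

lemma imat_apply_finite_support:
  assumes "\<And>k. N < k \<Longrightarrow> y k = 0" shows "imat_apply K y l = (\<Sum>k=1..N. K l k * y k)"
  unfolding imat_apply_def
  by (subst infsum_cong_neutral[where T="{1..N}" and g="\<lambda>k. K l k * y k"]) (use assms in \<open>auto simp: not_le\<close>)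

text \<open>For \<open>a = 0\<close> the a-period vanishes and with it the boundary term; the area
  inequality then says that the energy of the regular part is at most that of the principal
  part.\<close>

lemma grunsky_contraction:
  assumes \<rho>: "0 < \<rho>" "\<rho> < D / 2"
  shows "mbound (grunsky \<tau> \<rho>) 1"
proof -
  let ?G = "grunsky \<tau> \<rho>"
  have "cmod (\<Sum>k=1..N. \<Sum>l=1..N. x k * ?G k l * y l) \<le> 1 * trunc_norm N x * trunc_norm N y" for N x y
  proof -
    define y' where "y' k = (if k \<le> N then y k else 0)" for k
    have L2y: "trunc_norm N y' = trunc_norm N y"
      by (intro L2_set_cong) (auto simp: y'_def)
    have ap: "imat_apply ?G y' k = (\<Sum>l=1..N. ?G k l * y l)" for k
      using imat_apply_finite_support[of N y' ?G k] by (simp add: y'_def)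
    have "pi * (L2_set (\<lambda>l. cmod (of_real \<rho> * 0 * unit_seq 1 l + imat_apply ?G y' l)) {1..N})\<^sup>2
      \<le> period_form 0 (of_real \<rho> * y' 1) + pi * (trunc_norm N y')\<^sup>2"
      by (rule energy_inequality_finite[OF _ \<rho>]) (simp add: y'_def)
    then have "(L2_set (\<lambda>l. cmod (imat_apply ?G y' l)) {1..N})\<^sup>2 \<le> (trunc_norm N y)\<^sup>2"
      by (simp add: period_form_def L2y[simplified])
    then have le: "L2_set (\<lambda>l. cmod (imat_apply ?G y' l)) {1..N} \<le> trunc_norm N y"
      using power2_le_imp_le L2_set_nonneg by blast
    have "(\<Sum>k=1..N. \<Sum>l=1..N. x k * ?G k l * y l) = (\<Sum>k=1..N. x k * imat_apply ?G y' k)"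
      by (simp add: ap sum_distrib_left mult.assoc)
    also have "cmod \<dots> \<le> (\<Sum>k=1..N. \<bar>cmod (x k)\<bar> * \<bar>cmod (imat_apply ?G y' k)\<bar>)"
      by (rule order_trans[OF norm_sum]) (simp add: norm_mult)
    also have "\<dots> \<le> trunc_norm N x * L2_set (\<lambda>k. cmod (imat_apply ?G y' k)) {1..N}"
      by (rule L2_set_mult_ineq)
    also have "\<dots> \<le> trunc_norm N x * trunc_norm N y"
      using le by (intro mult_left_mono) auto
    finally show ?thesis by simp
  qed
  then show ?thesis by (auto simp: mbound_def)
qed

text \<open>The finite inequality is applied to truncations of y. The contraction property, already
  known, makes the regular part converge entrywise, and a fixed output range M is kept during the
  limit.\<close>

lemma energy_inequality:
  assumes y: "l2 y" and \<rho>: "0 < \<rho>" "\<rho> < D / 2"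
    and x: "\<And>k. 1 \<le> k \<Longrightarrow> x k = of_real \<rho> * a * unit_seq 1 k + imat_apply (grunsky \<tau> \<rho>) y k"
  shows "pi * (l2norm x)\<^sup>2 \<le> period_form a (of_real \<rho> * y 1) + pi * (l2norm y)\<^sup>2"
proof -
  let ?G = "grunsky \<tau> \<rho>"
  define B where "B = period_form a (of_real \<rho> * y 1) / pi + (l2norm y)\<^sup>2"
  have fin: "(trunc_norm M x)\<^sup>2 \<le> B" for M
  proof -
    define yN where "yN N k = (if k \<le> N then y k else 0)" for N k
    have lim: "(\<lambda>N. imat_apply ?G (yN N) k) \<longlonglongrightarrow> imat_apply ?G y k" if "1 \<le> k" for k
    proof -
      have "imat_apply ?G (yN N) k = (\<Sum>l=1..N. ?G k l * y l)" for N
        using imat_apply_finite_support[of N "yN N" ?G k] by (simp add: yN_def)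
      then show ?thesis
        using abs_summable_tendsto_Icc[OF abs_summable_summable[OF imat_apply_summable[OF grunsky_contraction[OF \<rho>] y that]]]
        by (simp add: imat_apply_def)
    qed
    have "(\<lambda>N. (L2_set (\<lambda>k. cmod (of_real \<rho> * a * unit_seq 1 k + imat_apply ?G (yN N) k)) {1..M})\<^sup>2)
       \<longlonglongrightarrow> (L2_set (\<lambda>k. cmod (of_real \<rho> * a * unit_seq 1 k + imat_apply ?G y k)) {1..M})\<^sup>2"
      unfolding L2_set_def by (intro tendsto_intros lim) auto
    also have "L2_set (\<lambda>k. cmod (of_real \<rho> * a * unit_seq 1 k + imat_apply ?G y k)) {1..M} = trunc_norm M x"
      using x by (intro L2_set_cong) auto
    finally have l: "(\<lambda>N. (L2_set (\<lambda>k. cmod (of_real \<rho> * a * unit_seq 1 k + imat_apply ?G (yN N) k)) {1..M})\<^sup>2)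
       \<longlonglongrightarrow> (trunc_norm M x)\<^sup>2" .
    \<comment> \<open>The condition \<open>1 \<le> N\<close> keeps the entry \<open>y 1\<close>, on
      which \<open>period_form\<close> depends.\<close>
    have ev: "(L2_set (\<lambda>k. cmod (of_real \<rho> * a * unit_seq 1 k + imat_apply ?G (yN N) k)) {1..M})\<^sup>2 \<le> B" if "1 \<le> N" for N
    proof -
      have "pi * (L2_set (\<lambda>k. cmod (of_real \<rho> * a * unit_seq 1 k + imat_apply ?G (yN N) k)) {1..M})\<^sup>2
        \<le> period_form a (of_real \<rho> * yN N 1) + pi * (L2_set (\<lambda>k. cmod (yN N k)) {1..N})\<^sup>2"
        by (rule energy_inequality_finite[OF _ \<rho>]) (simp add: yN_def)
      also have "L2_set (\<lambda>k. cmod (yN N k)) {1..N} = trunc_norm N y"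
        by (intro L2_set_cong) (auto simp: yN_def)
      also have "period_form a (of_real \<rho> * yN N 1) + pi * (trunc_norm N y)\<^sup>2
         \<le> period_form a (of_real \<rho> * y 1) + pi * (l2norm y)\<^sup>2"
        using that L2_set_le_l2norm[OF y, of "{1..N}"] by (auto simp: yN_def intro!: power_mono)
      also have "\<dots> = pi * B" by (simp add: B_def distrib_left)
      finally show ?thesis by (simp add: mult_le_cancel_left)
    qed
    show ?thesis by (rule tendsto_upperbound[OF l eventually_sequentiallyI[OF ev]]) auto
  qed
  have B: "0 \<le> B" using fin[of 0] by simp
  have "trunc_norm M x \<le> sqrt B" for M
    using fin[of M] by (simp add: real_le_rsqrt)
  then have "l2norm x \<le> sqrt B" by (rule l2I_bounded(2))
  then have "(l2norm x)\<^sup>2 \<le> B" using B power_mono[of "l2norm x" "sqrt B" 2] by simp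
  then have "pi * (l2norm x)\<^sup>2 \<le> pi * B" by (intro mult_left_mono) auto
  then show ?thesis by (simp add: B_def distrib_left)
qed

end

section \<open>The linear system for sewn one-forms\<close>

lemma two_add: "(a::2) + 1 + 1 = a" "(a::2) + 1 \<noteq> a" "a \<noteq> (a::2) + 1" "(a::2) + 2 = a"
proof -
  have e: "x = 1 \<or> x = 2" for x :: 2 by (rule exhaust_2)
  have "(1::2) + 1 = 2" "(2::2) + 1 = 1" "(1::2) \<noteq> 2" by simp_all
  then show "(a::2) + 1 + 1 = a" "(a::2) + 1 \<noteq> a" "a \<noteq> (a::2) + 1" "(a::2) + 2 = a" using e[of a] by auto
qed

lemma two_cases: "(b::2) = a \<or> b = a + 1"
proof -
  have "(1::2) + 1 = 2" "(2::2) + 1 = 1" by simp_all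
  then show ?thesis using exhaust_2[of a] exhaust_2[of b] by auto
qed

lemma UNIV_two: "(UNIV :: 2 set) = {a, a + 1}"
  using two_cases by auto

locale sewing =
  fixes \<tau> :: "complex ^ 2" and \<epsilon> :: complex and r :: "real ^ 2"
  assumes Im_pos: "\<And>a. 0 < Im (\<tau> $ a)" and radii: "sewing_radii \<tau> \<epsilon> r"
begin

lemma torus: "torus (\<tau> $ a)" using Im_pos by (simp add: torus_def)

lemma r_bounds: "0 < r $ a" "r $ a < min_norm (torus_lattice (\<tau> $ a)) / 2"
  using radii by (auto simp: sewing_radii_def)

lemma r_prod: "r $ a * r $ (a + 1) = r $ 1 * r $ 2"
proof -
  have "(2::2) + 1 = 1" by simp
  then show ?thesis using exhaust_2[of a] by (metis mult.commute one_add_one)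
qed

definition "u = \<epsilon> / of_real (r $ 1 * r $ 2)"

lemma u_less_1: "cmod u < 1"
proof -
  have "0 < r $ 1 * r $ 2" using r_bounds(1) by simp
  moreover have "cmod \<epsilon> < r $ 1 * r $ 2" using radii by (simp add: sewing_radii_def)
  ultimately show ?thesis unfolding u_def norm_divide norm_of_real by simp
qed

lemma u_eq: "u = \<epsilon> / (of_real (r $ a) * of_real (r $ (a + 1)))"
  unfolding u_def r_prod[of a, symmetric] by simp

definition "G a = grunsky (\<tau> $ a) (r $ a)"

lemma G_bound: "mbound (G a) 1"
  unfolding G_def by (rule torus.grunsky_contraction[OF torus r_bounds])

definition "system c x \<longleftrightarrow> (\<forall>a. l2 (x a)) \<and>
   (\<forall>a. \<forall>k\<ge>1. x a k = of_real (r $ a) * c a * unit_seq 1 k - imat_apply (mscale (G a) u) (x (a + 1)) k)"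

lemma systemD: "system c x \<Longrightarrow> l2 (x a)"
  "system c x \<Longrightarrow> 1 \<le> k \<Longrightarrow> x a k = of_real (r $ a) * c a * unit_seq 1 k - imat_apply (mscale (G a) u) (x (a + 1)) k"
  by (auto simp: system_def)

lemma mscale_bound: "mbound (mscale (G a) u) (cmod u)" by (rule mbound_mscale[OF G_bound u_less_1])

lemma imat_apply_linear:
  assumes K: "mbound K q" and x: "l2 x" "l2 y" and k: "1 \<le> k"
  shows "imat_apply K (\<lambda>m. s * x m + t * y m) k = s * imat_apply K x k + t * imat_apply K y k"
proof -
  have "imat_apply K (\<lambda>m. s * x m + t * y m) k = (\<Sum>\<^sub>\<infinity>m\<in>{1..}. s * (K k m * x m) + t * (K k m * y m))"
    unfolding imat_apply_def by (intro infsum_cong) (simp add: algebra_simps)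
  also have "\<dots> = (\<Sum>\<^sub>\<infinity>m\<in>{1..}. s * (K k m * x m)) + (\<Sum>\<^sub>\<infinity>m\<in>{1..}. t * (K k m * y m))"
    by (intro infsum_add summable_on_cmult_right abs_summable_summable[OF imat_apply_summable[OF K x(1) k]]
       abs_summable_summable[OF imat_apply_summable[OF K x(2) k]])
  finally show ?thesis by (simp only: infsum_cmult_right' imat_apply_def)
qed

lemma imat_apply_scale: "imat_apply K (\<lambda>m. s * x m) k = s * imat_apply K x k"
  unfolding imat_apply_def by (simp only: infsum_cmult_right'[symmetric] mult.left_commute)

lemma system_linear:
  assumes x: "system c x" and y: "system d y"
  shows "system (\<lambda>a. s * c a + t * d a) (\<lambda>a k. s * x a k + t * y a k)"
  unfolding system_def
proof (intro conjI allI impI)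
  fix a show "l2 (\<lambda>k. s * x a k + t * y a k)"
    by (intro l2_add l2_scale systemD(1)[OF x] systemD(1)[OF y])
  fix k :: nat assume k: "1 \<le> k"
  show "s * x a k + t * y a k = of_real (r $ a) * (s * c a + t * d a) * unit_seq 1 k
      - imat_apply (mscale (G a) u) (\<lambda>k. s * x (a + 1) k + t * y (a + 1) k) k"
    unfolding imat_apply_linear[OF mscale_bound systemD(1)[OF x] systemD(1)[OF y] k]
    by (subst systemD(2)[OF x k], subst systemD(2)[OF y k]) (simp add: algebra_simps)
qed

lemma system_unique:
  assumes x: "system c x" and y: "system c y" and k: "1 \<le> k"
  shows "x a k = y a k"
proof -
  define z where "z a k = 1 * x a k + (- 1) * y a k" for a k
  have z: "system (\<lambda>a. 1 * c a + (- 1) * c a) z" unfolding z_def by (rule system_linear[OF x y])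
  have "z a k = 0"
  proof (rule loop_homogeneous_zero[OF G_bound[of a] G_bound[of "a + 1"] u_less_1 systemD(1)[OF z] systemD(1)[OF z] _ _ k])
    show "z a k = - imat_apply (mscale (G a) u) (z (a + 1)) k" if "1 \<le> k" for k
      using systemD(2)[OF z that, of a] by simp
    show "z (a + 1) k = - imat_apply (mscale (G (a + 1)) u) (z a) k" if "1 \<le> k" for k
      using systemD(2)[OF z that, of "a + 1"] by (simp add: two_add)
  qed
  then show ?thesis by (simp add: z_def)
qed

definition "resolvent j k = loop_resolvent (G j) (G (j + 1)) u k 1"

text \<open>Normalised to c = 1 on torus j and 0 on the other one. Eliminating the other torus
  leaves the loop equation on torus j; the second component follows by substituting back
  once.\<close>

definition "sol j a k = of_real (r $ j) * (if a = j then resolvent j k else - imat_apply (mscale (G (j + 1)) u) (resolvent j) k)"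

lemma resolvent_l2: "l2 (resolvent j)"
  unfolding resolvent_def[abs_def] by (rule loop_resolvent_l2[OF G_bound G_bound u_less_1]) simp

lemma sol_system: "system (\<lambda>a. if a = j then 1 else 0) (sol j)"
  unfolding system_def
proof (intro conjI allI impI)
  have neg: "l2 (\<lambda>k. - x k)" if "l2 x" for x using l2_scale(1)[OF that, of "- 1"] by simp
  fix a
  show "l2 (sol j a)" unfolding sol_def[abs_def]
    using l2_scale(1)[OF resolvent_l2] l2_scale(1)[OF neg[OF imat_apply_l2(1)[OF mscale_bound resolvent_l2]]]
    by (cases "a = j") simp_all
  fix k :: nat assume k: "1 \<le> k"
  consider "a = j" | "a = j + 1" using two_cases[of a j] by auto
  then show "sol j a k = of_real (r $ a) * (if a = j then 1 else 0) * unit_seq 1 k - imat_apply (mscale (G a) u) (sol j (a + 1)) k"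
  proof cases
    case 1
    have "sol j (j + 1) = (\<lambda>k. (- of_real (r $ j)) * imat_apply (mscale (G (j + 1)) u) (resolvent j) k)"
      by (auto simp: sol_def two_add)
    moreover have "resolvent j k = unit_seq 1 k + imat_apply (mscale (G j) u) (imat_apply (mscale (G (j + 1)) u) (resolvent j)) k"
      using loop_resolvent_eq[OF G_bound G_bound u_less_1 k] by (simp add: resolvent_def[abs_def])
    ultimately have "imat_apply (mscale (G j) u) (sol j (j + 1)) k = - of_real (r $ j) * (resolvent j k - unit_seq 1 k)"
      by (simp only: imat_apply_scale) simp
    then show ?thesis unfolding 1 by (simp add: sol_def[of j j] right_diff_distrib)
  next
    case 2
    have "sol j j = (\<lambda>k. of_real (r $ j) * resolvent j k)" by (auto simp: sol_def)
    then show ?thesis using 2 by (simp add: sol_def two_add imat_apply_scale)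
  qed
qed

text \<open>The coefficient of index 1 in the principal part on torus a, as produced by the solution
  on the other torus; by \<open>tform_contour_integral\<close> it is the correction to the
  b-period.\<close>

definition "b_shift x a = - (\<epsilon> / of_real (r $ (a + 1))) * x (a + 1) 1"

lemma system_energy:
  assumes x: "system c x"
  shows "pi * (l2norm (x a))\<^sup>2 \<le> torus.period_form (\<tau> $ a) (c a) (b_shift x a) + pi * ((cmod u)\<^sup>2 * (l2norm (x (a + 1)))\<^sup>2)"
proof -
  define y where "y k = - (u ^ k) * x (a + 1) k" for k
  have dom: "cmod (y k) \<le> cmod u * cmod (x (a + 1) k)" if "1 \<le> k" for k
  proof -
    have "cmod u ^ k \<le> cmod u" using power_decreasing[of 1 k "cmod u"] that u_less_1 by simp
    then show ?thesis by (simp add: y_def norm_mult norm_power mult_right_mono)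
  qed
  have y: "l2 y" "l2norm y \<le> cmod u * l2norm (x (a + 1))"
    by (rule l2_dominated[OF systemD(1)[OF x] dom]; simp)+
  have "imat_apply (G a) y k = - imat_apply (mscale (G a) u) (x (a + 1)) k" for k
    unfolding imat_apply_def infsum_uminus[symmetric] by (simp add: y_def mscale_def mult.assoc)
  then have "pi * (l2norm (x a))\<^sup>2 \<le> torus.period_form (\<tau> $ a) (c a) (of_real (r $ a) * y 1) + pi * (l2norm y)\<^sup>2"
    using systemD(2)[OF x, of _ a]
    by (intro torus.energy_inequality[OF torus y(1) r_bounds]) (simp add: G_def)
  moreover have "(l2norm y)\<^sup>2 \<le> (cmod u * l2norm (x (a + 1)))\<^sup>2" using y(2) by (intro power_mono) auto
  moreover have "of_real (r $ a) * y 1 = b_shift x a"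
    using r_bounds(1)[of a] by (simp add: y_def b_shift_def u_eq[of a])
  ultimately show ?thesis by (simp add: power_mult_distrib) (smt (verit) mult_left_mono pi_ge_zero)
qed

text \<open>Each torus receives as principal energy at most the square of \<open>cmod u\<close>
  times the regular energy of the other. Adding the two inequalities, a nonpositive boundary term
  would force all coefficients to vanish, and then the equation for the first entry gives
  \<open>c a = 0\<close>.\<close>

lemma system_positive:
  assumes x: "system c x" and c: "c a \<noteq> 0"
  shows "0 < torus.period_form (\<tau> $ a) (c a) (b_shift x a) + torus.period_form (\<tau> $ (a + 1)) (c (a + 1)) (b_shift x (a + 1))"
proof (rule ccontr)
  assume neg: "\<not> ?thesis"
  define S where "S = (l2norm (x a))\<^sup>2 + (l2norm (x (a + 1)))\<^sup>2"
  have "pi * S = pi * (l2norm (x a))\<^sup>2 + pi * (l2norm (x (a + 1)))\<^sup>2"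
    "pi * ((cmod u)\<^sup>2 * S) = pi * ((cmod u)\<^sup>2 * (l2norm (x (a + 1)))\<^sup>2) + pi * ((cmod u)\<^sup>2 * (l2norm (x a))\<^sup>2)"
    by (simp_all add: S_def distrib_left)
  then have "pi * S \<le> pi * ((cmod u)\<^sup>2 * S)"
    using system_energy[OF x, of a] system_energy[OF x, of "a + 1", unfolded two_add] neg by linarith
  then have "S \<le> (cmod u)\<^sup>2 * S" by simp
  moreover have "(cmod u)\<^sup>2 < 1" using u_less_1 by (simp add: power_less_one_iff abs_square_less_1)
  moreover have "0 \<le> S" by (simp add: S_def)
  ultimately have "S = 0" by (smt (verit) mult_le_cancel_right1 mult_less_cancel_right1)
  then have "l2norm (x a) = 0" "l2norm (x (a + 1)) = 0" by (auto simp: S_def add_nonneg_eq_0_iff)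
  then have "x a k = 0" "x (a + 1) k = 0" if "1 \<le> k" for k
    using cmod_le_l2norm[OF systemD(1)[OF x] that] by (metis norm_le_zero_iff)+
  moreover from this have "imat_apply (mscale (G a) u) (x (a + 1)) 1 = 0"
    unfolding imat_apply_def by (intro infsum_0) auto
  ultimately have "of_real (r $ a) * c a = 0" using systemD(2)[OF x, of 1 a] by (simp add: unit_seq_def)
  then show False using c r_bounds(1)[of a] by simp
qed

definition omega :: "complex ^ 2 ^ 2" where
  "omega = (\<chi> i j. ((if i = j then 2 * pi * \<i> * \<tau> $ i else 0) + b_shift (sol j) i) / (2 * pi * \<i>))"

lemma omega_diag: "2 * pi * \<i> * omega $ j $ j = 2 * pi * \<i> * \<tau> $ j
   + \<epsilon> * of_real (r $ j / r $ (j + 1)) * imat_apply (mscale (G (j + 1)) u) (resolvent j) 1"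
  by (simp add: omega_def b_shift_def sol_def two_add)

lemma omega_off: "2 * pi * \<i> * omega $ (j + 1) $ j = - \<epsilon> * resolvent j 1"
  using r_bounds(1)[of j] by (simp add: omega_def b_shift_def sol_def two_add)

lemma resolvent_sym: "resolvent (j + 1) 1 = resolvent j 1"
  unfolding resolvent_def two_add
  by (rule loop_resolvent_sym[OF G_bound G_bound u_less_1]) (simp_all add: G_def grunsky_sym)

lemma omega_sym: "transpose omega = omega"
proof -
  have "omega $ (j + 1) $ j = omega $ j $ (j + 1)" for j
  proof -
    have "2 * pi * \<i> * omega $ (j + 1) $ j = 2 * pi * \<i> * omega $ j $ (j + 1)"
      using omega_off[of j] omega_off[of "j + 1", unfolded two_add resolvent_sym] by (simp only:)
    then show ?thesis by simp
  qed
  then have "omega $ i $ j = omega $ j $ i" for i j using two_cases[of i j] by metis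
  then show ?thesis by (simp add: transpose_def vec_eq_iff)
qed

text \<open>The solution with constants c equal to the real vector x is the corresponding
  combination of the normalised ones, and its total boundary term is 4 pi^2 times the quadratic form
  of the imaginary part at x.\<close>

lemma omega_siegel: "omega \<in> siegel_upper_half_space"
  unfolding siegel_upper_half_space_def
proof (intro CollectI conjI allI impI omega_sym)
  fix x :: "real ^ 2" assume "x \<noteq> 0"
  then obtain a where a: "x $ a \<noteq> 0" by (metis vec_eq_iff zero_index)
  define c where "c b = complex_of_real (x $ b)" for b
  define z where "z b k = c a * sol a b k + c (a + 1) * sol (a + 1) b k" for b k
  have "system (\<lambda>b. c a * (if b = a then 1 else 0) + c (a + 1) * (if b = a + 1 then 1 else 0)) z"
    unfolding z_def by (rule system_linear[OF sol_system sol_system])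
  also have "(\<lambda>b. c a * (if b = a then 1 else 0) + c (a + 1) * (if b = a + 1 then 1 else 0)) = c"
  proof
    fix b show "c a * (if b = a then 1 else 0) + c (a + 1) * (if b = a + 1 then 1 else 0) = c b"
      using two_cases[of b a] by (auto simp: two_add)
  qed
  finally have z: "system c z" .
  have pf: "torus.period_form (\<tau> $ i) (c i) (b_shift z i) = 4 * pi\<^sup>2 * (\<Sum>j\<in>UNIV. x $ i * Im (omega $ i $ j) * x $ j)" for i
  proof -
    have "b_shift z i = c a * b_shift (sol a) i + c (a + 1) * b_shift (sol (a + 1)) i"
      by (simp add: b_shift_def z_def algebra_simps)
    moreover have "2 * pi * \<i> * \<tau> $ i * c i = c a * (if i = a then 2 * pi * \<i> * \<tau> $ i else 0) + c (a + 1) * (if i = a + 1 then 2 * pi * \<i> * \<tau> $ i else 0)"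
      using two_cases[of i a] by (auto simp: two_add)
    ultimately have "2 * pi * \<i> * \<tau> $ i * c i + b_shift z i = 2 * pi * \<i> * (c a * omega $ i $ a + c (a + 1) * omega $ i $ (a + 1))"
      by (simp add: omega_def field_simps)
    then have "torus.period_form (\<tau> $ i) (c i) (b_shift z i)
       = Im (cnj (2 * pi * \<i> * c i) * (2 * pi * \<i> * (c a * omega $ i $ a + c (a + 1) * omega $ i $ (a + 1))))"
      by (simp add: torus.period_form_def[OF torus])
    also have "\<dots> = 4 * pi\<^sup>2 * (x $ i * (x $ a * Im (omega $ i $ a) + x $ (a + 1) * Im (omega $ i $ (a + 1))))"
      by (simp add: c_def algebra_simps power2_eq_square)
    finally show ?thesis unfolding UNIV_two[of a] by (simp add: two_add algebra_simps)
  qed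
  have "0 < 4 * pi\<^sup>2 * (\<Sum>i\<in>UNIV. \<Sum>j\<in>UNIV. x $ i * Im (omega $ i $ j) * x $ j)"
    using system_positive[OF z, of a] a unfolding pf UNIV_two[of a] by (simp add: c_def two_add distrib_left)
  then show "0 < (\<Sum>i\<in>UNIV. \<Sum>j\<in>UNIV. x $ i * Im (omega $ i $ j) * x $ j)"
    by (simp add: zero_less_mult_iff)
qed

end

section \<open>Cycles on a punctured torus\<close>

text \<open>The complement of the closed disc is the union of the complements of slightly larger
  open discs; these are connected and share the point
  \<open>\<kappa> + of_real \<delta>'\<close>.\<close>

lemma connected_diff_cball:
  fixes S :: "complex set"
  assumes S: "connected S" "open S" and sub: "cball \<kappa> \<delta> \<subseteq> S" and \<delta>: "0 \<le> \<delta>"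
  shows "connected (S - cball \<kappa> \<delta>)"
proof -
  obtain \<eta> where \<eta>: "0 < \<eta>" "cball \<kappa> (\<delta> + \<eta>) \<subseteq> S" by (rule cball_subset_open_enlarge[OF S(2) sub \<delta>])
  define \<delta>' where "\<delta>' = \<delta> + \<eta>"
  have d': "\<delta> < \<delta>'" "cball \<kappa> \<delta>' \<subseteq> S" using \<eta> by (simp_all add: \<delta>'_def)
  have "S - cball \<kappa> \<delta> = (\<Union>d\<in>{\<delta><..\<delta>'}. S - ball \<kappa> d)"
  proof (intro equalityI subsetI)
    fix z assume "z \<in> S - cball \<kappa> \<delta>"
    then show "z \<in> (\<Union>d\<in>{\<delta><..\<delta>'}. S - ball \<kappa> d)" using d' by (intro UN_I[of "min \<delta>' (dist \<kappa> z)"]) auto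
  qed auto
  moreover have "connected (\<Union>d\<in>{\<delta><..\<delta>'}. S - ball \<kappa> d)"
  proof (rule connected_Union)
    show "connected T" if T: "T \<in> (\<lambda>d. S - ball \<kappa> d) ` {\<delta><..\<delta>'}" for T
    proof -
      obtain d where d: "T = S - ball \<kappa> d" "\<delta> < d" "d \<le> \<delta>'" using T by auto
      have "cball \<kappa> d \<subseteq> S" using d d' subset_cball by blast
      then show ?thesis using connected_diff_ball[OF S(1)] d by simp
    qed
    have "\<kappa> + of_real \<delta>' \<in> S - ball \<kappa> d" if "\<delta> < d" "d \<le> \<delta>'" for d
      using d' \<delta> that by (auto simp: dist_norm)
    then show "\<Inter> ((\<lambda>d. S - ball \<kappa> d) ` {\<delta><..\<delta>'}) \<noteq> {}" by fastforce
  qed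
  ultimately show ?thesis by simp
qed

context torus begin

text \<open>Infinitely many discs are excised, but only finitely many meet a large ball. That ball
  is enlarged by the D / 2 neighbourhoods of their centres, so that each of these discs lies
  entirely inside and can be removed without losing connectedness.\<close>

lemma punctured_connected_subset:
  assumes \<delta>: "0 \<le> \<delta>" "\<delta> < D / 2" and pq: "p \<in> punctured \<delta>" "q \<in> punctured \<delta>"
  obtains W where "open W" "connected W" "p \<in> W" "q \<in> W" "W \<subseteq> punctured \<delta>"
proof -
  define M where "M = cmod p + cmod q + 1"
  define K where "K = {\<kappa>\<in>\<Lambda>. cball \<kappa> \<delta> \<inter> ball 0 M \<noteq> {}}"
  have "K \<subseteq> \<Lambda> \<inter> cball 0 (M + \<delta>)"
  proof
    fix \<kappa> assume "\<kappa> \<in> K"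
    then obtain z where "\<kappa> \<in> \<Lambda>" "cmod (\<kappa> - z) \<le> \<delta>" "cmod z < M" by (auto simp: K_def dist_norm)
    then show "\<kappa> \<in> \<Lambda> \<inter> cball 0 (M + \<delta>)" using norm_triangle_sub[of \<kappa> z] by auto
  qed
  then have fK: "finite K" using finite_lattice_ball finite_subset by blast
  define S where "S = ball 0 M \<union> (\<Union>\<kappa>\<in>K. ball \<kappa> (D / 2))"
  have oS: "open S" by (auto simp: S_def)
  have cS: "connected S"
  proof -
    have "connected (ball 0 M \<union> (\<Union>\<kappa>\<in>F. ball \<kappa> (D / 2)))" if "finite F" "F \<subseteq> K" for F
      using that
    proof (induction rule: finite_induct)
      case (insert \<kappa> F)
      have "connected ((ball 0 M \<union> (\<Union>\<kappa>\<in>F. ball \<kappa> (D / 2))) \<union> ball \<kappa> (D / 2))"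
      proof (rule connected_Un)
        have "cball \<kappa> \<delta> \<inter> ball 0 M \<noteq> {}" using insert.prems by (auto simp: K_def)
        moreover have "cball \<kappa> \<delta> \<subseteq> ball \<kappa> (D / 2)" using \<delta> by auto
        ultimately show "(ball 0 M \<union> (\<Union>\<kappa>\<in>F. ball \<kappa> (D / 2))) \<inter> ball \<kappa> (D / 2) \<noteq> {}" by blast
      qed (use insert in auto)
      then show ?case by (simp add: Un_ac)
    qed simp
    then show ?thesis using fK by (simp add: S_def)
  qed
  have cW: "connected (S - (\<Union>\<kappa>\<in>F. cball \<kappa> \<delta>)) \<and> open (S - (\<Union>\<kappa>\<in>F. cball \<kappa> \<delta>))" if "finite F" "F \<subseteq> K" for F
    using that
  proof (induction rule: finite_induct)
    case empty then show ?case using oS cS by simp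
  next
    case (insert \<kappa> F)
    then have IH: "connected (S - (\<Union>\<kappa>\<in>F. cball \<kappa> \<delta>))" "open (S - (\<Union>\<kappa>\<in>F. cball \<kappa> \<delta>))" by auto
    have sub: "cball \<kappa> \<delta> \<subseteq> S - (\<Union>\<kappa>\<in>F. cball \<kappa> \<delta>)"
    proof
      fix z assume z: "z \<in> cball \<kappa> \<delta>"
      have "z \<in> ball \<kappa> (D / 2)" "\<kappa> \<in> K" using z insert.prems \<delta> by auto
      then have "z \<in> S" unfolding S_def by blast
      moreover have "z \<notin> cball \<kappa>' \<delta>" if "\<kappa>' \<in> F" for \<kappa>'
      proof
        assume z': "z \<in> cball \<kappa>' \<delta>"
        have "\<kappa> = \<kappa>'" by (rule nearest_unique[of _ _ z]) (use z z' that insert \<delta> in \<open>auto simp: K_def dist_norm norm_minus_commute\<close>)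
        then show False using that insert by blast
      qed
      ultimately show "z \<in> S - (\<Union>\<kappa>\<in>F. cball \<kappa> \<delta>)" by blast
    qed
    have e: "S - (\<Union>\<kappa>\<in>insert \<kappa> F. cball \<kappa> \<delta>) = (S - (\<Union>\<kappa>\<in>F. cball \<kappa> \<delta>)) - cball \<kappa> \<delta>" by auto
    show ?case unfolding e
      using connected_diff_cball[OF IH sub \<delta>(1)] IH(2) by (simp add: open_Diff)
  qed
  define W where "W = S - (\<Union>\<kappa>\<in>K. cball \<kappa> \<delta>)"
  have W: "connected W" "open W" using cW[OF fK] by (auto simp: W_def)
  have in_W: "z \<in> W" if "z \<in> punctured \<delta>" "cmod z < M" for z
    using that by (auto simp: W_def S_def K_def punctured_def dist_norm norm_minus_commute not_le)
  have "W \<subseteq> punctured \<delta>"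
  proof
    fix z assume z: "z \<in> W"
    have "\<delta> < cmod (z - \<kappa>)" if k: "\<kappa> \<in> \<Lambda>" for \<kappa>
    proof (rule ccontr)
      assume "\<not> ?thesis"
      then have zk: "cmod (z - \<kappa>) \<le> \<delta>" by simp
      then have kK: "\<kappa> \<notin> K" using z by (auto simp: W_def dist_norm norm_minus_commute)
      then have "z \<notin> ball 0 M" using k zk by (auto simp: K_def dist_norm norm_minus_commute disjoint_iff)
      then obtain \<kappa>' where k': "\<kappa>' \<in> K" "z \<in> ball \<kappa>' (D / 2)" using z by (auto simp: W_def S_def)
      have "\<kappa>' = \<kappa>" by (rule nearest_unique[of _ _ z]) (use k' k zk \<delta> in \<open>auto simp: K_def dist_norm norm_minus_commute\<close>)
      then show False using kK k' by simp
    qed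
    then show "z \<in> punctured \<delta>" by (simp add: punctured_def)
  qed
  moreover have "p \<in> W" "q \<in> W" using in_W pq by (auto simp: M_def add_nonneg_pos)
  ultimately show ?thesis using that W by blast
qed

lemma punctured_path:
  assumes \<delta>: "0 \<le> \<delta>" "\<delta> < D / 2" and pq: "p \<in> punctured \<delta>" "q \<in> punctured \<delta>"
  obtains \<gamma> where "valid_path \<gamma>" "path_image \<gamma> \<subseteq> punctured \<delta>" "pathstart \<gamma> = p" "pathfinish \<gamma> = q"
proof -
  obtain W where W: "open W" "connected W" "p \<in> W" "q \<in> W" "W \<subseteq> punctured \<delta>"
    by (rule punctured_connected_subset[OF assms])
  obtain g where "polynomial_function g" "path_image g \<subseteq> W" "pathstart g = p" "pathfinish g = q"
    using connected_open_polynomial_connected[OF W(1-4)] by blast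
  then show ?thesis using that[of g] W(5) by (auto simp: valid_path_polynomial_function)
qed

lemma annulus_punctured:
  assumes "\<delta> < cmod z" "cmod z < D / 2" "\<delta> < D / 2" shows "z \<in> punctured \<delta>"
proof -
  have "\<delta> < cmod (z - \<kappa>)" if "\<kappa> \<in> \<Lambda>" for \<kappa>
  proof (cases "\<kappa> = 0")
    case False
    then have "D \<le> cmod \<kappa>" using D_le that by blast
    then show ?thesis using assms norm_triangle_sub[of \<kappa> z] by (simp add: norm_minus_commute)
  qed (use assms in simp)
  then show ?thesis by (simp add: punctured_def)
qed

lemma punctured_cycle:
  assumes \<delta>: "0 \<le> \<delta>" "\<delta> < D / 2" and \<omega>: "\<omega> \<in> \<Lambda>"
  obtains \<gamma> where "valid_path \<gamma>" "path_image \<gamma> \<subseteq> punctured \<delta>" "pathfinish \<gamma> = pathstart \<gamma> + \<omega>"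
proof -
  define z where "z = complex_of_real ((\<delta> + D / 2) / 2)"
  have "0 < \<delta> + D" using \<delta> D_pos by simp
  then have z: "z \<in> punctured \<delta>" using \<delta> D_pos by (intro annulus_punctured) (auto simp: z_def norm_of_real simp del: of_real_add of_real_divide)
  show ?thesis by (rule punctured_path[OF \<delta> z punctured_shift[OF z \<omega>]]) (use that in auto)
qed

end

section \<open>One-forms on the sewn surface\<close>

context sewing begin

definition "hole a = cmod \<epsilon> / r $ (a + 1)"

lemma hole_bounds: "0 \<le> hole a" "hole a < r $ a" "hole a < min_norm (torus_lattice (\<tau> $ a)) / 2"
proof -
  show 0: "0 \<le> hole a" using r_bounds(1)[of "a + 1"] by (simp add: hole_def)
  have "cmod \<epsilon> < r $ a * r $ (a + 1)" using radii r_prod[of a] by (simp add: sewing_radii_def)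
  then show "hole a < r $ a" using r_bounds(1)[of "a + 1"] by (simp add: hole_def pos_divide_less_eq)
  then show "hole a < min_norm (torus_lattice (\<tau> $ a)) / 2" using r_bounds(2)[of a] by linarith
qed

lemma piece_eq: "sewing_piece \<tau> \<epsilon> r a = (if \<epsilon> = 0 then UNIV else torus.punctured (\<tau> $ a) (hole a))"
  by (auto simp: sewing_piece_def torus.punctured_def[OF torus] hole_def not_le)

lemma punctured_subset_piece: "torus.punctured (\<tau> $ a) (hole a) \<subseteq> sewing_piece \<tau> \<epsilon> r a"
  by (simp add: piece_eq)

lemma open_piece: "open (sewing_piece \<tau> \<epsilon> r a)"
  using torus.punctured_open[OF torus hole_bounds(1)] by (simp add: piece_eq)

lemma piece_shift: "z \<in> sewing_piece \<tau> \<epsilon> r a \<Longrightarrow> \<omega> \<in> torus_lattice (\<tau> $ a) \<Longrightarrow> z + \<omega> \<in> sewing_piece \<tau> \<epsilon> r a"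
  using torus.punctured_shift[OF torus] by (auto simp: piece_eq split: if_splits)

lemma param_shift:
  assumes \<omega>: "\<omega> \<in> torus_lattice (\<tau> $ a)" and z: "z \<in> sewing_piece \<tau> \<epsilon> r a"
  shows "sewing_param \<tau> \<epsilon> r a (z + \<omega>) = sewing_param \<tau> \<epsilon> r a z"
proof -
  have sub: "sewing_param \<tau> \<epsilon> r a z \<subseteq> sewing_param \<tau> \<epsilon> r a (z + \<omega>)"
    if \<omega>: "\<omega> \<in> torus_lattice (\<tau> $ a)" and z: "z \<in> sewing_piece \<tau> \<epsilon> r a" for z \<omega>
  proof
    fix bw assume "bw \<in> sewing_param \<tau> \<epsilon> r a z"
    then obtain b w where bw: "bw = (b, w)" "((a, z), (b, w)) \<in> sewing_rel \<tau> \<epsilon> r" by (cases bw) (auto simp: sewing_param_def)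
    then have w: "w \<in> sewing_piece \<tau> \<epsilon> r b" and d: "a = b \<and> z - w \<in> torus_lattice (\<tau> $ a) \<or> b = a + 1 \<and>
           (\<exists>\<kappa>\<in>torus_lattice (\<tau> $ a). \<exists>\<mu>\<in>torus_lattice (\<tau> $ b). if \<epsilon> = 0 then z = \<kappa> \<and> w = \<mu>
              else (z - \<kappa>) * (w - \<mu>) = \<epsilon> \<and> cmod (z - \<kappa>) < r $ a \<and> cmod (w - \<mu>) < r $ b)"
      by (auto simp: sewing_rel_def)
    from d have "a = b \<and> z + \<omega> - w \<in> torus_lattice (\<tau> $ a) \<or> b = a + 1 \<and>
           (\<exists>\<kappa>\<in>torus_lattice (\<tau> $ a). \<exists>\<mu>\<in>torus_lattice (\<tau> $ b). if \<epsilon> = 0 then z + \<omega> = \<kappa> \<and> w = \<mu>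
              else (z + \<omega> - \<kappa>) * (w - \<mu>) = \<epsilon> \<and> cmod (z + \<omega> - \<kappa>) < r $ a \<and> cmod (w - \<mu>) < r $ b)"
    proof (elim disjE conjE bexE)
      assume "a = b" "z - w \<in> torus_lattice (\<tau> $ a)"
      moreover have "z + \<omega> - w = (z - w) + \<omega>" by simp
      ultimately show ?thesis using torus_lattice_add[OF _ \<omega>] by metis
    next
      fix \<kappa> \<mu> assume "b = a + 1" and k: "\<kappa> \<in> torus_lattice (\<tau> $ a)" "\<mu> \<in> torus_lattice (\<tau> $ b)"
        and "if \<epsilon> = 0 then z = \<kappa> \<and> w = \<mu> else (z - \<kappa>) * (w - \<mu>) = \<epsilon> \<and> cmod (z - \<kappa>) < r $ a \<and> cmod (w - \<mu>) < r $ b"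
      then show ?thesis
        using torus_lattice_add[OF k(1) \<omega>] by (intro disjI2 conjI bexI[of _ "\<kappa> + \<omega>"] bexI[of _ \<mu>]) (auto split: if_splits)
    qed
    then show "bw \<in> sewing_param \<tau> \<epsilon> r a (z + \<omega>)"
      using bw(1) w piece_shift[OF z \<omega>] by (auto simp: sewing_param_def sewing_rel_def)
  qed
  show ?thesis
  proof (rule equalityI[OF _ sub[OF \<omega> z]])
    show "sewing_param \<tau> \<epsilon> r a (z + \<omega>) \<subseteq> sewing_param \<tau> \<epsilon> r a z"
      using sub[OF torus_lattice_uminus[OF \<omega>] piece_shift[OF z \<omega>]] by simp
  qed
qed

definition "collar a = {z. hole a < cmod z \<and> cmod z < r $ a}"

lemma open_collar: "open (collar a)"
proof -
  have "collar a = ball 0 (r $ a) - cball 0 (hole a)" by (auto simp: collar_def)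
  then show ?thesis by (simp add: open_Diff)
qed

lemma collar_punctured: "collar a \<subseteq> torus.punctured (\<tau> $ a) (hole a)"
  using torus.annulus_punctured[OF torus, of "hole a" _ a] hole_bounds[of a] r_bounds(2)[of a]
  by (auto simp: collar_def)

lemma collar_piece: "collar a \<subseteq> sewing_piece \<tau> \<epsilon> r a"
  using collar_punctured punctured_subset_piece by blast

lemma collar_nz: "z \<in> collar a \<Longrightarrow> z \<noteq> 0" using hole_bounds(1)[of a] by (auto simp: collar_def)

lemma collar_flip:
  assumes "\<epsilon> \<noteq> 0" "z \<in> collar a" shows "\<epsilon> / z \<in> collar (a + 1)"
proof -
  have "0 < cmod z" using collar_nz[OF assms(2)] by simp
  then show ?thesis using assms r_bounds(1)[of "a + 1"] r_bounds(1)[of a]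
    by (auto simp: collar_def hole_def two_add norm_divide field_simps)
qed

text \<open>Since the radii are below D / 2, a point of the collar is near no lattice point other
  than 0. The identification thus reduces to w being congruent to \<epsilon> / z, and the size
  conditions hold automatically.\<close>

lemma param_collar:
  assumes \<epsilon>: "\<epsilon> \<noteq> 0" and z: "z \<in> collar a"
  shows "sewing_param \<tau> \<epsilon> r a z = {(b, w). w \<in> sewing_piece \<tau> \<epsilon> r b \<and>
     (b = a \<and> z - w \<in> torus_lattice (\<tau> $ a) \<or> b = a + 1 \<and> \<epsilon> / z - w \<in> torus_lattice (\<tau> $ b))}"
proof -
  have "(\<exists>\<kappa>\<in>torus_lattice (\<tau> $ a). \<exists>\<mu>\<in>torus_lattice (\<tau> $ b). (z - \<kappa>) * (w - \<mu>) = \<epsilon> \<and> cmod (z - \<kappa>) < r $ a \<and> cmod (w - \<mu>) < r $ b)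
     \<longleftrightarrow> \<epsilon> / z - w \<in> torus_lattice (\<tau> $ b)" if b: "b = a + 1" for b w
  proof
    assume "\<exists>\<kappa>\<in>torus_lattice (\<tau> $ a). \<exists>\<mu>\<in>torus_lattice (\<tau> $ b). (z - \<kappa>) * (w - \<mu>) = \<epsilon> \<and> cmod (z - \<kappa>) < r $ a \<and> cmod (w - \<mu>) < r $ b"
    then obtain \<kappa> \<mu> where k: "\<kappa> \<in> torus_lattice (\<tau> $ a)" "\<mu> \<in> torus_lattice (\<tau> $ b)" "(z - \<kappa>) * (w - \<mu>) = \<epsilon>" "cmod (z - \<kappa>) < r $ a" by blast
    have "\<kappa> = 0"
      by (rule torus.nearest_unique[OF torus k(1) torus_lattice_zero, of z]) (use k(4) r_bounds(2)[of a] z in \<open>auto simp: collar_def\<close>)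
    then have "\<epsilon> / z - w = - \<mu>" using k(3) collar_nz[OF z] by (simp add: field_simps)
    then show "\<epsilon> / z - w \<in> torus_lattice (\<tau> $ b)" using torus_lattice_uminus[OF k(2)] by simp
  next
    assume "\<epsilon> / z - w \<in> torus_lattice (\<tau> $ b)"
    then have "w - \<epsilon> / z \<in> torus_lattice (\<tau> $ b)" using torus_lattice_uminus by fastforce
    then show "\<exists>\<kappa>\<in>torus_lattice (\<tau> $ a). \<exists>\<mu>\<in>torus_lattice (\<tau> $ b). (z - \<kappa>) * (w - \<mu>) = \<epsilon> \<and> cmod (z - \<kappa>) < r $ a \<and> cmod (w - \<mu>) < r $ b"
      using collar_flip[OF \<epsilon> z] collar_nz[OF z] z b torus_lattice_zero
      by (intro bexI[of _ 0] bexI[of _ "w - \<epsilon> / z"]) (auto simp: collar_def)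
  qed
  then show ?thesis using \<epsilon> z collar_piece[of a] two_add
    by (auto simp: sewing_param_def sewing_rel_def)
qed

lemma param_flip:
  assumes \<epsilon>: "\<epsilon> \<noteq> 0" and z: "z \<in> collar a"
  shows "sewing_param \<tau> \<epsilon> r (a + 1) (\<epsilon> / z) = sewing_param \<tau> \<epsilon> r a z"
  unfolding param_collar[OF \<epsilon> collar_flip[OF \<epsilon> z]] param_collar[OF \<epsilon> z]
  using \<epsilon> collar_nz[OF z] by (auto simp: two_add)

text \<open>The transformation laws for translations and for the collar map z \<mapsto> \<epsilon> /
  z only. The next two lemmas show that these generate all coordinate changes.\<close>

definition "sewn_pair f \<longleftrightarrow> (\<forall>a. f a holomorphic_on sewing_piece \<tau> \<epsilon> r a) \<and>
   (\<forall>a. \<forall>z\<in>sewing_piece \<tau> \<epsilon> r a. \<forall>\<omega>\<in>torus_lattice (\<tau> $ a). f a (z + \<omega>) = f a z) \<and>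
   (\<epsilon> \<noteq> 0 \<longrightarrow> (\<forall>a. \<forall>z\<in>collar a. f a z = f (a + 1) (\<epsilon> / z) * (- \<epsilon> / z\<^sup>2)))"

lemma flip_derivative: "z \<noteq> 0 \<Longrightarrow> ((\<lambda>z. \<epsilon> / z) has_field_derivative (- \<epsilon> / z\<^sup>2)) (at z)"
  by (auto intro!: derivative_eq_intros simp: power2_eq_square)

lemma sewn_one_form_imp_pair:
  assumes "sewn_one_form \<tau> \<epsilon> r f" shows "sewn_pair f"
proof -
  have hol: "f a holomorphic_on sewing_piece \<tau> \<epsilon> r a" for a
    using assms by (simp add: sewn_one_form_def holomorphic_one_form_def)
  have tr: "f i z = f j (t z) * deriv t z"
    if "open V" "V \<subseteq> sewing_piece \<tau> \<epsilon> r i" "t holomorphic_on V" "t ` V \<subseteq> sewing_piece \<tau> \<epsilon> r j"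
      "\<And>z. z \<in> V \<Longrightarrow> sewing_param \<tau> \<epsilon> r j (t z) = sewing_param \<tau> \<epsilon> r i z" "z \<in> V" for i j V t z
    using assms that unfolding sewn_one_form_def holomorphic_one_form_def by blast
  show ?thesis unfolding sewn_pair_def
  proof (intro conjI allI ballI impI hol)
    fix a z \<omega> assume z: "z \<in> sewing_piece \<tau> \<epsilon> r a" and \<omega>: "\<omega> \<in> torus_lattice (\<tau> $ a)"
    have "f a z = f a (z + \<omega>) * deriv (\<lambda>z. z + \<omega>) z"
      by (rule tr[OF open_piece order_refl]) (use z piece_shift[OF _ \<omega>] param_shift[OF \<omega>] in \<open>auto intro!: holomorphic_intros\<close>)
    moreover have "deriv (\<lambda>z. z + \<omega>) z = 1" by (rule DERIV_imp_deriv) (auto intro!: derivative_eq_intros)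
    ultimately show "f a (z + \<omega>) = f a z" by simp
  next
    fix a z assume \<epsilon>: "\<epsilon> \<noteq> 0" and z: "z \<in> collar a"
    have "f a z = f (a + 1) (\<epsilon> / z) * deriv (\<lambda>z. \<epsilon> / z) z"
    proof (rule tr[OF open_collar collar_piece _ _ _ z])
      show "(\<lambda>z. \<epsilon> / z) holomorphic_on collar a" using collar_nz by (auto intro!: holomorphic_intros)
      show "(\<lambda>z. \<epsilon> / z) ` collar a \<subseteq> sewing_piece \<tau> \<epsilon> r (a + 1)" using collar_flip[OF \<epsilon>] collar_piece by blast
    qed (rule param_flip[OF \<epsilon>])
    then show "f a z = f (a + 1) (\<epsilon> / z) * (- \<epsilon> / z\<^sup>2)"
      using DERIV_imp_deriv[OF flip_derivative[OF collar_nz[OF z]]] by simp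
  qed
qed

text \<open>An arbitrary coordinate change is determined up to lattice points. The lattice is
  discrete and the map continuous, so near any point it is a single translation or a single
  translated flip.\<close>

lemma sewn_pair_imp_one_form:
  assumes f: "sewn_pair f" shows "sewn_one_form \<tau> \<epsilon> r f"
  unfolding sewn_one_form_def holomorphic_one_form_def
proof (intro conjI allI impI ballI)
  show "f i holomorphic_on sewing_piece \<tau> \<epsilon> r i" for i using f by (simp add: sewn_pair_def)
  have per: "f a (z + \<omega>) = f a z" if "z \<in> sewing_piece \<tau> \<epsilon> r a" "\<omega> \<in> torus_lattice (\<tau> $ a)" for a z \<omega>
    using f that by (simp add: sewn_pair_def)
  fix i j V t z
  assume A: "open V \<and> V \<subseteq> sewing_piece \<tau> \<epsilon> r i \<and> t holomorphic_on V \<and> t ` V \<subseteq> sewing_piece \<tau> \<epsilon> r j \<and>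
       (\<forall>z\<in>V. sewing_param \<tau> \<epsilon> r j (t z) = sewing_param \<tau> \<epsilon> r i z)" and z: "z \<in> V"
  have rel: "((j, t w), (i, w)) \<in> sewing_rel \<tau> \<epsilon> r" if "w \<in> V" for w
  proof -
    have "(i, w) \<in> sewing_param \<tau> \<epsilon> r i w"
      using A that torus_lattice_zero by (auto simp: sewing_param_def sewing_rel_def)
    then have "(i, w) \<in> sewing_param \<tau> \<epsilon> r j (t w)" using A that by simp
    then show ?thesis by (simp add: sewing_param_def)
  qed
  have tp: "t w \<in> sewing_piece \<tau> \<epsilon> r j" "w \<in> sewing_piece \<tau> \<epsilon> r i" if "w \<in> V" for w using A that by auto
  have ct: "(t \<longlongrightarrow> t z) (at z)"
    using A z by (meson continuous_on_eq_continuous_at holomorphic_on_imp_continuous_on isContD)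
  have evV: "\<forall>\<^sub>F w in nhds z. w \<in> V" using A z by (simp add: eventually_nhds_in_open)
  \<comment> \<open>A continuous function with values in the lattice is locally constant, because
    distinct lattice points are at least D apart.\<close>
  have const: "\<forall>\<^sub>F w in nhds z. h w = h z"
    if h: "(h \<longlongrightarrow> h z) (at z)" and L: "\<forall>\<^sub>F w in nhds z. h w \<in> torus_lattice (\<tau> $ a)" for h a
  proof -
    have "\<forall>\<^sub>F w in at z. dist (h w) (h z) < min_norm (torus_lattice (\<tau> $ a))"
      using tendstoD[OF h torus.D_pos[OF torus]] .
    then have near: "\<forall>\<^sub>F w in nhds z. w \<noteq> z \<longrightarrow> dist (h w) (h z) < min_norm (torus_lattice (\<tau> $ a))" by (simp add: eventually_at_filter)
    have hz: "h z \<in> torus_lattice (\<tau> $ a)" using L by (rule eventually_nhds_x_imp_x)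
    show ?thesis using near L
    proof eventually_elim
      case (elim w)
      show "h w = h z"
      proof (rule ccontr)
        assume ne: "h w \<noteq> h z"
        have "min_norm (torus_lattice (\<tau> $ a)) \<le> cmod (h w - h z)"
          by (rule torus.lattice_sep[OF torus elim(2) hz ne])
        then show False using elim(1) ne by (force simp: dist_norm)
      qed
    qed
  qed
  consider "j = i" | "i = j + 1" using two_cases[of i j] by auto
  then show "f i z = f j (t z) * deriv t z"
  proof cases
    case 1
    have L: "t w - w \<in> torus_lattice (\<tau> $ i)" if "w \<in> V" for w
      using rel[OF that] 1 two_add by (auto simp: sewing_rel_def)
    have evL: "\<forall>\<^sub>F w in nhds z. t w - w \<in> torus_lattice (\<tau> $ i)" using evV L by (rule eventually_mono)
    have "\<forall>\<^sub>F w in nhds z. t w - w = t z - z" by (rule const[OF _ evL]) (intro tendsto_intros ct)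
    then have ev: "\<forall>\<^sub>F w in nhds z. t w = w + (t z - z)" by eventually_elim (simp add: algebra_simps)
    have "deriv t z = deriv (\<lambda>w. w + (t z - z)) z" by (rule deriv_cong_ev[OF ev refl])
    also have "\<dots> = 1" by (rule DERIV_imp_deriv) (auto intro!: derivative_eq_intros)
    finally show ?thesis using per[OF tp(2)[OF z] L[OF z]] 1 by simp
  next
    case 2
    show ?thesis
    proof (cases "\<epsilon> = 0")
      \<comment> \<open>At the node the two tori share only lattice points, so an open set of
        identifications cannot exist.\<close>
      case True
      have L: "w \<in> torus_lattice (\<tau> $ i)" if "w \<in> V" for w
        using rel[OF that] 2 True two_add by (auto simp: sewing_rel_def)
      have evL: "\<forall>\<^sub>F w in nhds z. w \<in> torus_lattice (\<tau> $ i)" using evV L by (rule eventually_mono)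
      have "\<forall>\<^sub>F w in nhds z. w = z" by (rule const[OF _ evL]) (intro tendsto_intros)
      then have "\<forall>\<^sub>F w in at z. False" by (simp add: eventually_at_filter)
      then show ?thesis by simp
    next
      case False
      have R: "\<exists>\<kappa>\<in>torus_lattice (\<tau> $ j). \<exists>\<mu>\<in>torus_lattice (\<tau> $ i). (t w - \<kappa>) * (w - \<mu>) = \<epsilon> \<and> cmod (t w - \<kappa>) < r $ j \<and> cmod (w - \<mu>) < r $ i" if "w \<in> V" for w
        using rel[OF that] 2 False two_add by (auto simp: sewing_rel_def)
      obtain \<kappa> \<mu> where k: "\<kappa> \<in> torus_lattice (\<tau> $ j)" "\<mu> \<in> torus_lattice (\<tau> $ i)" "(t z - \<kappa>) * (z - \<mu>) = \<epsilon>" "cmod (t z - \<kappa>) < r $ j" "cmod (z - \<mu>) < r $ i"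
        using R[OF z] by blast
      have zm: "z - \<mu> \<noteq> 0" using k(3) False by auto
      have "\<forall>\<^sub>F w in nhds z. cmod (w - \<mu>) < r $ i"
        by (rule eventually_nhds_in_open[of "{w. cmod (w - \<mu>) < r $ i}", simplified])
           (use k(5) in \<open>auto intro!: open_Collect_less continuous_intros\<close>)
      then have evL: "\<forall>\<^sub>F w in nhds z. t w - \<epsilon> / (w - \<mu>) \<in> torus_lattice (\<tau> $ j)"
        using evV
      proof eventually_elim
        case (elim w)
        obtain \<kappa>' \<mu>' where k': "\<kappa>' \<in> torus_lattice (\<tau> $ j)" "\<mu>' \<in> torus_lattice (\<tau> $ i)" "(t w - \<kappa>') * (w - \<mu>') = \<epsilon>" "cmod (w - \<mu>') < r $ i"
          using R[OF elim(2)] by blast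
        \<comment> \<open>Both lattice points are within D / 2 of w, so the witness found at w is
          the one fixed at z.\<close>
        have "\<mu>' = \<mu>" by (rule torus.nearest_unique[OF torus k'(2) k(2), of w]) (use k'(4) elim(1) r_bounds(2)[of i] in auto)
        moreover have "w - \<mu>' \<noteq> 0" using k'(3) False by auto
        ultimately have "t w - \<epsilon> / (w - \<mu>) = \<kappa>'" using k'(3) by (simp add: field_simps)
        then show ?case using k'(1) by simp
      qed
      have "\<forall>\<^sub>F w in nhds z. t w - \<epsilon> / (w - \<mu>) = t z - \<epsilon> / (z - \<mu>)"
        by (rule const[OF _ evL]) (use zm in \<open>auto intro!: tendsto_intros ct\<close>)
      moreover have tz: "t z - \<epsilon> / (z - \<mu>) = \<kappa>" using k(3) zm by (simp add: field_simps)
      ultimately have ev: "\<forall>\<^sub>F w in nhds z. t w = \<kappa> + \<epsilon> / (w - \<mu>)" by (auto elim!: eventually_mono simp: algebra_simps)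
      have "deriv t z = deriv (\<lambda>w. \<kappa> + \<epsilon> / (w - \<mu>)) z" by (rule deriv_cong_ev[OF ev refl])
      also have "\<dots> = - \<epsilon> / (z - \<mu>)\<^sup>2"
        by (rule DERIV_imp_deriv) (use zm in \<open>auto intro!: derivative_eq_intros simp: power2_eq_square\<close>)
      finally have dt: "deriv t z = - \<epsilon> / (z - \<mu>)\<^sup>2" .
      have "- \<mu> \<in> torus_lattice (\<tau> $ i)" "- \<kappa> \<in> torus_lattice (\<tau> $ j)" using k torus_lattice_uminus by auto
      then have fi: "f i z = f i (z - \<mu>)" "f j (t z) = f j (t z - \<kappa>)"
        using per[OF tp(2)[OF z], of "- \<mu>"] per[OF tp(1)[OF z], of "- \<kappa>"] by auto
      have "z \<in> torus.punctured (\<tau> $ i) (hole i)" using tp(2)[OF z] False by (simp add: piece_eq)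
      then have "z - \<mu> \<in> collar i" using k(2,5) by (simp add: collar_def torus.punctured_def[OF torus])
      then have "f i (z - \<mu>) = f (i + 1) (\<epsilon> / (z - \<mu>)) * (- \<epsilon> / (z - \<mu>)\<^sup>2)" using f False by (simp add: sewn_pair_def)
      then show ?thesis using 2 dt fi tz by (simp add: two_add algebra_simps)
    qed
  qed
qed

end

section \<open>One-forms from solutions of the linear system\<close>

lemma decays_norm_summable:
  assumes "decays \<delta> v" "0 \<le> \<delta>" "\<delta> < cmod z"
  shows "(\<lambda>k. cmod (v k / z ^ Suc k)) summable_on UNIV"
proof -
  have "(\<lambda>k. inverse (cmod z) * (cmod (v k) / cmod z ^ k)) summable_on UNIV"
    using assms by (intro summable_on_cmult_right) (simp add: decays_def)
  then show ?thesis by (rule summable_on_cong[THEN iffD1, rotated]) (simp add: norm_divide norm_mult norm_power divide_simps)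
qed

lemma principal_part_sums:
  assumes "decays \<delta> v" "0 \<le> \<delta>" "\<delta> < cmod z"
  shows "(\<lambda>k. v k / z ^ Suc k) sums (\<Sum>\<^sub>\<infinity>k. v k / z ^ Suc k)"
  by (rule has_sum_imp_sums[OF has_sum_infsum[OF abs_summable_summable[OF decays_norm_summable[OF assms]]]])

context torus begin

lemma tform_regular_holomorphic:
  assumes "decays \<delta> v" "0 \<le> \<delta>"
  shows "(\<lambda>z. a + dseries v zeta_reg z) holomorphic_on ball 0 (D - \<delta>)"
  by (intro holomorphic_intros dseries_zeta_reg_holomorphic[OF assms]) simp

lemma tform_regular_sums:
  assumes v: "decays \<delta> v" "0 \<le> \<delta>" "v 0 = 0" and z: "cmod z + \<delta> < D"
  shows "(\<lambda>n. regular_coeff a v (Suc n) * z ^ n) sums (a + dseries v zeta_reg z)"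
proof -
  have "\<delta> < D" using z norm_ge_zero[of z] by linarith
  then have e: "(deriv ^^ n) (\<lambda>z. a + dseries v zeta_reg z) 0 / fact n = regular_coeff a v (Suc n)" for n
    using tform_regular_part[OF v(1,2) _ v(3), of "Suc n" a] by simp
  show ?thesis
    using holomorphic_power_series[OF tform_regular_holomorphic[OF v(1,2)], of z a] z by (simp add: e)
qed

lemma tform_split:
  assumes "decays \<delta> v" "0 \<le> \<delta>" "\<delta> < cmod z" "cmod z + \<delta> < D"
  shows "tform a v z = (a + dseries v zeta_reg z) + (\<Sum>\<^sub>\<infinity>k. v k / z ^ Suc k)"
  using dseries_zeta_split[OF assms] by (simp add: tform_def)

text \<open>Substituting \<epsilon> / z and multiplying by its derivative turns the power z^(k-1)
  into -\<epsilon>^k z^(-k-1): regular parts on one torus become principal parts on the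
  other.\<close>

lemma principal_part_flip:
  assumes v: "decays \<delta> v" "0 \<le> \<delta>" "v 0 = 0" "\<delta> < cmod z"
    and w: "decays \<delta>' w" "0 \<le> \<delta>'" "w 0 = 0" "cmod (\<epsilon> / z) + \<delta>' < D"
    and vw: "\<And>k. 1 \<le> k \<Longrightarrow> v k = - (\<epsilon> ^ k) * regular_coeff c w k"
  shows "(\<Sum>\<^sub>\<infinity>k. v k / z ^ Suc k) = (c + dseries w zeta_reg (\<epsilon> / z)) * (- \<epsilon> / z\<^sup>2)"
proof -
  have z: "z \<noteq> 0" using v by auto
  have "(\<lambda>n. (- \<epsilon> / z\<^sup>2) * (regular_coeff c w (Suc n) * (\<epsilon> / z) ^ n)) sums ((- \<epsilon> / z\<^sup>2) * (c + dseries w zeta_reg (\<epsilon> / z)))"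
    by (rule sums_mult[OF tform_regular_sums[OF w]])
  also have "(\<lambda>n. (- \<epsilon> / z\<^sup>2) * (regular_coeff c w (Suc n) * (\<epsilon> / z) ^ n)) = (\<lambda>n. v (Suc n) / z ^ Suc (Suc n))"
    using z by (simp add: vw power2_eq_square field_simps)
  finally have "(\<lambda>k. v k / z ^ Suc k) sums ((- \<epsilon> / z\<^sup>2) * (c + dseries w zeta_reg (\<epsilon> / z)))"
    using v(3) sums_Suc_iff[of "\<lambda>k. v k / z ^ Suc k"] by simp
  then show ?thesis using sums_unique2[OF principal_part_sums[OF v(1,2,4)]] by (simp add: mult.commute)
qed

end

context sewing begin

definition "form_coeffs x a = principal_coeffs (r $ a) (\<lambda>k. - (u ^ k) * x (a + 1) k)"

definition "form c x a = torus.tform (\<tau> $ a) (c a) (form_coeffs x a)"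

lemma form_coeffs_0: "form_coeffs x a 0 = 0" by (simp add: form_coeffs_def principal_coeffs_0)

lemma r_u: "of_real (r $ a) * u = \<epsilon> / of_real (r $ (a + 1))"
  using r_bounds(1)[of a] by (simp add: u_eq[of a])

lemma r_u_power: "of_real (r $ a) ^ k * u ^ k = \<epsilon> ^ k / of_real (r $ (a + 1)) ^ k"
  by (simp only: power_mult_distrib[symmetric] r_u power_divide)

text \<open>The factors r^k u^k equal \<epsilon>^k divided by the k-th power of the other radius, so
  the coefficients decay at the rate of the excised radius \<open>hole a\<close>, not merely at the
  rate \<open>r $ a\<close>.\<close>

lemma decays_form_coeffs:
  assumes "l2 (x (a + 1))" shows "decays (hole a) (form_coeffs x a)"
proof -
  have "cmod (form_coeffs x a k) = cmod (principal_coeffs (hole a) (x (a + 1)) k)" for k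
  proof -
    have "form_coeffs x a k = - of_real (sqrt (real k)) * (of_real (r $ a) ^ k * u ^ k) * x (a + 1) k"
      by (simp add: form_coeffs_def principal_coeffs_def)
    then have "cmod (form_coeffs x a k) = sqrt (real k) * cmod (\<epsilon> ^ k / of_real (r $ (a + 1)) ^ k) * cmod (x (a + 1) k)"
      unfolding r_u_power by (simp add: norm_mult norm_divide)
    also have "cmod (\<epsilon> ^ k / of_real (r $ (a + 1)) ^ k) = hole a ^ k"
      using r_bounds(1)[of "a + 1"] by (simp add: hole_def norm_divide norm_power power_divide)
    finally show ?thesis using hole_bounds(1)[of a] by (simp add: principal_coeffs_def norm_mult norm_power)
  qed
  then show ?thesis using decays_principal_coeffs[OF assms hole_bounds(1)[of a]] by (simp add: decays_def)
qed

lemma imat_apply_G: "imat_apply (G a) (\<lambda>k. - (u ^ k) * y k) l = - imat_apply (mscale (G a) u) y l"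
  unfolding imat_apply_def infsum_uminus[symmetric] by (simp add: mscale_def mult.assoc)

lemma form_regular_coeff:
  assumes x: "system c x" and l: "1 \<le> l"
  shows "torus.regular_coeff (\<tau> $ a) (c a) (form_coeffs x a) l = x a l * of_real (sqrt (real l) / r $ a ^ l)"
proof -
  let ?rc = "torus.regular_coeff (\<tau> $ a) (c a) (form_coeffs x a) l"
  have ne: "r $ a \<noteq> 0" using r_bounds(1)[of a] by simp
  have "?rc * of_real (r $ a ^ l / sqrt (real l)) = x a l"
    unfolding form_coeffs_def torus.regular_coeff_grunsky[OF torus l r_bounds(1)] systemD(2)[OF x l] G_def[symmetric] imat_apply_G
    by simp
  then have "x a l * of_real (sqrt (real l) / r $ a ^ l) = ?rc * of_real ((r $ a ^ l / sqrt (real l)) * (sqrt (real l) / r $ a ^ l))"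
    by (simp only: of_real_mult mult.assoc[symmetric])
  then show ?thesis using ne l by simp
qed

text \<open>The system says that x is the rescaled regular part (\<open>form_regular_coeff\<close>);
  undoing the scaling gives exactly the matching condition of
  \<open>principal_part_flip\<close>.\<close>

lemma form_coeffs_relation:
  assumes x: "system c x" and k: "1 \<le> k"
  shows "form_coeffs x a k = - (\<epsilon> ^ k) * torus.regular_coeff (\<tau> $ (a + 1)) (c (a + 1)) (form_coeffs x (a + 1)) k"
proof -
  have "form_coeffs x a k = - of_real (sqrt (real k)) * (of_real (r $ a) ^ k * u ^ k) * x (a + 1) k"
    by (simp add: form_coeffs_def principal_coeffs_def)
  then show ?thesis unfolding r_u_power form_regular_coeff[OF x k] by simp
qed

lemma form_trivial:
  assumes "\<epsilon> = 0" shows "form c x a = (\<lambda>z. c a)"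
proof -
  have "u = 0" unfolding u_def using assms by simp
  then have "form_coeffs x a k = 0" for k by (cases "k = 0") (simp_all add: form_coeffs_def principal_coeffs_def)
  then show ?thesis by (simp add: form_def torus.tform_def[OF torus] dseries_def fun_eq_iff)
qed

text \<open>On the collar the form is its own regular part plus the flipped regular part of the
  other torus, an expression that the flip z \<mapsto> \<epsilon> / z merely interchanges.\<close>

lemma form_sewn:
  assumes x: "system c x" shows "sewn_pair (form c x)"
proof -
  note dec = decays_form_coeffs[OF systemD(1)[OF x]] and h = hole_bounds(1)
  note triv = form_trivial[of c x]
  show ?thesis unfolding sewn_pair_def
  proof (intro conjI allI ballI impI)
    show "form c x a holomorphic_on sewing_piece \<tau> \<epsilon> r a" for a
      using triv torus.tform_holomorphic[OF torus dec h] by (cases "\<epsilon> = 0") (simp_all add: piece_eq form_def)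
    show "form c x a (z + \<omega>) = form c x a z" if "z \<in> sewing_piece \<tau> \<epsilon> r a" "\<omega> \<in> torus_lattice (\<tau> $ a)" for a z \<omega>
      using triv that torus.tform_quasi[OF torus dec h form_coeffs_0] by (cases "\<epsilon> = 0") (simp_all add: piece_eq form_def)
    fix a z assume \<epsilon>: "\<epsilon> \<noteq> 0" and z: "z \<in> collar a"
    have split: "form c x a z = (c a + dseries (form_coeffs x a) (torus.zeta_reg (\<tau> $ a)) z)
        + (c (a + 1) + dseries (form_coeffs x (a + 1)) (torus.zeta_reg (\<tau> $ (a + 1))) (\<epsilon> / z)) * (- \<epsilon> / z\<^sup>2)"
      if z: "z \<in> collar a" for a z
    proof -
      have b: "hole a < cmod z" "cmod z + hole a < min_norm (torus_lattice (\<tau> $ a))"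
          "cmod (\<epsilon> / z) + hole (a + 1) < min_norm (torus_lattice (\<tau> $ (a + 1)))"
        using z collar_flip[OF \<epsilon> z] hole_bounds[of a] hole_bounds[of "a + 1"] r_bounds(2)[of a] r_bounds(2)[of "a + 1"]
        unfolding collar_def by auto
      have "(\<Sum>\<^sub>\<infinity>k. form_coeffs x a k / z ^ Suc k)
        = (c (a + 1) + dseries (form_coeffs x (a + 1)) (torus.zeta_reg (\<tau> $ (a + 1))) (\<epsilon> / z)) * (- \<epsilon> / z\<^sup>2)"
        by (rule torus.principal_part_flip[OF torus dec h form_coeffs_0 b(1) dec h form_coeffs_0 b(3) form_coeffs_relation[OF x]])
      then show ?thesis unfolding form_def using torus.tform_split[OF torus dec h b(1,2), of "c a"] by simp
    qed
    have "z \<noteq> 0" by (rule collar_nz[OF z])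
    then show "form c x a z = form c x (a + 1) (\<epsilon> / z) * (- \<epsilon> / z\<^sup>2)"
      unfolding split[OF z] split[OF collar_flip[OF \<epsilon> z]] two_add using \<epsilon> by (simp add: power2_eq_square field_simps)
  qed
qed

lemma form_coeffs_1: "form_coeffs x a 1 = b_shift x a"
  using r_u[of a] by (simp add: form_coeffs_def principal_coeffs_def b_shift_def mult.assoc[symmetric])

lemma cycle_exists:
  assumes "\<omega> \<in> torus_lattice (\<tau> $ a)" shows "\<exists>\<gamma>. torus_cycle \<tau> \<epsilon> r a \<omega> \<gamma>"
  by (rule torus.punctured_cycle[OF torus hole_bounds(1,3)[of a] assms])
     (use punctured_subset_piece in \<open>auto simp: torus_cycle_def\<close>)

lemma constant_period:
  assumes "torus_cycle \<tau> \<epsilon> r a \<omega> \<gamma>" shows "((\<lambda>z. d) has_contour_integral d * \<omega>) \<gamma>"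
proof -
  have "((\<lambda>z. d) has_contour_integral (d * pathfinish \<gamma> - d * pathstart \<gamma>)) \<gamma>"
    using contour_integral_primitive[of UNIV "\<lambda>z. d * z" "\<lambda>z. d" \<gamma>] assms
    by (auto simp: torus_cycle_def intro!: derivative_eq_intros)
  then show ?thesis using assms by (simp add: torus_cycle_def distrib_left)
qed

lemma form_period:
  assumes x: "system c x" and \<gamma>: "torus_cycle \<tau> \<epsilon> r a (torus.quasi (\<tau> $ a) m n) \<gamma>"
  shows "(form c x a has_contour_integral (c a * torus.quasi (\<tau> $ a) m n + of_int m * b_shift x a)) \<gamma>"
proof -
  show ?thesis
  proof (cases "\<epsilon> = 0")
    case True
    then have "form c x a = (\<lambda>z. c a)" by (rule form_trivial)
    moreover have "b_shift x a = 0" unfolding b_shift_def using True by simp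
    ultimately show ?thesis using constant_period[OF \<gamma>] by simp
  next
    case False
    show ?thesis unfolding form_coeffs_1[symmetric] form_def
      by (rule torus.tform_contour_integral[OF torus decays_form_coeffs[OF systemD(1)[OF x]] hole_bounds(1) form_coeffs_0])
         (use \<gamma> False in \<open>auto simp: torus_cycle_def piece_eq\<close>)
  qed
qed

lemma quasi_basis: "torus.quasi (\<tau> $ a) 0 1 = 2 * pi * \<i>" "torus.quasi (\<tau> $ a) 1 0 = 2 * pi * \<i> * \<tau> $ a"
  by (simp_all add: torus.quasi_def[OF torus])

lemma a_cycle_quasi: "a_cycle \<tau> \<epsilon> r a = torus_cycle \<tau> \<epsilon> r a (torus.quasi (\<tau> $ a) 0 1)"
  and b_cycle_quasi: "b_cycle \<tau> \<epsilon> r a = torus_cycle \<tau> \<epsilon> r a (torus.quasi (\<tau> $ a) 1 0)"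
  by (simp_all add: a_cycle_def b_cycle_def quasi_basis)

lemma omega_period_matrix: "is_period_matrix \<tau> \<epsilon> r omega"
  unfolding is_period_matrix_def
proof (intro exI[of _ "\<lambda>j. form (\<lambda>a. if a = j then 1 else 0) (sol j)"] conjI allI)
  fix i j :: 2
  show "sewn_one_form \<tau> \<epsilon> r (form (\<lambda>a. if a = j then 1 else 0) (sol j))"
    by (rule sewn_pair_imp_one_form[OF form_sewn[OF sol_system]])
  note per = form_period[OF sol_system[of j], of i] and ex = cycle_exists[OF torus.quasi_lattice[OF torus]]
  show "has_period (a_cycle \<tau> \<epsilon> r i) (form (\<lambda>a. if a = j then 1 else 0) (sol j) i) (if i = j then 2 * pi * \<i> else 0)"
    unfolding has_period_def a_cycle_quasi
    using ex[of i 0 1] per[of 0 1] by (auto simp: quasi_basis split: if_splits)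
  show "\<exists>c. has_period (b_cycle \<tau> \<epsilon> r i) (form (\<lambda>a. if a = j then 1 else 0) (sol j) i) c \<and> omega $ i $ j = c / (2 * pi * \<i>)"
    unfolding has_period_def b_cycle_quasi
    using ex[of i 1 0] per[of 1 0]
    by (intro exI[of _ "(if i = j then 1 else 0) * torus.quasi (\<tau> $ i) 1 0 + of_int 1 * b_shift (sol j) i"])
       (auto simp: quasi_basis omega_def)
qed

end

section \<open>Laurent splitting on an annulus\<close>

lemma contour_integral_monomial:
  assumes "0 < s"
  shows "((\<lambda>z. z ^ j / z ^ Suc k) has_contour_integral (if j = k then 2 * pi * \<i> else 0)) (circlepath 0 s)"
proof -
  have "((\<lambda>z. (z - 0) ^ j / (z - 0) ^ Suc k) has_contour_integral
      ((2 * pi * \<i>) / fact k * (deriv ^^ k) (\<lambda>z. (z - 0) ^ j) 0)) (circlepath 0 s)"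
    using assms by (intro Cauchy_has_contour_integral_higher_derivative_circlepath holomorphic_intros continuous_intros) auto
  moreover have "(deriv ^^ k) (\<lambda>z::complex. (z - 0) ^ j) 0 = (if j = k then fact k else 0)"
    unfolding higher_deriv_power by (auto simp: pochhammer_fact power_0_left pochhammer_0_left not_le)
  ultimately show ?thesis by (auto split: if_splits)
qed

text \<open>The disc part integrates to 0 by Cauchy's theorem, and the principal part is integrated
  termwise on the circle, where it converges uniformly.\<close>

lemma laurent_coefficient:
  assumes b: "decays \<delta> b" "0 \<le> \<delta>" "\<delta> < s" and h: "h holomorphic_on ball 0 R" "s < R"
    and F: "\<And>z. cmod z = s \<Longrightarrow> F z = h z + (\<Sum>\<^sub>\<infinity>k. b k / z ^ Suc k)"
  shows "contour_integral (circlepath 0 s) (\<lambda>z. F z * z ^ j) = 2 * pi * \<i> * b j"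
proof -
  have s: "0 < s" using b by linarith
  have sm: "summable (\<lambda>k. cmod (b k) / s ^ Suc k * s ^ j)"
  proof -
    have "summable (\<lambda>k. cmod (b k / of_real s ^ Suc k))"
      by (rule summable_on_imp_summable[OF decays_norm_summable[OF b(1,2)]]) (use b s in auto)
    then show ?thesis using s by (intro summable_mult2) (simp add: norm_divide norm_mult norm_power)
  qed
  have ul: "uniform_limit (sphere 0 s) (\<lambda>n z. \<Sum>k<n. b k * (z ^ j / z ^ Suc k)) (\<lambda>z. suminf (\<lambda>k. b k * (z ^ j / z ^ Suc k))) sequentially"
    by (rule Weierstrass_m_test[OF _ sm]) (use s in \<open>simp add: norm_mult norm_divide norm_power divide_simps\<close>)
  have int: "((\<lambda>z. \<Sum>k<n. b k * (z ^ j / z ^ Suc k)) has_contour_integral (\<Sum>k<n. b k * (if j = k then 2 * pi * \<i> else 0))) (circlepath 0 s)" for n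
    by (intro has_contour_integral_sum has_contour_integral_lmul contour_integral_monomial s) simp
  have ev: "\<forall>\<^sub>F n in sequentially. (\<lambda>z. \<Sum>k<n. b k * (z ^ j / z ^ Suc k)) contour_integrable_on circlepath 0 s"
    using has_contour_integral_integrable[OF int] by simp
  have lim: "(\<lambda>n. contour_integral (circlepath 0 s) (\<lambda>z. \<Sum>k<n. b k * (z ^ j / z ^ Suc k))) \<longlonglongrightarrow>
      contour_integral (circlepath 0 s) (\<lambda>z. suminf (\<lambda>k. b k * (z ^ j / z ^ Suc k)))"
    and intb: "(\<lambda>z. suminf (\<lambda>k. b k * (z ^ j / z ^ Suc k))) contour_integrable_on (circlepath 0 s)"
    using contour_integral_uniform_limit_circlepath[OF ev ul _ s] by simp_all
  have "(\<lambda>n. contour_integral (circlepath 0 s) (\<lambda>z. \<Sum>k<n. b k * (z ^ j / z ^ Suc k))) \<longlonglongrightarrow> 2 * pi * \<i> * b j"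
  proof (rule tendsto_eventually)
    show "\<forall>\<^sub>F n in sequentially. contour_integral (circlepath 0 s) (\<lambda>z. \<Sum>k<n. b k * (z ^ j / z ^ Suc k)) = 2 * pi * \<i> * b j"
      unfolding contour_integral_unique[OF int]
      by (rule eventually_sequentiallyI[of "Suc j"]) (auto simp: if_distrib cong: if_cong)
  qed
  then have P: "((\<lambda>z. suminf (\<lambda>k. b k * (z ^ j / z ^ Suc k))) has_contour_integral (2 * pi * \<i> * b j)) (circlepath 0 s)"
    using LIMSEQ_unique[OF lim] has_contour_integral_integral[OF intb] by simp
  have H: "((\<lambda>z. h z * z ^ j) has_contour_integral 0) (circlepath 0 s)"
    by (rule Cauchy_theorem_disc_simple[of _ 0 R]) (use h s in \<open>auto intro!: holomorphic_intros\<close>)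
  have "((\<lambda>z. F z * z ^ j) has_contour_integral (0 + 2 * pi * \<i> * b j)) (circlepath 0 s)"
  proof (rule has_contour_integral_eq[OF has_contour_integral_add[OF H P]])
    fix z assume "z \<in> path_image (circlepath 0 s)"
    then have z: "cmod z = s" using s by simp
    have "(\<lambda>k. z ^ j * (b k / z ^ Suc k)) sums (z ^ j * (\<Sum>\<^sub>\<infinity>k. b k / z ^ Suc k))"
      by (intro sums_mult principal_part_sums[OF b(1,2)]) (use z b in simp)
    from sums_unique[OF this] have "suminf (\<lambda>k. b k * (z ^ j / z ^ Suc k)) = z ^ j * (\<Sum>\<^sub>\<infinity>k. b k / z ^ Suc k)"
      by (simp add: mult_ac)
    then show "h z * z ^ j + suminf (\<lambda>k. b k * (z ^ j / z ^ Suc k)) = F z * z ^ j"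
      using F[OF z] by (simp add: algebra_simps)
  qed
  then show ?thesis using contour_integral_unique by simp
qed

text \<open>The linear homotopy between concentric circles stays between their radii.\<close>

lemma contour_integral_annulus:
  assumes f: "f holomorphic_on {z. s0 < cmod z \<and> cmod z < R0}" and s: "0 \<le> s0" "s0 < s" "s \<le> R" "R < R0"
  shows "contour_integral (circlepath 0 s) f = contour_integral (circlepath 0 R) f"
proof (rule Cauchy_theorem_homotopic_loops)
  have "{z. s0 < cmod z \<and> cmod z < R0} = ball 0 R0 - cball 0 s0" by auto
  then show "open {z. s0 < cmod z \<and> cmod z < R0}" by (simp add: open_Diff)
  show "homotopic_loops {z. s0 < cmod z \<and> cmod z < R0} (circlepath 0 s) (circlepath 0 R)"
  proof (rule homotopic_loops_linear)
    fix t :: real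
    show "closed_segment (circlepath 0 s t) (circlepath 0 R t) \<subseteq> {z. s0 < cmod z \<and> cmod z < R0}"
    proof
      fix z assume "z \<in> closed_segment (circlepath 0 s t) (circlepath 0 R t)"
      then obtain x where x: "0 \<le> x" "x \<le> 1" "z = (1 - x) *\<^sub>R circlepath 0 s t + x *\<^sub>R circlepath 0 R t"
        by (auto simp: closed_segment_def)
      then have "z = of_real ((1 - x) * s + x * R) * exp (2 * of_real pi * \<i> * of_real t)"
        by (simp add: circlepath scaleR_conv_of_real algebra_simps)
      moreover have "0 \<le> (1 - x) * s + x * R" using x s by simp
      ultimately have e: "cmod z = (1 - x) * s + x * R" by (simp add: norm_mult del: of_real_add of_real_mult of_real_diff)
      have "(1 - x) * s + x * s \<le> (1 - x) * s + x * R" "(1 - x) * s + x * R \<le> (1 - x) * R + x * R"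
        using x s by (intro add_left_mono add_right_mono mult_left_mono; simp)+
      then have "s \<le> cmod z" "cmod z \<le> R" unfolding e by (simp_all add: algebra_simps)
      then show "z \<in> {z. s0 < cmod z \<and> cmod z < R0}" using s by simp
    qed
  qed auto
qed (use f in auto)

text \<open>The Cauchy integral over the outer circle gives h; expanding the Cauchy kernel over the
  inner circle in powers of w / z gives the principal part.\<close>

lemma annulus_laurent:
  assumes f: "f holomorphic_on {z. s0 < cmod z \<and> cmod z < R0}" and s: "0 \<le> s0" "s0 < s" "s < R" "R < R0"
  defines "b \<equiv> \<lambda>k. contour_integral (circlepath 0 s) (\<lambda>w. f w * w ^ k) / (2 * pi * \<i>)"
  obtains h where "h holomorphic_on ball 0 R" "decays s b"
    "\<And>z. s < cmod z \<Longrightarrow> cmod z < R \<Longrightarrow> f z = h z + (\<Sum>\<^sub>\<infinity>k. b k / z ^ Suc k)"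
proof -
  let ?A = "{z. s0 < cmod z \<and> cmod z < R0}"
  have "?A = ball 0 R0 - cball 0 s0" by auto
  then have oA: "open ?A" by (simp add: open_Diff)
  have s0: "0 < s" using s by linarith
  have cf: "continuous_on ?A f" by (rule holomorphic_on_imp_continuous_on[OF f])
  have cR: "continuous_on (sphere 0 R) f" and cs: "continuous_on (sphere 0 s) f"
    by (rule continuous_on_subset[OF cf]; use s in auto)+
  define h where "h z = contour_integral (circlepath 0 R) (\<lambda>w. f w / (w - z)) / (2 * pi * \<i>)" for z
  have "bounded (f ` sphere 0 s)" by (intro compact_imp_bounded compact_continuous_image cs) simp
  then obtain M where M: "0 < M" "\<And>w. cmod w = s \<Longrightarrow> cmod (f w) \<le> M"
    by (auto simp: bounded_pos)
  have intR: "((\<lambda>w. f w / (w - z) ^ 1) has_contour_integral (2 * pi * \<i> * h z)) (circlepath 0 R)" if "z \<in> ball 0 R" for z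
  proof -
    have "(\<lambda>w. f w / (w - z)) contour_integrable_on circlepath 0 R"
      using that s by (intro contour_integrable_continuous_circlepath continuous_intros) (use cR in \<open>auto simp: dist_norm\<close>)
    then show ?thesis using has_contour_integral_integral by (simp add: h_def)
  qed
  have hol: "h holomorphic_on ball 0 R"
  proof -
    have "(\<lambda>z. 2 * pi * \<i> * h z) holomorphic_on ball 0 R"
      unfolding holomorphic_on_open[OF open_ball]
      by (intro ballI exI) (rule Cauchy_next_derivative_circlepath(2)[OF _ intR], use cR s in auto)
    then have "(\<lambda>z. 2 * pi * \<i> * h z / (2 * pi * \<i>)) holomorphic_on ball 0 R"
      by (rule holomorphic_on_divide[OF _ holomorphic_on_const]) simp
    then show ?thesis by (rule holomorphic_transform) simp
  qed
  have intb: "((\<lambda>w. f w * w ^ k) has_contour_integral (2 * pi * \<i> * b k)) (circlepath 0 s)" for k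
  proof -
    have "(\<lambda>w. f w * w ^ k) contour_integrable_on circlepath 0 s"
      using s0 by (intro contour_integrable_continuous_circlepath continuous_intros) (use cs in auto)
    then show ?thesis using has_contour_integral_integral by (simp add: b_def)
  qed
  have dec: "decays s b" unfolding decays_def
  proof (intro allI impI)
    fix d assume d: "s < d"
    have bb: "cmod (b k) \<le> M * s ^ k * s" for k
    proof -
      have "cmod (2 * pi * \<i> * b k) \<le> M * s ^ k * (2 * pi * s)"
        by (rule has_contour_integral_bound_circlepath[OF intb _ s0])
           (use M s0 in \<open>auto simp: norm_mult norm_power intro!: mult_right_mono\<close>)
      then show ?thesis by (simp add: norm_mult)
    qed
    have "(\<lambda>k. M * s * (s / d) ^ k) summable_on UNIV"
      using d s0 M by (intro summable_nonneg_imp_summable_on summable_mult summable_geometric) auto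
    then show "(\<lambda>k. cmod (b k) / d ^ k) summable_on UNIV"
    proof (rule summable_on_comparison_test)
      show "cmod (b k) / d ^ k \<le> M * s * (s / d) ^ k" for k
        using divide_right_mono[OF bb[of k], of "d ^ k"] d s0 by (simp add: power_divide mult_ac)
    qed (use d s0 in auto)
  qed
  have "f z = h z + (\<Sum>\<^sub>\<infinity>k. b k / z ^ Suc k)" if z: "s < cmod z" "cmod z < R" for z
  proof -
    have nz: "z \<noteq> 0" and lt1: "s / cmod z < 1" using z s0 by (auto intro!: divide_less_eq_1_pos[THEN iffD2])
    \<comment> \<open>The difference quotient extends holomorphically over z, so its integrals over
      both circles agree. This is the Cauchy formula for the annulus, without a keyhole
      contour.\<close>
    define F where "F w = (if w = z then deriv f z else (f w - f z) / (w - z))" for w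
    have "F holomorphic_on ?A" unfolding F_def by (rule pole_lemma_open[OF f oA])
    then have FF: "contour_integral (circlepath 0 s) F = contour_integral (circlepath 0 R) F"
      by (rule contour_integral_annulus) (use s in auto)
    have "((\<lambda>w. 1 / (w - z)) has_contour_integral (2 * of_real pi * \<i> * 1)) (circlepath 0 R)"
      by (rule Cauchy_integral_circlepath_simple) (use z in \<open>auto intro!: holomorphic_intros\<close>)
    from has_contour_integral_lmul[OF this, of "f z"] have "((\<lambda>w. f w / (w - z) ^ 1 - f z * (1 / (w - z))) has_contour_integral
        (2 * pi * \<i> * h z - f z * (2 * of_real pi * \<i> * 1))) (circlepath 0 R)"
      by (intro has_contour_integral_diff intR) (use z in simp)
    then have "(F has_contour_integral (2 * pi * \<i> * h z - f z * (2 * of_real pi * \<i> * 1))) (circlepath 0 R)"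
      by (rule has_contour_integral_eq) (use z s in \<open>auto simp: F_def diff_divide_distrib\<close>)
    then have FR: "contour_integral (circlepath 0 R) F = 2 * pi * \<i> * (h z - f z)"
      using contour_integral_unique by (force simp: algebra_simps)
    \<comment> \<open>The partial sum of the geometric series and the kernel itself differ by the
      remainder with numerator q = (w / z)^n.\<close>
    have combine: "A * (1 - q) / (z - w) + (A - B) / (w - z) + B * (1 / (w - z)) = - (A * q / (z - w))" if "w \<noteq> z" for A B q w :: complex
      using that by (simp add: divide_simps) (simp add: algebra_simps)
    have i1: "((\<lambda>w. f z * (1 / (w - z))) has_contour_integral (f z * 0)) (circlepath 0 s)"
      by (intro has_contour_integral_lmul Cauchy_theorem_disc_simple[of _ 0 "cmod z"] holomorphic_intros) (use z s0 in auto)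
    have lim: "(\<lambda>n. \<Sum>k<n. 2 * pi * \<i> * (b k / z ^ Suc k)) \<longlonglongrightarrow> - contour_integral (circlepath 0 s) F"
    proof -
      have "cmod ((\<Sum>k<n. 2 * pi * \<i> * (b k / z ^ Suc k)) + contour_integral (circlepath 0 s) F) \<le> M / (cmod z - s) * (2 * pi * s) * (s / cmod z) ^ n" for n
      proof -
        have i2: "((\<lambda>w. \<Sum>k<n. f w * w ^ k * (1 / z ^ Suc k)) has_contour_integral (\<Sum>k<n. 2 * pi * \<i> * b k * (1 / z ^ Suc k))) (circlepath 0 s)"
          by (intro has_contour_integral_sum has_contour_integral_rmul intb) simp
        have "(\<lambda>w. f w / (w - z)) contour_integrable_on circlepath 0 s"
          using z s0 by (intro contour_integrable_continuous_circlepath continuous_intros) (use cs in auto)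
        from has_contour_integral_diff[OF has_contour_integral_integral[OF this] i1]
        have iF: "(F has_contour_integral (contour_integral (circlepath 0 s) (\<lambda>w. f w / (w - z)) - f z * 0)) (circlepath 0 s)"
          by (rule has_contour_integral_eq) (use z s0 in \<open>auto simp: F_def diff_divide_distrib\<close>)
        have "((\<lambda>w. (\<Sum>k<n. f w * w ^ k * (1 / z ^ Suc k)) + F w + f z * (1 / (w - z))) has_contour_integral
          (\<Sum>k<n. 2 * pi * \<i> * b k * (1 / z ^ Suc k)) + contour_integral (circlepath 0 s) F + f z * 0) (circlepath 0 s)"
          using iF by (intro has_contour_integral_add i1 i2) (simp add: contour_integral_unique)
        then have "cmod ((\<Sum>k<n. 2 * pi * \<i> * b k * (1 / z ^ Suc k)) + contour_integral (circlepath 0 s) F + f z * 0)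
            \<le> M / (cmod z - s) * (s / cmod z) ^ n * (2 * pi * s)"
        proof (rule has_contour_integral_bound_circlepath[OF _ _ s0])
          show "0 \<le> M / (cmod z - s) * (s / cmod z) ^ n" using M z s0 by simp
          fix w :: complex assume "cmod (w - 0) = s"
          then have w: "cmod w = s" by simp
          then have wz: "w \<noteq> z" using z by auto
          have "(\<Sum>k<n. f w * w ^ k * (1 / z ^ Suc k)) = f w / z * (\<Sum>k<n. (w / z) ^ k)"
            by (simp add: sum_distrib_left power_divide)
          also have "(\<Sum>k<n. (w / z) ^ k) = (1 - (w / z) ^ n) / (1 - w / z)"
            using wz nz by (intro sum_gp_strict[THEN trans]) auto
          also have "f w / z * ((1 - (w / z) ^ n) / (1 - w / z)) = f w * (1 - (w / z) ^ n) / (z - w)"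
            using wz nz by (simp add: divide_simps)
          finally have "(\<Sum>k<n. f w * w ^ k * (1 / z ^ Suc k)) + F w + f z * (1 / (w - z)) = - (f w * (w / z) ^ n / (z - w))"
            using combine[OF wz] wz by (simp add: F_def)
          then have "cmod ((\<Sum>k<n. f w * w ^ k * (1 / z ^ Suc k)) + F w + f z * (1 / (w - z))) = cmod (f w) * (s / cmod z) ^ n / cmod (z - w)"
            by (simp add: norm_mult norm_divide norm_power w)
          also have "\<dots> \<le> M * (s / cmod z) ^ n / (cmod z - s)"
            using M w z s0 norm_triangle_ineq2[of z w] by (intro frac_le mult_right_mono) auto
          finally show "cmod ((\<Sum>k<n. f w * w ^ k * (1 / z ^ Suc k)) + F w + f z * (1 / (w - z))) \<le> M / (cmod z - s) * (s / cmod z) ^ n"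
            by simp
        qed
        then show ?thesis by (simp add: mult_ac)
      qed
      then have bound: "\<forall>\<^sub>F n in sequentially. cmod ((\<Sum>k<n. 2 * pi * \<i> * (b k / z ^ Suc k)) + contour_integral (circlepath 0 s) F)
          \<le> M / (cmod z - s) * (2 * pi * s) * (s / cmod z) ^ n" by simp
      have lim0: "(\<lambda>n. M / (cmod z - s) * (2 * pi * s) * (s / cmod z) ^ n) \<longlonglongrightarrow> M / (cmod z - s) * (2 * pi * s) * 0"
        using lt1 s0 by (intro tendsto_mult tendsto_const LIMSEQ_power_zero) simp
      have "(\<lambda>n. (\<Sum>k<n. 2 * pi * \<i> * (b k / z ^ Suc k)) + contour_integral (circlepath 0 s) F) \<longlonglongrightarrow> 0"
        by (rule Lim_null_comparison[OF bound lim0[simplified mult_zero_right]])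
      from tendsto_diff[OF this tendsto_const[of "contour_integral (circlepath 0 s) F"]] show ?thesis by simp
    qed
    have "(\<lambda>n. \<Sum>k<n. 2 * pi * \<i> * (b k / z ^ Suc k)) \<longlonglongrightarrow> 2 * pi * \<i> * (\<Sum>\<^sub>\<infinity>k. b k / z ^ Suc k)"
      unfolding sums_def[symmetric] using s0 z by (intro sums_mult principal_part_sums[OF dec]) auto
    then have "2 * pi * \<i> * (\<Sum>\<^sub>\<infinity>k. b k / z ^ Suc k) = - (2 * pi * \<i> * (h z - f z))"
      using LIMSEQ_unique[OF lim] FF FR by simp
    then have "2 * pi * \<i> * (\<Sum>\<^sub>\<infinity>k. b k / z ^ Suc k) = 2 * pi * \<i> * (f z - h z)" by (simp add: algebra_simps)
    then show ?thesis by simp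
  qed
  then show ?thesis using that[OF hol dec] by blast
qed

section \<open>Classification of one-forms on a punctured torus\<close>

context torus begin

lemma lattice_reduction:
  obtains \<omega> where "\<omega> \<in> \<Lambda>" "cmod (z + \<omega>) \<le> 2 * pi * (cmod \<tau> + 1)"
proof -
  define w where "w = z / (2 * pi * \<i>)"
  define s where "s = Im w / Im \<tau>"
  define t where "t = Re w - s * Re \<tau>"
  have "w = of_real s * \<tau> + of_real t" using Im_pos by (simp add: complex_eq_iff s_def t_def)
  moreover have "z = 2 * pi * \<i> * w" by (simp add: w_def)
  ultimately have z: "z = of_real s * (2 * pi * \<i> * \<tau>) + of_real t * (2 * pi * \<i>)" by (simp add: algebra_simps)
  have "z + quasi (- \<lfloor>s\<rfloor>) (- \<lfloor>t\<rfloor>) = of_real (frac s) * (2 * pi * \<i> * \<tau>) + of_real (frac t) * (2 * pi * \<i>)"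
    by (simp add: z quasi_def frac_def algebra_simps)
  also have "cmod \<dots> \<le> cmod (of_real (frac s) * (2 * pi * \<i> * \<tau>)) + cmod (of_real (frac t) * (2 * pi * \<i>))"
    by (rule norm_triangle_ineq)
  also have "\<dots> = frac s * (2 * pi * cmod \<tau>) + frac t * (2 * pi)" by (simp add: norm_mult frac_ge_0)
  also have "\<dots> \<le> 1 * (2 * pi * cmod \<tau>) + 1 * (2 * pi)"
    using frac_lt_1[of s] frac_lt_1[of t] by (intro add_mono mult_right_mono) auto
  finally show ?thesis using that[OF quasi_lattice] by (simp add: algebra_simps)
qed

text \<open>The disc of \<open>lattice_reduction\<close> meets every coset of the lattice, so f is
  bounded by its values there and Liouville's theorem applies.\<close>

lemma entire_periodic_constant:
  assumes f: "f holomorphic_on UNIV" and per: "\<And>z \<omega>. \<omega> \<in> \<Lambda> \<Longrightarrow> f (z + \<omega>) = f z"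
  obtains c where "\<And>z. f z = c"
proof -
  let ?C = "cball 0 (2 * pi * (cmod \<tau> + 1)) :: complex set"
  have "range f \<subseteq> f ` ?C"
  proof
    fix y assume "y \<in> range f"
    then obtain z where z: "y = f z" by blast
    obtain \<omega> where "\<omega> \<in> \<Lambda>" "cmod (z + \<omega>) \<le> 2 * pi * (cmod \<tau> + 1)" by (rule lattice_reduction)
    then have "y = f (z + \<omega>)" "z + \<omega> \<in> ?C" using per z by auto
    then show "y \<in> f ` ?C" by blast
  qed
  moreover have "bounded (f ` ?C)"
    using f by (intro compact_imp_bounded compact_continuous_image holomorphic_on_imp_continuous_on)
      (auto intro: holomorphic_on_subset)
  ultimately have "bounded (range f)" by (rule bounded_subset[rotated])
  then show ?thesis using Liouville_theorem[OF f] that by (auto simp: constant_on_def)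
qed

text \<open>Subtracting the series of derivatives with the same principal part leaves a function
  that extends over all the holes. The extension is entire and periodic, hence constant. The
  vanishing residue gives \<open>v 0 = 0\<close> and thereby the periodicity of the subtracted
  series.\<close>

lemma punctured_form_classification:
  assumes f: "f holomorphic_on punctured \<delta>" and per: "\<And>z \<omega>. z \<in> punctured \<delta> \<Longrightarrow> \<omega> \<in> \<Lambda> \<Longrightarrow> f (z + \<omega>) = f z"
    and \<delta>: "0 \<le> \<delta>" "\<delta> < s" "s < D / 2" and res: "contour_integral (circlepath 0 s) f = 0"
  obtains c v where "decays s v" "v 0 = 0" "\<And>z. z \<in> punctured s \<Longrightarrow> f z = tform c v z"
proof -
  define R where "R = (s + D / 2) / 2"
  have R: "s < R" "R < D / 2" "0 \<le> s" using \<delta> by (auto simp: R_def)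
  define v where "v = (\<lambda>k. contour_integral (circlepath 0 s) (\<lambda>w. f w * w ^ k) / (2 * pi * \<i>))"
  have "{z. \<delta> < cmod z \<and> cmod z < D / 2} \<subseteq> punctured \<delta>" using annulus_punctured[of \<delta>] \<delta> by auto
  then have fA: "f holomorphic_on {z. \<delta> < cmod z \<and> cmod z < D / 2}" by (rule holomorphic_on_subset[OF f])
  obtain h where h: "h holomorphic_on ball 0 R" and dec: "decays s v"
    and fh: "\<And>z. s < cmod z \<Longrightarrow> cmod z < R \<Longrightarrow> f z = h z + (\<Sum>\<^sub>\<infinity>k. v k / z ^ Suc k)"
    by (rule annulus_laurent[OF fA \<delta>(1,2) R(1,2), folded v_def]) (rule that, assumption, assumption, simp add: v_def)
  have v0: "v 0 = 0" using res by (simp add: v_def)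
  have sub: "punctured s \<subseteq> punctured \<delta>" using \<delta> by (auto simp: punctured_def)
  define e where "e z = h z - dseries v zeta_reg z" for z
  define E0 where "E0 z = f z - dseries v zeta z" for z
  \<comment> \<open>Glued from the regular part e, translated to each lattice point, and the
    difference E0 elsewhere. The description is unambiguous since R is below D / 2.\<close>
  define E where "E z = (if \<exists>\<kappa>\<in>\<Lambda>. cmod (z - \<kappa>) < R then e (z - (THE \<kappa>. \<kappa> \<in> \<Lambda> \<and> cmod (z - \<kappa>) < R)) else E0 z)" for z
  have e: "e holomorphic_on ball 0 R" unfolding e_def
    using R by (intro holomorphic_intros h dseries_zeta_reg_holomorphic[OF dec R(3)]) simp
  have E0: "E0 holomorphic_on punctured s" unfolding E0_def
    using holomorphic_on_diff[OF holomorphic_on_subset[OF f sub] tform_holomorphic[OF dec R(3), of 0]] by (simp add: tform_def)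
  have E0_per: "E0 (z + \<omega>) = E0 z" if "z \<in> punctured s" "\<omega> \<in> \<Lambda>" for z \<omega>
    using per[of z \<omega>] that sub tform_quasi[OF dec R(3) v0 that, of 0] by (auto simp: E0_def tform_def)
  have E0_e: "E0 z = e z" if "s < cmod z" "cmod z < R" for z
    using fh[OF that] dseries_zeta_split[OF dec R(3) that(1)] that R by (simp add: E0_def e_def)
  have near: "E z = e (z - \<kappa>)" if k: "\<kappa> \<in> \<Lambda>" "cmod (z - \<kappa>) < R" for z \<kappa>
  proof -
    have "(THE \<kappa>. \<kappa> \<in> \<Lambda> \<and> cmod (z - \<kappa>) < R) = \<kappa>"
      using k R by (intro the_equality conjI) (auto intro!: nearest_unique[of _ _ z])
    then show ?thesis using k by (auto simp: E_def)
  qed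
  have far: "E z = E0 z" if z: "z \<in> punctured s" for z
  proof (cases "\<exists>\<kappa>\<in>\<Lambda>. cmod (z - \<kappa>) < R")
    case True
    then obtain \<kappa> where k: "\<kappa> \<in> \<Lambda>" "cmod (z - \<kappa>) < R" by blast
    have "s < cmod (z - \<kappa>)" using z k by (simp add: punctured_def)
    then have "E z = E0 (z + - \<kappa>)" using near[OF k] E0_e k by simp
    then show ?thesis using E0_per[OF z torus_lattice_uminus[OF k(1)]] by simp
  qed (auto simp: E_def)
  have cover: "z \<in> punctured s \<or> (\<exists>\<kappa>\<in>\<Lambda>. cmod (z - \<kappa>) < R)" for z
    using R by (fastforce simp: punctured_def)
  have "E holomorphic_on (punctured s \<union> (\<Union>\<kappa>\<in>\<Lambda>. ball \<kappa> R))"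
  proof (rule holomorphic_on_Un)
    show "E holomorphic_on punctured s" by (rule holomorphic_transform[OF E0]) (simp add: far)
    show "E holomorphic_on (\<Union>\<kappa>\<in>\<Lambda>. ball \<kappa> R)"
    proof (rule holomorphic_on_UN_open)
      fix \<kappa> assume k: "\<kappa> \<in> \<Lambda>"
      have "(e \<circ> (\<lambda>z. z - \<kappa>)) holomorphic_on ball \<kappa> R"
        by (rule holomorphic_on_compose_gen[OF _ e]) (auto intro!: holomorphic_intros simp: dist_norm norm_minus_commute)
      then show "E holomorphic_on ball \<kappa> R"
        by (rule holomorphic_transform) (use near[OF k] in \<open>auto simp: dist_norm norm_minus_commute\<close>)
    qed auto
  qed (use punctured_open R in auto)
  moreover have "punctured s \<union> (\<Union>\<kappa>\<in>\<Lambda>. ball \<kappa> R) = UNIV"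
  proof (intro equalityI subsetI UNIV_I)
    fix z
    show "z \<in> punctured s \<union> (\<Union>\<kappa>\<in>\<Lambda>. ball \<kappa> R)"
      using cover[of z] by (auto simp: dist_norm norm_minus_commute)
  qed
  ultimately have hol: "E holomorphic_on UNIV" by simp
  have perE: "E (z + \<omega>) = E z" if \<omega>: "\<omega> \<in> \<Lambda>" for z \<omega>
  proof (cases "z \<in> punctured s")
    case True
    then show ?thesis using far[OF punctured_shift[OF True \<omega>]] far[OF True] E0_per[OF True \<omega>] by simp
  next
    case False
    then obtain \<kappa> where k: "\<kappa> \<in> \<Lambda>" "cmod (z - \<kappa>) < R" using cover by blast
    have "\<kappa> + \<omega> \<in> \<Lambda>" by (rule torus_lattice_add[OF k(1) \<omega>])
    then show ?thesis using near[OF k] near[of "\<kappa> + \<omega>" "z + \<omega>"] k by simp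
  qed
  obtain c where c: "\<And>z. E z = c" by (rule entire_periodic_constant[OF hol]) (rule perE, assumption, rule that)
  have "f z = tform c v z" if "z \<in> punctured s" for z
    using far[OF that] c[of z] by (simp add: E0_def tform_def algebra_simps)
  then show ?thesis using that[OF dec v0] by blast
qed

end

section \<open>Uniqueness of the period matrix\<close>

text \<open>The terms of a power series convergent at \<sigma> are bounded.\<close>

lemma (in torus) regular_coeff_bounded:
  assumes v: "decays \<delta> v" "0 \<le> \<delta>" "v 0 = 0" and \<sigma>: "0 < \<sigma>" "\<sigma> + \<delta> < D"
  obtains B where "0 \<le> B" "\<And>l. 1 \<le> l \<Longrightarrow> cmod (regular_coeff a v l) \<le> B / \<sigma> ^ l"
proof -
  have "summable (\<lambda>n. regular_coeff a v (Suc n) * of_real \<sigma> ^ n)"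
    using tform_regular_sums[OF v, of "of_real \<sigma>" a] \<sigma> by (simp add: sums_iff)
  then have "Bseq (\<lambda>n. regular_coeff a v (Suc n) * of_real \<sigma> ^ n)"
    by (rule convergent_imp_Bseq[OF convergentI[OF summable_LIMSEQ_zero]])
  then obtain B where B: "0 < B" "\<And>n. cmod (regular_coeff a v (Suc n) * of_real \<sigma> ^ n) \<le> B" by (auto simp: Bseq_def)
  have "cmod (regular_coeff a v l) \<le> B * \<sigma> / \<sigma> ^ l" if "1 \<le> l" for l
    using B(2)[of "l - 1"] that \<sigma> by (cases l) (simp_all add: norm_mult norm_power pos_le_divide_eq)
  then show ?thesis using that[of "B * \<sigma>"] B \<sigma> by auto
qed

lemma l2_geometric_dominated:
  assumes "\<And>k. 1 \<le> k \<Longrightarrow> cmod (x k) \<le> B * q ^ k" "0 \<le> q" "q < 1"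
  shows "l2 x"
  unfolding l2_def
proof (rule summable_on_comparison_test)
  have "summable (\<lambda>k. B\<^sup>2 * (q\<^sup>2) ^ k)" using assms by (intro summable_mult summable_geometric) (simp add: power_less_one_iff)
  then have "(\<lambda>k. B\<^sup>2 * (q\<^sup>2) ^ k) summable_on UNIV" by (intro summable_nonneg_imp_summable_on) auto
  then show "(\<lambda>k. B\<^sup>2 * (q\<^sup>2) ^ k) summable_on {1..}" by (rule summable_on_subset_banach) auto
  show "(cmod (x k))\<^sup>2 \<le> B\<^sup>2 * (q\<^sup>2) ^ k" if "k \<in> {1..}" for k
    using power_mono[OF assms(1), of k 2] that by (simp add: power_mult_distrib power_mult[symmetric] mult.commute)
qed auto

context sewing begin

text \<open>The converse of \<open>principal_part_flip\<close>: the form is expanded on one circle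
  in the collar in two ways, directly and through the other torus. Both have a part holomorphic in
  the disc and a principal part, and the integrals in \<open>laurent_coefficient\<close> compare the
  latter.\<close>

lemma flipped_coefficients:
  assumes \<epsilon>: "\<epsilon> \<noteq> 0" and dec: "\<And>a. decays (hole a) (v a)" and v0: "\<And>a. v a 0 = 0"
    and rel: "\<And>a z. z \<in> collar a \<Longrightarrow> torus.tform (\<tau> $ a) (c a) (v a) z
        = torus.tform (\<tau> $ (a + 1)) (c (a + 1)) (v (a + 1)) (\<epsilon> / z) * (- \<epsilon> / z\<^sup>2)"
    and k: "1 \<le> k"
  shows "v a k = - (\<epsilon> ^ k) * torus.regular_coeff (\<tau> $ (a + 1)) (c (a + 1)) (v (a + 1)) k"
proof -
  let ?\<alpha> = "torus.regular_coeff (\<tau> $ (a + 1)) (c (a + 1)) (v (a + 1))"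
  let ?D = "\<lambda>a. min_norm (torus_lattice (\<tau> $ a))"
  note h = hole_bounds(1)
  define b where "b k = (if k = 0 then 0 else - (\<epsilon> ^ k) * ?\<alpha> k)" for k
  obtain B where B: "0 \<le> B" "\<And>l. 1 \<le> l \<Longrightarrow> cmod (?\<alpha> l) \<le> B / (r $ (a + 1)) ^ l"
    by (rule torus.regular_coeff_bounded[OF torus dec h v0 r_bounds(1)])
       (use r_bounds(2)[of "a + 1"] hole_bounds(3)[of "a + 1"] that in auto)
  have decb: "decays (hole a) b" unfolding decays_def
  proof (intro allI impI)
    fix d assume d: "hole a < d"
    then have d0: "0 < d" using h[of a] by linarith
    have "(\<lambda>k. B * (hole a / d) ^ k) summable_on UNIV"
      using d d0 h[of a] B by (intro summable_nonneg_imp_summable_on summable_mult summable_geometric) auto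
    then show "(\<lambda>k. cmod (b k) / d ^ k) summable_on UNIV"
    proof (rule summable_on_comparison_test)
      fix k
      show "cmod (b k) / d ^ k \<le> B * (hole a / d) ^ k"
      proof (cases "k = 0")
        case False
        then have "cmod \<epsilon> ^ k * cmod (?\<alpha> k) \<le> cmod \<epsilon> ^ k * (B / (r $ (a + 1)) ^ k)" using B(2)[of k] by (intro mult_left_mono) auto
        then have "cmod (b k) \<le> B * hole a ^ k"
          using False by (simp add: b_def norm_mult norm_power hole_def power_divide mult.commute)
        then show ?thesis using d0 by (simp add: power_divide divide_right_mono)
      qed (simp add: b_def B)
    qed (use d0 in auto)
  qed
  define P where "P z = (\<Sum>\<^sub>\<infinity>k. v (a + 1) k / z ^ Suc k)" for z
  \<comment> \<open>The flip of the other torus's principal part. It is a power series convergent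
    for \<open>cmod z < r $ a\<close>, and the value at 0 is its constant term.\<close>
  define h' where "h' z = (if z = 0 then - (v (a + 1) 1 / \<epsilon>) else P (\<epsilon> / z) * (- \<epsilon> / z\<^sup>2))" for z
  have "h' holomorphic_on ball 0 (r $ a)"
  proof (rule power_series_holomorphic)
    fix z :: complex assume z: "z \<in> ball 0 (r $ a)"
    show "(\<lambda>n. - (v (a + 1) (Suc n) / \<epsilon> ^ Suc n) * (z - 0) ^ n) sums h' z"
    proof (cases "z = 0")
      case True
      then show ?thesis using powser_sums_zero[of "\<lambda>n. - (v (a + 1) (Suc n) / \<epsilon> ^ Suc n)"] by (simp add: h'_def)
    next
      case False
      have "hole (a + 1) < cmod (\<epsilon> / z)"
        using z False \<epsilon> r_bounds(1)[of a] by (simp add: hole_def two_add norm_divide divide_strict_left_mono)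
      then have "(\<lambda>k. v (a + 1) k / (\<epsilon> / z) ^ Suc k) sums P (\<epsilon> / z)" unfolding P_def by (rule principal_part_sums[OF dec h])
      then have "(\<lambda>n. v (a + 1) (Suc n) / (\<epsilon> / z) ^ Suc (Suc n)) sums P (\<epsilon> / z)"
        using sums_Suc_iff[of "\<lambda>k. v (a + 1) k / (\<epsilon> / z) ^ Suc k"] v0 by simp
      then have "(\<lambda>n. v (a + 1) (Suc n) / (\<epsilon> / z) ^ Suc (Suc n) * (- \<epsilon> / z\<^sup>2)) sums (P (\<epsilon> / z) * (- \<epsilon> / z\<^sup>2))" by (rule sums_mult2)
      also have "(\<lambda>n. v (a + 1) (Suc n) / (\<epsilon> / z) ^ Suc (Suc n) * (- \<epsilon> / z\<^sup>2)) = (\<lambda>n. - (v (a + 1) (Suc n) / \<epsilon> ^ Suc n) * (z - 0) ^ n)"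
        using False \<epsilon> by (simp add: power_divide power2_eq_square field_simps)
      finally show ?thesis using False by (simp add: h'_def)
    qed
  qed
  define s where "s = (hole a + r $ a) / 2"
  have s: "hole a < s" "s < r $ a" using hole_bounds(2)[of a] by (auto simp: s_def)
  let ?F = "torus.tform (\<tau> $ a) (c a) (v a)"
  have bd: "hole a < cmod z" "cmod z + hole a < ?D a" "hole (a + 1) < cmod (\<epsilon> / z)" "cmod (\<epsilon> / z) + hole (a + 1) < ?D (a + 1)" "z \<noteq> 0" "z \<in> collar a"
    if "cmod z = s" for z
  proof -
    show z: "z \<in> collar a" using that s by (simp add: collar_def)
    show "z \<noteq> 0" by (rule collar_nz[OF z])
    show "hole a < cmod z" "cmod z + hole a < ?D a" "hole (a + 1) < cmod (\<epsilon> / z)" "cmod (\<epsilon> / z) + hole (a + 1) < ?D (a + 1)"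
      using z collar_flip[OF \<epsilon> z] hole_bounds(3)[of a] hole_bounds(3)[of "a + 1"] r_bounds(2)[of a] r_bounds(2)[of "a + 1"]
      unfolding collar_def by auto
  qed
  have "contour_integral (circlepath 0 s) (\<lambda>z. ?F z * z ^ k) = 2 * pi * \<i> * v a k"
    by (rule laurent_coefficient[OF dec h s(1) torus.tform_regular_holomorphic[OF torus dec h]])
       (use bd torus.tform_split[OF torus dec h] s(2) hole_bounds(3)[of a] r_bounds(2)[of a] in auto)
  moreover have "contour_integral (circlepath 0 s) (\<lambda>z. ?F z * z ^ k) = 2 * pi * \<i> * b k"
  proof (rule laurent_coefficient[OF decb h s(1) \<open>h' holomorphic_on ball 0 (r $ a)\<close> s(2)])
    fix z assume "cmod z = s"
    note z = bd[OF this]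
    have "(\<Sum>\<^sub>\<infinity>k. b k / z ^ Suc k) = (c (a + 1) + dseries (v (a + 1)) (torus.zeta_reg (\<tau> $ (a + 1))) (\<epsilon> / z)) * (- \<epsilon> / z\<^sup>2)"
      by (rule torus.principal_part_flip[OF torus decb h _ z(1) dec h v0 z(4)]) (simp_all add: b_def)
    then show "?F z = h' z + (\<Sum>\<^sub>\<infinity>k. b k / z ^ Suc k)"
      unfolding rel[OF z(6)] torus.tform_split[OF torus dec h z(3,4)] P_def[symmetric]
      using z(5) by (simp add: h'_def algebra_simps)
  qed
  ultimately have "2 * pi * \<i> * v a k = 2 * pi * \<i> * b k" by simp
  then have "v a k = b k" by simp
  then show ?thesis using k by (simp add: b_def)
qed

text \<open>Recovers the linear system from matching forms. Square-summability is clear because the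
  regular coefficients are controlled up to radius D / 2 while x is scaled with the smaller
  \<open>r $ a\<close>, so x decays geometrically.\<close>

lemma forms_system:
  assumes \<epsilon>: "\<epsilon> \<noteq> 0" and dec: "\<And>a. decays (hole a) (v a)" and v0: "\<And>a. v a 0 = 0"
    and rel: "\<And>a z. z \<in> collar a \<Longrightarrow> torus.tform (\<tau> $ a) (c a) (v a) z
        = torus.tform (\<tau> $ (a + 1)) (c (a + 1)) (v (a + 1)) (\<epsilon> / z) * (- \<epsilon> / z\<^sup>2)"
  defines "x \<equiv> \<lambda>a l. torus.regular_coeff (\<tau> $ a) (c a) (v a) l * of_real (r $ a ^ l / sqrt (real l))"
  shows "system c x" and "b_shift x a = v a 1"
proof -
  let ?D = "\<lambda>a. min_norm (torus_lattice (\<tau> $ a))"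
  have fc: "form_coeffs x a = v a" for a
  proof
    fix k show "form_coeffs x a k = v a k"
    proof (cases "k = 0")
      case False
      have "form_coeffs x a k = - of_real (sqrt (real k)) * (of_real (r $ a) ^ k * u ^ k) * x (a + 1) k"
        by (simp add: form_coeffs_def principal_coeffs_def)
      also have "\<dots> = - (\<epsilon> ^ k) * torus.regular_coeff (\<tau> $ (a + 1)) (c (a + 1)) (v (a + 1)) k"
        unfolding r_u_power x_def using False r_bounds(1)[of "a + 1"] by simp
      finally show ?thesis using flipped_coefficients[OF \<epsilon> dec v0 rel, of k a] False by simp
    qed (simp add: form_coeffs_0 v0)
  qed
  show "b_shift x a = v a 1" using form_coeffs_1 fc by metis
  show "system c x" unfolding system_def
  proof (intro conjI allI impI)
    fix a
    have D: "0 < ?D a" using r_bounds[of a] by linarith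
    obtain B where B: "0 \<le> B" "\<And>l. 1 \<le> l \<Longrightarrow> cmod (torus.regular_coeff (\<tau> $ a) (c a) (v a) l) \<le> B / (?D a / 2) ^ l"
      by (rule torus.regular_coeff_bounded[OF torus dec hole_bounds(1) v0, of "?D a / 2" a])
         (use D hole_bounds(3)[of a] that in auto)
    show "l2 (x a)"
    proof (rule l2_geometric_dominated[of _ B "r $ a / (?D a / 2)"])
      fix k :: nat assume k: "1 \<le> k"
      have "1 \<le> sqrt (real k)" using k by simp
      then have "r $ a ^ k / sqrt (real k) \<le> r $ a ^ k / 1" using r_bounds(1)[of a] by (intro divide_left_mono) auto
      then have "cmod (x a k) \<le> B / (?D a / 2) ^ k * (r $ a ^ k)"
        using r_bounds(1)[of a] B(1) D unfolding x_def norm_mult norm_of_real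
        by (intro mult_mono B(2)[OF k]) auto
      then show "cmod (x a k) \<le> B * (r $ a / (?D a / 2)) ^ k" by (simp only: power_divide times_divide_eq_right times_divide_eq_left)
    qed (use r_bounds[of a] D in \<open>auto simp: field_simps\<close>)
    fix l :: nat assume l: "1 \<le> l"
    show "x a l = of_real (r $ a) * c a * unit_seq 1 l - imat_apply (mscale (G a) u) (x (a + 1)) l"
      using torus.regular_coeff_grunsky[OF torus l r_bounds(1), of a "c a" a "\<lambda>k. - (u ^ k) * x (a + 1) k"]
      unfolding form_coeffs_def[symmetric] fc G_def[symmetric] imat_apply_G by (simp add: x_def)
  qed
qed

text \<open>\<open>has_period\<close> prescribes the same value for all cycles. Running once around
  the circle before an a-cycle gives another a-cycle with the same displacement, so the circle
  contributes 0.\<close>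

lemma residue_zero:
  assumes f: "f holomorphic_on sewing_piece \<tau> \<epsilon> r a" and per: "has_period (a_cycle \<tau> \<epsilon> r a) f P"
    and s: "hole a < s" "s < min_norm (torus_lattice (\<tau> $ a)) / 2"
  shows "contour_integral (circlepath 0 s) f = 0"
proof -
  have s0: "0 < s" using s hole_bounds(1)[of a] by linarith
  have sph: "sphere 0 s \<subseteq> torus.punctured (\<tau> $ a) (hole a)"
    using s hole_bounds(3)[of a] by (auto intro!: torus.annulus_punctured[OF torus])
  have p: "of_real s \<in> torus.punctured (\<tau> $ a) (hole a)" using sph s0 by auto
  have q: "of_real s + 2 * pi * \<i> \<in> torus.punctured (\<tau> $ a) (hole a)"
    using torus.punctured_shift[OF torus p torus.quasi_lattice[OF torus, of a 0 1]] by (simp add: quasi_basis)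
  obtain \<eta> where \<eta>: "valid_path \<eta>" "path_image \<eta> \<subseteq> torus.punctured (\<tau> $ a) (hole a)"
    "pathstart \<eta> = of_real s" "pathfinish \<eta> = of_real s + 2 * pi * \<i>"
    by (rule torus.punctured_path[OF torus hole_bounds(1,3) p q])
  have "a_cycle \<tau> \<epsilon> r a \<eta>" "a_cycle \<tau> \<epsilon> r a (circlepath 0 s +++ \<eta>)"
    using \<eta> sph punctured_subset_piece[of a] s0
    by (auto simp: a_cycle_def torus_cycle_def path_image_join intro!: valid_path_join)
  then have i: "(f has_contour_integral P) \<eta>" "(f has_contour_integral P) (circlepath 0 s +++ \<eta>)"
    using per by (auto simp: has_period_def)
  have "f contour_integrable_on circlepath 0 s"
    by (intro contour_integrable_continuous_circlepath holomorphic_on_imp_continuous_on holomorphic_on_subset[OF f])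
       (use sph punctured_subset_piece[of a] s0 in auto)
  then have "(f has_contour_integral (contour_integral (circlepath 0 s) f + P)) (circlepath 0 s +++ \<eta>)"
    by (intro has_contour_integral_join has_contour_integral_integral i(1) \<eta>(1)) simp_all
  from has_contour_integral_unique[OF this i(2)] show ?thesis by simp
qed

text \<open>For \<epsilon> = 0 no disc is removed and each component is a holomorphic form on a
  whole torus, hence constant.\<close>

lemma period_unique_cusp:
  assumes \<epsilon>: "\<epsilon> = 0" and f: "sewn_pair f"
    and a: "\<And>i. has_period (a_cycle \<tau> \<epsilon> r i) (f i) (if i = j then 2 * pi * \<i> else 0)"
    and b: "has_period (b_cycle \<tau> \<epsilon> r i) (f i) C"
  shows "C = 2 * pi * \<i> * omega $ i $ j"
proof -
  have fi: "f i holomorphic_on UNIV" "\<And>z \<omega>. \<omega> \<in> torus_lattice (\<tau> $ i) \<Longrightarrow> f i (z + \<omega>) = f i z"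
    using f[unfolded sewn_pair_def piece_eq] \<epsilon> by simp_all
  obtain d where d: "\<And>z. f i z = d"
    by (rule torus.entire_periodic_constant[OF torus fi(1)]) (rule fi(2), assumption, rule that)
  have int: "(f i has_contour_integral d * \<omega>) \<gamma>" if "torus_cycle \<tau> \<epsilon> r i \<omega> \<gamma>" for \<gamma> \<omega>
  proof -
    have "f i = (\<lambda>z. d)" using d by blast
    then show ?thesis using constant_period[OF that] by simp
  qed
  obtain \<gamma> where "torus_cycle \<tau> \<epsilon> r i (2 * pi * \<i>) \<gamma>" "(f i has_contour_integral (if i = j then 2 * pi * \<i> else 0)) \<gamma>"
    using a[of i] unfolding has_period_def a_cycle_def by blast
  from has_contour_integral_unique[OF int[OF this(1)] this(2)]
  have "d = (if i = j then 1 else 0)" by (auto split: if_splits)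
  moreover have "C = d * (2 * pi * \<i> * \<tau> $ i)"
  proof -
    obtain \<gamma> where "torus_cycle \<tau> \<epsilon> r i (2 * pi * \<i> * \<tau> $ i) \<gamma>" "(f i has_contour_integral C) \<gamma>"
      using b unfolding has_period_def b_cycle_def by blast
    from has_contour_integral_unique[OF this(2) int[OF this(1)]] show ?thesis .
  qed
  moreover have "b_shift (sol j) i = 0" unfolding b_shift_def using \<epsilon> by simp
  ultimately show ?thesis by (simp add: omega_def)
qed

text \<open>The classification yields an expansion only outside a hole larger than the given one,
  which amounts to sewing with smaller radii. The factor is chosen because its square still exceeds
  \<open>cmod u\<close>, so that \<open>cmod \<epsilon>\<close> remains below the product of the new
  radii.\<close>

definition "shrunk = (\<chi> a. (1 + cmod u) / 2 * r $ a)"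

lemma shrunk_bounds: "0 < shrunk $ a" "shrunk $ a < r $ a"
  using u_less_1 r_bounds(1)[of a] by (auto simp: shrunk_def add_pos_nonneg)

lemma shrunk_sewing: "sewing \<tau> \<epsilon> shrunk"
proof
  show "0 < Im (\<tau> $ a)" for a by (rule Im_pos)
  have "0 < r $ 1 * r $ 2" using r_bounds(1) by simp
  then have "cmod u = cmod \<epsilon> / (r $ 1 * r $ 2)" by (simp only: u_def norm_divide norm_of_real abs_of_pos)
  then have "cmod \<epsilon> = cmod u * (r $ 1 * r $ 2)" using \<open>0 < r $ 1 * r $ 2\<close> by (auto simp: field_simps)
  also have "\<dots> < ((1 + cmod u) / 2)\<^sup>2 * (r $ 1 * r $ 2)"
  proof (rule mult_strict_right_mono)
    have "0 < (1 - cmod u)\<^sup>2" using u_less_1 by simp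
    then show "cmod u < ((1 + cmod u) / 2)\<^sup>2" by (simp add: power2_eq_square field_simps)
  qed fact
  finally have "cmod \<epsilon> < shrunk $ 1 * shrunk $ 2" by (simp add: shrunk_def power2_eq_square mult_ac)
  then show "sewing_radii \<tau> \<epsilon> shrunk"
    unfolding sewing_radii_def using shrunk_bounds r_bounds(2) by (meson order_less_trans)
qed

text \<open>The a-periods determine the constants c, the matching on the smaller collar gives a
  solution of the system for the shrunk radii, and that solution is unique.\<close>

lemma period_unique_nondegenerate:
  assumes \<epsilon>: "\<epsilon> \<noteq> 0" and f: "sewn_pair f"
    and a: "\<And>i. has_period (a_cycle \<tau> \<epsilon> r i) (f i) (if i = j then 2 * pi * \<i> else 0)"
    and b: "has_period (b_cycle \<tau> \<epsilon> r i) (f i) C"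
  shows "C = 2 * pi * \<i> * sewing.omega \<tau> \<epsilon> shrunk $ i $ j"
proof -
  interpret S: sewing \<tau> \<epsilon> shrunk by (rule shrunk_sewing)
  have hol: "f a holomorphic_on torus.punctured (\<tau> $ a) (hole a)"
    and per: "z \<in> torus.punctured (\<tau> $ a) (hole a) \<Longrightarrow> \<omega> \<in> torus_lattice (\<tau> $ a) \<Longrightarrow> f a (z + \<omega>) = f a z" for a z \<omega>
    using f \<epsilon> by (auto simp: sewn_pair_def piece_eq)
  have hh: "hole a < S.hole a" for a
    unfolding hole_def S.hole_def using \<epsilon> shrunk_bounds[of "a + 1"] r_bounds(1)[of "a + 1"] by (intro divide_strict_left_mono) auto
  have "\<exists>c v. decays (S.hole a) v \<and> v 0 = 0 \<and> (\<forall>z\<in>torus.punctured (\<tau> $ a) (S.hole a). f a z = torus.tform (\<tau> $ a) c v z)" for a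
  proof -
    have "f a holomorphic_on sewing_piece \<tau> \<epsilon> r a" using f by (simp add: sewn_pair_def)
    from torus.punctured_form_classification[OF torus hol per hole_bounds(1) hh S.hole_bounds(3) residue_zero[OF this a hh S.hole_bounds(3)]]
    show ?thesis by metis
  qed
  then obtain c v where dec: "\<And>a. decays (S.hole a) (v a)" and v0: "\<And>a. v a 0 = 0"
    and ft: "\<And>a z. z \<in> torus.punctured (\<tau> $ a) (S.hole a) \<Longrightarrow> f a z = torus.tform (\<tau> $ a) (c a) (v a) z" by metis
  have sub: "torus.punctured (\<tau> $ a) (S.hole a) \<subseteq> sewing_piece \<tau> \<epsilon> r a" for a
    using hh[of a] \<epsilon> by (auto simp: piece_eq torus.punctured_def[OF torus] intro: order_less_trans)
  have int: "\<exists>\<gamma>. torus_cycle \<tau> \<epsilon> r a (torus.quasi (\<tau> $ a) m n) \<gamma> \<and>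
      (f a has_contour_integral (c a * torus.quasi (\<tau> $ a) m n + of_int m * v a 1)) \<gamma>" for a m n
  proof -
    obtain \<gamma> where g: "valid_path \<gamma>" "path_image \<gamma> \<subseteq> torus.punctured (\<tau> $ a) (S.hole a)" "pathfinish \<gamma> = pathstart \<gamma> + torus.quasi (\<tau> $ a) m n"
      by (rule torus.punctured_cycle[OF torus S.hole_bounds(1,3) torus.quasi_lattice[OF torus]])
    have "(torus.tform (\<tau> $ a) (c a) (v a) has_contour_integral (c a * torus.quasi (\<tau> $ a) m n + of_int m * v a 1)) \<gamma>"
      by (rule torus.tform_contour_integral[OF torus dec S.hole_bounds(1) v0 g])
    then have "(f a has_contour_integral (c a * torus.quasi (\<tau> $ a) m n + of_int m * v a 1)) \<gamma>"
      by (rule has_contour_integral_eq) (use ft g(2) in auto)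
    then show ?thesis using g sub[of a] by (auto simp: torus_cycle_def)
  qed
  have c: "c a = (if a = j then 1 else 0)" for a
  proof -
    have "c a * (2 * pi * \<i>) = (if a = j then 2 * pi * \<i> else 0)"
      using int[of a 0 1] a[of a] unfolding has_period_def a_cycle_quasi by (auto simp: quasi_basis dest: has_contour_integral_unique)
    then show ?thesis by (auto split: if_splits)
  qed
  have C: "C = c i * (2 * pi * \<i> * \<tau> $ i) + v i 1"
    using int[of i 1 0] b unfolding has_period_def b_cycle_quasi by (auto simp: quasi_basis dest: has_contour_integral_unique)
  have rel: "torus.tform (\<tau> $ a) (c a) (v a) z = torus.tform (\<tau> $ (a + 1)) (c (a + 1)) (v (a + 1)) (\<epsilon> / z) * (- \<epsilon> / z\<^sup>2)"
    if z: "z \<in> S.collar a" for a z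
  proof -
    have "z \<in> collar a" using z hh[of a] shrunk_bounds(2)[of a] by (auto simp: collar_def S.collar_def)
    then have "f a z = f (a + 1) (\<epsilon> / z) * (- \<epsilon> / z\<^sup>2)" using f \<epsilon> by (simp add: sewn_pair_def)
    then show ?thesis using ft S.collar_punctured z S.collar_flip[OF \<epsilon> z] by (metis subsetD)
  qed
  define x where "x = (\<lambda>a l. torus.regular_coeff (\<tau> $ a) (c a) (v a) l * of_real (shrunk $ a ^ l / sqrt (real l)))"
  have x: "S.system c x" "S.b_shift x i = v i 1"
    unfolding x_def by (rule S.forms_system[OF \<epsilon> dec v0 rel]; assumption?)+
  have "c = (\<lambda>a. if a = j then 1 else 0)" using c by blast
  then have "x (i + 1) 1 = S.sol j (i + 1) 1" using S.system_unique[OF x(1)] S.sol_system[of j] by simp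
  then have "v i 1 = S.b_shift (S.sol j) i" using x(2) by (simp add: S.b_shift_def)
  then show ?thesis by (simp add: S.omega_def C c)
qed

lemma period_matrix_classification:
  assumes "is_period_matrix \<tau> \<epsilon> r \<Omega>"
  obtains \<rho> where "sewing_radii \<tau> \<epsilon> \<rho>" "\<Omega> = sewing.omega \<tau> \<epsilon> \<rho>"
proof -
  obtain \<nu> where \<nu>: "\<And>j. sewn_pair (\<nu> j)"
    and a: "\<And>i j. has_period (a_cycle \<tau> \<epsilon> r i) (\<nu> j i) (if i = j then 2 * pi * \<i> else 0)"
    and b: "\<And>i j. \<exists>c. has_period (b_cycle \<tau> \<epsilon> r i) (\<nu> j i) c \<and> \<Omega> $ i $ j = c / (2 * pi * \<i>)"
    using assms sewn_one_form_imp_pair unfolding is_period_matrix_def by blast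
  show ?thesis
  proof (cases "\<epsilon> = 0")
    case True
    have "\<Omega> $ i $ j = omega $ i $ j" for i j
    proof -
      obtain C where C: "has_period (b_cycle \<tau> \<epsilon> r i) (\<nu> j i) C" "\<Omega> $ i $ j = C / (2 * pi * \<i>)" using b by blast
      show ?thesis unfolding C(2) period_unique_cusp[OF True \<nu> a C(1)] by simp
    qed
    then show ?thesis using that[OF radii] by (simp add: vec_eq_iff)
  next
    case False
    have "\<Omega> $ i $ j = sewing.omega \<tau> \<epsilon> shrunk $ i $ j" for i j
    proof -
      obtain C where C: "has_period (b_cycle \<tau> \<epsilon> r i) (\<nu> j i) C" "\<Omega> $ i $ j = C / (2 * pi * \<i>)" using b by blast
      show ?thesis unfolding C(2) period_unique_nondegenerate[OF False \<nu> a C(1)] by simp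
    qed
    then show ?thesis using that[OF sewing.radii[OF shrunk_sewing]] by (simp add: vec_eq_iff)
  qed
qed

end

section \<open>The period matrix in terms of the sewing matrices\<close>

context sewing begin

text \<open>The radii drop out: they enter the resolvent only through a diagonal conjugation, and
  the remaining quotient of radii in the diagonal entries is the ratio of the two conjugating
  weights.\<close>

lemma omega_formulas:
  fixes j
  defines "A \<equiv> \<lambda>a. sewing_matrix (\<tau> $ a) \<epsilon>"
  defines "N \<equiv> neumann_inverse (imat_mult (A j) (A (j + 1)))"
  shows "imat_mult_converges (A j) (A (j + 1))" "neumann_converges (imat_mult (A j) (A (j + 1)))"
    and "imat_mult_converges (A (j + 1)) N"
    and "2 * pi * \<i> * omega $ j $ j = 2 * pi * \<i> * \<tau> $ j + \<epsilon> * imat_mult (A (j + 1)) N 1 1"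
    and "2 * pi * \<i> * omega $ (j + 1) $ j = - \<epsilon> * N 1 1"
proof -
  have "imat_mult_converges (A j) (A (j + 1)) \<and> neumann_converges (imat_mult (A j) (A (j + 1))) \<and> imat_mult_converges (A (j + 1)) N
    \<and> \<epsilon> * imat_mult (A (j + 1)) N 1 1 = \<epsilon> * of_real (r $ j / r $ (j + 1)) * imat_apply (mscale (G (j + 1)) u) (resolvent j) 1
    \<and> \<epsilon> * N 1 1 = \<epsilon> * resolvent j 1"
  proof (cases "\<epsilon> = 0")
    case True
    have "A a k l = 0" if "1 \<le> k" "1 \<le> l" for a k l using True that by (simp add: A_def sewing_matrix_def)
    from zero_neumann[of "A j" "A (j + 1)", OF this this, folded N_def] show ?thesis using True by simp
  next
    case False
    \<comment> \<open>The principal branch satisfies the addition rule for exponents, so both the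
      factorisation of the sewing matrix and the product u^k of the two weights are exact.\<close>
    define W where "W a k = \<epsilon> powr (of_nat k / 2) / of_real (r $ a ^ k)" for a k
    have nz: "r $ a \<noteq> 0" for a using r_bounds(1)[of a] by simp
    have W0: "W a k \<noteq> 0" for a k using False nz by (simp add: W_def)
    have WW: "W j k * W (j + 1) k = u ^ k" for k
    proof -
      have "W j k * W (j + 1) k = (\<epsilon> powr (of_nat k / 2) * \<epsilon> powr (of_nat k / 2)) / (of_real (r $ j ^ k) * of_real (r $ (j + 1) ^ k))"
        by (simp add: W_def)
      also have "\<epsilon> powr (of_nat k / 2) * \<epsilon> powr (of_nat k / 2) = \<epsilon> ^ k"
        using False by (simp add: powr_add[symmetric] powr_nat)
      finally show ?thesis by (simp add: u_eq[of j] power_divide power_mult_distrib)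
    qed
    have A: "A a k l = W a k * G a k l * W a l" if "1 \<le> k" "1 \<le> l" for a k l
    proof -
      have "\<epsilon> powr (of_nat (k + l) / 2) = \<epsilon> powr (of_nat k / 2) * \<epsilon> powr (of_nat l / 2)"
        by (simp add: add_divide_distrib powr_add)
      then show ?thesis using nz[of a] by (simp add: A_def sewing_matrix_def W_def G_def grunsky_def power_add)
    qed
    note cn = conjugated_neumann[OF G_bound G_bound u_less_1, of "W j" "W (j + 1)" "A j" j "A (j + 1)" "j + 1", OF W0 W0 WW A A, folded N_def]
    have "W (j + 1) 1 / W j 1 = of_real (r $ j / r $ (j + 1))" using False nz by (simp add: W_def)
    then show ?thesis using cn by (simp add: resolvent_def[abs_def])
  qed
  then show "imat_mult_converges (A j) (A (j + 1))" "neumann_converges (imat_mult (A j) (A (j + 1)))" "imat_mult_converges (A (j + 1)) N"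
    "2 * pi * \<i> * omega $ j $ j = 2 * pi * \<i> * \<tau> $ j + \<epsilon> * imat_mult (A (j + 1)) N 1 1"
    "2 * pi * \<i> * omega $ (j + 1) $ j = - \<epsilon> * N 1 1"
    using omega_diag[of j] omega_off[of j] by auto
qed

text \<open>The expressions in \<open>omega_formulas\<close> contain only \<tau> and
  \<epsilon>.\<close>

lemma omega_independent:
  assumes "sewing_radii \<tau> \<epsilon> \<rho>" shows "sewing.omega \<tau> \<epsilon> \<rho> = omega"
proof -
  interpret S: sewing \<tau> \<epsilon> \<rho> by unfold_locales (rule Im_pos, rule assms)
  have "S.omega $ i $ j = omega $ i $ j" for i j
  proof -
    have "2 * pi * \<i> * S.omega $ i $ j = 2 * pi * \<i> * omega $ i $ j"
      using two_cases[of i j]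
    proof
      assume i: "i = j"
      show ?thesis unfolding i omega_formulas(4)[of j] S.omega_formulas(4)[of j] ..
    next
      assume i: "i = j + 1"
      show ?thesis unfolding i omega_formulas(5)[of j] S.omega_formulas(5)[of j] ..
    qed
    then show ?thesis by simp
  qed
  then show ?thesis by (simp add: vec_eq_iff)
qed

lemma period_matrix_iff: "is_period_matrix \<tau> \<epsilon> r \<Omega> \<longleftrightarrow> \<Omega> = omega"
proof
  assume "is_period_matrix \<tau> \<epsilon> r \<Omega>"
  then obtain \<rho> where "sewing_radii \<tau> \<epsilon> \<rho>" "\<Omega> = sewing.omega \<tau> \<epsilon> \<rho>" by (rule period_matrix_classification)
  then show "\<Omega> = omega" by (simp add: omega_independent)
qed (simp add: omega_period_matrix)

end

section \<open>Holomorphic dependence\<close>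

lemma divisor_power_sum_le: "divisor_power_sum k n \<le> n ^ Suc k"
proof (cases "n = 0")
  case False
  then have "{d. d dvd n} \<subseteq> {1..n}" by (auto dest: dvd_imp_le intro!: Suc_leI intro: gr0I)
  then have "divisor_power_sum k n \<le> (\<Sum>d\<in>{1..n}. d ^ k)" unfolding divisor_power_sum_def by (intro sum_mono2) auto
  also have "\<dots> \<le> (\<Sum>d\<in>{1..n}. n ^ k)" by (intro sum_mono power_mono) auto
  finally show ?thesis by simp
qed (auto simp: divisor_power_sum_def)

lemma eisenstein_holomorphic: "eisenstein k holomorphic_on {\<tau>. 0 < Im \<tau>}"
proof (cases "odd k")
  case True
  then have "eisenstein k = (\<lambda>\<tau>. 0)" by (simp add: eisenstein_def fun_eq_iff)
  then show ?thesis by simp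
next
  case False
  define a where "a n = complex_of_nat (divisor_power_sum (k - 1) n)" for n
  have "(\<lambda>w. \<Sum>\<^sub>\<infinity>n\<in>{1..}. a n * w ^ n) holomorphic_on (\<Union>\<rho>\<in>{0<..<1}. ball 0 \<rho>)"
  proof (rule holomorphic_on_UN_open)
    fix \<rho> :: real assume \<rho>: "\<rho> \<in> {0<..<1}"
    have "summable (\<lambda>n. real n ^ Suc (k - 1) * \<rho> ^ n)" using \<rho> by (intro summable_nat_power_geometric) auto
    then have "(\<lambda>n. real n ^ Suc (k - 1) * \<rho> ^ n) summable_on UNIV"
      using \<rho> by (intro summable_nonneg_imp_summable_on) auto
    then have M: "(\<lambda>n. real n ^ Suc (k - 1) * \<rho> ^ n) summable_on {1..}" by (rule summable_on_subset_banach) auto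
    show "(\<lambda>w. \<Sum>\<^sub>\<infinity>n\<in>{1..}. a n * w ^ n) holomorphic_on ball 0 \<rho>"
    proof (rule infsum_holomorphic(1)[OF open_ball _ _ M])
      fix n and w :: complex assume "w \<in> ball 0 \<rho>"
      then have "cmod (w ^ n) \<le> \<rho> ^ n" by (auto simp: norm_power intro!: power_mono)
      moreover have "cmod (a n) \<le> real n ^ Suc (k - 1)"
        unfolding a_def norm_of_nat of_nat_power[symmetric] of_nat_le_iff by (rule divisor_power_sum_le)
      ultimately show "cmod (a n * w ^ n) \<le> real n ^ Suc (k - 1) * \<rho> ^ n" unfolding norm_mult by (intro mult_mono) auto
    qed (auto intro!: holomorphic_intros)
  qed auto
  moreover have "ball 0 1 \<subseteq> (\<Union>\<rho>\<in>{0<..<1}. ball (0::complex) \<rho>)"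
  proof
    fix w :: complex assume w: "w \<in> ball 0 1"
    then have "0 < (1 + cmod w) / 2" "(1 + cmod w) / 2 < 1" "cmod w < (1 + cmod w) / 2" by (simp_all add: add_pos_nonneg)
    then show "w \<in> (\<Union>\<rho>\<in>{0<..<1}. ball (0::complex) \<rho>)" by (intro UN_I[of "(1 + cmod w) / 2"]) auto
  qed
  ultimately have "(\<lambda>w. \<Sum>\<^sub>\<infinity>n\<in>{1..}. a n * w ^ n) holomorphic_on ball 0 1" by (rule holomorphic_on_subset)
  then have "((\<lambda>w. \<Sum>\<^sub>\<infinity>n\<in>{1..}. a n * w ^ n) \<circ> (\<lambda>\<tau>. exp (2 * pi * \<i> * \<tau>))) holomorphic_on {\<tau>. 0 < Im \<tau>}"
    by (intro holomorphic_on_compose_gen[of _ _ _ "ball 0 1"] holomorphic_intros) auto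
  then have "(\<lambda>\<tau>. - of_real (bernoulli_number k) / fact k + 2 / fact (k - 1) *
      ((\<lambda>w. \<Sum>\<^sub>\<infinity>n\<in>{1..}. a n * w ^ n) \<circ> (\<lambda>\<tau>. exp (2 * pi * \<i> * \<tau>))) \<tau>) holomorphic_on {\<tau>. 0 < Im \<tau>}"
    by (intro holomorphic_intros)
  then show ?thesis by (rule holomorphic_transform) (use False in \<open>simp add: eisenstein_def a_def\<close>)
qed

lemma grunsky_holomorphic: "(\<lambda>\<tau>. grunsky \<tau> \<rho> k l) holomorphic_on {\<tau>. 0 < Im \<tau>}"
  unfolding grunsky_def torus_coeff_def by (intro holomorphic_intros eisenstein_holomorphic)

lemma imat_apply_cong: "(\<And>m. 1 \<le> m \<Longrightarrow> x m = y m) \<Longrightarrow> imat_apply K x k = imat_apply K y k"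
  unfolding imat_apply_def by (rule infsum_cong) simp

lemma imat_apply_diff:
  assumes K: "mbound K q" and x: "l2 x" "l2 y" and k: "1 \<le> k"
  shows "imat_apply K (\<lambda>m. x m - y m) k = imat_apply K x k - imat_apply K y k"
  unfolding imat_apply_def right_diff_distrib
  by (intro infsum_diff abs_summable_summable[OF imat_apply_summable[OF K x(1) k]] abs_summable_summable[OF imat_apply_summable[OF K x(2) k]])

lemma l2norm_cong: "(\<And>m. 1 \<le> m \<Longrightarrow> x m = y m) \<Longrightarrow> l2norm x = l2norm y"
  unfolding l2norm_def by (intro arg_cong[of _ _ sqrt] infsum_cong) simp

text \<open>Domination uses the entrywise bound 1 of the matrix and the geometric factor from u, so
  mere boundedness of the entries of y suffices.\<close>

lemma imat_apply_holomorphic: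
  assumes S: "open S" and g: "\<And>\<zeta>. \<zeta> \<in> S \<Longrightarrow> mbound (g \<zeta>) 1" "\<And>m. 1 \<le> m \<Longrightarrow> (\<lambda>\<zeta>. g \<zeta> k m) holomorphic_on S"
    and u: "u holomorphic_on S" "\<And>\<zeta>. \<zeta> \<in> S \<Longrightarrow> cmod (u \<zeta>) \<le> \<theta>" "\<theta> < 1"
    and y: "\<And>m. 1 \<le> m \<Longrightarrow> y m holomorphic_on S" "\<And>\<zeta> m. \<zeta> \<in> S \<Longrightarrow> 1 \<le> m \<Longrightarrow> cmod (y m \<zeta>) \<le> B" and k: "1 \<le> k"
  shows "(\<lambda>\<zeta>. imat_apply (mscale (g \<zeta>) (u \<zeta>)) (\<lambda>m. y m \<zeta>) k) holomorphic_on S"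
proof (cases "S = {}")
  case False
  then obtain \<zeta>0 where z0: "\<zeta>0 \<in> S" by blast
  have \<theta>: "0 \<le> \<theta>" using u(2)[OF z0] norm_ge_zero order_trans by blast
  have "(\<lambda>m. \<theta> ^ m) summable_on {1..}" using \<theta> u(3) by (intro summable_on_geometric_from_1) simp
  then have M: "(\<lambda>m. \<theta> ^ m * B) summable_on {1..}" by (rule summable_on_cmult_left)
  show ?thesis unfolding imat_apply_def mscale_def
  proof (rule infsum_holomorphic(1)[OF S _ _ M])
    fix m :: nat and \<zeta> assume m: "m \<in> {1..}" and \<zeta>: "\<zeta> \<in> S"
    have "cmod (g \<zeta> k m) * cmod (u \<zeta>) ^ m * cmod (y m \<zeta>) \<le> 1 * \<theta> ^ m * B"
      using mbound_entry[OF g(1)[OF \<zeta>] k, of m] u(2)[OF \<zeta>] y(2)[OF \<zeta>, of m] m \<theta>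
      by (intro mult_mono power_mono) auto
    then show "cmod (g \<zeta> k m * u \<zeta> ^ m * y m \<zeta>) \<le> \<theta> ^ m * B" by (simp add: norm_mult norm_power)
  qed (use g(2) y(1) u(1) in \<open>auto intro!: holomorphic_intros\<close>)
qed (simp add: holomorphic_on_def)

text \<open>From the fixed point equation the norm R satisfies R \<le> 1 + \<theta> R; one factor
  \<open>cmod u\<close> of the loop is kept and the other estimated by 1.\<close>

lemma loop_resolvent_norm:
  assumes G: "mbound G 1" "mbound G' 1" and u: "cmod u \<le> \<theta>" "\<theta> < 1"
  shows "l2norm (\<lambda>m. loop_resolvent G G' u m 1) \<le> 1 / (1 - \<theta>)"
    and "cmod (imat_apply (mscale G' u) (\<lambda>m. loop_resolvent G G' u m 1) 1) \<le> 1 / (1 - \<theta>)"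
proof -
  have u1: "cmod u < 1" and \<theta>: "0 \<le> \<theta>" using u norm_ge_zero[of u] by linarith+
  let ?R = "\<lambda>m. loop_resolvent G G' u m 1" and ?K = "mscale G u" and ?K' = "mscale G' u"
  note K = mbound_mscale[OF G(1) u1] mbound_mscale[OF G(2) u1]
  have R: "l2 ?R" by (rule loop_resolvent_l2[OF G u1]) simp
  note KR = imat_apply_l2[OF K(2) R]
  note KKR = imat_apply_l2[OF K(1) KR(1)]
  have a1: "cmod u * l2norm x \<le> \<theta> * l2norm x" "\<theta> * l2norm x \<le> 1 * l2norm x" for x
    using u by (intro mult_right_mono; simp)+
  have "l2norm ?R = l2norm (\<lambda>k. unit_seq 1 k + imat_apply ?K (imat_apply ?K' ?R) k)"
    by (rule l2norm_cong) (rule loop_resolvent_eq[OF G u1])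
  also have "\<dots> \<le> l2norm (unit_seq 1) + l2norm (imat_apply ?K (imat_apply ?K' ?R))"
    by (rule l2_add(2)[OF l2_unit_seq(1) KKR(1)]) simp
  also have "\<dots> \<le> 1 + \<theta> * l2norm ?R"
    using l2_unit_seq(2)[of 1] KKR(2) KR(2) a1[of ?R] a1[of "imat_apply ?K' ?R"] by linarith
  finally have "l2norm ?R * (1 - \<theta>) \<le> 1" by (simp add: algebra_simps)
  then show b: "l2norm ?R \<le> 1 / (1 - \<theta>)" using u by (simp add: pos_le_divide_eq)
  have "cmod (imat_apply ?K' ?R 1) \<le> l2norm (imat_apply ?K' ?R)" by (rule cmod_le_l2norm[OF KR(1)]) simp
  then show "cmod (imat_apply ?K' ?R 1) \<le> 1 / (1 - \<theta>)" using KR(2) a1[of ?R] b by linarith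
qed

text \<open>The resolvent vector is the limit of the iterates \<open>R \<mapsto> e1 + G U G' U R\<close>, uniformly in the parameter.\<close>

lemma loop_resolvent_holomorphic:
  assumes S: "open S" and g: "\<And>\<zeta>. \<zeta> \<in> S \<Longrightarrow> mbound (g \<zeta>) 1" "\<And>\<zeta>. \<zeta> \<in> S \<Longrightarrow> mbound (g' \<zeta>) 1"
    and gh: "\<And>k m. 1 \<le> k \<Longrightarrow> 1 \<le> m \<Longrightarrow> (\<lambda>\<zeta>. g \<zeta> k m) holomorphic_on S" "\<And>k m. 1 \<le> k \<Longrightarrow> 1 \<le> m \<Longrightarrow> (\<lambda>\<zeta>. g' \<zeta> k m) holomorphic_on S"
    and u: "u holomorphic_on S" "\<And>\<zeta>. \<zeta> \<in> S \<Longrightarrow> cmod (u \<zeta>) \<le> \<theta>" "\<theta> < 1"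
  shows "(\<lambda>\<zeta>. loop_resolvent (g \<zeta>) (g' \<zeta>) (u \<zeta>) 1 1) holomorphic_on S"
    and "(\<lambda>\<zeta>. imat_apply (mscale (g' \<zeta>) (u \<zeta>)) (\<lambda>m. loop_resolvent (g \<zeta>) (g' \<zeta>) (u \<zeta>) m 1) 1) holomorphic_on S"
proof -
  let ?R = "\<lambda>\<zeta> m. loop_resolvent (g \<zeta>) (g' \<zeta>) (u \<zeta>) m 1"
  let ?K = "\<lambda>\<zeta>. mscale (g \<zeta>) (u \<zeta>)" and ?K' = "\<lambda>\<zeta>. mscale (g' \<zeta>) (u \<zeta>)"
  define X where "X \<zeta> n = ((\<lambda>x k. unit_seq 1 k + imat_apply (?K \<zeta>) (imat_apply (?K' \<zeta>) x) k) ^^ n) (\<lambda>k. 0)" for \<zeta> n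
  have X0: "X \<zeta> 0 = (\<lambda>k. 0)" and XS: "X \<zeta> (Suc n) = (\<lambda>k. unit_seq 1 k + imat_apply (?K \<zeta>) (imat_apply (?K' \<zeta>) (X \<zeta> n)) k)" for \<zeta> n
    by (simp_all add: X_def)
  \<comment> \<open>Error and size of the iterates are bounded together: the error gives uniform
    convergence, the size gives the domination that makes the next iterate holomorphic.\<close>
  have main: "l2 (X \<zeta> n) \<and> l2norm (\<lambda>k. ?R \<zeta> k - X \<zeta> n k) \<le> \<theta> ^ n * (1 / (1 - \<theta>)) \<and> l2norm (X \<zeta> n) \<le> 1 / (1 - \<theta>)" if \<zeta>: "\<zeta> \<in> S" for \<zeta> n
  proof -
    have u1: "cmod (u \<zeta>) < 1" and \<theta>: "0 \<le> \<theta>" using u(2)[OF \<zeta>] u(3) norm_ge_zero[of "u \<zeta>"] by linarith+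
    note K = mbound_mscale[OF g(1)[OF \<zeta>] u1] mbound_mscale[OF g(2)[OF \<zeta>] u1]
    have R: "l2 (?R \<zeta>)" by (rule loop_resolvent_l2[OF g(1)[OF \<zeta>] g(2)[OF \<zeta>] u1]) simp
    have a1: "cmod (u \<zeta>) * l2norm x \<le> \<theta> * l2norm x" "\<theta> * l2norm x \<le> 1 * l2norm x" for x
      using u(2)[OF \<zeta>] u(3) by (intro mult_right_mono; simp)+
    show ?thesis
    proof (induction n)
      case 0
      show ?case using loop_resolvent_norm(1)[OF g(1)[OF \<zeta>] g(2)[OF \<zeta>] u(2)[OF \<zeta>] u(3)] u(3) by (simp add: X0 l2_zero)
    next
      case (Suc n)
      then have x: "l2 (X \<zeta> n)" and d: "l2norm (\<lambda>k. ?R \<zeta> k - X \<zeta> n k) \<le> \<theta> ^ n * (1 / (1 - \<theta>))"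
        and b: "l2norm (X \<zeta> n) \<le> 1 / (1 - \<theta>)" by auto
      note KX = imat_apply_l2[OF K(2) x]
      note KKX = imat_apply_l2[OF K(1) KX(1)]
      note D = l2_diff[OF R x]
      note KD = imat_apply_l2[OF K(2) D]
      note KKD = imat_apply_l2[OF K(1) KD(1)]
      have l: "l2 (X \<zeta> (Suc n))" unfolding XS by (rule l2_add(1)[OF l2_unit_seq(1) KKX(1)]) simp
      have "l2norm (X \<zeta> (Suc n)) \<le> l2norm (unit_seq 1) + l2norm (imat_apply (?K \<zeta>) (imat_apply (?K' \<zeta>) (X \<zeta> n)))"
        unfolding XS by (rule l2_add(2)[OF l2_unit_seq(1) KKX(1)]) simp
      also have "\<dots> \<le> 1 + \<theta> * l2norm (X \<zeta> n)"
        using l2_unit_seq(2)[of 1] KKX(2) KX(2) a1[of "X \<zeta> n"] a1[of "imat_apply (?K' \<zeta>) (X \<zeta> n)"] by linarith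
      also have "\<dots> \<le> 1 + \<theta> * (1 / (1 - \<theta>))" using b \<theta> by (intro add_left_mono mult_left_mono)
      also have "\<dots> = 1 / (1 - \<theta>)" using u(3) by (simp add: field_simps)
      finally have b': "l2norm (X \<zeta> (Suc n)) \<le> 1 / (1 - \<theta>)" .
      have "?R \<zeta> k - X \<zeta> (Suc n) k = imat_apply (?K \<zeta>) (imat_apply (?K' \<zeta>) (\<lambda>k. ?R \<zeta> k - X \<zeta> n k)) k" if k: "1 \<le> k" for k
      proof -
        have "imat_apply (?K \<zeta>) (imat_apply (?K' \<zeta>) (\<lambda>k. ?R \<zeta> k - X \<zeta> n k)) k
          = imat_apply (?K \<zeta>) (\<lambda>m. imat_apply (?K' \<zeta>) (?R \<zeta>) m - imat_apply (?K' \<zeta>) (X \<zeta> n) m) k"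
          by (rule imat_apply_cong) (rule imat_apply_diff[OF K(2) R x])
        also have "\<dots> = imat_apply (?K \<zeta>) (imat_apply (?K' \<zeta>) (?R \<zeta>)) k - imat_apply (?K \<zeta>) (imat_apply (?K' \<zeta>) (X \<zeta> n)) k"
          by (rule imat_apply_diff[OF K(1) imat_apply_l2(1)[OF K(2) R] KX(1) k])
        finally show ?thesis by (subst loop_resolvent_eq[OF g(1)[OF \<zeta>] g(2)[OF \<zeta>] u1 k]) (simp add: XS)
      qed
      then have "l2norm (\<lambda>k. ?R \<zeta> k - X \<zeta> (Suc n) k) = l2norm (imat_apply (?K \<zeta>) (imat_apply (?K' \<zeta>) (\<lambda>k. ?R \<zeta> k - X \<zeta> n k)))"
        by (rule l2norm_cong)
      also have "\<dots> \<le> \<theta> * l2norm (\<lambda>k. ?R \<zeta> k - X \<zeta> n k)"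
        using KKD(2) KD(2) a1[of "\<lambda>k. ?R \<zeta> k - X \<zeta> n k"] a1[of "imat_apply (?K' \<zeta>) (\<lambda>k. ?R \<zeta> k - X \<zeta> n k)"] by linarith
      also have "\<dots> \<le> \<theta> * (\<theta> ^ n * (1 / (1 - \<theta>)))" by (rule mult_left_mono[OF d \<theta>])
      finally show ?case using l b' by (simp add: mult.assoc)
    qed
  qed
  have Xb: "cmod (X \<zeta> n k) \<le> 1 / (1 - \<theta>)" if "\<zeta> \<in> S" "1 \<le> k" for \<zeta> n k
    using cmod_le_l2norm[of "X \<zeta> n" k] main[OF that(1), of n] that(2) by linarith
  have KXb: "cmod (imat_apply (?K' \<zeta>) (X \<zeta> n) k) \<le> 1 / (1 - \<theta>)" if \<zeta>: "\<zeta> \<in> S" and k: "1 \<le> k" for \<zeta> n k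
  proof -
    have u1: "cmod (u \<zeta>) < 1" using u(2)[OF \<zeta>] u(3) by linarith
    have x: "l2 (X \<zeta> n)" using main[OF \<zeta>] by blast
    note KX = imat_apply_l2[OF mbound_mscale[OF g(2)[OF \<zeta>] u1] x]
    have "cmod (u \<zeta>) * l2norm (X \<zeta> n) \<le> 1 * l2norm (X \<zeta> n)" using u1 by (intro mult_right_mono) auto
    then show ?thesis using cmod_le_l2norm[OF KX(1) k] KX(2) main[OF \<zeta>, of n] by linarith
  qed
  have Xh: "(\<lambda>\<zeta>. X \<zeta> n k) holomorphic_on S" if "1 \<le> k" for n k
    using that
  proof (induction n arbitrary: k)
    case (Suc n)
    have "(\<lambda>\<zeta>. imat_apply (?K' \<zeta>) (X \<zeta> n) m) holomorphic_on S" if "1 \<le> m" for m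
      using that by (intro imat_apply_holomorphic[OF S g(2) gh(2) u Suc.IH Xb]) auto
    then have "(\<lambda>\<zeta>. imat_apply (?K \<zeta>) (\<lambda>m. imat_apply (?K' \<zeta>) (X \<zeta> n) m) k) holomorphic_on S"
      using Suc.prems by (intro imat_apply_holomorphic[OF S g(1) gh(1) u _ KXb]) auto
    then show ?case unfolding XS by (intro holomorphic_intros)
  qed (simp add: X0)
  have KXh: "(\<lambda>\<zeta>. imat_apply (?K' \<zeta>) (X \<zeta> n) 1) holomorphic_on S" for n
    by (intro imat_apply_holomorphic[OF S g(2) gh(2) u Xh Xb]) auto
  have uniform_holo: "F holomorphic_on S"
    if f: "\<And>n. f n holomorphic_on S" and d: "\<And>n \<zeta>. \<zeta> \<in> S \<Longrightarrow> cmod (F \<zeta> - f n \<zeta>) \<le> \<theta> ^ n * (1 / (1 - \<theta>))" for F f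
  proof (rule holomorphic_uniform_sequence[OF S f])
    fix \<zeta> assume \<zeta>: "\<zeta> \<in> S"
    obtain e where e: "0 < e" "cball \<zeta> e \<subseteq> S" using S \<zeta> open_contains_cball by blast
    have \<theta>: "0 \<le> \<theta>" using u(2)[OF \<zeta>] norm_ge_zero order_trans by blast
    have "(\<lambda>n. \<theta> ^ n * (1 / (1 - \<theta>))) \<longlonglongrightarrow> 0 * (1 / (1 - \<theta>))"
      using \<theta> u(3) by (intro tendsto_mult tendsto_const LIMSEQ_power_zero) simp
    then have lim: "(\<lambda>n. \<theta> ^ n * (1 / (1 - \<theta>))) \<longlonglongrightarrow> 0" by simp
    have "uniform_limit (cball \<zeta> e) f F sequentially"
    proof (rule uniform_limitI)
      fix \<delta> :: real assume "0 < \<delta>"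
      then have "\<forall>\<^sub>F n in sequentially. \<theta> ^ n * (1 / (1 - \<theta>)) < \<delta>" using lim by (intro order_tendstoD(2))
      then show "\<forall>\<^sub>F n in sequentially. \<forall>x\<in>cball \<zeta> e. dist (f n x) (F x) < \<delta>"
      proof eventually_elim
        case (elim n)
        show ?case
        proof
          fix x assume "x \<in> cball \<zeta> e"
          then have "cmod (F x - f n x) \<le> \<theta> ^ n * (1 / (1 - \<theta>))" using e d by blast
          then show "dist (f n x) (F x) < \<delta>" using elim by (simp add: dist_norm norm_minus_commute)
        qed
      qed
    qed
    then show "\<exists>d>0. cball \<zeta> d \<subseteq> S \<and> uniform_limit (cball \<zeta> d) f F sequentially" using e by blast
  qed
  show "(\<lambda>\<zeta>. loop_resolvent (g \<zeta>) (g' \<zeta>) (u \<zeta>) 1 1) holomorphic_on S"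
  proof (rule uniform_holo[OF Xh[of 1]])
    fix n \<zeta> assume \<zeta>: "\<zeta> \<in> S"
    have u1: "cmod (u \<zeta>) < 1" using u(2)[OF \<zeta>] u(3) by linarith
    have R: "l2 (?R \<zeta>)" by (rule loop_resolvent_l2[OF g(1)[OF \<zeta>] g(2)[OF \<zeta>] u1]) simp
    have "l2 (\<lambda>k. ?R \<zeta> k - X \<zeta> n k)" using l2_diff[OF R] main[OF \<zeta>] by blast
    from cmod_le_l2norm[OF this, of 1] show "cmod (?R \<zeta> 1 - X \<zeta> n 1) \<le> \<theta> ^ n * (1 / (1 - \<theta>))"
      using main[OF \<zeta>, of n] by simp
  qed simp
  show "(\<lambda>\<zeta>. imat_apply (?K' \<zeta>) (?R \<zeta>) 1) holomorphic_on S"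
  proof (rule uniform_holo[OF KXh])
    fix n \<zeta> assume \<zeta>: "\<zeta> \<in> S"
    have u1: "cmod (u \<zeta>) < 1" using u(2)[OF \<zeta>] u(3) by linarith
    note K' = mbound_mscale[OF g(2)[OF \<zeta>] u1]
    have R: "l2 (?R \<zeta>)" by (rule loop_resolvent_l2[OF g(1)[OF \<zeta>] g(2)[OF \<zeta>] u1]) simp
    have x: "l2 (X \<zeta> n)" using main[OF \<zeta>] by blast
    note KD = imat_apply_l2[OF K' l2_diff[OF R x]]
    have "cmod (u \<zeta>) * l2norm (\<lambda>k. ?R \<zeta> k - X \<zeta> n k) \<le> 1 * l2norm (\<lambda>k. ?R \<zeta> k - X \<zeta> n k)" using u1 by (intro mult_right_mono) auto
    then have "cmod (imat_apply (?K' \<zeta>) (\<lambda>k. ?R \<zeta> k - X \<zeta> n k) 1) \<le> \<theta> ^ n * (1 / (1 - \<theta>))"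
      using cmod_le_l2norm[OF KD(1), of 1] KD(2) main[OF \<zeta>, of n] by simp
    then show "cmod (imat_apply (?K' \<zeta>) (?R \<zeta>) 1 - imat_apply (?K' \<zeta>) (X \<zeta> n) 1) \<le> \<theta> ^ n * (1 / (1 - \<theta>))"
      using imat_apply_diff[OF K' R x, of 1] by simp
  qed
qed

text \<open>The constant comes from Cauchy's inequality for the derivative on discs of radius
  \<delta> / 4, which stay inside the ball when centred in its half.\<close>

lemma holomorphic_lipschitz:
  assumes f: "f holomorphic_on ball a \<delta>" and b: "\<And>x. x \<in> ball a \<delta> \<Longrightarrow> cmod (f x) \<le> B"
    and x: "x \<in> ball a (\<delta> / 2)"
  shows "cmod (f x - f a) \<le> 4 * B / \<delta> * cmod (x - a)"
proof -
  have \<delta>: "0 < \<delta>" using x zero_le_dist[of a x] unfolding mem_ball by linarith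
  have d: "(f has_field_derivative deriv f y) (at y within ball a (\<delta> / 2))" if "y \<in> ball a (\<delta> / 2)" for y
    using holomorphic_derivI[OF f open_ball, of y] that \<delta> by (auto intro: has_field_derivative_at_within)
  have db: "cmod (deriv f y) \<le> 4 * B / \<delta>" if y: "y \<in> ball a (\<delta> / 2)" for y
  proof -
    have sub: "cball y (\<delta> / 4) \<subseteq> ball a \<delta>"
    proof
      fix w assume "w \<in> cball y (\<delta> / 4)"
      then show "w \<in> ball a \<delta>" using y \<delta> dist_triangle[of a w y] by auto
    qed
    have "cmod ((deriv ^^ 1) f y) \<le> fact 1 * B / (\<delta> / 4) ^ 1"
    proof (rule Cauchy_inequality)
      show "f holomorphic_on ball y (\<delta> / 4)" using sub by (intro holomorphic_on_subset[OF f]) (auto intro: ball_subset_cball[THEN subsetD])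
      show "continuous_on (cball y (\<delta> / 4)) f" by (rule holomorphic_on_imp_continuous_on[OF holomorphic_on_subset[OF f sub]])
      show "cmod (f w) \<le> B" if "cmod (y - w) = \<delta> / 4" for w
        using that sub by (intro b) (auto simp: dist_norm)
    qed (use \<delta> in simp)
    then show ?thesis by (simp add: mult.commute)
  qed
  show ?thesis by (rule field_differentiable_bound[OF convex_ball d db x]) (use \<delta> in auto)
qed

text \<open>Osgood's lemma at a point: by the Schwarz-type bound above, bounded separate holomorphy makes
  all mixed increments quadratically small.\<close>

lemma separately_holomorphic_has_derivative:
  fixes F :: "complex \<times> complex \<times> complex \<Rightarrow> complex"
  assumes \<delta>: "0 < \<delta>"
    and bound: "\<And>x y z. x \<in> ball a \<delta> \<Longrightarrow> y \<in> ball b \<delta> \<Longrightarrow> z \<in> ball c \<delta> \<Longrightarrow> cmod (F (x, y, z)) \<le> B"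
    and h1: "\<And>y z. y \<in> ball b \<delta> \<Longrightarrow> z \<in> ball c \<delta> \<Longrightarrow> (\<lambda>x. F (x, y, z)) holomorphic_on ball a \<delta>"
    and h2: "\<And>x z. x \<in> ball a \<delta> \<Longrightarrow> z \<in> ball c \<delta> \<Longrightarrow> (\<lambda>y. F (x, y, z)) holomorphic_on ball b \<delta>"
    and h3: "\<And>x y. x \<in> ball a \<delta> \<Longrightarrow> y \<in> ball b \<delta> \<Longrightarrow> (\<lambda>z. F (x, y, z)) holomorphic_on ball c \<delta>"
  shows "\<exists>A A' A''. (F has_derivative (\<lambda>(u, v, w). A * u + A' * v + A'' * w)) (at (a, b, c))"
proof -
  define A where "A = deriv (\<lambda>x. F (x, b, c)) a"
  define A' where "A' = deriv (\<lambda>y. F (a, y, c)) b"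
  define A'' where "A'' = deriv (\<lambda>z. F (a, b, z)) c"
  define K where "K = 4 * B / \<delta>"
  \<comment> \<open>F minus its values along the three coordinate axes. Only mixed increments
    remain, so R should have derivative 0, and the axis restrictions are differentiable
    separately.\<close>
  define R where "R q = F q - F (fst q, b, c) - F (a, fst (snd q), c) - F (a, b, snd (snd q)) + 2 * F (a, b, c)" for q
  have mem: "a \<in> ball a \<delta>" "b \<in> ball b \<delta>" "c \<in> ball c \<delta>" using \<delta> by auto
  have B0: "0 \<le> B" using bound[OF mem] norm_ge_zero order_trans by blast
  have half: "w \<in> ball v \<delta>" if "w \<in> ball v (\<delta> / 2)" for v w :: complex using that \<delta> by auto
  have Rb: "cmod (R (x, y, z)) \<le> 3 * (4 * K / \<delta>) * (norm ((x, y, z) - (a, b, c)))\<^sup>2"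
    if x: "x \<in> ball a (\<delta> / 2)" and y: "y \<in> ball b (\<delta> / 2)" and z: "z \<in> ball c (\<delta> / 2)" for x y z
  proof -
    define h where "h = norm ((x, y, z) - (a, b, c))"
    have n: "cmod (x - a) \<le> h" "cmod (y - b) \<le> h" "cmod (z - c) \<le> h"
      using norm_fst_le[of "x - a" "(y - b, z - c)"] norm_snd_le[of "(y - b, z - c)" "x - a"]
        norm_fst_le[of "y - b" "z - c"] norm_snd_le[of "z - c" "y - b"] unfolding h_def by auto
    have h0: "0 \<le> h" by (simp add: h_def)
    have K0: "0 \<le> K" using B0 \<delta> by (simp add: K_def)
    have L2: "cmod (F (x', y, z') - F (x', b, z')) \<le> K * h" if "x' \<in> ball a \<delta>" "z' \<in> ball c \<delta>" for x' z'
      using holomorphic_lipschitz[OF h2[OF that] bound[OF that(1) _ that(2)] y] mult_left_mono[OF n(2) K0] by (simp add: K_def)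
    have L3: "cmod (F (x', y', z) - F (x', y', c)) \<le> K * h" if "x' \<in> ball a \<delta>" "y' \<in> ball b \<delta>" for x' y'
      using holomorphic_lipschitz[OF h3[OF that] bound[OF that] z] mult_left_mono[OF n(3) K0] by (simp add: K_def)
    have "cmod ((F (x, y, z) - F (x, b, c)) - (F (a, y, z) - F (a, b, c))) \<le> 4 * (2 * (K * h)) / \<delta> * cmod (x - a)"
    proof (rule holomorphic_lipschitz[of "\<lambda>x. F (x, y, z) - F (x, b, c)", OF _ _ x])
      show "(\<lambda>x. F (x, y, z) - F (x, b, c)) holomorphic_on ball a \<delta>"
        by (intro holomorphic_on_diff h1 half y z mem)
      show "cmod (F (x', y, z) - F (x', b, c)) \<le> 2 * (K * h)" if "x' \<in> ball a \<delta>" for x'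
        using norm_triangle_ineq[of "F (x', y, z) - F (x', b, z)" "F (x', b, z) - F (x', b, c)"]
          L2[OF that half[OF z]] L3[OF that mem(2)] by simp
    qed
    also have "\<dots> \<le> 4 * (2 * (K * h)) / \<delta> * h" using n K0 \<delta> h0 by (intro mult_left_mono) auto
    finally have t1: "cmod ((F (x, y, z) - F (x, b, c)) - (F (a, y, z) - F (a, b, c))) \<le> 2 * (4 * K / \<delta>) * h\<^sup>2"
      by (simp add: power2_eq_square mult_ac)
    have "cmod ((F (a, y, z) - F (a, y, c)) - (F (a, b, z) - F (a, b, c))) \<le> 4 * (K * h) / \<delta> * cmod (y - b)"
    proof (rule holomorphic_lipschitz[of "\<lambda>y. F (a, y, z) - F (a, y, c)", OF _ _ y])
      show "(\<lambda>y. F (a, y, z) - F (a, y, c)) holomorphic_on ball b \<delta>"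
        by (intro holomorphic_on_diff h2 half z mem)
    qed (rule L3[OF mem(1)])
    also have "\<dots> \<le> 4 * (K * h) / \<delta> * h" using n K0 \<delta> h0 by (intro mult_left_mono) auto
    finally have t2: "cmod ((F (a, y, z) - F (a, y, c)) - (F (a, b, z) - F (a, b, c))) \<le> (4 * K / \<delta>) * h\<^sup>2"
      by (simp add: power2_eq_square mult_ac)
    \<comment> \<open>A mixed difference in x against (y, z) plus one in y against z. Each is a
      Lipschitz bound applied to a function that is itself of the size of the increment.\<close>
    have "R (x, y, z) = ((F (x, y, z) - F (x, b, c)) - (F (a, y, z) - F (a, b, c))) + ((F (a, y, z) - F (a, y, c)) - (F (a, b, z) - F (a, b, c)))"
      by (simp add: R_def)
    then have "cmod (R (x, y, z)) \<le> 2 * (4 * K / \<delta>) * h\<^sup>2 + (4 * K / \<delta>) * h\<^sup>2"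
      using t1 t2 norm_triangle_mono by metis
    then show ?thesis by (simp add: h_def)
  qed
  have R: "(R has_derivative (\<lambda>h. 0)) (at (a, b, c))"
    unfolding has_derivative_at
  proof
    define C where "C = 3 * (4 * K / \<delta>)"
    have R0: "R (a, b, c) = 0" by (simp add: R_def)
    have "\<forall>\<^sub>F h in at 0. h \<in> ball (0 :: complex \<times> complex \<times> complex) (\<delta> / 2)"
      using \<delta> by (intro eventually_at_in_open') auto
    then have ev: "\<forall>\<^sub>F h in at 0. norm (norm (R ((a, b, c) + h) - R (a, b, c) - 0) / norm h) \<le> C * norm h"
      using eventually_neq_at_within[of 0 0 UNIV]
    proof eventually_elim
      case (elim h)
      obtain h1 h2 h3 where h: "h = (h1, h2, h3)" by (cases h)
      have "cmod h1 < \<delta> / 2" "cmod h2 < \<delta> / 2" "cmod h3 < \<delta> / 2"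
        using elim(1) norm_fst_le[of h1 "(h2, h3)"] norm_snd_le[of "(h2, h3)" h1] norm_fst_le[of h2 h3] norm_snd_le[of h3 h2] by (auto simp: h)
      then have "cmod (R (a + h1, b + h2, c + h3)) \<le> C * (norm ((a + h1, b + h2, c + h3) - (a, b, c)))\<^sup>2"
        unfolding C_def by (intro Rb) (auto simp: dist_norm)
      then have "norm (R ((a, b, c) + h)) \<le> C * (norm h)\<^sup>2" by (simp add: h)
      then show ?case using elim(2) R0 by (simp add: power2_eq_square divide_le_eq mult.assoc)
    qed
    have "((\<lambda>h. C * norm h) \<longlongrightarrow> C * 0) (at (0 :: complex \<times> complex \<times> complex))"
      by (intro tendsto_mult tendsto_const tendsto_norm_zero tendsto_ident_at)
    then have "((\<lambda>h. C * norm h) \<longlongrightarrow> 0) (at (0 :: complex \<times> complex \<times> complex))" by simp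
    then show "(\<lambda>h. norm (R ((a, b, c) + h) - R (a, b, c) - 0) / norm h) \<midarrow>0\<rightarrow> 0"
      by (rule Lim_null_comparison[OF ev])
  qed simp
  have "((\<lambda>x. F (x, b, c)) has_derivative (\<lambda>h. A * h)) (at (fst (a, b, c)))"
    using holomorphic_derivI[OF h1[OF mem(2,3)] open_ball mem(1)] by (simp add: A_def has_field_derivative_def)
  from has_derivative_compose[OF has_derivative_fst[OF has_derivative_ident] this]
  have 1: "((\<lambda>q. F (fst q, b, c)) has_derivative (\<lambda>h. A * fst h)) (at (a, b, c))" .
  have "((\<lambda>y. F (a, y, c)) has_derivative (\<lambda>h. A' * h)) (at (fst (snd (a, b, c))))"
    using holomorphic_derivI[OF h2[OF mem(1,3)] open_ball mem(2)] by (simp add: A'_def has_field_derivative_def)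
  from has_derivative_compose[OF has_derivative_fst[OF has_derivative_snd[OF has_derivative_ident]] this]
  have 2: "((\<lambda>q. F (a, fst (snd q), c)) has_derivative (\<lambda>h. A' * fst (snd h))) (at (a, b, c))" .
  have "((\<lambda>z. F (a, b, z)) has_derivative (\<lambda>h. A'' * h)) (at (snd (snd (a, b, c))))"
    using holomorphic_derivI[OF h3[OF mem(1,2)] open_ball mem(3)] by (simp add: A''_def has_field_derivative_def)
  from has_derivative_compose[OF has_derivative_snd[OF has_derivative_snd[OF has_derivative_ident]] this]
  have 3: "((\<lambda>q. F (a, b, snd (snd q))) has_derivative (\<lambda>h. A'' * snd (snd h))) (at (a, b, c))" .
  have "((\<lambda>q. R q + F (fst q, b, c) + F (a, fst (snd q), c) + F (a, b, snd (snd q)) - 2 * F (a, b, c)) has_derivative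
      (\<lambda>h. 0 + A * fst h + A' * fst (snd h) + A'' * snd (snd h) - 0)) (at (a, b, c))"
    by (intro has_derivative_diff has_derivative_add R 1 2 3 has_derivative_const)
  then have "(F has_derivative (\<lambda>(u, v, w). A * u + A' * v + A'' * w)) (at (a, b, c))"
    by (simp add: R_def case_prod_unfold)
  then show ?thesis by blast
qed

section \<open>Uniform choice of the sewing radii\<close>

text \<open>A shortest vector \<kappa> of the moved lattice is compared with the vector \<kappa>0
  having the same integral coordinates in the old one. The coordinate m is at most |\<kappa>0| / (2
  pi Im \<tau>), so the move changes the vector by at most |x - \<tau>| / Im \<tau> times
  |\<kappa>0|.\<close>

lemma min_norm_lower:
  assumes \<tau>: "0 < Im \<tau>" and x: "cmod (x - \<tau>) < Im \<tau>"
  shows "0 < Im x" and "(1 - cmod (x - \<tau>) / Im \<tau>) * min_norm (torus_lattice \<tau>) \<le> min_norm (torus_lattice x)"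
proof -
  have "Im \<tau> - Im x \<le> cmod (x - \<tau>)" using abs_Im_le_cmod[of "x - \<tau>"] by simp
  then show Imx: "0 < Im x" using x by linarith
  interpret T: torus \<tau> using \<tau> by (simp add: torus_def)
  interpret X: torus x using Imx by (simp add: torus_def)
  obtain \<kappa> where k: "\<kappa> \<in> torus_lattice x" "\<kappa> \<noteq> 0" "cmod \<kappa> = min_norm (torus_lattice x)" by (rule X.min_norm_attained)
  obtain m n where mn: "\<kappa> = of_int m * (2 * pi * \<i> * x) + of_int n * (2 * pi * \<i>)" using k(1) torus_lattice_iff by blast
  define \<kappa>0 where "\<kappa>0 = of_int m * (2 * pi * \<i> * \<tau>) + of_int n * (2 * pi * \<i>)"
  have k0: "\<kappa>0 = 2 * pi * \<i> * (of_int m * \<tau> + of_int n)" "\<kappa> = 2 * pi * \<i> * (of_int m * x + of_int n)"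
    by (simp_all add: \<kappa>0_def mn algebra_simps)
  have kk: "\<kappa>0 = \<kappa> - 2 * pi * \<i> * (of_int m * (x - \<tau>))" by (simp add: k0 algebra_simps)
  have mI: "2 * pi * (\<bar>of_int m\<bar> * Im \<tau>) \<le> cmod \<kappa>0"
    using T.coeff_bound(1)[of m n] by (simp add: k0 norm_mult)
  have "\<kappa>0 \<noteq> 0"
  proof
    assume z: "\<kappa>0 = 0"
    have "2 * pi * (\<bar>of_int m\<bar> * Im \<tau>) \<le> 0" using mI z by simp
    moreover have "0 \<le> \<bar>of_int m\<bar> * Im \<tau>" using \<tau> by simp
    ultimately have "m = 0 \<or> pi \<le> 0" using \<tau> by (simp add: mult_le_0_iff)
    then have "m = 0" using pi_gt_zero by linarith
    then show False using kk z k(2) by simp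
  qed
  moreover have "\<kappa>0 \<in> torus_lattice \<tau>" unfolding torus_lattice_iff \<kappa>0_def by blast
  ultimately have D: "min_norm (torus_lattice \<tau>) \<le> cmod \<kappa>0" using T.D_le by blast
  have "cmod \<kappa>0 \<le> cmod \<kappa> + 2 * pi * (\<bar>of_int m\<bar> * cmod (x - \<tau>))"
    unfolding kk by (rule order_trans[OF norm_triangle_ineq4]) (simp add: norm_mult)
  moreover have "2 * pi * (\<bar>of_int m\<bar> * cmod (x - \<tau>)) \<le> cmod (x - \<tau>) / Im \<tau> * cmod \<kappa>0"
    using mult_left_mono[OF mI, of "cmod (x - \<tau>) / Im \<tau>"] \<tau> by (simp add: field_simps)
  ultimately have "(1 - cmod (x - \<tau>) / Im \<tau>) * cmod \<kappa>0 \<le> cmod \<kappa>" by (simp add: left_diff_distrib)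
  moreover have "(1 - cmod (x - \<tau>) / Im \<tau>) * min_norm (torus_lattice \<tau>) \<le> (1 - cmod (x - \<tau>) / Im \<tau>) * cmod \<kappa>0"
    using D x \<tau> by (intro mult_left_mono) auto
  ultimately show "(1 - cmod (x - \<tau>) / Im \<tau>) * min_norm (torus_lattice \<tau>) \<le> min_norm (torus_lattice x)" using k(3) by linarith
qed

text \<open>Holomorphy in \<tau> and \<epsilon> needs radii that are fixed on a whole neighbourhood,
  together with a bound \<theta> for u that is uniform there.\<close>

lemma sewing_domain_radii:
  assumes "(\<tau>1, \<tau>2, \<epsilon>) \<in> sewing_domain"
  obtains \<rho> \<theta> \<delta> where "0 < \<delta>" "\<theta> < 1"
    "\<And>x y z. x \<in> ball \<tau>1 \<delta> \<Longrightarrow> y \<in> ball \<tau>2 \<delta> \<Longrightarrow> z \<in> ball \<epsilon> \<delta> \<Longrightarrow>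
       sewing (vector [x, y]) z \<rho> \<and> cmod (sewing.u z \<rho>) \<le> \<theta>"
proof -
  let ?D = "\<lambda>\<tau>. min_norm (torus_lattice \<tau>)"
  have dom: "0 < Im \<tau>1" "0 < Im \<tau>2" "cmod \<epsilon> < ?D \<tau>1 * ?D \<tau>2 / 4"
    using assms by (auto simp: sewing_domain_def upper_half_plane_def)
  have D: "0 < ?D \<tau>1" "0 < ?D \<tau>2" using torus.D_pos dom by (auto simp: torus_def)
  define P where "P = ?D \<tau>1 * ?D \<tau>2 / 4"
  define m where "m = cmod \<epsilon> / P"
  have P: "0 < P" using D by (simp add: P_def)
  have m: "0 \<le> m" "m < 1" using dom P by (simp_all add: m_def P_def[symmetric])
  \<comment> \<open>The radii are to be s D / 2. This choice has s < 1, which leaves room for \<tau>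
    to move, and s^2 > m, which leaves room for \<epsilon>.\<close>
  define s where "s = (1 + m) / 2"
  have s: "0 < s" "s < 1" using m by (auto simp: s_def)
  have "0 < (1 - m)\<^sup>2" using m by simp
  then have ms: "m < s\<^sup>2" by (simp add: s_def power2_eq_square field_simps)
  define \<rho> :: "real ^ 2" where "\<rho> = vector [s * ?D \<tau>1 / 2, s * ?D \<tau>2 / 2]"
  have \<rho>: "\<rho> $ 1 = s * ?D \<tau>1 / 2" "\<rho> $ 2 = s * ?D \<tau>2 / 2" by (simp_all add: \<rho>_def vector_2)
  have \<rho>P: "\<rho> $ 1 * \<rho> $ 2 = s\<^sup>2 * P" by (simp add: \<rho> P_def power2_eq_square)
  \<comment> \<open>Halfway between 1 and m / s^2, the modulus of u at the centre.\<close>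
  define \<theta> where "\<theta> = (m / s\<^sup>2 + 1) / 2"
  have q: "m / s\<^sup>2 < 1" using ms s by simp
  have \<theta>: "\<theta> < 1" "m / s\<^sup>2 < \<theta>" "0 \<le> \<theta>"
  proof -
    define t where "t = m / s\<^sup>2"
    have "0 \<le> t" "t < 1" "\<theta> = (t + 1) / 2" using m q by (simp_all add: t_def \<theta>_def)
    then show "\<theta> < 1" "m / s\<^sup>2 < \<theta>" "0 \<le> \<theta>" unfolding t_def[symmetric] by simp_all
  qed
  \<comment> \<open>The first entry keeps u below \<theta> in modulus; by
    \<open>min_norm_lower\<close> the others keep the minimal norms above s times their values at
    the centre.\<close>
  define \<delta> where "\<delta> = min ((\<theta> - m / s\<^sup>2) * (s\<^sup>2 * P)) (min ((1 - s) * Im \<tau>1) ((1 - s) * Im \<tau>2))"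
  have \<delta>: "0 < \<delta>" using \<theta> s P dom by (simp add: \<delta>_def)
  have rad: "0 < Im x \<and> s * ?D \<tau> / 2 < ?D x / 2" if "cmod (x - \<tau>) < (1 - s) * Im \<tau>" "0 < Im \<tau>" "0 < ?D \<tau>" for x \<tau>
  proof -
    have "(1 - s) * Im \<tau> \<le> 1 * Im \<tau>" using s that by (intro mult_right_mono) auto
    then have lt: "cmod (x - \<tau>) < Im \<tau>" using that by linarith
    have "s < 1 - cmod (x - \<tau>) / Im \<tau>" using that by (simp add: field_simps)
    then have "s * ?D \<tau> < (1 - cmod (x - \<tau>) / Im \<tau>) * ?D \<tau>" using that by (intro mult_strict_right_mono)
    then show ?thesis using min_norm_lower[OF that(2) lt] by simp
  qed
  have "sewing (vector [x, y]) z \<rho> \<and> cmod (sewing.u z \<rho>) \<le> \<theta>"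
    if x: "x \<in> ball \<tau>1 \<delta>" and y: "y \<in> ball \<tau>2 \<delta>" and z: "z \<in> ball \<epsilon> \<delta>" for x y z
  proof -
    have "cmod (x - \<tau>1) < (1 - s) * Im \<tau>1" "cmod (y - \<tau>2) < (1 - s) * Im \<tau>2"
      using x y by (auto simp: \<delta>_def dist_norm norm_minus_commute)
    then have rx: "0 < Im x \<and> s * ?D \<tau>1 / 2 < ?D x / 2" and ry: "0 < Im y \<and> s * ?D \<tau>2 / 2 < ?D y / 2"
      using rad dom D by blast+
    have "cmod z < cmod \<epsilon> + \<delta>" using z norm_triangle_sub[of z \<epsilon>] by (simp add: dist_norm norm_minus_commute)
    also have "\<dots> \<le> cmod \<epsilon> + (\<theta> - m / s\<^sup>2) * (s\<^sup>2 * P)" by (simp add: \<delta>_def)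
    also have "\<dots> = \<theta> * (s\<^sup>2 * P)" using s P by (simp add: m_def field_simps)
    finally have zb: "cmod z < \<theta> * (\<rho> $ 1 * \<rho> $ 2)" by (simp add: \<rho>P)
    have pos: "0 < \<rho> $ 1 * \<rho> $ 2" using s P by (simp add: \<rho>P)
    have "\<theta> * (\<rho> $ 1 * \<rho> $ 2) \<le> 1 * (\<rho> $ 1 * \<rho> $ 2)" using \<theta> pos by (intro mult_right_mono) auto
    then have "cmod z < \<rho> $ 1 * \<rho> $ 2" using zb by linarith
    then have sw: "sewing (vector [x, y]) z \<rho>"
      using rx ry s D by (auto simp: sewing_def sewing_radii_def forall_2 vector_2 \<rho>)
    have "cmod (sewing.u z \<rho>) = cmod z / (\<rho> $ 1 * \<rho> $ 2)"
      unfolding sewing.u_def[OF sw] norm_divide norm_of_real using pos by (simp only: abs_of_pos)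
    then show ?thesis using sw zb pos by (simp add: pos_divide_le_eq)
  qed
  then show ?thesis using that[OF \<delta> \<theta>(1)] by blast
qed

text \<open>Supplies the local boundedness required for joint holomorphy. The factor 1 +
  \<open>r $ j / r $ (j + 1)\<close> covers the diagonal and the off-diagonal entries at
  once.\<close>

lemma (in sewing) omega_bound:
  assumes \<theta>: "cmod u \<le> \<theta>" "\<theta> < 1"
  shows "cmod (omega $ i $ j) \<le> cmod (\<tau> $ j) + cmod \<epsilon> * ((1 + r $ j / r $ (j + 1)) * (1 / (1 - \<theta>)))"
proof -
  let ?q = "r $ j / r $ (j + 1)"
  have q: "0 \<le> ?q" using r_bounds(1)[of j] r_bounds(1)[of "j + 1"] by simp
  note n = loop_resolvent_norm[OF G_bound[of j] G_bound[of "j + 1"] \<theta>]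
  have t: "0 \<le> 1 / (1 - \<theta>)" using \<theta> by simp
  have R: "cmod (resolvent j 1) \<le> 1 / (1 - \<theta>)"
    using cmod_le_l2norm[OF resolvent_l2[of j], of 1] n(1) by (simp add: resolvent_def[abs_def])
  have Y: "cmod (imat_apply (mscale (G (j + 1)) u) (resolvent j) 1) \<le> 1 / (1 - \<theta>)"
    using n(2) by (simp add: resolvent_def[abs_def])
  have "cmod (2 * pi * \<i> * omega $ i $ j) \<le> 2 * pi * cmod (\<tau> $ j) + cmod \<epsilon> * ((1 + ?q) * (1 / (1 - \<theta>)))"
    using two_cases[of i j]
  proof
    assume i: "i = j"
    have "cmod (2 * pi * \<i> * omega $ j $ j) \<le> cmod (2 * pi * \<i> * \<tau> $ j) + cmod (\<epsilon> * of_real ?q * imat_apply (mscale (G (j + 1)) u) (resolvent j) 1)"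
      unfolding omega_diag by (rule norm_triangle_ineq)
    also have "\<dots> = 2 * pi * cmod (\<tau> $ j) + cmod \<epsilon> * (?q * cmod (imat_apply (mscale (G (j + 1)) u) (resolvent j) 1))"
      unfolding norm_mult norm_of_real abs_of_nonneg[OF q] by simp
    also have "\<dots> \<le> 2 * pi * cmod (\<tau> $ j) + cmod \<epsilon> * ((1 + ?q) * (1 / (1 - \<theta>)))"
      using q by (intro add_left_mono mult_left_mono mult_mono Y) auto
    finally show ?thesis unfolding i .
  next
    assume i: "i = j + 1"
    have "cmod (2 * pi * \<i> * omega $ (j + 1) $ j) = cmod \<epsilon> * (1 * cmod (resolvent j 1))"
      unfolding omega_off by (simp add: norm_mult)
    also have "\<dots> \<le> cmod \<epsilon> * ((1 + ?q) * (1 / (1 - \<theta>)))"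
      using q by (intro mult_left_mono mult_mono R) auto
    also have "\<dots> \<le> 2 * pi * cmod (\<tau> $ j) + cmod \<epsilon> * ((1 + ?q) * (1 / (1 - \<theta>)))" by simp
    finally show ?thesis unfolding i .
  qed
  then have "2 * pi * cmod (omega $ i $ j) \<le> 2 * pi * cmod (\<tau> $ j) + cmod \<epsilon> * ((1 + ?q) * (1 / (1 - \<theta>)))" by (simp add: norm_mult)
  also have "\<dots> \<le> 2 * pi * (cmod (\<tau> $ j) + cmod \<epsilon> * ((1 + ?q) * (1 / (1 - \<theta>))))"
  proof -
    have "0 \<le> cmod \<epsilon> * ((1 + ?q) * (1 / (1 - \<theta>)))" using q t by simp
    moreover have "1 \<le> 2 * pi" using pi_gt3 by simp
    ultimately have "1 * (cmod \<epsilon> * ((1 + ?q) * (1 / (1 - \<theta>)))) \<le> 2 * pi * (cmod \<epsilon> * ((1 + ?q) * (1 / (1 - \<theta>))))"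
      by (rule mult_right_mono[rotated])
    then show ?thesis by (simp only: distrib_left mult_1)
  qed
  finally show ?thesis by (simp only: mult_le_cancel_left_pos pi_gt_zero zero_less_mult_iff zero_less_numeral simp_thms)
qed

text \<open>A one-parameter family T, e with fixed radii treats the three slices, in each \<tau> and
  in \<epsilon>, by the same argument.\<close>

lemma omega_slice_holomorphic:
  fixes T :: "complex \<Rightarrow> complex ^ 2" and \<rho> :: "real ^ 2"
  assumes S: "open S" and sw: "\<And>\<zeta>. \<zeta> \<in> S \<Longrightarrow> sewing (T \<zeta>) (e \<zeta>) \<rho> \<and> cmod (sewing.u (e \<zeta>) \<rho>) \<le> \<theta>" and \<theta>: "\<theta> < 1"
    and T: "\<And>a. (\<lambda>\<zeta>. T \<zeta> $ a) holomorphic_on S" and e: "e holomorphic_on S"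
  shows "(\<lambda>\<zeta>. sewing.omega (T \<zeta>) (e \<zeta>) \<rho> $ i $ j) holomorphic_on S"
proof -
  define g where "g a \<zeta> = grunsky (T \<zeta> $ a) (\<rho> $ a)" for a \<zeta>
  define u where "u \<zeta> = e \<zeta> / of_real (\<rho> $ 1 * \<rho> $ 2)" for \<zeta>
  note swS = sw[THEN conjunct1]
  have G: "sewing.G (T \<zeta>) \<rho> a = g a \<zeta>" and U: "sewing.u (e \<zeta>) \<rho> = u \<zeta>" if "\<zeta> \<in> S" for a \<zeta>
    using sewing.G_def[OF swS[OF that]] sewing.u_def[OF swS[OF that]] by (simp_all add: g_def u_def)
  have gb: "mbound (g a \<zeta>) 1" if "\<zeta> \<in> S" for a \<zeta> using sewing.G_bound[OF swS[OF that]] G[OF that] by simp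
  have gh: "(\<lambda>\<zeta>. g a \<zeta> k m) holomorphic_on S" for a k m
  proof -
    have "((\<lambda>\<tau>. grunsky \<tau> (\<rho> $ a) k m) \<circ> (\<lambda>\<zeta>. T \<zeta> $ a)) holomorphic_on S"
      by (rule holomorphic_on_compose_gen[OF T grunsky_holomorphic]) (use sewing.Im_pos[OF swS] in auto)
    then show ?thesis by (simp add: g_def o_def)
  qed
  have uh: "u holomorphic_on S"
  \<comment> \<open>For empty S nothing is known about the radii; in this case the quotient is the
    constant 0.\<close>
  proof (cases "\<rho> $ 1 * \<rho> $ 2 = 0")
    case False
    then show ?thesis unfolding u_def[abs_def] by (intro holomorphic_intros e) auto
  qed (auto simp: u_def[abs_def])
  have ub: "cmod (u \<zeta>) \<le> \<theta>" if "\<zeta> \<in> S" for \<zeta> using sw[OF that] U[OF that] by simp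
  note L = loop_resolvent_holomorphic[OF S gb gb gh gh uh ub \<theta>]
  show ?thesis using two_cases[of i j]
  proof
    assume i: "i = j"
    have "(\<lambda>\<zeta>. (2 * pi * \<i> * T \<zeta> $ j + e \<zeta> * of_real (\<rho> $ j / \<rho> $ (j + 1)) *
       imat_apply (mscale (g (j + 1) \<zeta>) (u \<zeta>)) (\<lambda>k. loop_resolvent (g j \<zeta>) (g (j + 1) \<zeta>) (u \<zeta>) k 1) 1) / (2 * pi * \<i>)) holomorphic_on S"
      by (intro holomorphic_on_divide holomorphic_on_add holomorphic_on_mult holomorphic_on_const T e L) auto
    then show ?thesis
    proof (rule holomorphic_transform)
      fix \<zeta> assume z: "\<zeta> \<in> S"
      show "(2 * pi * \<i> * T \<zeta> $ j + e \<zeta> * of_real (\<rho> $ j / \<rho> $ (j + 1)) *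
       imat_apply (mscale (g (j + 1) \<zeta>) (u \<zeta>)) (\<lambda>k. loop_resolvent (g j \<zeta>) (g (j + 1) \<zeta>) (u \<zeta>) k 1) 1) / (2 * pi * \<i>) = sewing.omega (T \<zeta>) (e \<zeta>) \<rho> $ i $ j"
        using sewing.omega_diag[OF swS[OF z], of j, symmetric] unfolding i sewing.resolvent_def[OF swS[OF z], abs_def] G[OF z] U[OF z] by simp
    qed
  next
    assume i: "i = j + 1"
    have "(\<lambda>\<zeta>. - e \<zeta> * loop_resolvent (g j \<zeta>) (g (j + 1) \<zeta>) (u \<zeta>) 1 1 / (2 * pi * \<i>)) holomorphic_on S"
      by (intro holomorphic_on_divide holomorphic_on_mult holomorphic_on_minus holomorphic_on_const e L) auto
    then show ?thesis
    proof (rule holomorphic_transform)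
      fix \<zeta> assume z: "\<zeta> \<in> S"
      show "- e \<zeta> * loop_resolvent (g j \<zeta>) (g (j + 1) \<zeta>) (u \<zeta>) 1 1 / (2 * pi * \<i>) = sewing.omega (T \<zeta>) (e \<zeta>) \<rho> $ i $ j"
        using sewing.omega_off[OF swS[OF z], of j, symmetric] unfolding i sewing.resolvent_def[OF swS[OF z], abs_def] G[OF z] U[OF z] by simp
    qed
  qed
qed

text \<open>The definite description ranges over all admissible radii. It is well defined because
  for each of them the period matrix is unique and the value does not depend on the radii.\<close>

lemma period_map_eq:
  assumes "sewing (vector [\<tau>1, \<tau>2]) \<epsilon> \<rho>"
  shows "period_map (\<tau>1, \<tau>2, \<epsilon>) = sewing.omega (vector [\<tau>1, \<tau>2]) \<epsilon> \<rho>"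
proof -
  interpret sewing "vector [\<tau>1, \<tau>2]" \<epsilon> \<rho> by (rule assms)
  have "(THE \<Omega>. \<exists>r. sewing_radii (vector [\<tau>1, \<tau>2]) \<epsilon> r \<and> is_period_matrix (vector [\<tau>1, \<tau>2]) \<epsilon> r \<Omega>) = omega"
  proof (rule the_equality)
    show "\<exists>r. sewing_radii (vector [\<tau>1, \<tau>2]) \<epsilon> r \<and> is_period_matrix (vector [\<tau>1, \<tau>2]) \<epsilon> r omega"
      using radii omega_period_matrix by blast
    fix \<Omega> assume "\<exists>r. sewing_radii (vector [\<tau>1, \<tau>2]) \<epsilon> r \<and> is_period_matrix (vector [\<tau>1, \<tau>2]) \<epsilon> r \<Omega>"
    then obtain r where r: "sewing_radii (vector [\<tau>1, \<tau>2]) \<epsilon> r" "is_period_matrix (vector [\<tau>1, \<tau>2]) \<epsilon> r \<Omega>" by blast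
    have "sewing (vector [\<tau>1, \<tau>2]) \<epsilon> r" by unfold_locales (rule Im_pos, rule r(1))
    then show "\<Omega> = omega" using sewing.period_matrix_iff r omega_independent by metis
  qed
  then show ?thesis by (simp add: period_map_def)
qed

lemma sewing_imp_domain:
  assumes "sewing (vector [\<tau>1, \<tau>2]) \<epsilon> \<rho>" shows "(\<tau>1, \<tau>2, \<epsilon>) \<in> sewing_domain"
proof -
  interpret sewing "vector [\<tau>1, \<tau>2]" \<epsilon> \<rho> by (rule assms)
  have "\<rho> $ 1 * \<rho> $ 2 < (min_norm (torus_lattice \<tau>1) / 2) * (min_norm (torus_lattice \<tau>2) / 2)"
    using r_bounds[of 1] r_bounds[of 2] by (intro mult_strict_mono) (simp_all add: vector_2)
  moreover have "cmod \<epsilon> < \<rho> $ 1 * \<rho> $ 2" using radii by (simp add: sewing_radii_def)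
  ultimately show ?thesis using Im_pos[of 1] Im_pos[of 2] by (simp add: sewing_domain_def upper_half_plane_def vector_2)
qed

lemma open_sewing_domain: "open sewing_domain"
proof (subst open_subopen, rule ballI)
  fix p assume "p \<in> sewing_domain"
  moreover obtain \<tau>1 \<tau>2 \<epsilon> where p: "p = (\<tau>1, \<tau>2, \<epsilon>)" by (cases p)
  ultimately have d: "(\<tau>1, \<tau>2, \<epsilon>) \<in> sewing_domain" by simp
  obtain \<rho> \<theta> \<delta> where R: "0 < \<delta>" "\<And>x y z. x \<in> ball \<tau>1 \<delta> \<Longrightarrow> y \<in> ball \<tau>2 \<delta> \<Longrightarrow> z \<in> ball \<epsilon> \<delta> \<Longrightarrow>
       sewing (vector [x, y]) z \<rho> \<and> cmod (sewing.u z \<rho>) \<le> \<theta>"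
    by (rule sewing_domain_radii[OF d]) (rule that)
  have "ball \<tau>1 \<delta> \<times> ball \<tau>2 \<delta> \<times> ball \<epsilon> \<delta> \<subseteq> sewing_domain" using R(2) sewing_imp_domain by blast
  moreover have "open (ball \<tau>1 \<delta> \<times> ball \<tau>2 \<delta> \<times> ball \<epsilon> \<delta>)" by (intro open_Times open_ball)
  moreover have "p \<in> ball \<tau>1 \<delta> \<times> ball \<tau>2 \<delta> \<times> ball \<epsilon> \<delta>" using R(1) p by simp
  ultimately show "\<exists>T. open T \<and> p \<in> T \<and> T \<subseteq> sewing_domain" by blast
qed

lemma period_map_holomorphic: "holomorphic_map_on period_map sewing_domain"
  unfolding holomorphic_map_on_def
proof (intro conjI ballI allI open_sewing_domain)
  fix p and i j :: 2 assume "p \<in> sewing_domain"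
  moreover obtain \<tau>1 \<tau>2 \<epsilon> where p: "p = (\<tau>1, \<tau>2, \<epsilon>)" by (cases p)
  ultimately have d: "(\<tau>1, \<tau>2, \<epsilon>) \<in> sewing_domain" by simp
  obtain \<rho> \<theta> \<delta> where \<delta>: "0 < \<delta>" and \<theta>: "\<theta> < 1"
    and R: "\<And>x y z. x \<in> ball \<tau>1 \<delta> \<Longrightarrow> y \<in> ball \<tau>2 \<delta> \<Longrightarrow> z \<in> ball \<epsilon> \<delta> \<Longrightarrow>
       sewing (vector [x, y]) z \<rho> \<and> cmod (sewing.u z \<rho>) \<le> \<theta>"
    by (rule sewing_domain_radii[OF d]) (rule that)
  have pm: "period_map (x, y, z) = sewing.omega (vector [x, y]) z \<rho>"
    if "x \<in> ball \<tau>1 \<delta>" "y \<in> ball \<tau>2 \<delta>" "z \<in> ball \<epsilon> \<delta>" for x y z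
    by (rule period_map_eq) (use R[OF that] in blast)
  have vh: "(\<lambda>\<zeta>. (vector [f \<zeta>, g \<zeta>] :: complex ^ 2) $ a) holomorphic_on S"
    if "f holomorphic_on S" "g holomorphic_on S" for f g a S
    using exhaust_2[of a] that by (auto simp: vector_2)
  define B where "B = (cmod \<tau>1 + \<delta> + (cmod \<tau>2 + \<delta>)) + (cmod \<epsilon> + \<delta>) * ((1 + \<rho> $ j / \<rho> $ (j + 1)) * (1 / (1 - \<theta>)))"
  show "\<exists>a b c. ((\<lambda>x. period_map x $ i $ j) has_derivative (\<lambda>(u, v, w). a * u + b * v + c * w)) (at p)"
    unfolding p
  proof (rule separately_holomorphic_has_derivative[OF \<delta>])
    fix x y z assume xyz: "x \<in> ball \<tau>1 \<delta>" "y \<in> ball \<tau>2 \<delta>" "z \<in> ball \<epsilon> \<delta>"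
    then have sw: "sewing (vector [x, y]) z \<rho>" "cmod (sewing.u z \<rho>) \<le> \<theta>" using R by blast+
    have n: "cmod x \<le> cmod \<tau>1 + \<delta>" "cmod y \<le> cmod \<tau>2 + \<delta>" "cmod z \<le> cmod \<epsilon> + \<delta>"
      using xyz norm_triangle_sub[of x \<tau>1] norm_triangle_sub[of y \<tau>2] norm_triangle_sub[of z \<epsilon>]
      by (auto simp: dist_norm norm_minus_commute)
    have q: "0 \<le> (1 + \<rho> $ j / \<rho> $ (j + 1)) * (1 / (1 - \<theta>))"
      using sewing.r_bounds(1)[OF sw(1), of j] sewing.r_bounds(1)[OF sw(1), of "j + 1"] \<theta> by simp
    have "cmod ((vector [x, y] :: complex ^ 2) $ j) \<le> cmod x + cmod y" using exhaust_2[of j] by (auto simp: vector_2)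
    then have "cmod ((vector [x, y] :: complex ^ 2) $ j) \<le> cmod \<tau>1 + \<delta> + (cmod \<tau>2 + \<delta>)" using n by linarith
    then have "cmod ((vector [x, y] :: complex ^ 2) $ j) + cmod z * ((1 + \<rho> $ j / \<rho> $ (j + 1)) * (1 / (1 - \<theta>))) \<le> B"
      unfolding B_def by (rule add_mono[OF _ mult_right_mono[OF n(3) q]])
    then show "cmod (period_map (x, y, z) $ i $ j) \<le> B"
      unfolding pm[OF xyz] using sewing.omega_bound[OF sw \<theta>] order_trans by blast
  next
    fix y z assume yz: "y \<in> ball \<tau>2 \<delta>" "z \<in> ball \<epsilon> \<delta>"
    have "(\<lambda>x. sewing.omega (vector [x, y]) z \<rho> $ i $ j) holomorphic_on ball \<tau>1 \<delta>"
      by (rule omega_slice_holomorphic[OF open_ball R[OF _ yz] \<theta>]) (auto intro!: vh holomorphic_intros)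
    then show "(\<lambda>x. period_map (x, y, z) $ i $ j) holomorphic_on ball \<tau>1 \<delta>"
      by (rule holomorphic_transform) (simp only: pm[OF _ yz])
  next
    fix x z assume xz: "x \<in> ball \<tau>1 \<delta>" "z \<in> ball \<epsilon> \<delta>"
    have "(\<lambda>y. sewing.omega (vector [x, y]) z \<rho> $ i $ j) holomorphic_on ball \<tau>2 \<delta>"
      by (rule omega_slice_holomorphic[OF open_ball R[OF xz(1) _ xz(2)] \<theta>]) (auto intro!: vh holomorphic_intros)
    then show "(\<lambda>y. period_map (x, y, z) $ i $ j) holomorphic_on ball \<tau>2 \<delta>"
      by (rule holomorphic_transform) (simp only: pm[OF xz(1) _ xz(2)])
  next
    fix x y assume xy: "x \<in> ball \<tau>1 \<delta>" "y \<in> ball \<tau>2 \<delta>"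
    have "(\<lambda>z. sewing.omega (vector [x, y]) z \<rho> $ i $ j) holomorphic_on ball \<epsilon> \<delta>"
      by (rule omega_slice_holomorphic[OF open_ball R[OF xy] \<theta>]) (auto intro!: vh holomorphic_intros)
    then show "(\<lambda>z. period_map (x, y, z) $ i $ j) holomorphic_on ball \<epsilon> \<delta>"
      by (rule holomorphic_transform) (simp only: pm[OF xy])
  qed
qed

theorem theorem4p2:
  shows "(\<forall>(\<tau>1, \<tau>2, \<epsilon>) \<in> sewing_domain.
            (\<exists>r. sewing_radii (vector [\<tau>1, \<tau>2]) \<epsilon> r) \<and>
            (\<forall>r. sewing_radii (vector [\<tau>1, \<tau>2]) \<epsilon> r \<longrightarrow>
               (\<forall>\<Omega>. is_period_matrix (vector [\<tau>1, \<tau>2]) \<epsilon> r \<Omega> \<longleftrightarrow> \<Omega> = period_map (\<tau>1, \<tau>2, \<epsilon>))))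
       \<and> period_map ` sewing_domain \<subseteq> siegel_upper_half_space
       \<and> holomorphic_map_on period_map sewing_domain
       \<and> (\<forall>(\<tau>1, \<tau>2, \<epsilon>) \<in> sewing_domain.
            let \<Omega> = period_map (\<tau>1, \<tau>2, \<epsilon>);
                A1 = sewing_matrix \<tau>1 \<epsilon>;
                A2 = sewing_matrix \<tau>2 \<epsilon>;
                N12 = neumann_inverse (imat_mult A1 A2);
                N21 = neumann_inverse (imat_mult A2 A1)
            in imat_mult_converges A1 A2 \<and> imat_mult_converges A2 A1 \<and>
               neumann_converges (imat_mult A1 A2) \<and> neumann_converges (imat_mult A2 A1) \<and>
               imat_mult_converges A2 N12 \<and> imat_mult_converges A1 N21 \<and>
               2 * pi * \<i> * \<Omega> $ 1 $ 1 = 2 * pi * \<i> * \<tau>1 + \<epsilon> * imat_mult A2 N12 1 1 \<and>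
               2 * pi * \<i> * \<Omega> $ 2 $ 2 = 2 * pi * \<i> * \<tau>2 + \<epsilon> * imat_mult A1 N21 1 1 \<and>
               2 * pi * \<i> * \<Omega> $ 1 $ 2 = - \<epsilon> * N12 1 1)"
proof -
  have ex: "\<exists>\<rho>. sewing (vector [\<tau>1, \<tau>2]) \<epsilon> \<rho>" if "(\<tau>1, \<tau>2, \<epsilon>) \<in> sewing_domain" for \<tau>1 \<tau>2 \<epsilon>
  proof (rule sewing_domain_radii[OF that])
    fix \<rho> \<theta> and \<delta> :: real
    assume "0 < \<delta>" and R: "\<And>x y z. x \<in> ball \<tau>1 \<delta> \<Longrightarrow> y \<in> ball \<tau>2 \<delta> \<Longrightarrow> z \<in> ball \<epsilon> \<delta> \<Longrightarrow>
       sewing (vector [x, y]) z \<rho> \<and> cmod (sewing.u z \<rho>) \<le> \<theta>"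
    then show ?thesis using R[of \<tau>1 \<tau>2 \<epsilon>] by (intro exI[of _ \<rho>]) simp
  qed
  have periods: "(\<exists>r. sewing_radii (vector [\<tau>1, \<tau>2]) \<epsilon> r) \<and>
      (\<forall>r. sewing_radii (vector [\<tau>1, \<tau>2]) \<epsilon> r \<longrightarrow>
        (\<forall>\<Omega>. is_period_matrix (vector [\<tau>1, \<tau>2]) \<epsilon> r \<Omega> \<longleftrightarrow> \<Omega> = period_map (\<tau>1, \<tau>2, \<epsilon>)))"
    if d: "(\<tau>1, \<tau>2, \<epsilon>) \<in> sewing_domain" for \<tau>1 \<tau>2 \<epsilon>
  proof -
    obtain \<rho> where "sewing (vector [\<tau>1, \<tau>2]) \<epsilon> \<rho>" using ex[OF d] by blast
    then interpret S: sewing "vector [\<tau>1, \<tau>2]" \<epsilon> \<rho> .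
    have "is_period_matrix (vector [\<tau>1, \<tau>2]) \<epsilon> r \<Omega> \<longleftrightarrow> \<Omega> = period_map (\<tau>1, \<tau>2, \<epsilon>)" if "sewing_radii (vector [\<tau>1, \<tau>2]) \<epsilon> r" for r \<Omega>
    proof -
      have "sewing (vector [\<tau>1, \<tau>2]) \<epsilon> r" by unfold_locales (rule S.Im_pos, rule that)
      then show ?thesis by (simp add: sewing.period_matrix_iff period_map_eq)
    qed
    then show ?thesis using S.radii by blast
  qed
  have formulas: "let \<Omega> = period_map (\<tau>1, \<tau>2, \<epsilon>);
                A1 = sewing_matrix \<tau>1 \<epsilon>;
                A2 = sewing_matrix \<tau>2 \<epsilon>;
                N12 = neumann_inverse (imat_mult A1 A2);
                N21 = neumann_inverse (imat_mult A2 A1)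
            in imat_mult_converges A1 A2 \<and> imat_mult_converges A2 A1 \<and>
               neumann_converges (imat_mult A1 A2) \<and> neumann_converges (imat_mult A2 A1) \<and>
               imat_mult_converges A2 N12 \<and> imat_mult_converges A1 N21 \<and>
               2 * pi * \<i> * \<Omega> $ 1 $ 1 = 2 * pi * \<i> * \<tau>1 + \<epsilon> * imat_mult A2 N12 1 1 \<and>
               2 * pi * \<i> * \<Omega> $ 2 $ 2 = 2 * pi * \<i> * \<tau>2 + \<epsilon> * imat_mult A1 N21 1 1 \<and>
               2 * pi * \<i> * \<Omega> $ 1 $ 2 = - \<epsilon> * N12 1 1"
    if d: "(\<tau>1, \<tau>2, \<epsilon>) \<in> sewing_domain" for \<tau>1 \<tau>2 \<epsilon>
  proof -
    obtain \<rho> where sw: "sewing (vector [\<tau>1, \<tau>2]) \<epsilon> \<rho>" using ex[OF d] by blast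
    then interpret S: sewing "vector [\<tau>1, \<tau>2]" \<epsilon> \<rho> .
    have two: "(1::2) + 1 = 2" "(2::2) + 1 = 1" by simp_all
    \<comment> \<open>\<open>omega_formulas\<close> for torus 1 gives the entry in row 2 and column
      1; symmetry transfers it to the stated one, with the product of matrices in the right
      order.\<close>
    have "S.omega $ 1 $ 2 = transpose S.omega $ 1 $ 2" by (simp only: S.omega_sym)
    then have sym: "S.omega $ 1 $ 2 = S.omega $ 2 $ 1" by (simp add: transpose_def)
    show ?thesis unfolding Let_def period_map_eq[OF sw] sym
      using S.omega_formulas[of 1, unfolded two vector_2] S.omega_formulas[of 2, unfolded two vector_2] by blast
  qed
  have "period_map p \<in> siegel_upper_half_space" if d: "p \<in> sewing_domain" for p
  proof -
    obtain \<tau>1 \<tau>2 \<epsilon> where p: "p = (\<tau>1, \<tau>2, \<epsilon>)" by (cases p)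
    then obtain \<rho> where sw: "sewing (vector [\<tau>1, \<tau>2]) \<epsilon> \<rho>" using ex d by blast
    show ?thesis unfolding p period_map_eq[OF sw] by (rule sewing.omega_siegel[OF sw])
  qed
  then show ?thesis using periods formulas period_map_holomorphic by blast
qed

end
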